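(* Let $X$ be a connected compact complex manifold with $\dim_{\mathbb{C}}X=n\geq 2$, let $\omega$ be a balanced hyperbolic metric on $X$, let $\pi:\widetilde{X}\longrightarrow X$ be the universal cover of $X$ and let $\widetilde\omega:=\pi^\star\omega$ be the lift of $\omega$ to $\widetilde{X}$. There exists no non-zero $d$-closed positive $(1,1)$-current $\widetilde{T}\geq 0$ on $\widetilde{X}$ such that $\widetilde{T}$ is $L^1_{\widetilde\omega}$.
   Context: A Hermitian metric on a complex manifold is identified with its associated smooth positive definite $(1,1)$-form $\omega$. A Hermitian metric $\omega$ on an $n$-dimensional compact complex manifold $X$ is balanced if $d\omega^{n-1}=0$. It is a balanced hyperbolic metric if it is balanced and there is a smooth $(2n-3)$-form $\beta$ on $\widetilde{X}$, bounded with respect to $\widetilde\omega$, such that $\pi^\star\omega^{n-1}=d\beta$ on $\widetilde{X}$. An object $\eta$ (form, or current with measurable coefficients) on $\widetilde{X}$ is $L^1_{\widetilde\omega}$ if $\int_{\widetilde{X}}|\eta(x)|_{\widetilde\omega}\,dV_{\widetilde\omega}(x)<+\infty$, where $dV_{\widetilde\omega}$ is the volume form and $|\cdot|_{\widetilde\omega}$ the pointwise norm induced by $\widetilde\omega$. Positivity $\widetilde T\ge 0$ is the usual (semi-)positivity of $(1,1)$-currents. *)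

theory Defs
  imports "HOL-Analysis.Analysis" "HOL-Combinatorics.Permutations"
begin

section \<open>Exterior algebra of the real vector space underlying a complex coordinate space\<close>

text \<open>
  A complex-valued \<open>k\<close>-covector on \<open>V\<close> is a function on lists of vectors of \<open>V\<close>. Only lists of
  length \<open>k\<close> carry information; on all other lists the function is zero, so that equality of
  covectors is equality of functions. Linearity is over the reals.
\<close>

type_synonym 'v covector = "'v list \<Rightarrow> complex"

definition alt_form :: "nat \<Rightarrow> ('v::real_vector) covector \<Rightarrow> bool" where
  "alt_form k \<eta> \<longleftrightarrow>
     (\<forall>vs. length vs \<noteq> k \<longrightarrow> \<eta> vs = 0) \<and>
     (\<forall>vs i. length vs = k \<and> i < k \<longrightarrow> linear (\<lambda>x. \<eta> (vs[i := x]))) \<and>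
     (\<forall>vs i j. length vs = k \<and> i < j \<and> j < k \<and> vs ! i = vs ! j \<longrightarrow> \<eta> vs = 0)"

text \<open>
  The normalisation is the one for which \<open>(\<alpha> \<and> \<beta>)(u, v) = \<alpha> u * \<beta> v - \<alpha> v * \<beta> u\<close>
  for 1-forms.
\<close>

definition wedge :: "nat \<Rightarrow> nat \<Rightarrow> 'v covector \<Rightarrow> 'v covector \<Rightarrow> 'v covector" where
  "wedge p q \<alpha> \<beta> vs =
     (if length vs = p + q then
        (\<Sum>\<sigma> | \<sigma> permutes {..<p + q}.
           of_int (sign \<sigma>) * \<alpha> (take p (permute_list \<sigma> vs)) * \<beta> (drop p (permute_list \<sigma> vs)))
        / (fact p * fact q)
      else 0)"

fun wedges :: "nat \<Rightarrow> 'v covector list \<Rightarrow> 'v covector" where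
  "wedges k [] = (\<lambda>vs. if vs = [] then 1 else 0)"
| "wedges k (\<eta> # \<eta>s) = wedge k (k * length \<eta>s) \<eta> (wedges k \<eta>s)"

definition wedge_power :: "nat \<Rightarrow> nat \<Rightarrow> 'v covector \<Rightarrow> 'v covector" where
  "wedge_power k m \<eta> = wedges k (replicate m \<eta>)"

definition covector1 :: "('v \<Rightarrow> complex) \<Rightarrow> 'v covector" where
  "covector1 \<alpha> vs = (if length vs = 1 then \<alpha> (hd vs) else 0)"

text \<open>The \<open>(1,0)\<close>-covectors; the \<open>(0,1)\<close>-covectors are their complex conjugates.\<close>

definition covector10 :: "(complex ^ 'n \<Rightarrow> complex) \<Rightarrow> bool" where
  "covector10 \<alpha> \<longleftrightarrow> Vector_Spaces.linear (*s) (*) \<alpha>"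

text \<open>
  Type \<open>(p,q)\<close>: complex combinations of
  \<open>\<alpha>\<^sub>1 \<and> \<dots> \<and> \<alpha>\<^sub>p \<and> cnj \<beta>\<^sub>1 \<and> \<dots> \<and> cnj \<beta>\<^sub>q\<close>
  with all \<open>\<alpha>\<^sub>i\<close> and \<open>\<beta>\<^sub>j\<close> of type \<open>(1,0)\<close>.
\<close>

definition type_form :: "nat \<Rightarrow> nat \<Rightarrow> (complex ^ 'n) covector \<Rightarrow> bool" where
  "type_form p q \<eta> \<longleftrightarrow>
     (\<exists>(m::nat) (a :: nat \<Rightarrow> complex) L M.
        (\<forall>s<m. length (L s) = p \<and> length (M s) = q \<and>
               (\<forall>\<alpha> \<in> set (L s) \<union> set (M s). covector10 \<alpha>)) \<and>
        \<eta> = (\<lambda>vs. \<Sum>s<m. a s *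
               wedges 1 (map covector1 (L s) @ map (\<lambda>\<beta>. covector1 (cnj \<circ> \<beta>)) (M s)) vs))"

text \<open>
  Strongly positive \<open>(p,p)\<close>-covectors: nonnegative combinations of
  \<open>(\<i> \<alpha>\<^sub>1 \<and> cnj \<alpha>\<^sub>1) \<and> \<dots> \<and> (\<i> \<alpha>\<^sub>p \<and> cnj \<alpha>\<^sub>p)\<close>.
\<close>

definition elementary_11 :: "('v \<Rightarrow> complex) \<Rightarrow> 'v covector" where
  "elementary_11 \<alpha> vs = \<i> * wedge 1 1 (covector1 \<alpha>) (covector1 (cnj \<circ> \<alpha>)) vs"

definition strongly_positive :: "nat \<Rightarrow> (complex ^ 'n) covector \<Rightarrow> bool" where
  "strongly_positive p \<eta> \<longleftrightarrow>
     (\<exists>(m::nat) (\<gamma> :: nat \<Rightarrow> real) L.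
        (\<forall>s<m. 0 \<le> \<gamma> s \<and> length (L s) = p \<and> (\<forall>\<alpha> \<in> set (L s). covector10 \<alpha>)) \<and>
        \<eta> = (\<lambda>vs. \<Sum>s<m. of_real (\<gamma> s) * wedges 2 (map elementary_11 (L s)) vs))"

text \<open>
  The Riemannian inner product \<open>g(u, v) = w(u, J v)\<close> of a positive \<open>(1,1)\<close>-covector \<open>w\<close>, an
  orthonormal basis for it, and the induced Euclidean norm on \<open>k\<close>-covectors, which is the sum of
  squares over the increasing multi-indices and does not depend on the chosen basis.
\<close>

definition metric_of :: "(complex ^ 'n) covector \<Rightarrow> complex ^ 'n \<Rightarrow> complex ^ 'n \<Rightarrow> real" where
  "metric_of w u v = Re (w [u, \<i> *s v])"

definition orthonormal_frame :: "(complex ^ 'n) covector \<Rightarrow> (complex ^ 'n) list" where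
  "orthonormal_frame w =
     (SOME es. length es = 2 * CARD('n) \<and>
        (\<forall>i<length es. \<forall>j<length es. metric_of w (es ! i) (es ! j) = (if i = j then 1 else 0)))"

definition cov_norm :: "(complex ^ 'n) covector \<Rightarrow> nat \<Rightarrow> (complex ^ 'n) covector \<Rightarrow> real" where
  "cov_norm w k \<eta> =
     sqrt (\<Sum>I | length I = k \<and> sorted_wrt (<) I \<and> set I \<subseteq> {..<2 * CARD('n)}.
             (cmod (\<eta> (map ((!) (orthonormal_frame w)) I)))\<^sup>2)"

text \<open>
  The real frame \<open>e\<^sub>1, \<i> e\<^sub>1, e\<^sub>2, \<i> e\<^sub>2, \<dots>\<close>, which gives the orientation of the complex coordinate
  space. The enumeration of the index type is irrelevant, since permuting it permutes the frame
  evenly.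
\<close>

definition standard_frame :: "(complex ^ 'n) list" where
  "standard_frame =
     concat (map (\<lambda>i. [axis i 1, axis i \<i>]) (SOME is. distinct is \<and> set is = (UNIV :: 'n set)))"


section \<open>Calculus on open subsets of a complex coordinate space\<close>

fun iter_deriv ::
    "'v list \<Rightarrow> ('v::real_normed_vector \<Rightarrow> 'w::real_normed_vector) \<Rightarrow> 'v \<Rightarrow> 'w" where
  "iter_deriv [] f = f"
| "iter_deriv (v # vs) f = iter_deriv vs (\<lambda>x. frechet_derivative f (at x) v)"

definition smooth_on :: "'v set \<Rightarrow> ('v::euclidean_space \<Rightarrow> 'w::real_normed_vector) \<Rightarrow> bool" where
  "smooth_on S f \<longleftrightarrow> (\<forall>ds. \<forall>x\<in>S. iter_deriv ds f differentiable (at x))"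

definition holo_on :: "(complex ^ 'n) set \<Rightarrow> (complex ^ 'n \<Rightarrow> complex ^ 'm) \<Rightarrow> bool" where
  "holo_on S f \<longleftrightarrow>
     (\<forall>z\<in>S. \<exists>D. (f has_derivative D) (at z) \<and> Vector_Spaces.linear (*s) (*s) D)"

definition ext_deriv ::
    "nat \<Rightarrow> ('v::real_normed_vector \<Rightarrow> 'v covector) \<Rightarrow> 'v \<Rightarrow> 'v covector" where
  "ext_deriv k \<eta> x vs =
     (if length vs = Suc k then
        (\<Sum>i\<le>k. (- 1) ^ i *
           frechet_derivative (\<lambda>y. \<eta> y (take i vs @ drop (Suc i) vs)) (at x) (vs ! i))
      else 0)"


section \<open>Complex manifolds and differential forms\<close>

text \<open>
  A complex manifold is a Hausdorff second countable type with an atlas, not necessarily maximal.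
  A chart is a pair of its domain and its coordinate map.
\<close>

type_synonym ('a, 'n) chart = "'a set \<times> ('a \<Rightarrow> complex ^ 'n)"

definition chart_image :: "('a, 'n::finite) chart \<Rightarrow> (complex ^ 'n) set" where
  "chart_image c = snd c ` fst c"

definition chart_inv :: "('a, 'n::finite) chart \<Rightarrow> complex ^ 'n \<Rightarrow> 'a" where
  "chart_inv c = inv_into (fst c) (snd c)"

definition local_rep ::
    "('a, 'n::finite) chart \<Rightarrow> ('b, 'm::finite) chart \<Rightarrow> ('a \<Rightarrow> 'b) \<Rightarrow> complex ^ 'n \<Rightarrow> complex ^ 'm"
  where "local_rep c d f = snd d \<circ> f \<circ> chart_inv c"

definition complex_atlas ::
    "('a::{t2_space, second_countable_topology}, 'n::finite) chart set \<Rightarrow> bool" where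
  "complex_atlas A \<longleftrightarrow>
     (\<forall>c\<in>A. open (fst c) \<and> open (chart_image c) \<and>
            homeomorphism (fst c) (chart_image c) (snd c) (chart_inv c)) \<and>
     (\<Union>c\<in>A. fst c) = UNIV \<and>
     (\<forall>c\<in>A. \<forall>d\<in>A. holo_on (snd c ` (fst c \<inter> fst d)) (local_rep c d id))"

definition holo_map_on ::
    "('a::topological_space, 'n::finite) chart set \<Rightarrow> 'a set \<Rightarrow>
     ('b::topological_space, 'm::finite) chart set \<Rightarrow> ('a \<Rightarrow> 'b) \<Rightarrow> bool" where
  "holo_map_on A U B f \<longleftrightarrow>
     continuous_on U f \<and>
     (\<forall>c\<in>A. \<forall>d\<in>B. holo_on (snd c ` {x \<in> fst c \<inter> U. f x \<in> fst d}) (local_rep c d f))"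

definition local_biholomorphism ::
    "('a::topological_space, 'n::finite) chart set \<Rightarrow>
     ('b::topological_space, 'n) chart set \<Rightarrow> ('a \<Rightarrow> 'b) \<Rightarrow> bool" where
  "local_biholomorphism A B f \<longleftrightarrow>
     (\<forall>x. \<exists>U V g. x \<in> U \<and> open U \<and> open V \<and> homeomorphism U V f g \<and>
                  holo_map_on A U B f \<and> holo_map_on B V A g)"

text \<open>
  The complex structure of the universal cover is the lifted one, which is the one that makes the
  covering map a local biholomorphism.
\<close>

definition universal_cover ::
    "('b::{t2_space, second_countable_topology}, 'n::finite) chart set \<Rightarrow>
     ('a::{t2_space, second_countable_topology}, 'n) chart set \<Rightarrow> ('b \<Rightarrow> 'a) \<Rightarrow> bool" where
  "universal_cover B A \<pi> \<longleftrightarrow>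
     complex_atlas B \<and>
     covering_space (UNIV :: 'b set) \<pi> (UNIV :: 'a set) \<and>
     simply_connected (UNIV :: 'b set) \<and>
     local_biholomorphism B A \<pi>"

text \<open>
  A differential form, with no regularity imposed, is the family of its expressions in the charts
  of the atlas, related by pullback along the transition maps. The expressions are zero outside
  the charts, so that equality of forms is equality of families.
\<close>

type_synonym ('a, 'n) form = "('a, 'n) chart \<Rightarrow> complex ^ 'n \<Rightarrow> (complex ^ 'n) covector"

definition on_charts ::
    "('a, 'n::finite) chart set \<Rightarrow> ('a, 'n) form \<Rightarrow> ('a, 'n) form" where
  "on_charts A \<eta> = (\<lambda>c x vs. if c \<in> A \<and> x \<in> chart_image c then \<eta> c x vs else 0)"

definition diff_form ::
    "('a, 'n::finite) chart set \<Rightarrow> nat \<Rightarrow> ('a, 'n) form \<Rightarrow> bool" where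
  "diff_form A k \<eta> \<longleftrightarrow>
     on_charts A \<eta> = \<eta> \<and>
     (\<forall>c\<in>A. \<forall>x\<in>chart_image c. alt_form k (\<eta> c x)) \<and>
     (\<forall>c\<in>A. \<forall>d\<in>A. \<forall>x \<in> snd c ` (fst c \<inter> fst d). \<forall>vs.
        \<eta> c x vs = \<eta> d (local_rep c d id x)
                       (map (frechet_derivative (local_rep c d id) (at x)) vs))"

definition smooth_form ::
    "('a, 'n::finite) chart set \<Rightarrow> nat \<Rightarrow> ('a, 'n) form \<Rightarrow> bool" where
  "smooth_form A k \<eta> \<longleftrightarrow>
     diff_form A k \<eta> \<and> (\<forall>c\<in>A. \<forall>vs. smooth_on (chart_image c) (\<lambda>x. \<eta> c x vs))"

definition mf_d ::
    "('a, 'n::finite) chart set \<Rightarrow> nat \<Rightarrow> ('a, 'n) form \<Rightarrow> ('a, 'n) form" where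
  "mf_d A k \<eta> = on_charts A (\<lambda>c. ext_deriv k (\<eta> c))"

definition mf_wedge ::
    "('a, 'n::finite) chart set \<Rightarrow> nat \<Rightarrow> nat \<Rightarrow> ('a, 'n) form \<Rightarrow> ('a, 'n) form \<Rightarrow> ('a, 'n) form"
  where "mf_wedge A p q \<alpha> \<beta> = on_charts A (\<lambda>c x. wedge p q (\<alpha> c x) (\<beta> c x))"

definition mf_power ::
    "('a, 'n::finite) chart set \<Rightarrow> nat \<Rightarrow> nat \<Rightarrow> ('a, 'n) form \<Rightarrow> ('a, 'n) form" where
  "mf_power A k m \<eta> = on_charts A (\<lambda>c x. wedge_power k m (\<eta> c x))"

text \<open>
  Pullback of a form on the manifold with atlas \<open>A\<close> along a smooth map from the manifold with
  atlas \<open>B\<close>. Any chart around the image point gives the same value.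
\<close>

definition mf_pullback ::
    "('b, 'm::finite) chart set \<Rightarrow> ('a, 'n::finite) chart set \<Rightarrow> ('b \<Rightarrow> 'a) \<Rightarrow>
     ('a, 'n) form \<Rightarrow> ('b, 'm) form" where
  "mf_pullback B A f \<eta> = on_charts B (\<lambda>c x vs.
     let d = (SOME d. d \<in> A \<and> f (chart_inv c x) \<in> fst d)
     in \<eta> d (local_rep c d f x) (map (frechet_derivative (local_rep c d f) (at x)) vs))"


section \<open>Integration\<close>

text \<open>
  Integration over a manifold: the manifold is cut into countably many measurable pieces, each
  contained in one chart (countably many charts suffice, by second countability), and the integrals over the pieces are added. For nonnegative and for
  absolutely integrable integrands the result does not depend on the charts chosen.
\<close>

definition chart_seq :: "('a, 'n::finite) chart set \<Rightarrow> nat \<Rightarrow> ('a, 'n) chart" where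
  "chart_seq A = (SOME cs. range cs \<subseteq> A \<and> (\<Union>i. fst (cs i)) = UNIV)"

definition cell :: "('a, 'n::finite) chart set \<Rightarrow> nat \<Rightarrow> (complex ^ 'n) set" where
  "cell A i = snd (chart_seq A i) ` (fst (chart_seq A i) - (\<Union>j<i. fst (chart_seq A j)))"

definition mf_integral ::
    "('a, 'n::finite) chart set \<Rightarrow> ('a, 'n) form \<Rightarrow> complex" where
  "mf_integral A \<mu> =
     (\<Sum>i. set_lebesgue_integral lebesgue (cell A i) (\<lambda>x. \<mu> (chart_seq A i) x standard_frame))"

definition volume_form ::
    "('a, 'n::finite) chart set \<Rightarrow> ('a, 'n) form \<Rightarrow> ('a, 'n) form" where
  "volume_form A \<omega> = (\<lambda>c x vs. mf_power A 2 CARD('n) \<omega> c x vs / fact CARD('n))"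

text \<open>The integral of the pointwise norm \<open>|\<eta>|\<close> of a \<open>k\<close>-form against the volume form of \<open>\<omega>\<close>.\<close>

definition L1_norm ::
    "('a, 'n::finite) chart set \<Rightarrow> ('a, 'n) form \<Rightarrow> nat \<Rightarrow> ('a, 'n) form \<Rightarrow> ennreal" where
  "L1_norm A \<omega> k \<eta> =
     (\<Sum>i. \<integral>\<^sup>+ x. ennreal (cov_norm (\<omega> (chart_seq A i) x) k (\<eta> (chart_seq A i) x) *
                           Re (volume_form A \<omega> (chart_seq A i) x standard_frame)) *
                   indicator (cell A i) x \<partial>lebesgue)"


section \<open>Hermitian and balanced hyperbolic metrics\<close>

definition hermitian_metric ::
    "('a, 'n::finite) chart set \<Rightarrow> ('a, 'n) form \<Rightarrow> bool" where
  "hermitian_metric A \<omega> \<longleftrightarrow>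
     smooth_form A 2 \<omega> \<and>
     (\<forall>c\<in>A. \<forall>x\<in>chart_image c.
        type_form 1 1 (\<omega> c x) \<and>
        (\<forall>vs. \<omega> c x vs \<in> \<real>) \<and>
        (\<forall>v. v \<noteq> 0 \<longrightarrow> metric_of (\<omega> c x) v v > 0))"

definition balanced ::
    "('a, 'n::finite) chart set \<Rightarrow> ('a, 'n) form \<Rightarrow> bool" where
  "balanced A \<omega> \<longleftrightarrow>
     hermitian_metric A \<omega> \<and>
     mf_d A (2 * CARD('n) - 2) (mf_power A 2 (CARD('n) - 1) \<omega>) = (\<lambda>_ _ _. 0)"

definition bounded_form ::
    "('a, 'n::finite) chart set \<Rightarrow> ('a, 'n) form \<Rightarrow> nat \<Rightarrow> ('a, 'n) form \<Rightarrow> bool" where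
  "bounded_form A \<omega> k \<eta> \<longleftrightarrow>
     (\<exists>C. \<forall>c\<in>A. \<forall>x\<in>chart_image c. cov_norm (\<omega> c x) k (\<eta> c x) \<le> C)"

definition balanced_hyperbolic ::
    "('b, 'n::finite) chart set \<Rightarrow> ('a, 'n) chart set \<Rightarrow> ('b \<Rightarrow> 'a) \<Rightarrow> ('a, 'n) form \<Rightarrow> bool" where
  "balanced_hyperbolic B A \<pi> \<omega> \<longleftrightarrow>
     balanced A \<omega> \<and>
     (\<exists>\<beta>. smooth_form B (2 * CARD('n) - 3) \<beta> \<and>
          bounded_form B (mf_pullback B A \<pi> \<omega>) (2 * CARD('n) - 3) \<beta> \<and>
          mf_pullback B A \<pi> (mf_power A 2 (CARD('n) - 1) \<omega>) = mf_d B (2 * CARD('n) - 3) \<beta>)"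


section \<open>Currents\<close>

definition supported_in ::
    "('a, 'n::finite) chart set \<Rightarrow> 'a set \<Rightarrow> ('a, 'n) form \<Rightarrow> bool" where
  "supported_in A K \<eta> \<longleftrightarrow>
     (\<forall>c\<in>A. \<forall>x\<in>chart_image c. chart_inv c x \<notin> K \<longrightarrow> \<eta> c x = (\<lambda>_. 0))"

definition test_form ::
    "('a::topological_space, 'n::finite) chart set \<Rightarrow> nat \<Rightarrow> ('a, 'n) form \<Rightarrow> bool" where
  "test_form A k \<phi> \<longleftrightarrow> smooth_form A k \<phi> \<and> (\<exists>K. compact K \<and> supported_in A K \<phi>)"

text \<open>
  Convergence to zero of test forms: supports in a common compact set, and all derivatives of all
  coefficients converge to zero uniformly on compact subsets of the charts.
\<close>

definition test_null_seq ::
    "('a::topological_space, 'n::finite) chart set \<Rightarrow> nat \<Rightarrow> (nat \<Rightarrow> ('a, 'n) form) \<Rightarrow> bool" where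
  "test_null_seq A k \<phi> \<longleftrightarrow>
     (\<forall>j. test_form A k (\<phi> j)) \<and>
     (\<exists>K. compact K \<and> (\<forall>j. supported_in A K (\<phi> j))) \<and>
     (\<forall>c\<in>A. \<forall>L. compact L \<and> L \<subseteq> chart_image c \<longrightarrow>
        (\<forall>vs ds. uniform_limit L (\<lambda>j. iter_deriv ds (\<lambda>x. \<phi> j c x vs)) (\<lambda>_. 0) sequentially))"

text \<open>
  A current of degree \<open>k\<close> is a continuous linear functional on test forms of complementary degree.
  Its values on anything but test forms are irrelevant. Continuity on the space of test forms
  with support in a fixed compact set is sequential, that space being metrizable.
\<close>

type_synonym ('a, 'n) current = "('a, 'n) form \<Rightarrow> complex"

definition is_current ::
    "('a::topological_space, 'n::finite) chart set \<Rightarrow> nat \<Rightarrow> ('a, 'n) current \<Rightarrow> bool" where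
  "is_current A k T \<longleftrightarrow> k \<le> 2 * CARD('n) \<and>
     (\<forall>\<phi> \<psi>. test_form A (2 * CARD('n) - k) \<phi> \<and> test_form A (2 * CARD('n) - k) \<psi> \<longrightarrow>
        T (\<lambda>c x vs. \<phi> c x vs + \<psi> c x vs) = T \<phi> + T \<psi>) \<and>
     (\<forall>a \<phi>. test_form A (2 * CARD('n) - k) \<phi> \<longrightarrow> T (\<lambda>c x vs. a * \<phi> c x vs) = a * T \<phi>) \<and>
     (\<forall>\<phi>. test_null_seq A (2 * CARD('n) - k) \<phi> \<longrightarrow> (\<lambda>j. T (\<phi> j)) \<longlonglongrightarrow> 0)"

text \<open>A current has bidegree \<open>(p,q)\<close> if it sees only the \<open>(n-p,n-q)\<close>-part of a test form.\<close>

definition bidegree_current ::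
    "('a::topological_space, 'n::finite) chart set \<Rightarrow> nat \<Rightarrow> nat \<Rightarrow> ('a, 'n) current \<Rightarrow> bool" where
  "bidegree_current A p q T \<longleftrightarrow>
     p \<le> CARD('n) \<and> q \<le> CARD('n) \<and> is_current A (p + q) T \<and>
     (\<forall>r s \<phi>. r + s = 2 * CARD('n) - (p + q) \<and> (r, s) \<noteq> (CARD('n) - p, CARD('n) - q) \<and>
        test_form A (r + s) \<phi> \<and> (\<forall>c\<in>A. \<forall>x\<in>chart_image c. type_form r s (\<phi> c x)) \<longrightarrow>
        T \<phi> = 0)"

definition zero_current ::
    "('a::topological_space, 'n::finite) chart set \<Rightarrow> nat \<Rightarrow> ('a, 'n) current \<Rightarrow> bool" where
  "zero_current A k T \<longleftrightarrow> (\<forall>\<phi>. test_form A (2 * CARD('n) - k) \<phi> \<longrightarrow> T \<phi> = 0)"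

text \<open>
  Up to sign, \<open>(d T)(\<phi>) = T (d \<phi>)\<close>; so \<open>T\<close> is closed if the degree \<open>k + 1\<close> current \<open>d T\<close> is zero.
  Used for \<open>k < 2 n\<close>.
\<close>

definition closed_current ::
    "('a::topological_space, 'n::finite) chart set \<Rightarrow> nat \<Rightarrow> ('a, 'n) current \<Rightarrow> bool" where
  "closed_current A k T \<longleftrightarrow>
     zero_current A (k + 1) (\<lambda>\<phi>. T (mf_d A (2 * CARD('n) - (k + 1)) \<phi>))"

definition positive_current ::
    "('a::topological_space, 'n::finite) chart set \<Rightarrow> nat \<Rightarrow> ('a, 'n) current \<Rightarrow> bool" where
  "positive_current A p T \<longleftrightarrow>
     (\<forall>\<phi>. test_form A (2 * CARD('n) - 2 * p) \<phi> \<and>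
          (\<forall>c\<in>A. \<forall>x\<in>chart_image c. strongly_positive (CARD('n) - p) (\<phi> c x)) \<longrightarrow>
          T \<phi> \<in> \<real>\<^sub>\<ge>\<^sub>0)"

definition measurable_coeffs ::
    "('a::topological_space, 'n::finite) chart set \<Rightarrow> nat \<Rightarrow> ('a, 'n) current \<Rightarrow>
     ('a, 'n) form \<Rightarrow> bool" where
  "measurable_coeffs A k T \<tau> \<longleftrightarrow>
     diff_form A k \<tau> \<and>
     (\<forall>c\<in>A. \<forall>vs. (\<lambda>x. \<tau> c x vs) \<in> borel_measurable lebesgue \<and>
        (\<forall>L. compact L \<and> L \<subseteq> chart_image c \<longrightarrow> set_integrable lebesgue L (\<lambda>x. \<tau> c x vs))) \<and>
     (\<forall>\<phi>. test_form A (2 * CARD('n) - k) \<phi> \<longrightarrow>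
        T \<phi> = mf_integral A (mf_wedge A k (2 * CARD('n) - k) \<tau> \<phi>))"

definition L1_current ::
    "('a::topological_space, 'n::finite) chart set \<Rightarrow> ('a, 'n) form \<Rightarrow> nat \<Rightarrow>
     ('a, 'n) current \<Rightarrow> bool" where
  "L1_current A \<omega> k T \<longleftrightarrow> (\<exists>\<tau>. measurable_coeffs A k T \<tau> \<and> L1_norm A \<omega> k \<tau> < \<infinity>)"

end

theory Submission
  imports Defs "Jordan_Normal_Form.Determinant" "HOL-Complex_Analysis.Complex_Analysis"
begin

text \<open>
  Fix cutoff functions \<open>\<psi>\<^sub>m\<close> on the covering space, compactly supported, with \<open>0 \<le> \<psi>\<^sub>m \<le> 1\<close>, eventually
  \<open>1\<close> near every point, and with differentials bounded uniformly in \<open>m\<close>. They are built from bump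
  functions on finitely many evenly covered sets of the compact base, lifted to more and more sheets, so that
  completeness of the metric on the covering space is not needed. Writing \<open>\<omega>\<close> also for the lifted metric and
  \<open>\<omega>\<^sup>n\<^sup>-\<^sup>1 = d \<beta>\<close> with \<open>\<beta>\<close> bounded, the closedness of \<open>T\<close> gives
  \<open>T (\<psi>\<^sub>m \<omega>\<^sup>n\<^sup>-\<^sup>1) = - T (d \<psi>\<^sub>m \<and> \<beta>)\<close>. The right-hand side tends to \<open>0\<close> by dominated convergence: the
  forms \<open>d \<psi>\<^sub>m \<and> \<beta>\<close> are uniformly bounded and tend to \<open>0\<close> pointwise, while \<open>T\<close> is integrable. For a real test
  function \<open>f\<close> on a chart and a constant elementary strongly positive covector \<open>\<sigma>\<close>, both
  \<open>C \<psi>\<^sub>m \<omega>\<^sup>n\<^sup>-\<^sup>1 \<plusminus> f \<sigma>\<close> are strongly positive for suitable \<open>C\<close> and large \<open>m\<close>, so positivity of \<open>T\<close> forces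
  \<open>T (f \<sigma>) = 0\<close>. The covectors \<open>\<sigma>\<close> span the covectors of type \<open>(n-1, n-1)\<close> by polarization, and the other
  types are killed by the bidegree of \<open>T\<close>. Hence \<open>T = 0\<close>.
\<close>

no_notation scalar_prod (infix "\<bullet>" 70)
no_notation vec_index (infixl "$" 100)

section \<open>Smooth functions\<close>

text \<open>The customary ending, in which the trace measure of \<open>T\<close> vanishes and
  therefore \<open>T\<close> does, is replaced by a two-sided estimate on test forms, so that no
  measure is attached to \<open>T\<close>. The decisive point is that the bound on the differentials
  of the cutoffs does not grow with the number of sheets. Sheets over one evenly covered set are
  disjoint, so at each point at most one of the lifted bumps \<open>b\<close> has a nonzero
  differential. A product of factors \<open>1 - b\<close> with values in \<open>[0, 1]\<close> has a
  differential no larger than the sum of theirs, and finitely many evenly covered sets suffice. Two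
  features of the definitions shape the rest. Holomorphic means complex differentiable at each
  point, so smoothness of transition maps has to be drawn from Cauchy's formula. The norm of a
  covector is computed in a frame picked by a choice operator at every point; nothing is known about
  how this frame varies, and all estimates are pointwise and use orthonormality alone.\<close>

primrec ksmooth :: "nat \<Rightarrow> 'v set \<Rightarrow> ('v::euclidean_space \<Rightarrow> 'w::real_normed_vector) \<Rightarrow> bool" where
  "ksmooth 0 S f \<longleftrightarrow> (\<forall>x\<in>S. f differentiable (at x))"
| "ksmooth (Suc n) S f \<longleftrightarrow>
     (\<forall>x\<in>S. f differentiable (at x)) \<and> (\<forall>v. ksmooth n S (\<lambda>x. frechet_derivative f (at x) v))"

lemma smooth_on_D:
  assumes "smooth_on S f"
  shows "\<And>x. x \<in> S \<Longrightarrow> f differentiable (at x)"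
    and "smooth_on S (\<lambda>x. frechet_derivative f (at x) v)"
  using assms unfolding smooth_on_def
  by (metis iter_deriv.simps(1), metis iter_deriv.simps(2))

text \<open>\<open>iter_deriv\<close> consumes the head of its list first, which is the recursion of
  \<open>ksmooth\<close>. Bounding the length of the list makes smoothness accessible to induction
  on the order, so that closure rules can be proved one derivative at a time.\<close>

lemma ksmooth_iff_iter_deriv:
  "ksmooth n S f \<longleftrightarrow> (\<forall>ds. length ds \<le> n \<longrightarrow> (\<forall>x\<in>S. iter_deriv ds f differentiable (at x)))"
proof (induction n arbitrary: f)
  case 0
  then show ?case by simp
next
  case (Suc n)
  show ?case
  proof
    assume k: "ksmooth (Suc n) S f"
    show "\<forall>ds. length ds \<le> Suc n \<longrightarrow> (\<forall>x\<in>S. iter_deriv ds f differentiable (at x))"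
    proof (intro allI impI)
      fix ds :: "'a list" assume "length ds \<le> Suc n"
      then show "\<forall>x\<in>S. iter_deriv ds f differentiable (at x)"
        using k Suc.IH by (cases ds) auto
    qed
  next
    assume r: "\<forall>ds. length ds \<le> Suc n \<longrightarrow> (\<forall>x\<in>S. iter_deriv ds f differentiable (at x))"
    have "\<forall>x\<in>S. f differentiable (at x)" using r[rule_format, of "[]"] by simp
    moreover have "ksmooth n S (\<lambda>x. frechet_derivative f (at x) v)" for v
      unfolding Suc.IH using r[rule_format, of "v # _"] by auto
    ultimately show "ksmooth (Suc n) S f" by simp
  qed
qed

lemma smooth_on_iff_ksmooth: "smooth_on S f \<longleftrightarrow> (\<forall>n. ksmooth n S f)"
  unfolding smooth_on_def ksmooth_iff_iter_deriv by blast

lemma ksmooth_mono: "ksmooth n S f \<Longrightarrow> m \<le> n \<Longrightarrow> ksmooth m S f"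
  unfolding ksmooth_iff_iter_deriv by auto

lemma smooth_on_subset: "smooth_on S f \<Longrightarrow> S' \<subseteq> S \<Longrightarrow> smooth_on S' f"
  unfolding smooth_on_def by blast

text \<open>\<open>frechet_derivative\<close> is a choice operator. Both functions have the same
  candidate derivatives at \<open>x\<close>, so the choices coincide even at points where no
  derivative exists.\<close>

lemma frechet_derivative_cong_open:
  assumes "open S" "x \<in> S" "\<And>y. y \<in> S \<Longrightarrow> f y = g y"
  shows "frechet_derivative f (at x) = frechet_derivative g (at x)"
proof -
  have "(f has_derivative D) (at x) \<longleftrightarrow> (g has_derivative D) (at x)" for D
    using assms has_derivative_transform_within_open[OF _ assms(1,2)] by metis
  then show ?thesis unfolding frechet_derivative_def by presburger
qed

lemma differentiable_cong_open:
  assumes "open S" "x \<in> S" "\<And>y. y \<in> S \<Longrightarrow> f y = g y" "f differentiable (at x)"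
  shows "g differentiable (at x)"
  using assms has_derivative_transform_within_open[OF _ assms(1,2)] unfolding differentiable_def by metis

lemma ksmooth_cong:
  assumes "open S" "\<And>y. y \<in> S \<Longrightarrow> f y = g y" "ksmooth n S f"
  shows "ksmooth n S g"
  using assms(2,3)
proof (induction n arbitrary: f g)
  case 0
  then show ?case using differentiable_cong_open[OF assms(1)] by (metis ksmooth.simps(1))
next
  case (Suc n)
  have "ksmooth n S (\<lambda>x. frechet_derivative g (at x) v)" for v
    using Suc.IH[of "\<lambda>x. frechet_derivative f (at x) v" "\<lambda>x. frechet_derivative g (at x) v"]
      frechet_derivative_cong_open[OF assms(1) _ Suc.prems(1)] Suc.prems(2) by simp
  moreover have "\<forall>x\<in>S. g differentiable (at x)"
    using Suc.prems differentiable_cong_open[OF assms(1)] by (metis ksmooth.simps(2))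
  ultimately show ?case by simp
qed

lemma smooth_on_cong:
  assumes "open S" "\<And>y. y \<in> S \<Longrightarrow> f y = g y" "smooth_on S f"
  shows "smooth_on S g"
  unfolding smooth_on_iff_ksmooth
proof
  fix n show "ksmooth n S g"
    by (rule ksmooth_cong[OF assms(1,2)]) (use assms(3) smooth_on_iff_ksmooth in auto)
qed

lemma smooth_on_local:
  assumes "\<And>x. x \<in> S \<Longrightarrow> \<exists>U g. open U \<and> x \<in> U \<and> smooth_on U g \<and> (\<forall>y\<in>U. f y = g y)"
  shows "smooth_on S f"
proof -
  have "\<exists>U. x \<in> U \<and> smooth_on U f" if "x \<in> S" for x
    using assms[OF that] smooth_on_cong by metis
  then show ?thesis unfolding smooth_on_def by blast
qed

lemma frechet_derivativeI: "(f has_derivative D) (at x) \<Longrightarrow> frechet_derivative f (at x) = D"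
  using frechet_derivative_at by blast

lemma has_frechet_derivative:
  "f differentiable (at x) \<Longrightarrow> (f has_derivative frechet_derivative f (at x)) (at x)"
  using frechet_derivative_works by blast

text \<open>Allows the derivative to be replaced by any explicit formula \<open>D\<close>. Each
  closure rule below supplies the textbook formula and checks only its values in fixed
  directions.\<close>

lemma ksmooth_SucI:
  assumes "open S"
    and "\<And>x. x \<in> S \<Longrightarrow> (f has_derivative D x) (at x)"
    and "\<And>v. ksmooth n S (\<lambda>x. D x v)"
  shows "ksmooth (Suc n) S f"
proof -
  have "ksmooth n S (\<lambda>x. frechet_derivative f (at x) v)" for v
    by (rule ksmooth_cong[OF assms(1) _ assms(3)[of v]]) (simp add: frechet_derivativeI[OF assms(2)])
  then show ?thesis using assms(2) unfolding ksmooth.simps differentiable_def by blast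
qed

lemma ksmooth_0I: "(\<And>x. x \<in> S \<Longrightarrow> (f has_derivative D x) (at x)) \<Longrightarrow> ksmooth 0 S f"
  unfolding ksmooth.simps differentiable_def by blast

lemma ksmooth_has_derivative:
  "ksmooth n S f \<Longrightarrow> x \<in> S \<Longrightarrow> (f has_derivative frechet_derivative f (at x)) (at x)"
  using ksmooth_mono[of n S f 0] has_frechet_derivative by auto

section \<open>Closure properties of finite-order smoothness\<close>

lemma ksmooth_const: "open S \<Longrightarrow> ksmooth n S (\<lambda>x. c)"
proof (induction n arbitrary: c)
  case (Suc n)
  then show ?case by (intro ksmooth_SucI[where D = "\<lambda>_ _. 0"]) auto
qed simp

lemma ksmooth_linear:
  assumes "open S" "bounded_linear f" shows "ksmooth n S f"
proof -
  have d: "(f has_derivative f) (at x)" for x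
    by (rule bounded_linear_imp_has_derivative[OF assms(2)])
  show ?thesis
  proof (cases n)
    case 0
    then show ?thesis using ksmooth_0I[of S f "\<lambda>_. f"] d by simp
  next
    case (Suc m)
    show ?thesis unfolding Suc by (rule ksmooth_SucI[OF assms(1) d ksmooth_const[OF assms(1)]])
  qed
qed

lemma ksmooth_Suc_D:
  assumes "ksmooth (Suc n) S f"
  shows "ksmooth n S f" "ksmooth n S (\<lambda>x. frechet_derivative f (at x) v)"
  using ksmooth_mono[OF assms, of n] assms by simp_all

lemma ksmooth_add:
  assumes "open S" "ksmooth n S f" "ksmooth n S g"
  shows "ksmooth n S (\<lambda>x. f x + g x)"
  using assms(2,3)
proof (induction n arbitrary: f g)
  case 0
  then show ?case by simp
next
  case (Suc n)
  show ?case
  proof (rule ksmooth_SucI[OF assms(1)])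
    show "((\<lambda>x. f x + g x) has_derivative
        (\<lambda>v. frechet_derivative f (at x) v + frechet_derivative g (at x) v)) (at x)" if "x \<in> S" for x
      using Suc.prems that by (intro has_derivative_add ksmooth_has_derivative)
    show "ksmooth n S (\<lambda>x. frechet_derivative f (at x) v + frechet_derivative g (at x) v)" for v
      by (rule Suc.IH[OF ksmooth_Suc_D(2)[OF Suc.prems(1)] ksmooth_Suc_D(2)[OF Suc.prems(2)]])
  qed
qed

lemma ksmooth_sum:
  assumes "open S" "\<And>i. i \<in> I \<Longrightarrow> ksmooth n S (f i)"
  shows "ksmooth n S (\<lambda>x. \<Sum>i\<in>I. f i x)"
  using assms(2) by (induction I rule: infinite_finite_induct) (auto intro: ksmooth_const ksmooth_add assms(1))

lemma ksmooth_bilinear: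
  assumes "open S" "bounded_bilinear p" "ksmooth n S f" "ksmooth n S g"
  shows "ksmooth n S (\<lambda>x. p (f x) (g x))"
  using assms(3,4)
proof (induction n arbitrary: f g)
  case 0
  show ?case
    by (rule ksmooth_0I, rule bounded_bilinear.FDERIV[OF assms(2)])
       (rule ksmooth_has_derivative[OF 0(1)], assumption, rule ksmooth_has_derivative[OF 0(2)], assumption)
next
  case (Suc n)
  show ?case
  proof (rule ksmooth_SucI[OF assms(1)])
    show "((\<lambda>x. p (f x) (g x)) has_derivative
        (\<lambda>v. p (f x) (frechet_derivative g (at x) v) + p (frechet_derivative f (at x) v) (g x))) (at x)"
      if "x \<in> S" for x
      using Suc.prems that by (intro bounded_bilinear.FDERIV[OF assms(2)] ksmooth_has_derivative)
    show "ksmooth n S (\<lambda>x. p (f x) (frechet_derivative g (at x) v) + p (frechet_derivative f (at x) v) (g x))" for v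
      by (rule ksmooth_add[OF assms(1) Suc.IH[OF ksmooth_Suc_D(1)[OF Suc.prems(1)] ksmooth_Suc_D(2)[OF Suc.prems(2)]]
            Suc.IH[OF ksmooth_Suc_D(2)[OF Suc.prems(1)] ksmooth_Suc_D(1)[OF Suc.prems(2)]]])
  qed
qed

lemma ksmooth_linear_comp:
  assumes "open S" "bounded_linear l" "ksmooth n S f"
  shows "ksmooth n S (\<lambda>x. l (f x))"
  using assms(3)
proof (induction n arbitrary: f)
  case 0
  show ?case
    by (rule ksmooth_0I, rule bounded_linear.has_derivative[OF assms(2)], rule ksmooth_has_derivative[OF 0])
next
  case (Suc n)
  show ?case
  proof (rule ksmooth_SucI[OF assms(1)])
    show "((\<lambda>x. l (f x)) has_derivative (\<lambda>v. l (frechet_derivative f (at x) v))) (at x)" if "x \<in> S" for x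
      using Suc.prems that by (intro bounded_linear.has_derivative[OF assms(2)] ksmooth_has_derivative)
    show "ksmooth n S (\<lambda>x. l (frechet_derivative f (at x) v))" for v
      by (rule Suc.IH[OF ksmooth_Suc_D(2)[OF Suc.prems]])
  qed
qed

lemma linear_euclidean_expansion:
  assumes "linear f"
  shows "f v = (\<Sum>b\<in>Basis. (v \<bullet> b) *\<^sub>R f b)"
proof -
  have "f v = f (\<Sum>b\<in>Basis. (v \<bullet> b) *\<^sub>R b)" by (simp add: euclidean_representation)
  also have "\<dots> = (\<Sum>b\<in>Basis. (v \<bullet> b) *\<^sub>R f b)"
    using assms by (simp add: linear_sum linear_scale)
  finally show ?thesis .
qed

text \<open>In the chain rule the derivative of \<open>f\<close> is taken in a direction that moves
  with \<open>x\<close>. Expanding this direction in an orthonormal basis leaves derivatives of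
  \<open>f\<close> in fixed directions, composed with \<open>g\<close>, and to these the induction
  hypothesis applies; this is why \<open>f\<close> is general in the induction while
  \<open>g\<close> is fixed.\<close>

lemma ksmooth_compose:
  fixes g :: "'u::euclidean_space \<Rightarrow> 'v::euclidean_space" and f :: "'v \<Rightarrow> 'w::real_normed_vector"
  assumes "open S" "g ` S \<subseteq> T" "open T" "ksmooth n T f" "ksmooth n S g"
  shows "ksmooth n S (\<lambda>x. f (g x))"
  using assms(4,5)
proof (induction n arbitrary: f)
  case 0
  have "((\<lambda>x. f (g x)) has_derivative (\<lambda>v. frechet_derivative f (at (g x)) (frechet_derivative g (at x) v))) (at x)"
    if "x \<in> S" for x
    using diff_chain_at[OF ksmooth_has_derivative[OF 0(2) that] ksmooth_has_derivative[OF 0(1)]] that assms(2)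
    by (auto simp: o_def)
  then show ?case by (rule ksmooth_0I)
next
  case (Suc n)
  have gn: "ksmooth n S g" using Suc.prems ksmooth_Suc_D by blast
  let ?f' = "\<lambda>y. frechet_derivative f (at y)" and ?g' = "\<lambda>x. frechet_derivative g (at x)"
  have df: "(f has_derivative ?f' (g x)) (at (g x))" if "x \<in> S" for x
    using that assms(2) ksmooth_has_derivative[OF Suc.prems(1)] by blast
  show ?case
  proof (rule ksmooth_SucI[OF assms(1), where D = "\<lambda>x v. \<Sum>b\<in>Basis. (?g' x v \<bullet> b) *\<^sub>R ?f' (g x) b"])
    fix x assume x: "x \<in> S"
    have "((f \<circ> g) has_derivative (?f' (g x) \<circ> ?g' x)) (at x)"
      by (rule diff_chain_at[OF ksmooth_has_derivative[OF Suc.prems(2) x] df[OF x]])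
    moreover have "?f' (g x) \<circ> ?g' x = (\<lambda>v. \<Sum>b\<in>Basis. (?g' x v \<bullet> b) *\<^sub>R ?f' (g x) b)"
      unfolding o_def
      by (rule ext, rule linear_euclidean_expansion, rule has_derivative_linear[OF df[OF x]])
    ultimately show "((\<lambda>x. f (g x)) has_derivative (\<lambda>v. \<Sum>b\<in>Basis. (?g' x v \<bullet> b) *\<^sub>R ?f' (g x) b)) (at x)"
      by (simp add: o_def)
  next
    fix v
    have "ksmooth n S (\<lambda>x. ?f' (g x) b)" for b
      using Suc.IH[of "\<lambda>y. ?f' y b"] Suc.prems(1) gn by simp
    moreover have "ksmooth n S (\<lambda>x. ?g' x v \<bullet> b)" for b
      by (rule ksmooth_linear_comp[OF assms(1) bounded_linear_inner_left ksmooth_Suc_D(2)[OF Suc.prems(2)]])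
    ultimately show "ksmooth n S (\<lambda>x. \<Sum>b\<in>Basis. (?g' x v \<bullet> b) *\<^sub>R ?f' (g x) b)"
      by (intro ksmooth_sum[OF assms(1)] ksmooth_bilinear[OF assms(1) bounded_bilinear_scaleR])
  qed
qed

lemma smooth_on_const: "open S \<Longrightarrow> smooth_on S (\<lambda>x. c)"
  by (simp add: smooth_on_iff_ksmooth ksmooth_const)

lemma smooth_on_linear: "open S \<Longrightarrow> bounded_linear l \<Longrightarrow> smooth_on S l"
  by (simp add: smooth_on_iff_ksmooth ksmooth_linear)

lemma smooth_on_add:
  "open S \<Longrightarrow> smooth_on S f \<Longrightarrow> smooth_on S g \<Longrightarrow> smooth_on S (\<lambda>x. f x + g x)"
  by (simp add: smooth_on_iff_ksmooth ksmooth_add)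

lemma smooth_on_bilinear:
  "open S \<Longrightarrow> bounded_bilinear p \<Longrightarrow> smooth_on S f \<Longrightarrow> smooth_on S g
    \<Longrightarrow> smooth_on S (\<lambda>x. p (f x) (g x))"
  by (simp add: smooth_on_iff_ksmooth ksmooth_bilinear)

lemma smooth_on_linear_comp:
  "open S \<Longrightarrow> bounded_linear l \<Longrightarrow> smooth_on S f \<Longrightarrow> smooth_on S (\<lambda>x. l (f x))"
  by (simp add: smooth_on_iff_ksmooth ksmooth_linear_comp)

lemma smooth_on_sum:
  "open S \<Longrightarrow> (\<And>i. i \<in> I \<Longrightarrow> smooth_on S (f i)) \<Longrightarrow> smooth_on S (\<lambda>x. \<Sum>i\<in>I. f i x)"
  by (simp add: smooth_on_iff_ksmooth ksmooth_sum)

lemma smooth_on_compose: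
  "open S \<Longrightarrow> g ` S \<subseteq> T \<Longrightarrow> open T \<Longrightarrow> smooth_on T f \<Longrightarrow> smooth_on S g \<Longrightarrow> smooth_on S (\<lambda>x. f (g x))"
  by (simp add: smooth_on_iff_ksmooth ksmooth_compose)

lemma smooth_on_mult:
  fixes f g :: "'v::euclidean_space \<Rightarrow> 'a::real_normed_algebra"
  shows "open S \<Longrightarrow> smooth_on S f \<Longrightarrow> smooth_on S g \<Longrightarrow> smooth_on S (\<lambda>x. f x * g x)"
  by (rule smooth_on_bilinear[OF _ bounded_bilinear_mult])

lemma smooth_on_minus: "open S \<Longrightarrow> smooth_on S f \<Longrightarrow> smooth_on S (\<lambda>x. - f x)"
  by (rule smooth_on_linear_comp[OF _ bounded_linear_minus[OF bounded_linear_ident]])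

lemma smooth_on_diff: "open S \<Longrightarrow> smooth_on S f \<Longrightarrow> smooth_on S g \<Longrightarrow> smooth_on S (\<lambda>x. f x - g x)"
  using smooth_on_add[OF _ _ smooth_on_minus, of S f g] by simp

lemma smooth_on_of_real:
  fixes f :: "'v::euclidean_space \<Rightarrow> real"
  shows "open S \<Longrightarrow> smooth_on S f \<Longrightarrow> smooth_on S (\<lambda>x. complex_of_real (f x))"
  by (rule smooth_on_linear_comp[OF _ bounded_linear_of_real])

lemma smooth_on_prod:
  fixes f :: "'i \<Rightarrow> 'v::euclidean_space \<Rightarrow> 'a::{real_normed_algebra, comm_ring_1}"
  shows "open S \<Longrightarrow> (\<And>i. i \<in> I \<Longrightarrow> smooth_on S (f i)) \<Longrightarrow> smooth_on S (\<lambda>x. \<Prod>i\<in>I. f i x)"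
  by (induction I rule: infinite_finite_induct) (auto intro: smooth_on_const smooth_on_mult)

lemma smooth_on_continuous: "smooth_on S f \<Longrightarrow> continuous_on S f"
  by (rule continuous_at_imp_continuous_on) (auto intro: differentiable_imp_continuous_within smooth_on_D(1))

subsection \<open>Bump functions\<close>

lemma smooth_on_inverse: "smooth_on {x::real. x \<noteq> 0} inverse"
proof -
  have op: "open {x::real. x \<noteq> 0}" by (simp add: open_Collect_neq)
  have "ksmooth n {x::real. x \<noteq> 0} inverse" for n
  proof (induction n)
    case 0
    show ?case by (rule ksmooth_0I, rule has_derivative_inverse') simp
  next
    case (Suc n)
    show ?case
    proof (rule ksmooth_SucI[OF op, where D = "\<lambda>x v. - (inverse x * v * inverse x)"])
      fix v :: real
      show "ksmooth n {x. x \<noteq> 0} (\<lambda>x. - (inverse x * v * inverse x))"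
        by (rule ksmooth_linear_comp[OF op bounded_linear_minus[OF bounded_linear_ident]
            ksmooth_bilinear[OF op bounded_bilinear_mult
              ksmooth_bilinear[OF op bounded_bilinear_mult Suc ksmooth_const[OF op]] Suc]])
    qed (rule has_derivative_inverse', simp)
  qed
  then show ?thesis unfolding smooth_on_iff_ksmooth by blast
qed

text \<open>Functions \<open>p (1 / t) exp (- 1 / t)\<close>, extended by zero to the left. The
  whole family, and not only \<open>exp (- 1 / t)\<close>, is introduced because it is closed under
  differentiation.\<close>

definition flat_exp :: "real poly \<Rightarrow> real \<Rightarrow> real" where
  "flat_exp p t = (if t > 0 then poly p (1 / t) * exp (- (1 / t)) else 0)"

lemma poly_exp_neg_tendsto_0: "((\<lambda>x::real. poly p x * exp (- x)) \<longlongrightarrow> 0) at_top"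
proof -
  have "((\<lambda>x. \<Sum>i\<le>degree p. coeff p i * (x ^ i / exp x)) \<longlongrightarrow> (\<Sum>i\<le>degree p. coeff p i * 0)) at_top"
    by (intro tendsto_sum tendsto_mult tendsto_const tendsto_power_div_exp_0)
  then show ?thesis
    by (simp add: poly_altdef sum_divide_distrib exp_minus divide_inverse[symmetric])
qed

lemma flat_exp_tendsto_0: "(flat_exp p \<longlongrightarrow> 0) (at 0)"
proof -
  have "((\<lambda>t::real. poly p (1 / t) * exp (- (1 / t))) \<longlongrightarrow> 0) (at_right 0)"
    using filterlim_compose[OF poly_exp_neg_tendsto_0 filterlim_inverse_at_top_right]
    by (simp add: inverse_eq_divide)
  then have "(flat_exp p \<longlongrightarrow> 0) (at_right 0)"
    by (rule Lim_transform_eventually) (auto simp: flat_exp_def eventually_at_right_less eventually_at_filter)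
  moreover have "(flat_exp p \<longlongrightarrow> 0) (at_left 0)"
    by (rule Lim_transform_eventually[OF tendsto_const]) (auto simp: flat_exp_def eventually_at_filter)
  ultimately show ?thesis by (simp add: filterlim_at_split)
qed

text \<open>Differentiating \<open>p (1 / t)\<close> and \<open>exp (- 1 / t)\<close> produces the
  common factor \<open>1 / t ^ 2\<close>, with \<open>- p'\<close> from the first and
  \<open>p\<close> from the second. Written as a polynomial in \<open>1 / t\<close> this is
  \<open>X ^ 2 (p - p')\<close>.\<close>

lemma flat_exp_deriv:
  "(flat_exp p has_real_derivative flat_exp ([:0, 0, 1:] * (p - pderiv p)) t) (at t)"
proof -
  consider "t > 0" | "t < 0" | "t = 0" by linarith
  then show ?thesis
  proof cases
    case 1
    have "((\<lambda>t. poly p (1 / t) * exp (- (1 / t))) has_real_derivative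
        flat_exp ([:0, 0, 1:] * (p - pderiv p)) t) (at t)"
      using 1 by (auto intro!: derivative_eq_intros DERIV_chain2[OF poly_DERIV]
          simp: flat_exp_def field_simps power2_eq_square)
    then show ?thesis
      by (rule has_field_derivative_transform_within_open[of _ _ _ "{0<..}"]) (use 1 in \<open>auto simp: flat_exp_def\<close>)
  next
    case 2
    have "((\<lambda>t. 0) has_real_derivative flat_exp ([:0, 0, 1:] * (p - pderiv p)) t) (at t)"
      using 2 by (simp add: flat_exp_def)
    then show ?thesis
      by (rule has_field_derivative_transform_within_open[of _ _ _ "{..<0}"]) (use 2 in \<open>auto simp: flat_exp_def\<close>)
  next
    case 3
    \<comment> \<open>Dividing by \<open>h\<close> multiplies the polynomial in \<open>1 / h\<close>
      by its variable, so the difference quotient at 0 is the member of the family that belongs to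
      \<open>X p\<close>.\<close>
    have "((\<lambda>h. flat_exp (pCons 0 p) h) \<longlongrightarrow> 0) (at 0)" by (rule flat_exp_tendsto_0)
    then have "((\<lambda>h. (flat_exp p h - flat_exp p 0) / (h - 0)) \<longlongrightarrow> 0) (at 0)"
      by (rule Lim_transform_eventually) (auto simp: flat_exp_def eventually_at_filter field_simps)
    then show ?thesis
      using 3 by (simp add: has_field_derivative_iff flat_exp_def)
  qed
qed

lemma flat_exp_smooth: "smooth_on UNIV (flat_exp p)"
proof -
  have "ksmooth n UNIV (flat_exp p)" for n
  proof (induction n arbitrary: p)
    case 0
    show ?case by (rule ksmooth_0I, rule has_field_derivative_imp_has_derivative, rule flat_exp_deriv)
  next
    case (Suc n)
    show ?case
    proof (rule ksmooth_SucI[OF open_UNIV])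
      show "(flat_exp p has_derivative (\<lambda>v. flat_exp ([:0, 0, 1:] * (p - pderiv p)) x * v)) (at x)" for x
        by (rule has_field_derivative_imp_has_derivative[OF flat_exp_deriv])
      show "ksmooth n UNIV (\<lambda>x. flat_exp ([:0, 0, 1:] * (p - pderiv p)) x * v)" for v
        by (rule ksmooth_bilinear[OF open_UNIV bounded_bilinear_mult Suc ksmooth_const[OF open_UNIV]])
    qed
  qed
  then show ?thesis unfolding smooth_on_iff_ksmooth by blast
qed

text \<open>The quotient \<open>e (2 - s) / (e (2 - s) + e (s - 1))\<close> with \<open>e\<close>
  the flat exponential. Since \<open>2 - s\<close> and \<open>s - 1\<close> are never both
  nonpositive, the denominator does not vanish.\<close>

lemma smooth_step:
  obtains h :: "real \<Rightarrow> real" where "smooth_on UNIV h" "\<And>s. 0 \<le> h s" "\<And>s. h s \<le> 1"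
    "\<And>s. s \<le> 1 \<Longrightarrow> h s = 1" "\<And>s. s \<ge> 2 \<Longrightarrow> h s = 0"
proof
  let ?e = "flat_exp 1"
  let ?h = "\<lambda>s::real. ?e (2 - s) * inverse (?e (2 - s) + ?e (s - 1))"
  have nonneg: "0 \<le> ?e s" and pos: "0 < ?e s \<longleftrightarrow> 0 < s" for s by (auto simp: flat_exp_def)
  have den: "?e (2 - s) + ?e (s - 1) \<noteq> 0" for s
    using nonneg[of "2 - s"] nonneg[of "s - 1"] pos[of "2 - s"] pos[of "s - 1"]
    by (cases "s < 2") linarith+
  have e1: "smooth_on UNIV (\<lambda>s::real. ?e (2 - s))" and e2: "smooth_on UNIV (\<lambda>s::real. ?e (s - 1))"
    by (rule smooth_on_compose[where T = UNIV and f = ?e, OF open_UNIV _ open_UNIV flat_exp_smooth];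
        intro smooth_on_diff smooth_on_const smooth_on_linear bounded_linear_ident open_UNIV subset_UNIV)+
  show "smooth_on UNIV ?h"
    by (intro smooth_on_mult e1 smooth_on_compose[OF _ _ _ smooth_on_inverse] smooth_on_add e2)
       (use den in \<open>auto simp: open_Collect_neq\<close>)
  show "0 \<le> ?h s" "?h s \<le> 1" for s
    using nonneg[of "2 - s"] nonneg[of "s - 1"] den[of s] by (auto simp: field_simps)
  show "?h s = 1" if "s \<le> 1" for s
    using den[of s] that by (simp add: flat_exp_def)
  show "?h s = 0" if "s \<ge> 2" for s using that by (simp add: flat_exp_def)
qed

lemma smooth_bump:
  fixes p :: "'v::euclidean_space"
  assumes "open W" "p \<in> W"
  obtains h :: "'v \<Rightarrow> real" and K N where "smooth_on UNIV h" "\<And>x. 0 \<le> h x" "\<And>x. h x \<le> 1"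
    "compact K" "K \<subseteq> W" "\<And>x. x \<notin> K \<Longrightarrow> h x = 0" "open N" "p \<in> N" "N \<subseteq> W" "\<And>x. x \<in> N \<Longrightarrow> h x = 1"
proof -
  obtain s :: "real \<Rightarrow> real" where s: "smooth_on UNIV s" "\<And>t. 0 \<le> s t" "\<And>t. s t \<le> 1"
    "\<And>t. t \<le> 1 \<Longrightarrow> s t = 1" "\<And>t. t \<ge> 2 \<Longrightarrow> s t = 0"
    using smooth_step by blast
  obtain r where r: "r > 0" "cball p r \<subseteq> W" using assms open_contains_cball by blast
  \<comment> \<open>The squared distance, unlike the distance, is smooth at \<open>p\<close>. The
    factor makes \<open>?q\<close> at least 2 outside the ball of radius \<open>r\<close> and at
    most 1 on the ball of half that radius, the two thresholds of the step function.\<close>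
  let ?q = "\<lambda>x. (2 / r\<^sup>2) * ((x - p) \<bullet> (x - p))"
  have q: "?q x = 2 * (dist p x / r)\<^sup>2" for x
    by (simp add: power_divide dist_norm norm_minus_commute power2_norm_eq_inner[symmetric])
  have "smooth_on UNIV ?q"
    by (intro smooth_on_bilinear[OF _ bounded_bilinear_mult] smooth_on_bilinear[OF _ bounded_bilinear_inner]
        smooth_on_const smooth_on_diff smooth_on_linear bounded_linear_ident open_UNIV)
  then have h: "smooth_on UNIV (\<lambda>x. s (?q x))"
    by (intro smooth_on_compose[OF _ _ _ s(1)]) auto
  show thesis
  proof (rule that[of "\<lambda>x. s (?q x)" "cball p r" "ball p (r / 2)"])
    show "s (?q x) = 0" if "x \<notin> cball p r" for x
    proof -
      have "1 \<le> (dist p x / r)\<^sup>2" using that r(1) by (intro one_le_power) (auto simp: field_simps)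
      then show ?thesis using s(5) q by auto
    qed
    show "s (?q x) = 1" if "x \<in> ball p (r / 2)" for x
    proof -
      have "(dist p x / r)\<^sup>2 \<le> (1 / 2)\<^sup>2" using that r(1) by (intro power_mono) (auto simp: field_simps)
      also have "(1 / 2 :: real)\<^sup>2 = 1 / 4" by (simp add: power2_eq_square)
      finally have "?q x \<le> 1" unfolding q by linarith
      then show ?thesis by (rule s(4))
    qed
    show "ball p (r / 2) \<subseteq> W" using r by (force simp: subset_iff)
  qed (use r s h in auto)
qed

subsection \<open>Holomorphic maps are smooth\<close>

text \<open>Scalar-valued holomorphy, phrased through \<open>frechet_derivative\<close> so that a
  directional derivative is a concrete function to which the predicate can be applied again.\<close>

definition holo_fn :: "(complex ^ 'n) set \<Rightarrow> (complex ^ 'n \<Rightarrow> complex) \<Rightarrow> bool" where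
  "holo_fn S f \<longleftrightarrow>
     (\<forall>z\<in>S. f differentiable (at z) \<and>
        (\<forall>c v. frechet_derivative f (at z) (c *s v) = c * frechet_derivative f (at z) v))"

lemma holo_fn_D:
  assumes "holo_fn S f" "z \<in> S"
  shows "(f has_derivative frechet_derivative f (at z)) (at z)"
    and "frechet_derivative f (at z) (c *s v) = c * frechet_derivative f (at z) v"
  using assms has_frechet_derivative unfolding holo_fn_def by blast+

lemma bounded_linear_vector_scalar_mult: "bounded_linear (\<lambda>c. c *s (v :: complex ^ 'n))"
  by (rule linear_conv_bounded_linear[THEN iffD1])
     (auto intro!: linearI simp: Finite_Cartesian_Product.vec_eq_iff algebra_simps)

lemmas continuous_on_vector_scalar_mult [continuous_intros] =
  bounded_linear.continuous_on[OF bounded_linear_vector_scalar_mult]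

text \<open>The circle of integration is parametrised over the unit interval, so that the Cauchy integral
  becomes an integral depending on a parameter.\<close>

lemma holo_fn_Cauchy_derivative:
  assumes "holo_fn S f" "open S" "r > 0" "\<And>t. t \<in> cball 0 r \<Longrightarrow> z + t *s v \<in> S"
  shows "frechet_derivative f (at z) v =
     integral (cbox 0 1) (\<lambda>t::real. f (z + circlepath 0 r t *s v) * (exp (- (2 * of_real pi * \<i> * t)) / r))"
proof -
  let ?g = "\<lambda>t. f (z + t *s v)"
  have der: "(?g has_field_derivative frechet_derivative f (at (z + t *s v)) v) (at t)"
    if "t \<in> cball 0 r" for t
  proof -
    have s: "((\<lambda>t. z + t *s v) has_derivative (\<lambda>c. c *s v)) (at t)"
      by (auto intro!: derivative_eq_intros bounded_linear_imp_has_derivative bounded_linear_vector_scalar_mult)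
    have "(?g has_derivative (\<lambda>c. frechet_derivative f (at (z + t *s v)) (c *s v))) (at t)"
      using diff_chain_at[OF s holo_fn_D(1)[OF assms(1) assms(4)[OF that]]] by (simp add: o_def)
    then show ?thesis
      unfolding has_field_derivative_def
      by (simp add: holo_fn_D(2)[OF assms(1) assms(4)[OF that]] mult.commute[of _ "frechet_derivative f (at (z + t *s v)) v"])
  qed
  have hol: "?g holomorphic_on cball 0 r"
    unfolding holomorphic_on_def field_differentiable_def
    using der has_field_derivative_at_within by blast
  have "(?g has_field_derivative
      (1 / (2 * of_real pi * \<i>) * contour_integral (circlepath 0 r) (\<lambda>u. ?g u / (u - 0)\<^sup>2))) (at 0)"
    by (rule Cauchy_derivative_integral_circlepath(2))
       (use hol assms(3) in \<open>auto intro: holomorphic_on_imp_continuous_on holomorphic_on_subset\<close>)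
  then have "frechet_derivative f (at z) v =
      1 / (2 * of_real pi * \<i>) * contour_integral (circlepath 0 r) (\<lambda>u. ?g u / u\<^sup>2)"
    using DERIV_unique der[of 0] assms(3) by fastforce
  also have "\<dots> = integral {0..1} (\<lambda>t. 1 / (2 * of_real pi * \<i>) * (?g (circlepath 0 r t) / (circlepath 0 r t)\<^sup>2
      * (2 * of_real pi * \<i> * r * exp (2 * of_real pi * \<i> * t))))"
    unfolding contour_integral_integral vector_derivative_circlepath
    by (subst integral_mult_right[symmetric]) simp
  also have "\<dots> = integral (cbox 0 1) (\<lambda>t. ?g (circlepath 0 r t) * (exp (- (2 * of_real pi * \<i> * t)) / r))"
    unfolding cbox_interval
  proof (rule integral_cong)
    fix t :: real
    show "1 / (2 * of_real pi * \<i>) * (?g (circlepath 0 r t) / (circlepath 0 r t)\<^sup>2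
      * (2 * of_real pi * \<i> * r * exp (2 * of_real pi * \<i> * t))) =
      ?g (circlepath 0 r t) * (exp (- (2 * of_real pi * \<i> * t)) / r)"
      using assms(3) by (simp add: circlepath exp_minus power2_eq_square divide_simps)
  qed
  finally show ?thesis .
qed

text \<open>One radius serves all centres near \<open>z0\<close>, so that the Cauchy integral over a
  fixed circle represents the derivative on a whole neighbourhood and may be differentiated in its
  centre.\<close>

lemma cball_translates_in_open:
  fixes z0 v :: "complex ^ 'n"
  assumes "open S" "z0 \<in> S"
  obtains d r where "d > 0" "r > 0"
    "\<And>z t. z \<in> ball z0 d \<Longrightarrow> t \<in> cball (0 :: complex) r \<Longrightarrow> z + t *s v \<in> S"
proof -
  obtain e where e: "e > 0" "ball z0 e \<subseteq> S" using assms open_contains_ball by blast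
  obtain K where K: "K > 0" "\<And>c. norm (c *s v) \<le> norm c * K"
    using bounded_linear.pos_bounded[OF bounded_linear_vector_scalar_mult[of v]] by blast
  show thesis
  proof (rule that[of "e / 2" "e / (2 * K)"])
    fix z and t :: complex assume "z \<in> ball z0 (e / 2)" "t \<in> cball 0 (e / (2 * K))"
    then have "norm (t *s v) \<le> e / 2" "dist z0 z < e / 2"
      using K(2)[of t] K(1) by (auto simp: field_simps intro: order_trans)
    then have "dist z0 (z + t *s v) < e"
      using dist_triangle[of z0 "z + t *s v" z] by (simp add: dist_norm)
    then show "z + t *s v \<in> S" using e by auto
  qed (use e K in auto)
qed

lemma holo_fn_continuous: "holo_fn S f \<Longrightarrow> continuous_on S f"
  unfolding holo_fn_def
  by (rule continuous_at_imp_continuous_on) (auto intro: differentiable_imp_continuous_within)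

text \<open>Complex differentiability at each point says nothing about continuity of the derivative.
  It comes from the Cauchy representation, whose integrand involves only the continuous function
  \<open>f\<close>, and it is the hypothesis needed to differentiate under the integral
  sign.\<close>

lemma holo_fn_derivative_continuous:
  assumes "holo_fn S f" "open S"
  shows "continuous_on S (\<lambda>z. frechet_derivative f (at z) v)"
proof (rule continuous_at_imp_continuous_on, rule ballI)
  fix z0 assume "z0 \<in> S"
  then obtain d r where dr: "d > 0" "r > 0" "\<And>z t. z \<in> ball z0 d \<Longrightarrow> t \<in> cball 0 r \<Longrightarrow> z + t *s v \<in> S"
    using cball_translates_in_open[OF assms(2), of z0 v] by metis
  have "continuous_on (ball z0 d) (\<lambda>z. integral (cbox 0 1)
      (\<lambda>t::real. f (z + circlepath 0 r t *s v) * (exp (- (2 * of_real pi * \<i> * t)) / r)))"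
  proof (rule integral_continuous_on_param)
    have "(\<lambda>(z, t). z + circlepath 0 r t *s v) ` (ball z0 d \<times> cbox 0 1) \<subseteq> S"
      using dr(2) by (auto intro!: dr(3) simp: circlepath norm_mult)
    then have "continuous_on (ball z0 d \<times> cbox 0 1) (\<lambda>(z, t). f (z + circlepath 0 r t *s v))"
      unfolding split_def
      by (intro continuous_on_compose2[OF holo_fn_continuous[OF assms(1)]])
         (auto simp: circlepath intro!: continuous_intros)
    then show "continuous_on (ball z0 d \<times> cbox 0 1)
       (\<lambda>(z, t). f (z + circlepath 0 r t *s v) * (exp (- (2 * of_real pi * \<i> * t)) / r))"
      using dr(2) unfolding split_def by (intro continuous_intros) auto
  qed
  then have "continuous_on (ball z0 d) (\<lambda>z. frechet_derivative f (at z) v)"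
    by (rule continuous_on_eq) (rule holo_fn_Cauchy_derivative[OF assms dr(2), symmetric], rule dr(3))
  then show "isCont (\<lambda>z. frechet_derivative f (at z) v) z0"
    using dr(1) continuous_on_eq_continuous_at[OF open_ball] by (metis centre_in_ball)
qed

text \<open>Leibniz's rule for the Cauchy integral. For each parameter the derivative of the
  integrand is complex linear, and this passes to the integral. The class is therefore stable under
  directional derivatives, and smoothness follows by induction on the order.\<close>

lemma holo_fn_deriv:
  assumes "holo_fn S f" "open S"
  shows "holo_fn S (\<lambda>z. frechet_derivative f (at z) v)"
  unfolding holo_fn_def
proof
  fix z0 assume z0: "z0 \<in> S"
  then obtain d r where dr: "d > 0" "r > 0" "\<And>z t. z \<in> ball z0 d \<Longrightarrow> t \<in> cball 0 r \<Longrightarrow> z + t *s v \<in> S"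
    using cball_translates_in_open[OF assms(2), of z0 v] by metis
  let ?U = "ball z0 d"
  define k where "k = (\<lambda>t::real. exp (- (2 * of_real pi * \<i> * t)) / r)"
  define p where "p = (\<lambda>z t. z + circlepath 0 r t *s v)"
  \<comment> \<open>Leibniz's rule asks for the derivative as a bounded linear operator that is
    jointly continuous in the point and the parameter, hence the passage to
    \<open>Blinfun\<close>.\<close>
  define D where "D = (\<lambda>z. Blinfun (frechet_derivative f (at z)))"
  define fx where "fx = (\<lambda>z t. blinfun_mult_left (k t) o\<^sub>L D (p z t))"
  have pS: "p z t \<in> S" if "z \<in> ?U" "t \<in> cbox 0 1" for z t
    using dr that by (auto simp: p_def circlepath norm_mult)
  have D: "blinfun_apply (D z) = frechet_derivative f (at z)" if "z \<in> S" for z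
    unfolding D_def using holo_fn_D(1)[OF assms(1) that] has_derivative_bounded_linear
    by (blast intro: bounded_linear_Blinfun_apply)
  have contD: "continuous_on S D"
    by (rule continuous_on_blinfun_componentwise,
        rule continuous_on_eq[OF holo_fn_derivative_continuous[OF assms]], simp add: D)
  have contk: "continuous_on T k" for T
    unfolding k_def using dr(2) by (intro continuous_intros) auto
  have contp: "continuous_on (?U \<times> cbox 0 1) (\<lambda>(z, t). p z t)"
    unfolding split_def p_def by (auto simp: circlepath intro!: continuous_intros)
  have der: "((\<lambda>z. f (p z t) * k t) has_derivative blinfun_apply (fx z t)) (at z within ?U)"
    if "z \<in> ?U" "t \<in> cbox 0 1" for z t
  proof -
    have "((\<lambda>z. p z t) has_derivative (\<lambda>h. h)) (at z)"
      unfolding p_def by (auto intro!: derivative_eq_intros)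
    from diff_chain_at[OF this holo_fn_D(1)[OF assms(1) pS[OF that]]]
    have "((\<lambda>z. f (p z t)) has_derivative D (p z t)) (at z)"
      by (simp add: o_def D[OF pS[OF that]])
    then have "((\<lambda>z. f (p z t) * k t) has_derivative blinfun_apply (fx z t)) (at z)"
      unfolding fx_def by (auto intro!: derivative_eq_intros simp: algebra_simps)
    then show ?thesis by (rule has_derivative_at_withinI)
  qed
  have contfx: "continuous_on (?U \<times> cbox 0 1) (\<lambda>(z, t). fx z t)"
  proof -
    have "continuous_on (?U \<times> cbox 0 1) (\<lambda>x. D (p (fst x) (snd x)))"
      using contp pS unfolding split_def by (intro continuous_on_compose2[OF contD]) auto
    then show ?thesis
      unfolding split_def fx_def
      by (intro continuous_on_blinfun_componentwise)
         (auto intro!: continuous_intros continuous_on_compose2[OF contk[of UNIV]])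
  qed
  have int: "(\<lambda>t. f (p z t) * k t) integrable_on cbox 0 1" if "z \<in> ?U" for z
  proof (rule integrable_continuous)
    have "continuous_on (cbox 0 1) (\<lambda>t. p z t)"
      unfolding p_def by (auto simp: circlepath intro!: continuous_intros)
    then show "continuous_on (cbox 0 1) (\<lambda>t. f (p z t) * k t)"
      using pS[OF that] by (intro continuous_intros contk continuous_on_compose2[OF holo_fn_continuous[OF assms(1)]]) auto
  qed
  let ?I = "integral (cbox 0 1) (fx z0)"
  have "((\<lambda>z. integral (cbox 0 1) (\<lambda>t. f (p z t) * k t)) has_derivative ?I) (at z0 within ?U)"
    using der int contfx dr(1) by (intro leibniz_rule) auto
  then have "((\<lambda>z. frechet_derivative f (at z) v) has_derivative ?I) (at z0 within ?U)"
  proof (rule has_derivative_transform[rotated 2])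
    show "frechet_derivative f (at z) v = integral (cbox 0 1) (\<lambda>t. f (p z t) * k t)" if "z \<in> ?U" for z
      unfolding p_def k_def by (rule holo_fn_Cauchy_derivative[OF assms dr(2) dr(3)[OF that]])
  qed (use dr(1) in simp)
  then have hd: "((\<lambda>z. frechet_derivative f (at z) v) has_derivative ?I) (at z0)"
    using dr(1) at_within_open[OF _ open_ball] by (metis centre_in_ball)
  have "continuous_on (cbox 0 1) (fx z0)"
  proof -
    have "continuous_on (cbox (0::real) 1) (\<lambda>t. (z0, t))" by (intro continuous_intros)
    then show ?thesis using continuous_on_compose2[OF contfx, of "cbox 0 1" "\<lambda>t. (z0, t)"] dr(1)
      by (simp add: image_subset_iff)
  qed
  then have fxint: "fx z0 integrable_on cbox 0 1" by (rule integrable_continuous)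
  have "blinfun_apply ?I (c *s w) = c * blinfun_apply ?I w" for c w
  proof -
    have "blinfun_apply ?I (c *s w) = integral (cbox 0 1) (\<lambda>t. c * blinfun_apply (fx z0 t) w)"
      unfolding blinfun_apply_integral[OF fxint]
      using pS[of z0] dr(1) by (intro integral_cong) (simp add: fx_def D holo_fn_D(2)[OF assms(1)])
    then show ?thesis unfolding blinfun_apply_integral[OF fxint] by simp
  qed
  then show "(\<lambda>z. frechet_derivative f (at z) v) differentiable at z0 \<and>
      (\<forall>c w. frechet_derivative (\<lambda>z. frechet_derivative f (at z) v) (at z0) (c *s w) =
           c * frechet_derivative (\<lambda>z. frechet_derivative f (at z) v) (at z0) w)"
    using hd frechet_derivativeI[OF hd] unfolding differentiable_def by metis
qed

lemma holo_fn_smooth: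
  assumes "holo_fn S f" "open S"
  shows "smooth_on S f"
proof -
  have "ksmooth n S f" for n
    using assms(1)
  proof (induction n arbitrary: f)
    case 0
    then show ?case by (simp add: holo_fn_def)
  next
    case (Suc n)
    then show ?case using holo_fn_deriv[OF _ assms(2)] by (simp add: holo_fn_def)
  qed
  then show ?thesis unfolding smooth_on_iff_ksmooth by blast
qed

lemma holo_on_D:
  assumes "holo_on S f" "z \<in> S"
  shows "(f has_derivative frechet_derivative f (at z)) (at z)"
    and "frechet_derivative f (at z) (c *s v) = c *s frechet_derivative f (at z) v"
proof -
  obtain D where D: "(f has_derivative D) (at z)" "Vector_Spaces.linear (*s) (*s) D"
    using assms unfolding holo_on_def by blast
  have e: "frechet_derivative f (at z) = D" by (rule frechet_derivativeI[OF D(1)])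
  show "(f has_derivative frechet_derivative f (at z)) (at z)" using D(1) e by simp
  show "frechet_derivative f (at z) (c *s v) = c *s frechet_derivative f (at z) v"
    unfolding e using D(2) by (simp add: Vector_Spaces.linear_iff)
qed

lemma holo_on_smooth:
  fixes f :: "complex ^ 'n \<Rightarrow> complex ^ 'm"
  assumes "holo_on S f" "open S"
  shows "smooth_on S f"
proof -
  have "smooth_on S (\<lambda>z. f z $ i)" for i
  proof (rule holo_fn_smooth[OF _ assms(2)])
    show "holo_fn S (\<lambda>z. f z $ i)"
      unfolding holo_fn_def
    proof
      fix z assume z: "z \<in> S"
      have d: "((\<lambda>z. f z $ i) has_derivative (\<lambda>v. frechet_derivative f (at z) v $ i)) (at z)"
        by (rule bounded_linear.has_derivative[OF bounded_linear_vec_nth holo_on_D(1)[OF assms(1) z]])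
      show "(\<lambda>z. f z $ i) differentiable at z \<and>
          (\<forall>c v. frechet_derivative (\<lambda>z. f z $ i) (at z) (c *s v) =
                c * frechet_derivative (\<lambda>z. f z $ i) (at z) v)"
        using d frechet_derivativeI[OF d] unfolding differentiable_def
        by (auto simp: holo_on_D(2)[OF assms(1) z])
    qed
  qed
  then have "smooth_on S (\<lambda>z. \<Sum>i\<in>UNIV. f z $ i *s axis i 1)"
    by (intro smooth_on_sum[OF assms(2)] smooth_on_linear_comp[OF assms(2) bounded_linear_vector_scalar_mult])
  then show ?thesis by (simp add: basis_expansion)
qed

section \<open>Alternating covectors\<close>

definition multilin :: "nat \<Rightarrow> ('v::real_vector) covector \<Rightarrow> bool" where
  "multilin k \<eta> \<longleftrightarrow> (\<forall>xs ys. length xs + Suc (length ys) = k \<longrightarrow> linear (\<lambda>v. \<eta> (xs @ v # ys)))"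

lemma multilinD: "multilin k \<eta> \<Longrightarrow> length xs + Suc (length ys) = k \<Longrightarrow> linear (\<lambda>v. \<eta> (xs @ v # ys))"
  unfolding multilin_def by blast

lemma alt_form_linear:
  assumes "alt_form k \<eta>" "length xs + Suc (length ys) = k"
  shows "linear (\<lambda>v. \<eta> (xs @ v # ys))"
proof -
  have "\<forall>vs i. length vs = k \<and> i < k \<longrightarrow> linear (\<lambda>x. \<eta> (vs[i := x]))"
    using assms(1) unfolding alt_form_def by blast
  from this[rule_format, of "xs @ 0 # ys" "length xs"] assms(2) show ?thesis by simp
qed

lemma alt_form_multilin: "alt_form k \<eta> \<Longrightarrow> multilin k \<eta>"
  unfolding multilin_def using alt_form_linear by blast

lemma alt_form_length: "alt_form k \<eta> \<Longrightarrow> length vs \<noteq> k \<Longrightarrow> \<eta> vs = 0"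
  unfolding alt_form_def by blast

lemma alt_form_repeat: "alt_form k \<eta> \<Longrightarrow> \<not> distinct vs \<Longrightarrow> \<eta> vs = 0"
proof -
  assume a: "alt_form k \<eta>" "\<not> distinct vs"
  then obtain i j where "i < length vs" "j < length vs" "i \<noteq> j" "vs ! i = vs ! j"
    unfolding distinct_conv_nth by blast
  then show ?thesis using a(1) unfolding alt_form_def by (metis linorder_neqE_nat)
qed

text \<open>Expand the value with \<open>a + b\<close> in both slots; it vanishes, and so do the two
  terms with a repeated entry.\<close>

lemma alt_form_swap:
  assumes "alt_form k \<eta>"
  shows "\<eta> (xs @ a # ys @ b # zs) = - \<eta> (xs @ b # ys @ a # zs)"
proof (cases "length (xs @ a # ys @ b # zs) = k")
  case True
  have l: "linear (\<lambda>v. \<eta> (xs @ v # ys @ w # zs))" "linear (\<lambda>v. \<eta> (xs @ w # ys @ v # zs))" for w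
    using alt_form_linear[OF assms, of xs "ys @ w # zs"] alt_form_linear[OF assms, of "xs @ w # ys" zs] True
    by auto
  have r: "\<eta> (xs @ w # ys @ w # zs) = 0" for w by (rule alt_form_repeat[OF assms]) simp
  have "\<eta> (xs @ (a + b) # ys @ (a + b) # zs) =
      \<eta> (xs @ a # ys @ (a + b) # zs) + \<eta> (xs @ b # ys @ (a + b) # zs)"
    by (rule linear_add[OF l(1)])
  moreover have "\<eta> (xs @ c # ys @ (a + b) # zs) = \<eta> (xs @ c # ys @ a # zs) + \<eta> (xs @ c # ys @ b # zs)" for c
    by (rule linear_add[OF l(2)])
  ultimately have "\<eta> (xs @ a # ys @ b # zs) + \<eta> (xs @ b # ys @ a # zs) = 0"
    using r[of "a + b"] r[of a] r[of b] by simp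
  then show ?thesis by (simp add: add_eq_0_iff)
next
  case False
  then show ?thesis using alt_form_length[OF assms] by simp
qed

text \<open>Induction on a product of transpositions. A composite acts on lists by its left factor
  first, so the induction hypothesis is applied to the list that has already been transposed, and
  \<open>vs\<close> must be general.\<close>

lemma alt_form_permute:
  assumes "alt_form k \<eta>" "\<sigma> permutes {..<k}" "length vs = k"
  shows "\<eta> (permute_list \<sigma> vs) = of_int (sign \<sigma>) * \<eta> vs"
  using assms(2) finite_lessThan assms(3)
proof (induction arbitrary: vs rule: permutes_induct)
  case id
  then show ?case by simp
next
  case (swap a b p)
  have t: "Transposition.transpose a b permutes {..<length vs}"
    using swap by (intro permutes_swap_id) auto
  have swp: "\<eta> (permute_list (Transposition.transpose a b) vs) = - \<eta> vs"
    if ab: "a < b" "b < length vs" for a b and vs :: "'a list"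
  proof -
    define xs ys zs where "xs = take a vs" and "ys = take (b - Suc a) (drop (Suc a) vs)" and "zs = drop (Suc b) vs"
    have vs: "vs = xs @ vs ! a # ys @ vs ! b # zs"
    proof -
      have "drop (Suc a) vs = ys @ drop b vs"
        unfolding ys_def using ab by (metis Suc_leI append_take_drop_id drop_drop le_add_diff_inverse2)
      then have "drop (Suc a) vs = ys @ vs ! b # zs"
        unfolding zs_def using ab(2) by (simp add: Cons_nth_drop_Suc)
      then show ?thesis unfolding xs_def using ab id_take_nth_drop[of a vs] by simp
    qed
    have len: "length xs = a" "length ys = b - Suc a" unfolding xs_def ys_def using ab by auto
    have "permute_list (Transposition.transpose a b) vs = xs @ vs ! b # ys @ vs ! a # zs"
    proof (rule nth_equalityI)
      show "length (permute_list (Transposition.transpose a b) vs) = length (xs @ vs ! b # ys @ vs ! a # zs)"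
        using arg_cong[OF vs, of length] by simp
      fix i assume "i < length (permute_list (Transposition.transpose a b) vs)"
      then have i: "i < length vs" by simp
      have "permute_list (Transposition.transpose a b) vs ! i = vs ! Transposition.transpose a b i"
        by (rule permute_list_nth) (use i ab in \<open>auto intro: permutes_swap_id\<close>)
      also have "\<dots> = (xs @ vs ! b # ys @ vs ! a # zs) ! i"
      proof -
        have vi: "vs ! i = (xs @ vs ! a # ys @ vs ! b # zs) ! i" using vs by simp
        consider "i = a" | "i = b" | "i \<noteq> a" "i \<noteq> b" by blast
        then show ?thesis
        proof cases
          case 3
          then show ?thesis unfolding transpose_apply_other[OF 3] vi using len ab
            by (auto simp: nth_append nth_Cons split: nat.splits)
        qed (use len ab in \<open>auto simp: nth_append nth_Cons split: nat.splits\<close>)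
      qed
      finally show "permute_list (Transposition.transpose a b) vs ! i = (xs @ vs ! b # ys @ vs ! a # zs) ! i" .
    qed
    then show ?thesis using alt_form_swap[OF assms(1)] vs by metis
  qed
  have swp': "\<eta> (permute_list (Transposition.transpose a b) ws) = - \<eta> ws" if "length ws = k" for ws :: "'a list"
    using swp[of a b ws] swp[of b a ws] swap.hyps(1-3) that
    by (cases "a < b") (auto simp: transpose_commute)
  have "permute_list (Transposition.transpose a b \<circ> p) vs = permute_list p (permute_list (Transposition.transpose a b) vs)"
    using swap by (intro permute_list_compose) auto
  then have "\<eta> (permute_list (Transposition.transpose a b \<circ> p) vs) = - (of_int (sign p) * \<eta> vs)"
    using swap.IH[of "permute_list (Transposition.transpose a b) vs"] swap.prems swp'[of vs] by simp
  moreover have "sign (Transposition.transpose a b \<circ> p) = - sign p"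
    using swap by (subst sign_compose)
      (auto simp: sign_swap_id permutation_swap_id intro: permutation_permutes[THEN iffD2])
  ultimately show ?case by (simp only: of_int_minus mult_minus_left)
qed

lemma alt_form_norm_permute:
  assumes "alt_form k \<eta>" "mset us = mset vs"
  shows "cmod (\<eta> us) = cmod (\<eta> vs)"
proof (cases "length vs = k")
  case True
  obtain p where "p permutes {..<length vs}" "permute_list p vs = us"
    using mset_eq_permutation[OF assms(2)] by blast
  then show ?thesis using alt_form_permute[OF assms(1), of p vs] True
    by (auto simp: norm_mult sign_def)
next
  case False
  then show ?thesis using alt_form_length[OF assms(1)] mset_eq_length[OF assms(2)] by metis
qed

text \<open>The decomposable covector \<open>\<gamma>1 \<and> ... \<and> \<gamma>k\<close>, that is,
  the determinant of the values \<open>\<gamma>i (vj)\<close>. Identities between wedge products are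
  transferred to it and then read off from permutation sums or determinants.\<close>

definition altprod :: "('v \<Rightarrow> complex) list \<Rightarrow> 'v covector" where
  "altprod \<gamma>s vs =
     (if length vs = length \<gamma>s then
        \<Sum>\<sigma> | \<sigma> permutes {..<length \<gamma>s}. of_int (sign \<sigma>) * (\<Prod>i<length \<gamma>s. (\<gamma>s ! i) (vs ! \<sigma> i))
      else 0)"

lemma altprod_det:
  assumes "length vs = length \<gamma>s"
  shows "altprod \<gamma>s vs =
    Determinant.det (Matrix.mat (length \<gamma>s) (length \<gamma>s) (\<lambda>(i, j). (\<gamma>s ! i) (vs ! j)))"
  using assms unfolding altprod_def Determinant.det_def
  by (auto intro!: sum.cong prod.cong simp: atLeast0LessThan permutes_in_image)

lemma altprod_Nil: "altprod [] = (\<lambda>vs. if vs = [] then 1 else 0)"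
proof -
  have "{\<sigma>::nat \<Rightarrow> nat. \<forall>x. \<sigma> x = x} = {id}" by (auto simp: fun_eq_iff)
  then show ?thesis by (auto simp: altprod_def fun_eq_iff)
qed

lemma altprod_repeat_vector:
  assumes "\<not> distinct vs"
  shows "altprod \<gamma>s vs = 0"
proof (cases "length vs = length \<gamma>s")
  case True
  obtain i j where ij: "i < length vs" "j < length vs" "i \<noteq> j" "vs ! i = vs ! j"
    using assms unfolding distinct_conv_nth by blast
  show ?thesis unfolding altprod_det[OF True]
    by (rule det_identical_columns[OF _ ij(3)]) (use ij True in \<open>auto intro!: eq_vecI\<close>)
qed (simp add: altprod_def)

lemma altprod_repeat_covector:
  assumes "\<not> distinct \<gamma>s"
  shows "altprod \<gamma>s vs = 0"
proof (cases "length vs = length \<gamma>s")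
  case True
  obtain i j where ij: "i < length \<gamma>s" "j < length \<gamma>s" "i \<noteq> j" "\<gamma>s ! i = \<gamma>s ! j"
    using assms unfolding distinct_conv_nth by blast
  show ?thesis unfolding altprod_det[OF True]
    by (rule det_identical_rows[OF _ ij(3)]) (use ij True in \<open>auto intro!: eq_vecI\<close>)
qed (simp add: altprod_def)

lemma altprod_permute:
  assumes "p permutes {..<length \<gamma>s}"
  shows "altprod (permute_list p \<gamma>s) vs = of_int (sign p) * altprod \<gamma>s vs"
proof (cases "length vs = length \<gamma>s")
  case True
  let ?n = "length \<gamma>s"
  let ?A = "Matrix.mat ?n ?n (\<lambda>(i, j). (\<gamma>s ! i) (vs ! j))"
  have "altprod (permute_list p \<gamma>s) vs = Determinant.det (Matrix.mat ?n ?n (\<lambda>(i, j). ?A $$ (p i, j)))"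
    using True assms unfolding altprod_det[of vs "permute_list p \<gamma>s", simplified, OF True]
    by (intro arg_cong[of _ _ Determinant.det] eq_matI)
       (auto simp: permute_list_nth permutes_in_image[of p "{..<?n}", simplified])
  also have "\<dots> = of_int (sign p) * Determinant.det ?A"
    by (rule det_permute_rows) (use assms in \<open>auto simp: atLeast0LessThan\<close>)
  finally show ?thesis unfolding altprod_det[OF True] .
qed (simp add: altprod_def)

lemma altprod_mset_eq:
  assumes "mset \<gamma>s = mset \<delta>s"
  obtains s :: int where "s = 1 \<or> s = -1" "\<And>vs. altprod \<gamma>s vs = of_int s * altprod \<delta>s vs"
proof -
  obtain p where p: "p permutes {..<length \<delta>s}" "permute_list p \<delta>s = \<gamma>s"
    using mset_eq_permutation[OF assms] by blast
  show thesis
    using that[of "sign p"] altprod_permute[OF p(1)] p(2) by (auto simp: sign_def)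
qed

text \<open>Isolates the factor of one slot. The entry \<open>undefined\<close> stands at the
  excluded position, so the remaining product is literally the same term for every \<open>a\<close>,
  and additivity and homogeneity in the slot become linearity of a sum.\<close>

lemma altprod_slot:
  assumes "length vs = length xs + Suc (length ys)"
  shows "altprod (xs @ a # ys) vs =
    (\<Sum>\<sigma> | \<sigma> permutes {..<length vs}. of_int (sign \<sigma>) * (a (vs ! \<sigma> (length xs)) *
       (\<Prod>i\<in>{..<length vs} - {length xs}. ((xs @ undefined # ys) ! i) (vs ! \<sigma> i))))"
proof -
  have "(\<Prod>i<length vs. ((xs @ a # ys) ! i) (vs ! \<sigma> i)) = a (vs ! \<sigma> (length xs)) *
       (\<Prod>i\<in>{..<length vs} - {length xs}. ((xs @ undefined # ys) ! i) (vs ! \<sigma> i))" for \<sigma>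
  proof -
    have "(xs @ a # ys) ! i = (xs @ undefined # ys) ! i" if "i \<noteq> length xs" for i
      using nth_list_update_neq[of "length xs" i "xs @ undefined # ys" a] that by simp
    then have "(\<Prod>i\<in>{..<length vs} - {length xs}. ((xs @ a # ys) ! i) (vs ! \<sigma> i)) =
        (\<Prod>i\<in>{..<length vs} - {length xs}. ((xs @ undefined # ys) ! i) (vs ! \<sigma> i))"
      by (intro prod.cong refl) simp
    then show ?thesis using assms prod.remove[of "{..<length vs}" "length xs" "\<lambda>i. ((xs @ a # ys) ! i) (vs ! \<sigma> i)"]
      by simp
  qed
  then show ?thesis using assms by (simp add: altprod_def)
qed

lemma altprod_add:
  "altprod (xs @ (\<lambda>v. a v + b v) # ys) vs = altprod (xs @ a # ys) vs + altprod (xs @ b # ys) vs"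
proof (cases "length vs = length xs + Suc (length ys)")
  case True
  show ?thesis unfolding altprod_slot[OF True] by (simp add: algebra_simps sum.distrib)
qed (simp add: altprod_def)

lemma altprod_scale:
  "altprod (xs @ (\<lambda>v. c * a v) # ys) vs = c * altprod (xs @ a # ys) vs"
proof (cases "length vs = length xs + Suc (length ys)")
  case True
  show ?thesis unfolding altprod_slot[OF True] by (simp add: algebra_simps sum_distrib_left)
qed (simp add: altprod_def)

lemma altprod_map:
  "altprod \<gamma>s (map l vs) = altprod (map (\<lambda>\<gamma>. \<gamma> \<circ> l) \<gamma>s) vs"
  unfolding altprod_def
  by (auto intro!: sum.cong prod.cong) (metis (no_types, lifting) lessThan_iff nth_map permutes_in_image)

lemma altprod_alt_form:
  assumes "\<And>\<gamma>. \<gamma> \<in> set \<gamma>s \<Longrightarrow> linear \<gamma>"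
  shows "alt_form (length \<gamma>s) (altprod \<gamma>s)"
  unfolding alt_form_def
proof (intro conjI allI impI)
  fix vs :: "'a list" and i assume vi: "length vs = length \<gamma>s \<and> i < length \<gamma>s"
  let ?n = "length \<gamma>s"
  \<comment> \<open>Only the covector that \<open>\<sigma>\<close> pairs with slot \<open>i\<close>
    sees the new entry \<open>x\<close>.\<close>
  have e: "(\<Prod>k<?n. (\<gamma>s ! k) (vs[i := x] ! \<sigma> k)) =
      (\<gamma>s ! inv_into UNIV \<sigma> i) x * (\<Prod>k\<in>{..<?n} - {inv_into UNIV \<sigma> i}. (\<gamma>s ! k) (vs ! \<sigma> k))"
    if s: "\<sigma> permutes {..<?n}" for \<sigma> x
  proof -
    have "inv_into UNIV \<sigma> i < ?n" using permutes_in_image[OF permutes_inv[OF s]] vi by auto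
    moreover have "i \<noteq> \<sigma> k" if "k \<noteq> inv_into UNIV \<sigma> i" for k
      using that permutes_inverses(2)[OF s, of k] by auto
    ultimately show ?thesis using vi permutes_inverses(1)[OF s]
      by (subst prod.remove[of _ "inv_into UNIV \<sigma> i"]) (auto intro!: prod.cong)
  qed
  have "linear (\<lambda>x. \<Sum>\<sigma> | \<sigma> permutes {..<?n}. of_int (sign \<sigma>) *
      ((\<gamma>s ! inv_into UNIV \<sigma> i) x * (\<Prod>k\<in>{..<?n} - {inv_into UNIV \<sigma> i}. (\<gamma>s ! k) (vs ! \<sigma> k))))"
  proof (rule linear_compose_sum, rule ballI)
    fix \<sigma> assume "\<sigma> \<in> {\<sigma>. \<sigma> permutes {..<?n}}"
    then have "inv_into UNIV \<sigma> i < ?n" using permutes_in_image[OF permutes_inv] vi by fastforce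
    then have "linear (\<gamma>s ! inv_into UNIV \<sigma> i)" using assms by simp
    then show "linear (\<lambda>x. of_int (sign \<sigma>) *
      ((\<gamma>s ! inv_into UNIV \<sigma> i) x * (\<Prod>k\<in>{..<?n} - {inv_into UNIV \<sigma> i}. (\<gamma>s ! k) (vs ! \<sigma> k))))"
      by (auto intro!: linearI simp: linear_add linear_scale algebra_simps)
  qed
  moreover have "altprod \<gamma>s (vs[i := x]) = (\<Sum>\<sigma> | \<sigma> permutes {..<?n}. of_int (sign \<sigma>) *
      ((\<gamma>s ! inv_into UNIV \<sigma> i) x * (\<Prod>k\<in>{..<?n} - {inv_into UNIV \<sigma> i}. (\<gamma>s ! k) (vs ! \<sigma> k))))" for x
    unfolding altprod_def using vi e by (auto intro!: sum.cong)
  ultimately show "linear (\<lambda>x. altprod \<gamma>s (vs[i := x]))" by simp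
next
  fix vs :: "'a list" and i j
  assume "length vs = length \<gamma>s \<and> i < j \<and> j < length \<gamma>s \<and> vs ! i = vs ! j"
  then have "\<not> distinct vs" by (metis distinct_conv_nth less_trans nat_neq_iff)
  then show "altprod \<gamma>s vs = 0" by (rule altprod_repeat_vector)
qed (simp add: altprod_def)

subsection \<open>Wedge products\<close>

text \<open>In the double sum over permutations \<open>\<rho>\<close> and \<open>\<rho>'\<close> of the two blocks, each pair is absorbed into the
  permutation \<open>\<sigma>\<close> of the whole list, so that every pair contributes the same amount.\<close>

lemma wedge_altprod:
  assumes "length as = p" "length bs = q"
  shows "wedge p q (altprod as) (altprod bs) = altprod (as @ bs)"
proof
  fix vs :: "'a list"
  show "wedge p q (altprod as) (altprod bs) vs = altprod (as @ bs) vs"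
  proof (cases "length vs = p + q")
    case True
    let ?S = "{\<sigma>. \<sigma> permutes {..<p + q}}" and ?P = "{\<sigma>. \<sigma> permutes {..<p}}" and ?Q = "{\<sigma>. \<sigma> permutes {..<q}}"
    let ?X = "\<lambda>\<sigma>. of_int (sign \<sigma>) * (\<Prod>i<p + q. ((as @ bs) ! i) (vs ! \<sigma> i))"
    \<comment> \<open>A permutation of the second block, transported to the positions from
      \<open>p\<close> on and extended by the identity.\<close>
    let ?sh = "\<lambda>\<rho>. map_permutation {..<q} ((+) p) \<rho>"
    have t: "altprod as (take p (permute_list \<sigma> vs)) =
        (\<Sum>\<rho>\<in>?P. of_int (sign \<rho>) * (\<Prod>i<p. (as ! i) (vs ! \<sigma> (\<rho> i))))" if "\<sigma> \<in> ?S" for \<sigma>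
      using that True assms unfolding altprod_def
      by (auto intro!: sum.cong prod.cong simp: permute_list_nth permutes_in_image[of _ "{..<p}", simplified])
         (metis (no_types, lifting) lessThan_iff permute_list_nth permutes_in_image trans_less_add1)
    have d: "altprod bs (drop p (permute_list \<sigma> vs)) =
        (\<Sum>\<rho>\<in>?Q. of_int (sign \<rho>) * (\<Prod>i<q. (bs ! i) (vs ! \<sigma> (p + \<rho> i))))" if "\<sigma> \<in> ?S" for \<sigma>
      using that True assms unfolding altprod_def
      by (auto intro!: sum.cong prod.cong)
         (metis (no_types, lifting) lessThan_iff permute_list_nth permutes_in_image nat_add_left_cancel_less)
    have c: "(\<Sum>\<sigma>\<in>?S. of_int (sign \<sigma>) * ((of_int (sign \<rho>) * (\<Prod>i<p. (as ! i) (vs ! \<sigma> (\<rho> i)))) *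
        (of_int (sign \<rho>') * (\<Prod>i<q. (bs ! i) (vs ! \<sigma> (p + \<rho>' i)))))) = (\<Sum>\<sigma>\<in>?S. ?X \<sigma>)"
      if r: "\<rho> \<in> ?P" "\<rho>' \<in> ?Q" for \<rho> \<rho>'
    proof -
      have bij: "bij_betw ((+) p) {..<q} {p..<p + q}"
        by (rule bij_betwI[where g = "\<lambda>x. x - p"]) auto
      have sh: "?sh \<rho>' permutes {p..<p + q}" using r(2) map_permutation_permutes[OF bij] by simp
      have shv: "?sh \<rho>' (p + j) = p + \<rho>' j" if "j < q" for j
        using that bij by (simp add: map_permutation_def restrict_id_def bij_betw_def)
      let ?k = "\<rho> \<circ> ?sh \<rho>'"
      have rS: "\<rho> permutes {..<p + q}" by (rule permutes_subset[of \<rho> "{..<p}"]) (use r(1) in auto)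
      have shS: "?sh \<rho>' permutes {..<p + q}" by (rule permutes_subset[OF sh]) auto
      have kS: "?k permutes {..<p + q}" using permutes_compose[OF shS rS] .
      have k1: "?k i = \<rho> i" if "i < p" for i
        using that permutes_not_in[OF sh, of i] by simp
      have k2: "?k (p + j) = p + \<rho>' j" if "j < q" for j
        using that shv permutes_not_in[of \<rho> "{..<p}"] r(1) by simp
      have sg: "sign ?k = sign \<rho> * sign \<rho>'"
        using sign_compose[of \<rho> "?sh \<rho>'"] rS shS sign_map_permutation[of "(+) p" "{..<q}" \<rho>'] r(2)
        by (auto simp: permutation_permutes)
      have "(\<Sum>\<sigma>\<in>?S. ?X \<sigma>) = (\<Sum>\<sigma>\<in>?S. ?X (\<sigma> \<circ> ?k))"
        by (rule sum_permutations_compose_right[OF kS])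
      also have "\<dots> = (\<Sum>\<sigma>\<in>?S. of_int (sign \<sigma>) * ((of_int (sign \<rho>) * (\<Prod>i<p. (as ! i) (vs ! \<sigma> (\<rho> i)))) *
        (of_int (sign \<rho>') * (\<Prod>i<q. (bs ! i) (vs ! \<sigma> (p + \<rho>' i))))))"
      proof (rule sum.cong[OF refl])
        fix \<sigma> assume "\<sigma> \<in> ?S"
        then have "sign (\<sigma> \<circ> ?k) = sign \<sigma> * (sign \<rho> * sign \<rho>')"
          using sign_compose[of \<sigma> ?k] kS sg by (auto simp: permutation_permutes)
        moreover have "(\<Prod>i<p + q. ((as @ bs) ! i) (vs ! (\<sigma> \<circ> ?k) i)) =
            (\<Prod>i<p. (as ! i) (vs ! \<sigma> (\<rho> i))) * (\<Prod>i<q. (bs ! i) (vs ! \<sigma> (p + \<rho>' i)))"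
        proof -
          have "{..<p + q} = {..<p} \<union> {p..<p + q}" by auto
          then have "(\<Prod>i<p + q. ((as @ bs) ! i) (vs ! (\<sigma> \<circ> ?k) i)) =
            (\<Prod>i<p. ((as @ bs) ! i) (vs ! (\<sigma> \<circ> ?k) i)) * (\<Prod>i=p..<p+q. ((as @ bs) ! i) (vs ! (\<sigma> \<circ> ?k) i))"
            by (simp add: prod.union_disjoint[symmetric] ivl_disj_int)
          also have "(\<Prod>i=p..<p+q. ((as @ bs) ! i) (vs ! (\<sigma> \<circ> ?k) i)) =
              (\<Prod>j<q. ((as @ bs) ! (p + j)) (vs ! (\<sigma> \<circ> ?k) (p + j)))"
            by (rule prod.reindex_bij_betw[OF bij, symmetric])
          also have "(\<Prod>i<p. ((as @ bs) ! i) (vs ! (\<sigma> \<circ> ?k) i)) = (\<Prod>i<p. (as ! i) (vs ! \<sigma> (\<rho> i)))"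
            using k1 assms by (intro prod.cong refl) (simp add: nth_append)
          also have "(\<Prod>j<q. ((as @ bs) ! (p + j)) (vs ! (\<sigma> \<circ> ?k) (p + j))) =
              (\<Prod>i<q. (bs ! i) (vs ! \<sigma> (p + \<rho>' i)))"
            using k2 assms by (intro prod.cong refl) (simp add: nth_append)
          finally show ?thesis .
        qed
        ultimately show "?X (\<sigma> \<circ> ?k) = of_int (sign \<sigma>) * ((of_int (sign \<rho>) * (\<Prod>i<p. (as ! i) (vs ! \<sigma> (\<rho> i)))) *
          (of_int (sign \<rho>') * (\<Prod>i<q. (bs ! i) (vs ! \<sigma> (p + \<rho>' i)))))"
          by simp
      qed
      finally show ?thesis by simp
    qed
    have "(\<Sum>\<sigma>\<in>?S. of_int (sign \<sigma>) * altprod as (take p (permute_list \<sigma> vs)) * altprod bs (drop p (permute_list \<sigma> vs)))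
      = (\<Sum>\<sigma>\<in>?S. \<Sum>\<rho>\<in>?P. \<Sum>\<rho>'\<in>?Q. of_int (sign \<sigma>) * ((of_int (sign \<rho>) * (\<Prod>i<p. (as ! i) (vs ! \<sigma> (\<rho> i)))) *
        (of_int (sign \<rho>') * (\<Prod>i<q. (bs ! i) (vs ! \<sigma> (p + \<rho>' i))))))"
      by (rule sum.cong[OF refl], subst mult.assoc, simp only: t d, subst sum_product, simp only: sum_distrib_left)
    also have "\<dots> = (\<Sum>\<rho>\<in>?P. \<Sum>\<rho>'\<in>?Q. \<Sum>\<sigma>\<in>?S. of_int (sign \<sigma>) * ((of_int (sign \<rho>) * (\<Prod>i<p. (as ! i) (vs ! \<sigma> (\<rho> i)))) *
        (of_int (sign \<rho>') * (\<Prod>i<q. (bs ! i) (vs ! \<sigma> (p + \<rho>' i))))))"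
      by (subst sum.swap, rule sum.cong[OF refl], rule sum.swap)
    also have "\<dots> = (\<Sum>\<rho>\<in>?P. \<Sum>\<rho>'\<in>?Q. \<Sum>\<sigma>\<in>?S. ?X \<sigma>)"
      by (intro sum.cong refl c) auto
    \<comment> \<open>The number of pairs is the denominator in \<open>wedge\<close>, which is the
      normalisation under which decomposable covectors multiply by concatenation.\<close>
    also have "\<dots> = fact p * fact q * altprod (as @ bs) vs"
      using True assms by (simp add: card_permutations altprod_def)
    finally show ?thesis using True by (simp add: wedge_def)
  next
    case False
    then show ?thesis using assms by (simp add: wedge_def altprod_def)
  qed
qed

lemma covector1_altprod: "covector1 \<gamma> = altprod [\<gamma>]"
proof
  fix vs :: "'a list"
  show "covector1 \<gamma> vs = altprod [\<gamma>] vs"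
    by (cases vs) (auto simp: covector1_def altprod_def lessThan_Suc)
qed

lemma wedges_covector1: "wedges 1 (map covector1 \<gamma>s) = altprod \<gamma>s"
proof (induction \<gamma>s)
  case Nil
  then show ?case by (simp add: altprod_Nil)
next
  case (Cons \<gamma> \<gamma>s)
  then show ?case using wedge_altprod[of "[\<gamma>]" 1 \<gamma>s] by (simp add: covector1_altprod)
qed

lemma wedges_pairs:
  "wedges 2 (map (\<lambda>(a, b). altprod [a, b]) ps) = altprod (concat (map (\<lambda>(a, b). [a, b]) ps))"
proof (induction ps)
  case Nil
  then show ?case by (simp add: altprod_Nil)
next
  case (Cons ab ps)
  have "length (concat (map (\<lambda>(a, b). [a, b]) ps)) = 2 * length ps"
    by (induction ps) auto
  then show ?case using Cons wedge_altprod[of "[fst ab, snd ab]" 2 "concat (map (\<lambda>(a, b). [a, b]) ps)"]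
    by (simp add: split_def)
qed

section \<open>Multilinearity and naturality of wedge products\<close>

lemma wedge_scale_left: "wedge p q (\<lambda>vs. c * \<alpha> vs) \<beta> vs = c * wedge p q \<alpha> \<beta> vs"
  and wedge_scale_right: "wedge p q \<alpha> (\<lambda>vs. c * \<beta> vs) vs = c * wedge p q \<alpha> \<beta> vs"
  by (auto simp: wedge_def sum_distrib_left algebra_simps)

lemma wedge_sum_left: "wedge p q (\<lambda>vs. \<Sum>i\<in>I. \<alpha> i vs) \<beta> vs = (\<Sum>i\<in>I. wedge p q (\<alpha> i) \<beta> vs)"
proof -
  have "(\<Sum>\<sigma> | \<sigma> permutes {..<p + q}. of_int (sign \<sigma>) * (\<Sum>i\<in>I. \<alpha> i (take p (permute_list \<sigma> vs))) * \<beta> (drop p (permute_list \<sigma> vs)))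
     = (\<Sum>i\<in>I. \<Sum>\<sigma> | \<sigma> permutes {..<p + q}. of_int (sign \<sigma>) * \<alpha> i (take p (permute_list \<sigma> vs)) * \<beta> (drop p (permute_list \<sigma> vs)))"
    by (subst sum.swap) (simp add: sum_distrib_left sum_distrib_right)
  then show ?thesis by (simp add: wedge_def sum_divide_distrib)
qed

lemma wedge_sum_right: "wedge p q \<alpha> (\<lambda>vs. \<Sum>i\<in>I. \<beta> i vs) vs = (\<Sum>i\<in>I. wedge p q \<alpha> (\<beta> i) vs)"
proof -
  have "(\<Sum>\<sigma> | \<sigma> permutes {..<p + q}. of_int (sign \<sigma>) * \<alpha> (take p (permute_list \<sigma> vs)) * (\<Sum>i\<in>I. \<beta> i (drop p (permute_list \<sigma> vs))))
     = (\<Sum>i\<in>I. \<Sum>\<sigma> | \<sigma> permutes {..<p + q}. of_int (sign \<sigma>) * \<alpha> (take p (permute_list \<sigma> vs)) * \<beta> i (drop p (permute_list \<sigma> vs)))"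
    by (subst sum.swap) (simp add: sum_distrib_left)
  then show ?thesis by (simp add: wedge_def sum_divide_distrib)
qed

lemma wedge_map: "wedge p q \<alpha> \<beta> (map l vs) = wedge p q (\<lambda>us. \<alpha> (map l us)) (\<lambda>us. \<beta> (map l us)) vs"
  unfolding wedge_def by (auto simp: permute_list_map take_map drop_map intro!: sum.cong)

lemma wedges_map: "wedges k \<eta>s (map l vs) = wedges k (map (\<lambda>\<eta> us. \<eta> (map l us)) \<eta>s) vs"
proof (induction \<eta>s arbitrary: vs)
  case (Cons \<eta> \<eta>s)
  then show ?case by (simp add: wedge_map)
qed simp

lemma wedge_power_map: "wedge_power k m \<eta> (map l vs) = wedge_power k m (\<lambda>us. \<eta> (map l us)) vs"
  by (simp add: wedge_power_def wedges_map)

lemma wedge_lincomb_slot: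
  assumes "\<And>us. length us = p \<Longrightarrow> \<alpha> us = (\<Sum>i\<in>I. c i * \<alpha>' i us)"
  shows "wedge p q \<alpha> \<beta> vs = (\<Sum>i\<in>I. c i * wedge p q (\<alpha>' i) \<beta> vs)"
proof -
  have "wedge p q \<alpha> \<beta> vs = wedge p q (\<lambda>us. \<Sum>i\<in>I. c i * \<alpha>' i us) \<beta> vs"
    unfolding wedge_def using assms by (auto intro!: sum.cong)
  then show ?thesis by (simp add: wedge_sum_left wedge_scale_left)
qed

lemma wedges_lincomb_slot:
  assumes "\<And>us. \<alpha> us = (\<Sum>i\<in>I. c i * \<alpha>' i us)"
  shows "wedges k (xs @ \<alpha> # ys) vs = (\<Sum>i\<in>I. c i * wedges k (xs @ \<alpha>' i # ys) vs)"
proof (induction xs arbitrary: vs)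
  case Nil
  show ?case by (simp add: wedge_lincomb_slot[OF assms])
next
  case (Cons x xs)
  then have e: "wedges k (xs @ \<alpha> # ys) = (\<lambda>vs. \<Sum>i\<in>I. c i * wedges k (xs @ \<alpha>' i # ys) vs)" by (simp add: fun_eq_iff)
  show ?case by (simp add: e wedge_sum_right wedge_scale_right)
qed

lemma sum_lists_length_Suc:
  assumes "finite I"
  shows "(\<Sum>is | set is \<subseteq> I \<and> length is = Suc k. f is) =
    (\<Sum>i\<in>I. \<Sum>is | set is \<subseteq> I \<and> length is = k. f (i # is))"
proof -
  let ?L = "{is. set is \<subseteq> I \<and> length is = k}"
  have "{is. set is \<subseteq> I \<and> length is = Suc k} = (\<lambda>(i, is). i # is) ` (I \<times> ?L)"
    by (auto simp: length_Suc_conv image_iff)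
  then have "(\<Sum>is | set is \<subseteq> I \<and> length is = Suc k. f is) = (\<Sum>(i, is)\<in>I \<times> ?L. f (i # is))"
    by (simp add: sum.reindex inj_on_def split_def)
  then show ?thesis using assms finite_lists_length_eq[OF assms, of k] by (simp add: sum.cartesian_product)
qed

text \<open>Distributivity alone: the words keep their order and their repetitions, and no two
  factors are interchanged.\<close>

lemma wedge_power_sum:
  assumes "finite I"
  shows "wedge_power 2 m (\<lambda>us. \<Sum>i\<in>I. \<alpha> i us) vs =
    (\<Sum>is | set is \<subseteq> I \<and> length is = m. wedges 2 (map \<alpha> is) vs)"
proof (induction m arbitrary: vs)
  case 0
  have "{is::'a list. set is \<subseteq> I \<and> length is = 0} = {[]}" by auto
  then show ?case by (simp add: wedge_power_def)
next
  case (Suc m)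
  then have "wedges 2 (replicate m (\<lambda>us. \<Sum>i\<in>I. \<alpha> i us)) =
      (\<lambda>vs. \<Sum>is | set is \<subseteq> I \<and> length is = m. wedges 2 (map \<alpha> is) vs)"
    by (simp add: wedge_power_def fun_eq_iff)
  then show ?case
    by (simp add: wedge_power_def sum_lists_length_Suc[OF assms] wedge_sum_left wedge_sum_right)
qed

text \<open>The family \<open>b\<close> with coefficients \<open>c\<close> has only to reproduce
  every vector, so the same expansion serves the standard basis and the orthonormal frames of the
  metric. In the induction the first argument is frozen, which leaves a multilinear function of the
  others.\<close>

lemma multilin_expansion:
  assumes "finite I" "\<And>v. v = (\<Sum>e\<in>I. c e v *\<^sub>R b e)" "multilin k \<eta>" "length vs = k"
  shows "\<eta> vs = (\<Sum>is | set is \<subseteq> I \<and> length is = k. (\<Prod>i<k. of_real (c (is ! i) (vs ! i))) * \<eta> (map b is))"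
  using assms(3,4)
proof (induction k arbitrary: \<eta> vs)
  case 0
  have "{is::'a list. set is \<subseteq> I \<and> length is = 0} = {[]}" by auto
  then show ?case using 0 by simp
next
  case (Suc k)
  obtain v us where vs: "vs = v # us" "length us = k" using Suc.prems(2) by (cases vs) auto
  have ml: "multilin k (\<lambda>us. \<eta> (w # us))" for w
    unfolding multilin_def
  proof (intro allI impI)
    fix xs ys :: "'b list" assume "length xs + Suc (length ys) = k"
    then show "linear (\<lambda>v. \<eta> (w # xs @ v # ys))" using multilinD[OF Suc.prems(1), of "w # xs" ys] by simp
  qed
  have lin: "linear (\<lambda>v. \<eta> (v # us))" using multilinD[OF Suc.prems(1), of "[]" us] vs by simp
  have "\<eta> vs = \<eta> ((\<Sum>e\<in>I. c e v *\<^sub>R b e) # us)" using assms(2)[of v] vs by simp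
  also have "\<dots> = (\<Sum>e\<in>I. of_real (c e v) * \<eta> (b e # us))"
    by (simp only: linear_sum[OF lin] linear_scale[OF lin] scaleR_conv_of_real)
  also have "\<dots> = (\<Sum>e\<in>I. of_real (c e v) * (\<Sum>is | set is \<subseteq> I \<and> length is = k.
      (\<Prod>i<k. of_real (c (is ! i) (us ! i))) * \<eta> (b e # map b is)))"
    by (intro sum.cong refl, subst Suc.IH[OF ml vs(2)]) simp
  also have "\<dots> = (\<Sum>is | set is \<subseteq> I \<and> length is = Suc k. (\<Prod>i<Suc k. of_real (c (is ! i) (vs ! i))) * \<eta> (map b is))"
    unfolding sum_lists_length_Suc[OF assms(1)] using vs
    by (simp add: prod.lessThan_Suc_shift sum_distrib_left mult.assoc del: prod.lessThan_Suc)
  finally show ?case .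
qed

text \<open>Averaging the multilinear expansion over all permutations of the arguments.\<close>

lemma alt_form_expansion:
  assumes "finite I" "\<And>v. v = (\<Sum>e\<in>I. c e v *\<^sub>R b e)" "alt_form k \<eta>"
  shows "\<eta> vs = (\<Sum>is | set is \<subseteq> I \<and> length is = k.
           (\<eta> (map b is) / fact k) * altprod (map (\<lambda>e v. of_real (c e v)) is) vs)"
proof (cases "length vs = k")
  case True
  let ?S = "{\<sigma>. \<sigma> permutes {..<k}}" and ?L = "{is. set is \<subseteq> I \<and> length is = k}"
  have "fact k * \<eta> vs = (\<Sum>\<sigma>\<in>?S. \<eta> vs)" by (simp add: card_permutations)
  also have "\<dots> = (\<Sum>\<sigma>\<in>?S. of_int (sign \<sigma>) * \<eta> (permute_list \<sigma> vs))"
    by (intro sum.cong refl) (use alt_form_permute[OF assms(3)] True in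
        \<open>auto simp: mult.assoc[symmetric] of_int_mult[symmetric] simp del: of_int_mult\<close>)
  also have "\<dots> = (\<Sum>\<sigma>\<in>?S. \<Sum>is\<in>?L. of_int (sign \<sigma>) * ((\<Prod>i<k. of_real (c (is ! i) (vs ! \<sigma> i))) * \<eta> (map b is)))"
  proof (rule sum.cong[OF refl])
    fix \<sigma> assume s: "\<sigma> \<in> ?S"
    have "(\<Prod>i<k. complex_of_real (c (is ! i) (permute_list \<sigma> vs ! i))) = (\<Prod>i<k. of_real (c (is ! i) (vs ! \<sigma> i)))" for "is"
      using s True by (intro prod.cong refl) (simp add: permute_list_nth)
    then show "of_int (sign \<sigma>) * \<eta> (permute_list \<sigma> vs) =
       (\<Sum>is\<in>?L. of_int (sign \<sigma>) * ((\<Prod>i<k. of_real (c (is ! i) (vs ! \<sigma> i))) * \<eta> (map b is)))"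
      using multilin_expansion[OF assms(1,2) alt_form_multilin[OF assms(3)], of "permute_list \<sigma> vs"] True
      by (simp add: sum_distrib_left)
  qed
  also have "\<dots> = (\<Sum>is\<in>?L. \<eta> (map b is) * altprod (map (\<lambda>e v. of_real (c e v)) is) vs)"
    using True by (subst sum.swap, intro sum.cong refl) (auto simp: altprod_def sum_distrib_left algebra_simps intro!: sum.cong)
  finally have "\<eta> vs = (\<Sum>is\<in>?L. \<eta> (map b is) * altprod (map (\<lambda>e v. of_real (c e v)) is) vs) / fact k"
    by (simp add: field_simps)
  then show ?thesis by (simp add: sum_divide_distrib)
next
  case False
  then show ?thesis using alt_form_length[OF assms(3)] by (simp add: altprod_def)
qed

lemma alt_form_cong: "alt_form k \<eta> \<Longrightarrow> (\<And>vs. \<eta> vs = \<eta>' vs) \<Longrightarrow> alt_form k \<eta>'"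
proof -
  assume "alt_form k \<eta>" "\<And>vs. \<eta> vs = \<eta>' vs"
  moreover from this(2) have "\<eta> = \<eta>'" by (rule ext)
  ultimately show ?thesis by simp
qed

lemma alt_form_zero: "alt_form k (\<lambda>vs. 0)"
  by (auto simp: alt_form_def intro!: linearI)

lemma alt_form_add:
  assumes "alt_form k \<eta>" "alt_form k \<theta>"
  shows "alt_form k (\<lambda>vs. \<eta> vs + \<theta> vs)"
  using assms unfolding alt_form_def by (auto intro!: linear_compose_add)

lemma linear_complex_mult: "linear f \<Longrightarrow> linear (\<lambda>x. (c::complex) * f x)"
  by (rule linearI) (simp_all add: linear_add linear_scale algebra_simps)

lemma alt_form_scale:
  assumes "alt_form k \<eta>"
  shows "alt_form k (\<lambda>vs. c * \<eta> vs)"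
  using assms unfolding alt_form_def by (auto intro!: linear_complex_mult)

lemma alt_form_sum:
  assumes "\<And>i. i \<in> I \<Longrightarrow> alt_form k (\<eta> i)"
  shows "alt_form k (\<lambda>vs. \<Sum>i\<in>I. \<eta> i vs)"
  using assms by (induction I rule: infinite_finite_induct) (auto intro: alt_form_zero alt_form_add)

lemma alt_form_map:
  assumes "alt_form k \<eta>" "linear l"
  shows "alt_form k (\<lambda>vs. \<eta> (map l vs))"
  unfolding alt_form_def
proof (intro conjI allI impI)
  fix vs :: "'b list" and i assume "length vs = k \<and> i < k"
  then have "linear (\<lambda>x. \<eta> ((map l vs)[i := x]))"
    using assms(1) unfolding alt_form_def by simp
  from linear_compose[OF assms(2) this] show "linear (\<lambda>x. \<eta> (map l (vs[i := x])))"
    by (simp add: o_def map_update)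
next
  fix vs :: "'b list" and i j assume "length vs = k \<and> i < j \<and> j < k \<and> vs ! i = vs ! j"
  then have "\<not> distinct (map l vs)"
    using nth_eq_iff_index_eq[of "map l vs" i j] by auto
  then show "\<eta> (map l vs) = 0" by (rule alt_form_repeat[OF assms(1)])
qed (use assms(1) in \<open>simp add: alt_form_def\<close>)

section \<open>Positive (1,1)-covectors\<close>

lemma altprod_pair: "altprod [a, b] [u, v] = a u * b v - a v * b u"
proof -
  have s: "{..<Suc (Suc 0)} = {0, Suc 0}" by auto
  have "{\<sigma>. \<sigma> permutes {0, Suc 0}} = {id, Transposition.transpose 0 (Suc 0)}"
    using permutes_doubleton_iff[of _ 0 "Suc 0"] by auto
  moreover have "id \<noteq> Transposition.transpose 0 (Suc 0)" by (metis id_apply transpose_apply_first nat.distinct(1))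
  ultimately show ?thesis by (simp add: altprod_def s sign_swap_id)
qed

lemma covector10_add: "covector10 \<alpha> \<Longrightarrow> \<alpha> (u + v) = \<alpha> u + \<alpha> v"
  and covector10_scale: "covector10 \<alpha> \<Longrightarrow> \<alpha> (c *s v) = c * \<alpha> v"
  unfolding covector10_def by (simp_all add: Vector_Spaces.linear_iff)

lemma vector_space_complex: "vector_space ((*) :: complex \<Rightarrow> complex \<Rightarrow> complex)"
  by unfold_locales (auto simp: algebra_simps)

lemma covector10I:
  assumes "\<And>u v. \<alpha> (u + v) = \<alpha> u + \<alpha> v" "\<And>c v. \<alpha> (c *s v) = c * \<alpha> v"
  shows "covector10 \<alpha>"
  unfolding covector10_def Vector_Spaces.linear_iff
  using assms vector_space_complex vec.vector_space_axioms by auto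

lemma scaleR_eq_vector_scalar_mult: "r *\<^sub>R (v :: complex ^ 'n) = of_real r *s v"
  by (simp add: Finite_Cartesian_Product.vec_eq_iff scaleR_conv_of_real[where 'a = complex])

lemma covector10_linear: "covector10 \<alpha> \<Longrightarrow> linear \<alpha>"
  by (rule linearI) (simp_all add: covector10_add covector10_scale scaleR_eq_vector_scalar_mult scaleR_conv_of_real[where 'a = complex])

lemma linear_cnj_comp: "linear \<alpha> \<Longrightarrow> linear (cnj \<circ> \<alpha>)"
  by (rule linearI) (simp_all add: linear_add linear_scale)

lemma elementary_11_altprod: "elementary_11 \<alpha> = (\<lambda>vs. \<i> * altprod [\<alpha>, cnj \<circ> \<alpha>] vs)"
  using wedge_altprod[of "[\<alpha>]" 1 "[cnj \<circ> \<alpha>]" 1]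
  by (simp add: elementary_11_def covector1_altprod fun_eq_iff)

lemma elementary_11_pair: "elementary_11 \<alpha> [u, v] = \<i> * (\<alpha> u * cnj (\<alpha> v) - \<alpha> v * cnj (\<alpha> u))"
  by (simp add: elementary_11_altprod altprod_pair)

lemma elementary_11_alt_form: "covector10 \<alpha> \<Longrightarrow> alt_form 2 (elementary_11 \<alpha>)"
  unfolding elementary_11_altprod
  using altprod_alt_form[of "[\<alpha>, cnj \<circ> \<alpha>]"] covector10_linear linear_cnj_comp
  by (intro alt_form_scale) (auto simp: numeral_2_eq_2)

lemma elementary_11_scale: "c \<ge> 0 \<Longrightarrow> elementary_11 (\<lambda>v. of_real (sqrt c) * \<alpha> v) vs = of_real c * elementary_11 \<alpha> vs"
proof -
  assume c: "c \<ge> 0"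
  have "altprod [\<lambda>v. of_real (sqrt c) * \<alpha> v, cnj \<circ> (\<lambda>v. of_real (sqrt c) * \<alpha> v)] vs =
      of_real (sqrt c) * (of_real (sqrt c) * altprod [\<alpha>, cnj \<circ> \<alpha>] vs)"
    using altprod_scale[of "[]" "of_real (sqrt c)" \<alpha>]
      altprod_scale[of "[\<alpha>]" "of_real (sqrt c)" "cnj \<circ> \<alpha>" "[]"]
    by (simp add: o_def)
  also have "\<dots> = of_real c * altprod [\<alpha>, cnj \<circ> \<alpha>] vs"
    using c by (simp add: mult.assoc[symmetric] of_real_mult[symmetric] del: of_real_mult)
  finally show ?thesis by (simp add: elementary_11_altprod)
qed

text \<open>Type \<open>(1,1)\<close> is encoded as invariance under multiplication of both
  arguments by \<open>\<i>\<close>: the \<open>(2,0)\<close>- and \<open>(0,2)\<close>-parts would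
  change sign. This form is preserved by sums and needs no explicit decomposition.\<close>

definition real11 :: "(complex ^ 'n) covector \<Rightarrow> bool" where
  "real11 w \<longleftrightarrow> alt_form 2 w \<and> (\<forall>vs. w vs \<in> \<real>) \<and> (\<forall>u v. w [\<i> *s u, \<i> *s v] = w [u, v])"

lemma type_form_11_invariant:
  assumes "type_form 1 1 w"
  shows "w [\<i> *s u, \<i> *s v] = w [u, v]"
proof -
  obtain m :: nat and a L M where m: "\<forall>s<m. length (L s) = 1 \<and> length (M s) = 1 \<and> (\<forall>\<alpha> \<in> set (L s) \<union> set (M s). covector10 \<alpha>)"
    and w: "w = (\<lambda>vs. \<Sum>s<m. a s * wedges 1 (map covector1 (L s) @ map (\<lambda>\<beta>. covector1 (cnj \<circ> \<beta>)) (M s)) vs)"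
    using assms unfolding type_form_def by blast
  have "wedges 1 (map covector1 (L s) @ map (\<lambda>\<beta>. covector1 (cnj \<circ> \<beta>)) (M s)) [\<i> *s u, \<i> *s v] =
     wedges 1 (map covector1 (L s) @ map (\<lambda>\<beta>. covector1 (cnj \<circ> \<beta>)) (M s)) [u, v]" if s: "s < m" for s
  proof -
    obtain \<alpha> \<beta> where ab': "L s = [\<alpha>]" "M s = [\<beta>]"
      using m s by (auto simp: length_Suc_conv)
    then have ab: "L s = [\<alpha>]" "M s = [\<beta>]" "covector10 \<alpha>" "covector10 \<beta>"
      using m s by auto
    have e: "map covector1 (L s) @ map (\<lambda>\<beta>. covector1 (cnj \<circ> \<beta>)) (M s) = map covector1 [\<alpha>, cnj \<circ> \<beta>]"
      using ab by simp
    show ?thesis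
      unfolding e unfolding wedges_covector1 altprod_pair o_def covector10_scale[OF ab(3)] covector10_scale[OF ab(4)]
      by (simp add: complex_eq_iff algebra_simps)
  qed
  then show ?thesis unfolding w by simp
qed

lemma metric_of_sym: "real11 w \<Longrightarrow> metric_of w u v = metric_of w v u"
proof -
  assume w: "real11 w"
  have "w [v, \<i> *s u] = w [\<i> *s v, \<i> *s (\<i> *s u)]" using w unfolding real11_def by metis
  also have "\<dots> = w [\<i> *s v, - u]" by (simp add: vector_smult_assoc)
  also have "\<dots> = - w [\<i> *s v, u]"
    using alt_form_linear[of 2 w "[\<i> *s v]" "[]"] w linear_neg unfolding real11_def by fastforce
  also have "\<dots> = w [u, \<i> *s v]"
    using alt_form_swap[of 2 w "[]" u "[]" "\<i> *s v" "[]"] w unfolding real11_def by simp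
  finally show ?thesis by (simp add: metric_of_def)
qed

lemma real11_linear:
  assumes "real11 w"
  shows "linear (\<lambda>u. w [u, v])" "linear (\<lambda>v. w [u, v])"
  using assms alt_form_linear[of 2 w "[]" "[v]"] alt_form_linear[of 2 w "[u]" "[]"] unfolding real11_def by auto

lemma metric_of_linear:
  assumes "real11 w"
  shows "linear (metric_of w u)" "linear (\<lambda>u. metric_of w u v)"
proof -
  show l: "linear (\<lambda>u. metric_of w u v)" for v
    using linear_compose[OF real11_linear(1)[OF assms] bounded_linear.linear[OF bounded_linear_Re]]
    by (simp add: metric_of_def o_def)
  show "linear (metric_of w u)"
    using l[of u] metric_of_sym[OF assms] by (metis (no_types, lifting) ext)
qed

section \<open>Positive semidefinite Hermitian forms\<close>

definition psd_herm :: "(complex ^ 'n \<Rightarrow> complex ^ 'n \<Rightarrow> complex) \<Rightarrow> bool" where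
  "psd_herm h \<longleftrightarrow>
     (\<forall>u u' v. h (u + u') v = h u v + h u' v) \<and> (\<forall>c u v. h (c *s u) v = c * h u v) \<and>
     (\<forall>u v. h v u = cnj (h u v)) \<and> (\<forall>v. 0 \<le> Re (h v v))"

lemma psd_herm_diag: "psd_herm h \<Longrightarrow> h v v = of_real (Re (h v v))"
  unfolding psd_herm_def by (metis Reals_cnj_iff complex_is_Real_iff of_real_Re)

lemma psd_herm_Cauchy_Schwarz:
  assumes "psd_herm h"
  shows "(cmod (h u e))\<^sup>2 \<le> Re (h u u) * Re (h e e)"
proof -
  let ?k = "h u e" and ?d = "Re (h e e)"
  have add: "h (a + b) v = h a v + h b v" and scl: "h (c *s a) v = c * h a v" and sym: "h v a = cnj (h a v)"
    and pos: "0 \<le> Re (h v v)" for a b c v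
    using assms unfolding psd_herm_def by blast+
  have q: "0 \<le> Re (h u u) - 2 * Re (cnj c * ?k) + (cmod c)\<^sup>2 * ?d" for c
  proof -
    define z where "z = u + (- c) *s e"
    have z: "h z x = h u x + (- c) * h e x" for x unfolding z_def by (simp only: add scl)
    have uz: "h u z = cnj (h u u + (- c) * h e u)" and ez: "h e z = cnj (h u e + (- c) * h e e)"
      using sym[of u z] sym[of e z] by (simp_all only: z)
    have csym: "cnj (h a b) = h b a" for a b using sym[of b a] by simp
    have "h z z = cnj (h u u + (- c) * h e u) + (- c) * cnj (h u e + (- c) * h e e)"
      by (simp only: z[of z] uz ez)
    then have "h z z = h u u - cnj c * ?k - c * cnj ?k + (c * cnj c) * h e e"
      by (simp add: csym algebra_simps)
    moreover have "Re (c * cnj ?k) = Re (cnj c * ?k)" by simp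
    moreover have "Re ((c * cnj c) * h e e) = (cmod c)\<^sup>2 * ?d"
    proof -
      have "Re ((c * cnj c) * of_real r) = (cmod c)\<^sup>2 * r" for r
        by (simp add: complex_norm_square[symmetric] del: complex_mult_cnj)
      then show ?thesis by (subst psd_herm_diag[OF assms])
    qed
    ultimately show ?thesis using pos[of z] by (simp only: minus_complex.sel plus_complex.sel)
  qed
  show ?thesis
  proof (cases "?d = 0")
    case True
    have "?k = 0"
    proof (rule ccontr)
      assume k: "?k \<noteq> 0"
      \<comment> \<open>Chosen so that the nonnegative quantity \<open>q\<close>, taken at this
        multiple of \<open>?k\<close>, would equal \<open>-1\<close>.\<close>
      define t where "t = (Re (h u u) + 1) / (2 * (cmod ?k)\<^sup>2)"
      have "Re (cnj (of_real t * ?k) * ?k) = t * (cmod ?k)\<^sup>2"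
        by (simp add: cmod_def power2_eq_square algebra_simps)
      then have "0 \<le> Re (h u u) - 2 * (t * (cmod ?k)\<^sup>2)" using q[of "of_real t * ?k"] True by simp
      moreover have "2 * (t * (cmod ?k)\<^sup>2) = Re (h u u) + 1" using k by (simp add: t_def)
      ultimately show False by simp
    qed
    then show ?thesis using True by simp
  next
    case False
    then have d: "?d > 0" using pos[of e] by linarith
    \<comment> \<open>The coefficient \<open>?k / ?d\<close> minimises the quadratic function in
      \<open>q\<close>.\<close>
    have "Re (cnj (?k / of_real ?d) * ?k) = (cmod ?k)\<^sup>2 / ?d"
      by (simp add: cmod_def power2_eq_square add_divide_distrib Re_divide_of_real Im_divide_of_real)
    moreover have "(cmod (?k / of_real ?d))\<^sup>2 * ?d = (cmod ?k)\<^sup>2 / ?d"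
      using d by (simp add: norm_divide power_divide power2_eq_square)
    ultimately have "0 \<le> Re (h u u) - (cmod ?k)\<^sup>2 / ?d" using q[of "?k / of_real ?d"] by linarith
    then show ?thesis using d by (simp add: field_simps)
  qed
qed

text \<open>Cholesky decomposition: each basis vector is split off in turn.\<close>

lemma psd_herm_partial_decomposition:
  fixes h :: "complex ^ 'n \<Rightarrow> complex ^ 'n \<Rightarrow> complex" and J :: "'n set"
  assumes "psd_herm h" "finite J"
  shows "\<exists>\<alpha>. (\<forall>j. covector10 (\<alpha> j)) \<and> psd_herm (\<lambda>u v. h u v - (\<Sum>j\<in>J. \<alpha> j u * cnj (\<alpha> j v))) \<and>
     (\<forall>j\<in>J. \<forall>u. h u (axis j 1) = (\<Sum>i\<in>J. \<alpha> i u * cnj (\<alpha> i (axis j 1))))"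
  using assms(2)
proof (induction J rule: finite_induct)
  case empty
  show ?case using assms(1) by (intro exI[of _ "\<lambda>_ _. 0"]) (auto intro!: covector10I)
next
  case (insert k J)
  obtain \<alpha> where a: "\<forall>j. covector10 (\<alpha> j)" and p: "psd_herm (\<lambda>u v. h u v - (\<Sum>j\<in>J. \<alpha> j u * cnj (\<alpha> j v)))"
    and z: "\<forall>j\<in>J. \<forall>u. h u (axis j 1) = (\<Sum>i\<in>J. \<alpha> i u * cnj (\<alpha> i (axis j 1)))"
    using insert.IH by blast
  define g where "g = (\<lambda>u v. h u v - (\<Sum>j\<in>J. \<alpha> j u * cnj (\<alpha> j v)))"
  have gp: "psd_herm g" using p unfolding g_def .
  have add: "g (x + y) v = g x v + g y v" and scl: "g (c *s x) v = c * g x v" and sym: "g v x = cnj (g x v)"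
    and pos: "0 \<le> Re (g v v)" for x y c v
    using gp unfolding psd_herm_def by blast+
  have gz: "g u (axis j 1) = 0" if "j \<in> J" for j u using z that by (simp add: g_def)
  define e where "e = (axis k 1 :: complex ^ 'n)"
  define d where "d = Re (g e e)"
  \<comment> \<open>If \<open>d = 0\<close>, division by zero makes \<open>b\<close> vanish. This is
    the right value: Cauchy-Schwarz then gives \<open>g u e = 0\<close> for all \<open>u\<close>, so
    there is nothing to split off.\<close>
  define b where "b = (\<lambda>u. g u e / of_real (sqrt d))"
  have d0: "d \<ge> 0" using pos d_def by simp
  have bb: "b u * cnj (b v) = g u e * cnj (g v e) / of_real d" for u v
    using d0 unfolding b_def by (simp add: of_real_mult[symmetric] del: of_real_mult)
  have gee: "g e e = of_real d" using psd_herm_diag[OF gp] d_def by blast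
  have g0: "g u e = 0" if "d = 0" for u
    using psd_herm_Cauchy_Schwarz[OF gp, of u e] that by (simp add: d_def)
  let ?\<alpha> = "\<alpha>(k := b)"
  have sum: "(\<Sum>j\<in>insert k J. ?\<alpha> j u * cnj (?\<alpha> j v)) = (\<Sum>j\<in>J. \<alpha> j u * cnj (\<alpha> j v)) + g u e * cnj (g v e) / of_real d" for u v
  proof -
    have "(\<Sum>j\<in>J. ?\<alpha> j u * cnj (?\<alpha> j v)) = (\<Sum>j\<in>J. \<alpha> j u * cnj (\<alpha> j v))"
      using insert.hyps by (intro sum.cong refl) auto
    then show ?thesis using insert.hyps bb by simp
  qed
  have new: "h u v - (\<Sum>j\<in>insert k J. ?\<alpha> j u * cnj (?\<alpha> j v)) = g u v - g u e * cnj (g v e) / of_real d" for u v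
    unfolding sum by (simp add: g_def)
  show ?case
  proof (intro exI[of _ ?\<alpha>] conjI)
    show "\<forall>j. covector10 (?\<alpha> j)"
      using a by (auto intro!: covector10I simp: b_def add scl add_divide_distrib)
    show "psd_herm (\<lambda>u v. h u v - (\<Sum>j\<in>insert k J. ?\<alpha> j u * cnj (?\<alpha> j v)))"
      unfolding new unfolding psd_herm_def
    proof (intro conjI allI)
      fix u v x :: "complex ^ 'n" and c :: complex
      show "g (u + x) v - g (u + x) e * cnj (g v e) / of_real d =
          g u v - g u e * cnj (g v e) / of_real d + (g x v - g x e * cnj (g v e) / of_real d)"
        by (simp add: add algebra_simps add_divide_distrib)
      show "g (c *s u) v - g (c *s u) e * cnj (g v e) / of_real d = c * (g u v - g u e * cnj (g v e) / of_real d)"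
        by (simp add: scl algebra_simps)
      show "g v u - g v e * cnj (g u e) / of_real d = cnj (g u v - g u e * cnj (g v e) / of_real d)"
        using sym[of v u] by simp
      have "Re (g v e * cnj (g v e) / of_real d) = (cmod (g v e))\<^sup>2 / d"
        by (simp add: complex_norm_square[symmetric] of_real_divide[symmetric] del: of_real_divide)
      also have "\<dots> \<le> Re (g v v)"
      proof (cases "d = 0")
        case False
        then show ?thesis using psd_herm_Cauchy_Schwarz[OF gp, of v e] d0 by (simp add: d_def[symmetric] field_simps)
      qed (simp add: pos)
      finally show "0 \<le> Re (g v v - g v e * cnj (g v e) / of_real d)" by simp
    qed
    show "\<forall>j\<in>insert k J. \<forall>u. h u (axis j 1) = (\<Sum>i\<in>insert k J. ?\<alpha> i u * cnj (?\<alpha> i (axis j 1)))"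
    proof (intro ballI allI)
      fix j u assume j: "j \<in> insert k J"
      have "g u (axis j 1) - g u e * cnj (g (axis j 1) e) / of_real d = 0"
      proof (cases "j = k")
        case True
        then show ?thesis using gee g0 by (cases "d = 0") (auto simp: e_def[symmetric])
      next
        case False
        then show ?thesis using j gz sym[of "axis j 1" e] by simp
      qed
      then show "h u (axis j 1) = (\<Sum>i\<in>insert k J. ?\<alpha> i u * cnj (?\<alpha> i (axis j 1)))"
        using new[of u "axis j 1"] by simp
    qed
  qed
qed

text \<open>Once every coordinate vector has been split off, the remainder vanishes with a
  coordinate vector in its second slot, by Hermitian symmetry also in its first, and by linearity
  everywhere.\<close>

lemma psd_herm_decomposition:
  fixes h :: "complex ^ 'n \<Rightarrow> complex ^ 'n \<Rightarrow> complex"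
  assumes "psd_herm h"
  obtains \<alpha> :: "'n \<Rightarrow> complex ^ 'n \<Rightarrow> complex"
    where "\<And>j. covector10 (\<alpha> j)" "\<And>u v. h u v = (\<Sum>j\<in>UNIV. \<alpha> j u * cnj (\<alpha> j v))"
proof -
  obtain \<alpha> :: "'n \<Rightarrow> complex ^ 'n \<Rightarrow> complex" where a: "\<forall>j. covector10 (\<alpha> j)" and p: "psd_herm (\<lambda>u v. h u v - (\<Sum>j\<in>UNIV. \<alpha> j u * cnj (\<alpha> j v)))"
    and z: "\<forall>j u. h u (axis j 1) = (\<Sum>i\<in>UNIV. \<alpha> i u * cnj (\<alpha> i (axis j 1)))"
    using psd_herm_partial_decomposition[OF assms finite_class.finite_UNIV] by blast
  let ?g = "\<lambda>u v. h u v - (\<Sum>j\<in>UNIV. \<alpha> j u * cnj (\<alpha> j v))"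
  have add: "?g (x + y) v = ?g x v + ?g y v" and scl: "?g (c *s x) v = c * ?g x v" and sym: "?g v x = cnj (?g x v)"
    for x y c v
    using p unfolding psd_herm_def by blast+
  have c: "covector10 (\<lambda>u. ?g u v)" for v by (rule covector10I; fact add scl)
  have zero: "?g (axis j 1) v = 0" for j v
    using sym[of "axis j 1" v] z by simp
  have "?g u v = 0" for u v
  proof -
    have "?g u v = ?g (\<Sum>i\<in>UNIV. u $ i *s axis i 1) v" by (simp add: basis_expansion)
    also have "\<dots> = (\<Sum>i\<in>UNIV. ?g (u $ i *s axis i 1) v)"
      by (rule linear_sum[OF covector10_linear[OF c]])
    also have "\<dots> = 0" using scl zero by simp
    finally show ?thesis .
  qed
  then show thesis by (intro that[of \<alpha>]) (use a in simp_all)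
qed

lemma real11_decomposition:
  fixes w :: "(complex ^ 'n) covector"
  assumes "real11 w" "\<And>v. 0 \<le> metric_of w v v"
  obtains \<alpha> :: "'n \<Rightarrow> complex ^ 'n \<Rightarrow> complex"
    where "\<And>j. covector10 (\<alpha> j)" "w = (\<lambda>vs. \<Sum>j\<in>UNIV. elementary_11 (\<alpha> j) vs)"
      "\<And>u v. metric_of w u v = 2 * Re (\<Sum>j\<in>UNIV. \<alpha> j u * cnj (\<alpha> j v))"
proof -
  have alt: "alt_form 2 w" and real: "\<And>vs. w vs \<in> \<real>" and inv: "\<And>u v. w [\<i> *s u, \<i> *s v] = w [u, v]"
    using assms(1) unfolding real11_def by auto
  note lin = real11_linear[OF assms(1)]
  \<comment> \<open>The Hermitian form behind \<open>w\<close>. The factor one half gives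
    \<open>w = \<i> (h - cnj h)\<close>, which becomes the sum of elementary covectors when
    \<open>h\<close> is written as a sum of terms \<open>\<alpha> u * cnj (\<alpha> v)\<close>; the
    metric is then twice the real part of \<open>h\<close>.\<close>
  define h where "h = (\<lambda>u v. (of_real (metric_of w u v) - \<i> * w [u, v]) / 2)"
  have m: "of_real (metric_of w u v) = w [u, \<i> *s v]" for u v
    unfolding metric_of_def using real by (metis of_real_Re)
  have sw: "w [u, v] = - w [v, u]" for u v
    using alt_form_swap[OF alt, of "[]" u "[]" v "[]"] by simp
  have hi: "h (\<i> *s u) v = \<i> * h u v" for u v
  proof -
    have "w [\<i> *s u, v] = w [\<i> *s (\<i> *s u), \<i> *s v]" by (rule inv[symmetric])
    also have "\<dots> = - w [u, \<i> *s v]" using linear_neg[OF lin(1)] by (simp add: vector_smult_assoc)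
    finally show ?thesis unfolding h_def m inv by (simp add: algebra_simps)
  qed
  have hr: "h (r *\<^sub>R u) v = r * h u v" and ha: "h (u + u') v = h u v + h u' v" for r :: real and u u' v
    unfolding h_def using linear_scale[OF lin(1)] linear_scale[OF metric_of_linear(2)[OF assms(1)]]
      linear_add[OF lin(1)] linear_add[OF metric_of_linear(2)[OF assms(1)]]
    by (simp_all add: scaleR_conv_of_real algebra_simps add_divide_distrib diff_divide_distrib)
  have hc: "h (c *s u) v = c * h u v" for c u v
  proof -
    have "c *s u = Re c *\<^sub>R u + Im c *\<^sub>R (\<i> *s u)"
      by (simp add: Finite_Cartesian_Product.vec_eq_iff complex_eq_iff)
    then have "h (c *s u) v = of_real (Re c) * h u v + of_real (Im c) * (\<i> * h u v)"
      by (simp only: ha hr hi)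
    also have "\<dots> = c * h u v" by (subst (3) complex_eq[of c]) (simp add: algebra_simps)
    finally show ?thesis .
  qed
  have "psd_herm h"
    unfolding psd_herm_def
  proof (intro conjI allI)
    fix u v :: "complex ^ 'n"
    show "h v u = cnj (h u v)"
      unfolding h_def using metric_of_sym[OF assms(1), of u v] sw[of u v] real[of "[v, u]"]
      by (simp add: Reals_cnj_iff)
    have "w [v, v] = 0" by (rule alt_form_repeat[OF alt]) simp
    then show "0 \<le> Re (h v v)" using assms(2) by (simp add: h_def)
  qed (use ha hc in auto)
  then obtain \<alpha> :: "'n \<Rightarrow> complex ^ 'n \<Rightarrow> complex"
    where \<alpha>: "\<And>j. covector10 (\<alpha> j)" "\<And>u v. h u v = (\<Sum>j\<in>UNIV. \<alpha> j u * cnj (\<alpha> j v))"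
    by (rule psd_herm_decomposition) (rule that)
  show thesis
  proof (rule that[OF \<alpha>(1)])
    show "metric_of w u v = 2 * Re (\<Sum>j\<in>UNIV. \<alpha> j u * cnj (\<alpha> j v))" for u v
    proof -
      have "Re (\<i> * w [u, v]) = 0" using real[of "[u, v]"] by (auto elim!: Reals_cases)
      then show ?thesis unfolding \<alpha>(2)[symmetric] h_def by simp
    qed
    show "w = (\<lambda>vs. \<Sum>j\<in>UNIV. elementary_11 (\<alpha> j) vs)"
    proof
      fix vs :: "(complex ^ 'n) list"
      show "w vs = (\<Sum>j\<in>UNIV. elementary_11 (\<alpha> j) vs)"
      proof (cases "length vs = 2")
        case True
        then obtain u v where vs: "vs = [u, v]" by (auto simp: length_Suc_conv numeral_2_eq_2)
        have "w [u, v] = \<i> * (h u v - cnj (h u v))"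
          unfolding h_def using real[of "[u, v]"] by (simp add: Reals_cnj_iff algebra_simps diff_divide_distrib)
        also have "\<dots> = (\<Sum>j\<in>UNIV. elementary_11 (\<alpha> j) vs)"
          unfolding vs elementary_11_pair \<alpha>(2)
          by (simp add: sum_subtractf sum_distrib_left algebra_simps)
        finally show ?thesis by (simp add: vs)
      next
        case False
        then show ?thesis
          using alt_form_length[OF alt] alt_form_length[OF elementary_11_alt_form[OF \<alpha>(1)]] by simp
      qed
    qed
  qed
qed

subsection \<open>Strongly positive covectors\<close>

lemma sum_lessThan_add: "(\<Sum>s<m + k. f s) = (\<Sum>s<m. f s) + (\<Sum>s<k. f (m + s))"
  for f :: "nat \<Rightarrow> 'a::comm_monoid_add"
  by (induction k) (simp_all add: add.assoc)

lemma strongly_positive_add: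
  assumes "strongly_positive p \<eta>" "strongly_positive p \<theta>"
  shows "strongly_positive p (\<lambda>vs. \<eta> vs + \<theta> vs)"
proof -
  obtain m :: nat and \<gamma> :: "nat \<Rightarrow> real" and L where 1:
    "\<forall>s<m. 0 \<le> \<gamma> s \<and> length (L s) = p \<and> (\<forall>\<alpha> \<in> set (L s). covector10 \<alpha>)"
    "\<eta> = (\<lambda>vs. \<Sum>s<m. of_real (\<gamma> s) * wedges 2 (map elementary_11 (L s)) vs)"
    using assms(1) unfolding strongly_positive_def by blast
  obtain m' :: nat and \<gamma>' :: "nat \<Rightarrow> real" and L' where 2:
    "\<forall>s<m'. 0 \<le> \<gamma>' s \<and> length (L' s) = p \<and> (\<forall>\<alpha> \<in> set (L' s). covector10 \<alpha>)"
    "\<theta> = (\<lambda>vs. \<Sum>s<m'. of_real (\<gamma>' s) * wedges 2 (map elementary_11 (L' s)) vs)"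
    using assms(2) unfolding strongly_positive_def by blast
  let ?g = "\<lambda>s. if s < m then \<gamma> s else \<gamma>' (s - m)" and ?L = "\<lambda>s. if s < m then L s else L' (s - m)"
  have "(\<Sum>s<m + m'. of_real (?g s) * wedges 2 (map elementary_11 (?L s)) vs) = \<eta> vs + \<theta> vs" for vs
    unfolding 1(2) 2(2) sum_lessThan_add by simp
  then show ?thesis
    unfolding strongly_positive_def
  proof (intro exI[of _ "m + m'"] exI[of _ ?g] exI[of _ ?L] conjI allI impI)
    fix s assume "s < m + m'"
    then have "s < m \<or> s - m < m'" by linarith
    then show "0 \<le> ?g s" "length (?L s) = p" "\<forall>\<alpha> \<in> set (?L s). covector10 \<alpha>"
      using 1(1) 2(1) by (cases "s < m"; simp)+
  qed auto
qed

lemma strongly_positive_zero: "strongly_positive p (\<lambda>vs. 0)"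
  unfolding strongly_positive_def by (rule exI[of _ 0]) auto

lemma strongly_positive_sum:
  assumes "\<And>i. i \<in> I \<Longrightarrow> strongly_positive p (\<eta> i)"
  shows "strongly_positive p (\<lambda>vs. \<Sum>i\<in>I. \<eta> i vs)"
  using assms by (induction I rule: infinite_finite_induct) (auto intro: strongly_positive_zero strongly_positive_add)

lemma strongly_positive_scale:
  assumes "strongly_positive p \<eta>" "c \<ge> 0"
  shows "strongly_positive p (\<lambda>vs. of_real c * \<eta> vs)"
proof -
  obtain m :: nat and \<gamma> :: "nat \<Rightarrow> real" and L where 1:
    "\<forall>s<m. 0 \<le> \<gamma> s \<and> length (L s) = p \<and> (\<forall>\<alpha> \<in> set (L s). covector10 \<alpha>)"
    "\<eta> = (\<lambda>vs. \<Sum>s<m. of_real (\<gamma> s) * wedges 2 (map elementary_11 (L s)) vs)"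
    using assms(1) unfolding strongly_positive_def by blast
  show ?thesis
    unfolding strongly_positive_def 1(2) using 1(1) assms(2)
    by (intro exI[of _ m] exI[of _ "\<lambda>s. c * \<gamma> s"] exI[of _ L]) (auto simp: sum_distrib_left mult.assoc)
qed

lemma strongly_positive_elementary:
  assumes "length L = p" "\<And>\<alpha>. \<alpha> \<in> set L \<Longrightarrow> covector10 \<alpha>"
  shows "strongly_positive p (wedges 2 (map elementary_11 L))"
  unfolding strongly_positive_def using assms
  by (intro exI[of _ 1] exI[of _ "\<lambda>_. 1"] exI[of _ "\<lambda>_. L"]) auto

lemma elementary_11_map: "elementary_11 \<alpha> (map l vs) = elementary_11 (\<alpha> \<circ> l) vs"
  by (simp add: elementary_11_altprod altprod_map o_def)

section \<open>Pullback of positive and typed covectors by complex linear maps\<close>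

definition complex_linear :: "(complex ^ 'n \<Rightarrow> complex ^ 'm) \<Rightarrow> bool" where
  "complex_linear l \<longleftrightarrow> (\<forall>u v. l (u + v) = l u + l v) \<and> (\<forall>c v. l (c *s v) = c *s l v)"

lemma complex_linear_linear: "complex_linear l \<Longrightarrow> linear l"
  by (rule linearI) (auto simp: complex_linear_def scaleR_eq_vector_scalar_mult)

lemma covector10_comp: "covector10 \<alpha> \<Longrightarrow> complex_linear l \<Longrightarrow> covector10 (\<alpha> \<circ> l)"
  by (rule covector10I) (auto simp: complex_linear_def covector10_add covector10_scale)

lemma strongly_positive_map:
  assumes "strongly_positive p \<eta>" "complex_linear l"
  shows "strongly_positive p (\<lambda>vs. \<eta> (map l vs))"
proof -
  obtain m :: nat and \<gamma> :: "nat \<Rightarrow> real" and L where 1: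
    "\<forall>s<m. 0 \<le> \<gamma> s \<and> length (L s) = p \<and> (\<forall>\<alpha> \<in> set (L s). covector10 \<alpha>)"
    "\<eta> = (\<lambda>vs. \<Sum>s<m. of_real (\<gamma> s) * wedges 2 (map elementary_11 (L s)) vs)"
    using assms(1) unfolding strongly_positive_def by blast
  have e: "map (\<lambda>\<eta> us. \<eta> (map l us)) (map elementary_11 (L s)) = map elementary_11 (map (\<lambda>\<alpha>. \<alpha> \<circ> l) (L s))" for s
    by (simp add: elementary_11_map fun_eq_iff o_def)
  then show ?thesis
    unfolding strongly_positive_def 1(2) wedges_map e using 1(1) covector10_comp[OF _ assms(2)]
    by (intro exI[of _ m] exI[of _ \<gamma>] exI[of _ "\<lambda>s. map (\<lambda>\<alpha>. \<alpha> \<circ> l) (L s)"]) auto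
qed

lemma type_form_map:
  assumes "type_form p q \<eta>" "complex_linear l"
  shows "type_form p q (\<lambda>vs. \<eta> (map l vs))"
proof -
  obtain m :: nat and a :: "nat \<Rightarrow> complex" and L M where 1:
    "\<forall>s<m. length (L s) = p \<and> length (M s) = q \<and> (\<forall>\<alpha> \<in> set (L s) \<union> set (M s). covector10 \<alpha>)"
    "\<eta> = (\<lambda>vs. \<Sum>s<m. a s * wedges 1 (map covector1 (L s) @ map (\<lambda>\<beta>. covector1 (cnj \<circ> \<beta>)) (M s)) vs)"
    using assms(1) unfolding type_form_def by blast
  have e: "map (\<lambda>\<eta> us. \<eta> (map l us)) (map covector1 (L s) @ map (\<lambda>\<beta>. covector1 (cnj \<circ> \<beta>)) (M s)) =
      map covector1 (map (\<lambda>\<alpha>. \<alpha> \<circ> l) (L s)) @ map (\<lambda>\<beta>. covector1 (cnj \<circ> \<beta>)) (map (\<lambda>\<alpha>. \<alpha> \<circ> l) (M s))" for s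
    by (simp add: covector1_altprod altprod_map fun_eq_iff o_def)
  then show ?thesis
    unfolding type_form_def 1(2) wedges_map e using 1(1) covector10_comp[OF _ assms(2)]
    by (intro exI[of _ m] exI[of _ a] exI[of _ "\<lambda>s. map (\<lambda>\<alpha>. \<alpha> \<circ> l) (L s)"]
        exI[of _ "\<lambda>s. map (\<lambda>\<alpha>. \<alpha> \<circ> l) (M s)"]) auto
qed

lemma length_concat_pairs: "length (concat (map (\<lambda>x. [f x, g x]) xs)) = 2 * length xs"
  by (induction xs) auto

lemma wedges_elementary:
  "wedges 2 (map elementary_11 L) = (\<lambda>vs. \<i> ^ length L * altprod (concat (map (\<lambda>\<alpha>. [\<alpha>, cnj \<circ> \<alpha>]) L)) vs)"
proof (induction L)
    case Nil
    then show ?case by (simp add: altprod_Nil)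
  next
    case (Cons \<alpha> L)
    let ?C = "\<lambda>L. concat (map (\<lambda>\<alpha>. [\<alpha>, cnj \<circ> \<alpha>]) L)"
    have w: "wedge 2 (2 * length L) (altprod [\<alpha>, cnj \<circ> \<alpha>]) (altprod (?C L)) = altprod (?C (\<alpha> # L))"
      using wedge_altprod[of "[\<alpha>, cnj \<circ> \<alpha>]" 2 "?C L", OF _ length_concat_pairs] by simp
    have "wedges 2 (map elementary_11 (\<alpha> # L)) =
        wedge 2 (2 * length L) (elementary_11 \<alpha>) (\<lambda>vs. \<i> ^ length L * altprod (?C L) vs)"
      by (simp only: list.map wedges.simps length_map Cons)
    also have "\<dots> = (\<lambda>vs. \<i> * (\<i> ^ length L * altprod (?C (\<alpha> # L)) vs))"
      by (rule ext) (simp only: elementary_11_altprod wedge_scale_left wedge_scale_right w)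
    finally show ?case by (simp only: list.size(4) power_Suc mult.assoc add_0_right add_Suc_right)
  qed

lemma wedges_elementary_alt_form:
  assumes "\<And>\<alpha>. \<alpha> \<in> set L \<Longrightarrow> covector10 \<alpha>"
  shows "alt_form (2 * length L) (wedges 2 (map elementary_11 L))"
proof -
  have "alt_form (length (concat (map (\<lambda>\<alpha>. [\<alpha>, cnj \<circ> \<alpha>]) L))) (altprod (concat (map (\<lambda>\<alpha>. [\<alpha>, cnj \<circ> \<alpha>]) L)))"
    by (rule altprod_alt_form) (use assms covector10_linear linear_cnj_comp in auto)
  then show ?thesis unfolding wedges_elementary length_concat_pairs by (rule alt_form_scale)
qed

text \<open>After diagonalisation of \<open>w\<close> each word in the expansion of its power is
  itself a generator of the strongly positive cone.\<close>

lemma wedge_power_positive: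
  fixes w :: "(complex ^ 'n) covector"
  assumes "real11 w" "\<And>v. 0 \<le> metric_of w v v"
  shows "strongly_positive m (wedge_power 2 m w)" "alt_form (2 * m) (wedge_power 2 m w)"
proof -
  obtain \<alpha> :: "'n \<Rightarrow> complex ^ 'n \<Rightarrow> complex"
    where \<alpha>: "\<And>j. covector10 (\<alpha> j)" "w = (\<lambda>vs. \<Sum>j\<in>UNIV. elementary_11 (\<alpha> j) vs)"
    by (rule real11_decomposition[OF assms]) (rule that)
  have e: "wedge_power 2 m w = (\<lambda>vs. \<Sum>is | set is \<subseteq> UNIV \<and> length is = m. wedges 2 (map elementary_11 (map \<alpha> is)) vs)"
    unfolding \<alpha>(2) by (rule ext, subst wedge_power_sum) (auto simp: o_def)
  show "strongly_positive m (wedge_power 2 m w)"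
    unfolding e by (rule strongly_positive_sum, rule strongly_positive_elementary) (use \<alpha>(1) in auto)
  show "alt_form (2 * m) (wedge_power 2 m w)"
    unfolding e
  proof (rule alt_form_sum)
    fix "is" :: "'n list" assume "is \<in> {is. set is \<subseteq> UNIV \<and> length is = m}"
    then show "alt_form (2 * m) (wedges 2 (map elementary_11 (map \<alpha> is)))"
      using wedges_elementary_alt_form[of "map \<alpha> is"] \<alpha>(1) by auto
  qed
qed

lemma wedges_scale: "wedges 2 (map (\<lambda>\<eta> vs. c * \<eta> vs) \<eta>s) vs = c ^ length \<eta>s * wedges 2 \<eta>s vs"
proof (induction \<eta>s arbitrary: vs)
  case (Cons \<eta> \<eta>s)
  then have e: "wedges 2 (map (\<lambda>\<eta> vs. c * \<eta> vs) \<eta>s) = (\<lambda>vs. c ^ length \<eta>s * wedges 2 \<eta>s vs)" by (rule ext)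
  show ?case by (simp add: e wedge_scale_left wedge_scale_right)
qed simp

text \<open>Write \<open>w\<close> as the sum of \<open>c\<close> times the elementary covectors in \<open>L\<close> and of a positive remainder. Then
  \<open>c ^ m\<close> times the product over \<open>L\<close> is one of the words in the expansion of the power of \<open>w\<close>.\<close>

lemma wedge_power_dominates:
  fixes w :: "(complex ^ 'n) covector"
  assumes "real11 w" "length L = m" "\<And>\<alpha>. \<alpha> \<in> set L \<Longrightarrow> covector10 \<alpha>" "c \<ge> 0"
    and dom: "\<And>v. c * (\<Sum>s<m. 2 * (cmod ((L ! s) v))\<^sup>2) \<le> metric_of w v v"
  shows "strongly_positive m (\<lambda>vs. wedge_power 2 m w vs - of_real (c ^ m) * wedges 2 (map elementary_11 L) vs)"
proof -
  define w' where "w' = (\<lambda>vs. w vs + (- of_real c) * (\<Sum>s<m. elementary_11 (L ! s) vs))"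
  have Lc: "covector10 (L ! s)" if "s < m" for s using that assms(2,3) by simp
  have el: "elementary_11 \<alpha> [u, \<i> *s v] = of_real (2 * Re (\<alpha> u * cnj (\<alpha> v)))" if "covector10 \<alpha>" for \<alpha> u v
    unfolding elementary_11_pair covector10_scale[OF that] by (simp add: complex_eq_iff algebra_simps)
  have elr: "elementary_11 \<alpha> vs \<in> \<real>" if "covector10 \<alpha>" for \<alpha> :: "complex ^ 'n \<Rightarrow> complex" and vs
  proof (cases "length vs = 2")
    case True
    then obtain u v where vs: "vs = [u, v]" by (auto simp: length_Suc_conv numeral_2_eq_2)
    show ?thesis unfolding vs elementary_11_pair complex_is_Real_iff by (simp add: algebra_simps)
  next
    case False
    then show ?thesis using alt_form_length[OF elementary_11_alt_form[OF that]] by simp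
  qed
  have eli: "elementary_11 \<alpha> [\<i> *s u, \<i> *s v] = elementary_11 \<alpha> [u, v]" if "covector10 \<alpha>" for \<alpha> u v
    unfolding elementary_11_pair covector10_scale[OF that] by (simp add: complex_eq_iff algebra_simps)
  have r: "real11 w'"
    unfolding real11_def
  proof (intro conjI allI)
    show "alt_form 2 w'"
      unfolding w'_def using assms(1) Lc unfolding real11_def
      by (intro alt_form_add alt_form_scale alt_form_sum elementary_11_alt_form) auto
    show "w' vs \<in> \<real>" for vs
      unfolding w'_def using assms(1) elr[OF Lc] unfolding real11_def
      by (intro Reals_add Reals_mult sum_in_Reals) auto
    show "w' [\<i> *s u, \<i> *s v] = w' [u, v]" for u v
    proof -
      have "(\<Sum>s<m. elementary_11 (L ! s) [\<i> *s u, \<i> *s v]) = (\<Sum>s<m. elementary_11 (L ! s) [u, v])"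
        using eli[OF Lc] by (intro sum.cong refl) simp
      then show ?thesis using assms(1) by (simp add: w'_def real11_def)
    qed
  qed
  have pos: "0 \<le> metric_of w' v v" for v
  proof -
    have "(\<Sum>s<m. elementary_11 (L ! s) [v, \<i> *s v]) = of_real (\<Sum>s<m. 2 * (cmod ((L ! s) v))\<^sup>2)"
      using Lc by (simp add: el complex_norm_square[symmetric] del: complex_mult_cnj)
    then have "metric_of w' v v = metric_of w v v - c * (\<Sum>s<m. 2 * (cmod ((L ! s) v))\<^sup>2)"
      by (simp add: metric_of_def w'_def del: of_real_sum)
    then show ?thesis using dom[of v] by simp
  qed
  obtain \<alpha> :: "'n \<Rightarrow> complex ^ 'n \<Rightarrow> complex"
    where \<alpha>: "\<And>j. covector10 (\<alpha> j)" "w' = (\<lambda>vs. \<Sum>j\<in>UNIV. elementary_11 (\<alpha> j) vs)"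
    by (rule real11_decomposition[OF r pos]) (rule that)
  \<comment> \<open>The left summands carry the remainder, the right ones the entries of
    \<open>L\<close>. An elementary covector is quadratic in its \<open>(1,0)\<close>-covector, so
    the factor \<open>c\<close> becomes \<open>sqrt c\<close>.\<close>
  define b where "b = (case_sum \<alpha> (\<lambda>s v. of_real (sqrt c) * (L ! s) v))"
  define I where "I = (UNIV :: 'n set) <+> {..<m}"
  have fin: "finite I" by (simp add: I_def)
  have b10: "covector10 (b i)" if "i \<in> I" for i
    using that \<alpha>(1) Lc unfolding I_def b_def
    by (auto intro!: covector10I simp: covector10_add covector10_scale algebra_simps)
  have "w vs = (\<Sum>i\<in>I. elementary_11 (b i) vs)" for vs
  proof -
    have "w vs = w' vs + (\<Sum>s<m. of_real c * elementary_11 (L ! s) vs)"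
      by (simp add: w'_def sum_distrib_left[symmetric])
    also have "\<dots> = (\<Sum>i\<in>I. elementary_11 (b i) vs)"
      unfolding \<alpha>(2) I_def using assms(4) by (subst sum.Plus) (auto simp: b_def elementary_11_scale)
    finally show ?thesis .
  qed
  then have w: "w = (\<lambda>vs. \<Sum>i\<in>I. elementary_11 (b i) vs)" by (rule ext)
  let ?W = "{is. set is \<subseteq> I \<and> length is = m}"
  \<comment> \<open>The word that runs through \<open>L\<close> once in order. Removing this single
    term leaves a sum of generators of the cone.\<close>
  let ?z = "map Inr [0..<m] :: ('n + nat) list"
  have z: "?z \<in> ?W" by (auto simp: I_def)
  have fW: "finite ?W" by (rule finite_lists_length_eq[OF fin])
  have "map (\<lambda>i. elementary_11 (b i)) ?z = map (\<lambda>\<eta> vs. of_real c * \<eta> vs) (map elementary_11 L)"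
    using assms(2,4) by (intro nth_equalityI) (auto simp: b_def elementary_11_scale fun_eq_iff)
  then have wz: "wedges 2 (map (\<lambda>i. elementary_11 (b i)) ?z) vs = of_real (c ^ m) * wedges 2 (map elementary_11 L) vs" for vs
    using wedges_scale[of "of_real c" "map elementary_11 L"] assms(2) by (simp only: length_map of_real_power)
  have "wedge_power 2 m w vs - of_real (c ^ m) * wedges 2 (map elementary_11 L) vs =
      (\<Sum>is\<in>?W - {?z}. wedges 2 (map elementary_11 (map b is)) vs)" for vs
    unfolding w wedge_power_sum[OF fin] wz[symmetric]
    by (subst sum.remove[OF fW z]) (simp add: o_def)
  moreover have "strongly_positive m (\<lambda>vs. \<Sum>is\<in>?W - {?z}. wedges 2 (map elementary_11 (map b is)) vs)"
    by (rule strongly_positive_sum, rule strongly_positive_elementary) (use b10 in auto)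
  ultimately show ?thesis by simp
qed

subsection \<open>Orthonormal frames and the volume form\<close>

definition pos11 :: "(complex ^ 'n) covector \<Rightarrow> bool" where
  "pos11 w \<longleftrightarrow> real11 w \<and> (\<forall>v. v \<noteq> 0 \<longrightarrow> 0 < metric_of w v v)"

lemma pos11_nonneg: "pos11 w \<Longrightarrow> 0 \<le> metric_of w v v"
proof (cases "v = 0")
  case True
  assume "pos11 w"
  then show ?thesis using linear_0[OF metric_of_linear(1)[of w 0]] True by (simp add: pos11_def)
qed (auto simp: pos11_def less_imp_le)

lemma nth_concat_pairs:
  "k < length xs \<Longrightarrow> concat (map (\<lambda>x. [f x, g x]) xs) ! (2 * k) = f (xs ! k)"
  "k < length xs \<Longrightarrow> concat (map (\<lambda>x. [f x, g x]) xs) ! Suc (2 * k) = g (xs ! k)"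
proof (induction xs arbitrary: k)
  case (Cons x xs)
  { case 1 then show ?case using Cons.IH(1)[of "k - 1"] by (cases k) auto }
  { case 2 then show ?case using Cons.IH(2)[of "k - 1"] by (cases k) auto }
qed simp_all

lemma nth_concat_pairs':
  "k < 2 * length xs \<Longrightarrow> concat (map (\<lambda>x. [f x, g x]) xs) ! k = (if even k then f else g) (xs ! (k div 2))"
  by (cases "even k") (auto elim!: evenE oddE simp: nth_concat_pairs)

lemma standard_frame_concat:
  obtains "is" :: "'n::finite list" where "distinct is" "set is = UNIV" "length is = CARD('n)"
    "(standard_frame :: (complex ^ 'n) list) = concat (map (\<lambda>i. [axis i 1, axis i \<i>]) is)"
proof -
  let ?is = "SOME is. distinct is \<and> set is = (UNIV :: 'n set)"
  have i: "distinct ?is \<and> set ?is = (UNIV :: 'n set)"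
    by (rule someI_ex) (metis finite_distinct_list finite_class.finite_UNIV)
  then have "length ?is = CARD('n)" by (metis distinct_card)
  with i show thesis using that[of ?is] by (simp add: standard_frame_def)
qed

lemma standard_frame_length: "length (standard_frame :: (complex ^ 'n) list) = 2 * CARD('n)"
proof -
  obtain "is" :: "'n list" where iss: "length is = CARD('n)"
    "(standard_frame :: (complex ^ 'n) list) = concat (map (\<lambda>i. [axis i 1, axis i \<i>]) is)"
    by (rule standard_frame_concat) (rule that)
  show ?thesis unfolding iss(2) length_concat_pairs iss(1) ..
qed

lemma standard_frame_orthonormal:
  assumes "i < 2 * CARD('n)" "j < 2 * CARD('n)"
  shows "(standard_frame ! i :: complex ^ 'n) \<bullet> standard_frame ! j = (if i = j then 1 else 0)"
proof -
  obtain "is" :: "'n list" where iss: "distinct is" "length is = CARD('n)"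
    "(standard_frame :: (complex ^ 'n) list) = concat (map (\<lambda>i. [axis i 1, axis i \<i>]) is)"
    by (rule standard_frame_concat) (rule that)
  have d: "is ! (i div 2) = is ! (j div 2) \<longleftrightarrow> i div 2 = j div 2"
    using assms iss(1,2) by (intro nth_eq_iff_index_eq) auto
  have "i = j \<longleftrightarrow> i div 2 = j div 2 \<and> (even i \<longleftrightarrow> even j)"
    by (metis bit_eq_rec)
  then show ?thesis
    using assms iss(2) d unfolding iss(3)
    by (auto simp: nth_concat_pairs' inner_axis_axis inner_complex_def)
qed

text \<open>Justifies the choice operator by exhibiting a frame. The decomposition of
  \<open>w\<close> yields a real linear isomorphism \<open>a\<close> that carries the metric to
  twice the Euclidean inner product.\<close>

lemma orthonormal_frame:
  fixes w :: "(complex ^ 'n) covector"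
  assumes "pos11 w"
  shows "length (orthonormal_frame w) = 2 * CARD('n)"
    and "\<And>i j. i < 2 * CARD('n) \<Longrightarrow> j < 2 * CARD('n) \<Longrightarrow>
      metric_of w (orthonormal_frame w ! i) (orthonormal_frame w ! j) = (if i = j then 1 else 0)"
proof -
  obtain \<alpha> :: "'n \<Rightarrow> complex ^ 'n \<Rightarrow> complex"
    where \<alpha>: "\<And>j. covector10 (\<alpha> j)" and m: "\<And>u v. metric_of w u v = 2 * Re (\<Sum>j\<in>UNIV. \<alpha> j u * cnj (\<alpha> j v))"
    by (rule real11_decomposition[OF _ pos11_nonneg[OF assms]]) (use assms in \<open>simp add: pos11_def\<close>, rule that)
  define a where "a = (\<lambda>v. \<chi> j. \<alpha> j v)"
  have mi: "metric_of w u v = 2 * (a u \<bullet> a v)" for u v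
    unfolding m a_def by (simp add: inner_vec_def inner_complex_def)
  have lin: "linear a"
    by (rule linearI) (simp_all add: a_def Finite_Cartesian_Product.vec_eq_iff linear_add[OF covector10_linear[OF \<alpha>]]
        linear_scale[OF covector10_linear[OF \<alpha>]])
  have "v = 0" if "a v = 0" for v
    using that mi[of v v] assms unfolding pos11_def by (metis inner_zero_left less_irrefl mult_zero_right)
  then have "inj a" using linear_injective_0[OF lin] by blast
  then have "surj a" by (rule linear_inj_imp_surj[OF lin])
  then have inv: "a (inv_into UNIV a y) = y" for y by (rule surj_f_inv_f)
  \<comment> \<open>The factor \<open>1 / sqrt 2\<close> absorbs the 2 in the comparison of the
    metric with the Euclidean inner product.\<close>
  define es where "es = map (\<lambda>b. inv_into UNIV a ((1 / sqrt 2) *\<^sub>R b)) (standard_frame :: (complex ^ 'n) list)"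
  have "length es = 2 * CARD('n) \<and>
        (\<forall>i<length es. \<forall>j<length es. metric_of w (es ! i) (es ! j) = (if i = j then 1 else 0))"
    using standard_frame_orthonormal[where 'n = 'n]
    by (auto simp: es_def standard_frame_length mi inv)
  then have "length (orthonormal_frame w) = 2 * CARD('n) \<and>
        (\<forall>i<length (orthonormal_frame w). \<forall>j<length (orthonormal_frame w).
          metric_of w (orthonormal_frame w ! i) (orthonormal_frame w ! j) = (if i = j then 1 else 0))"
    unfolding orthonormal_frame_def by (rule someI)
  then show "length (orthonormal_frame w) = 2 * CARD('n)"
    and "\<And>i j. i < 2 * CARD('n) \<Longrightarrow> j < 2 * CARD('n) \<Longrightarrow>
      metric_of w (orthonormal_frame w ! i) (orthonormal_frame w ! j) = (if i = j then 1 else 0)"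
    by auto
qed

text \<open>The frame has as many members as the real dimension and is independent, hence spans. The
  defect \<open>z\<close> of the expansion is orthogonal to the frame, therefore to itself, and
  definiteness makes it zero.\<close>

lemma orthonormal_frame_expansion:
  fixes w :: "(complex ^ 'n) covector"
  assumes "pos11 w"
  shows "v = (\<Sum>k<2 * CARD('n). metric_of w (orthonormal_frame w ! k) v *\<^sub>R (orthonormal_frame w ! k))"
proof -
  let ?e = "(!) (orthonormal_frame w)" and ?g = "metric_of w" and ?N = "2 * CARD('n)"
  have r: "real11 w" using assms by (simp add: pos11_def)
  note lin = metric_of_linear[OF r]
  have on: "?g (?e i) (?e j) = (if i = j then 1 else 0)" if "i < ?N" "j < ?N" for i j
    using orthonormal_frame(2)[OF assms that] .
  have inj: "inj_on ?e {..<?N}"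
    by (rule inj_onI) (metis lessThan_iff on zero_neq_one)
  have coef: "?g (?e j) (\<Sum>k<?N. c k *\<^sub>R ?e k) = c j" if "j < ?N" for j c
  proof -
    have "?g (?e j) (\<Sum>k<?N. c k *\<^sub>R ?e k) = (\<Sum>k<?N. c k * ?g (?e j) (?e k))"
      by (simp add: linear_sum[OF lin(1)] linear_scale[OF lin(1)])
    also have "\<dots> = (\<Sum>k<?N. if k = j then c k else 0)"
      using on that by (intro sum.cong refl) auto
    finally show ?thesis using that by simp
  qed
  have ind: "independent (?e ` {..<?N})"
  proof (rule independent_if_scalars_zero)
    fix f x assume z: "(\<Sum>x\<in>?e ` {..<?N}. f x *\<^sub>R x) = 0" and "x \<in> ?e ` {..<?N}"
    then obtain j where j: "j < ?N" "x = ?e j" by auto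
    have "(\<Sum>k<?N. f (?e k) *\<^sub>R ?e k) = 0" using z inj by (simp add: sum.reindex)
    then show "f x = 0" using coef[OF j(1), of "\<lambda>k. f (?e k)"] j linear_0[OF lin(1)] by simp
  qed simp
  have "UNIV \<subseteq> span (?e ` {..<?N})"
    by (rule card_ge_dim_independent[OF _ ind]) (use inj in \<open>simp_all add: card_image dim_UNIV\<close>)
  then have span: "x \<in> span (?e ` {..<?N})" for x by blast
  define z where "z = v - (\<Sum>k<?N. ?g (?e k) v *\<^sub>R ?e k)"
  have zj: "?g z (?e j) = 0" if "j < ?N" for j
  proof -
    have "?g z (?e j) = ?g (?e j) z" by (rule metric_of_sym[OF r])
    also have "\<dots> = 0" unfolding z_def by (simp only: linear_diff[OF lin(1)] coef[OF that] diff_self)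
    finally show ?thesis .
  qed
  have zz: "?g z z = 0"
  proof (rule linear_eq_0_on_span[OF lin(1)[of z] _ span])
    fix x assume "x \<in> ?e ` {..<?N}"
    then show "?g z x = 0" using zj by (elim imageE) simp
  qed
  have pos: "0 < ?g x x" if "x \<noteq> 0" for x using assms that by (simp add: pos11_def)
  have "z = 0"
  proof (rule ccontr)
    assume "z \<noteq> 0"
    from pos[OF this] zz show False by linarith
  qed
  then show ?thesis unfolding z_def by (simp only: right_minus_eq)
qed

text \<open>\<open>cov_norm\<close> runs over increasing multi-indices only. A multi-index without
  repetition differs from its sorted version by a sign in the value, and one with a repetition gives
  zero.\<close>

lemma cov_norm_bound:
  fixes w :: "(complex ^ 'n) covector"
  assumes "alt_form k \<eta>" "length is = k" "set is \<subseteq> {..<2 * CARD('n)}"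
  shows "cmod (\<eta> (map ((!) (orthonormal_frame w)) is)) \<le> cov_norm w k \<eta>"
proof (cases "distinct is")
  case True
  let ?I = "{I. length I = k \<and> sorted_wrt (<) I \<and> set I \<subseteq> {..<2 * CARD('n)}}"
  have "?I \<subseteq> {I. set I \<subseteq> {..<2 * CARD('n)} \<and> length I = k}" by auto
  then have fin: "finite ?I" using finite_lists_length_eq[of "{..<2 * CARD('n)}" k] finite_subset by blast
  have s: "sort is \<in> ?I" using assms(2,3) True by (simp add: strict_sorted_iff)
  have "(cmod (\<eta> (map ((!) (orthonormal_frame w)) is)))\<^sup>2 = (cmod (\<eta> (map ((!) (orthonormal_frame w)) (sort is))))\<^sup>2"
    by (rule arg_cong[of _ _ "\<lambda>x. x\<^sup>2"], rule alt_form_norm_permute[OF assms(1)]) simp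
  also have "\<dots> \<le> (\<Sum>I\<in>?I. (cmod (\<eta> (map ((!) (orthonormal_frame w)) I)))\<^sup>2)"
    by (rule member_le_sum[OF s _ fin]) simp
  finally show ?thesis unfolding cov_norm_def by (rule real_le_rsqrt)
next
  case False
  then have "\<eta> (map ((!) (orthonormal_frame w)) is) = 0"
    by (intro alt_form_repeat[OF assms(1)]) (simp add: distinct_map)
  then show ?thesis by (simp add: cov_norm_def sum_nonneg)
qed

text \<open>In top degree a word in \<open>m\<close> covectors either repeats one of them or is a
  rearrangement of all.\<close>

lemma altprod_top_bound:
  assumes "length is = m" "set is \<subseteq> {..<m}"
  shows "cmod (altprod (map c is) vs) \<le> cmod (altprod (map c [0..<m]) vs)"
proof (cases "distinct is")
  case True
  then have "set is = {..<m}" using assms by (metis card_lessThan card_subset_eq distinct_card finite_lessThan)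
  then have "mset is = mset [0..<m]"
    using True by (metis atLeast_upt distinct_upt set_eq_iff_mset_eq_distinct)
  then have "mset (map c is) = mset (map c [0..<m])" by simp
  then obtain s :: int where s: "s = 1 \<or> s = -1" "\<And>vs. altprod (map c is) vs = of_int s * altprod (map c [0..<m]) vs"
    by (rule altprod_mset_eq) (rule that)
  then show ?thesis by (auto simp: norm_mult)
next
  case False
  then show ?thesis using altprod_repeat_covector[of "map c is" vs] by (simp add: distinct_map)
qed

section \<open>Determinants of interleaved complex matrices\<close>

lemma det_cnj: "Determinant.det (Matrix.mat n n (\<lambda>(i, j). cnj (A i j))) = cnj (Determinant.det (Matrix.mat n n (\<lambda>(i, j). A i j)))"
proof -
  have "cnj (of_int (sign p) * (\<Prod>i = 0..<n. Matrix.mat n n (\<lambda>(i, j). A i j) $$ (i, p i))) =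
      of_int (sign p) * (\<Prod>i = 0..<n. Matrix.mat n n (\<lambda>(i, j). cnj (A i j)) $$ (i, p i))"
    if "p permutes {0..<n}" for p
    using permutes_in_image[OF that] by (auto intro!: prod.cong)
  then show ?thesis by (simp add: Determinant.det_def cnj_sum)
qed

text \<open>The sign of \<open>p\<close> enters once through the rows and once through the columns,
  and its square is 1.\<close>

lemma det_permute_both:
  fixes M :: "complex mat"
  assumes "M \<in> carrier_mat n n" "p permutes {0..<n}"
  shows "Determinant.det (Matrix.mat n n (\<lambda>(i, j). M $$ (p i, p j))) = Determinant.det M"
proof -
  have pn: "p i < n \<longleftrightarrow> i < n" for i using permutes_in_image[OF assms(2), of i] by simp
  let ?R = "Matrix.mat n n (\<lambda>(i, j). M $$ (p i, j))"
  let ?T = "Matrix.mat n n (\<lambda>(i, j). transpose_mat ?R $$ (p i, j))"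
  have "Matrix.mat n n (\<lambda>(i, j). M $$ (p i, p j)) = transpose_mat ?T"
    using pn by (intro eq_matI) auto
  then have "Determinant.det (Matrix.mat n n (\<lambda>(i, j). M $$ (p i, p j))) = Determinant.det ?T"
    by (simp add: det_transpose[of _ n])
  also have "\<dots> = of_int (sign p) * Determinant.det (transpose_mat ?R)"
    by (rule det_permute_rows[OF _ assms(2)]) simp
  also have "Determinant.det (transpose_mat ?R) = Determinant.det ?R"
    by (rule det_transpose[of _ n]) simp
  also have "Determinant.det ?R = of_int (sign p) * Determinant.det M"
    by (rule det_permute_rows[OF assms])
  finally show ?thesis
    by (simp add: mult.assoc[symmetric] of_int_mult[symmetric] del: of_int_mult)
qed

text \<open>The interleaving permutation turns the matrix into the block matrix with rows
  \<open>A, \<i> A\<close> and \<open>cnj A, - \<i> cnj A\<close>.\<close>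

lemma det_interleaved:
  fixes A :: "nat \<Rightarrow> nat \<Rightarrow> complex" and n :: nat
  defines "M \<equiv> Matrix.mat (2 * n) (2 * n) (\<lambda>(i, j).
     (if even i then A (i div 2) (j div 2) else cnj (A (i div 2) (j div 2))) *
     (if even j then 1 else if even i then \<i> else - \<i>))"
  shows "Determinant.det M = (- 2 * \<i>) ^ n * of_real ((cmod (Determinant.det (Matrix.mat n n (\<lambda>(i, j). A i j))))\<^sup>2)"
proof -
  let ?A = "Matrix.mat n n (\<lambda>(i, j). A i j)" and ?B = "Matrix.mat n n (\<lambda>(i, j). cnj (A i j))"
  \<comment> \<open>Lists the even positions first and the odd positions after them.\<close>
  define p where "p = (\<lambda>i. if i < n then 2 * i else if i < 2 * n then Suc (2 * (i - n)) else i)"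
  have inj: "inj_on p {0..<2 * n}"
    unfolding p_def by (rule inj_onI) (auto split: if_splits; presburger)
  have "p ` {0..<2 * n} \<subseteq> {0..<2 * n}" unfolding p_def by auto
  then have "bij_betw p {0..<2 * n} {0..<2 * n}"
    using inj by (simp add: bij_betw_def endo_inj_surj)
  then have p: "p permutes {0..<2 * n}" by (rule bij_imp_permutes) (simp add: p_def)
  have "Matrix.mat (2 * n) (2 * n) (\<lambda>(i, j). M $$ (p i, p j)) =
      four_block_mat ?A (\<i> \<cdot>\<^sub>m ?A) ?B ((- \<i>) \<cdot>\<^sub>m ?B)"
    unfolding M_def p_def by (intro eq_matI) (auto simp: mult.commute)
  then have "Determinant.det M = Determinant.det (four_block_mat ?A (\<i> \<cdot>\<^sub>m ?A) ?B ((- \<i>) \<cdot>\<^sub>m ?B))"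
    using det_permute_both[OF _ p, of M] by (simp add: M_def)
  \<comment> \<open>The formula for block determinants applies because the two lower blocks are
    multiples of one matrix and therefore commute.\<close>
  also have "\<dots> = Determinant.det (?A * ((- \<i>) \<cdot>\<^sub>m ?B) - (\<i> \<cdot>\<^sub>m ?A) * ?B)"
    by (rule det_four_block_mat[of _ n])
       (auto simp: mult_smult_distrib[of _ n n _ n] mult_smult_assoc_mat[of _ n n _ n])
  also have "?A * ((- \<i>) \<cdot>\<^sub>m ?B) - (\<i> \<cdot>\<^sub>m ?A) * ?B = (- 2 * \<i>) \<cdot>\<^sub>m (?A * ?B)"
    by (subst mult_smult_distrib[of _ n n _ n], simp, simp, subst mult_smult_assoc_mat[of _ n n _ n], simp, simp)
       (intro eq_matI; simp)
  also have "Determinant.det ((- 2 * \<i>) \<cdot>\<^sub>m (?A * ?B)) = (- 2 * \<i>) ^ n * (Determinant.det ?A * Determinant.det ?B)"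
    by (simp add: det_smult det_mult[of _ n])
  also have "Determinant.det ?A * Determinant.det ?B = of_real ((cmod (Determinant.det ?A))\<^sup>2)"
    unfolding det_cnj complex_norm_square ..
  finally show ?thesis .
qed

text \<open>The factor \<open>\<i> ^ n\<close> of the product and the factor
  \<open>(- 2 * \<i>) ^ n\<close> of the interleaved determinant combine to \<open>2 ^ n\<close>, so
  the value is real and nonnegative. This expresses that the standard frame is positively oriented,
  and it excludes cancellation between the words of a power of \<open>w\<close>.\<close>

lemma wedges_elementary_standard_frame:
  fixes L :: "(complex ^ 'n \<Rightarrow> complex) list"
  assumes "\<And>\<alpha>. \<alpha> \<in> set L \<Longrightarrow> covector10 \<alpha>" "length L = CARD('n)"
  shows "wedges 2 (map elementary_11 L) standard_frame =
    of_real (cmod (altprod (concat (map (\<lambda>\<alpha>. [\<alpha>, cnj \<circ> \<alpha>]) L)) standard_frame))"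
proof -
  let ?n = "CARD('n)" and ?C = "concat (map (\<lambda>\<alpha>. [\<alpha>, cnj \<circ> \<alpha>]) L)"
  let ?s = "standard_frame :: (complex ^ 'n) list"
  obtain "is" :: "'n list" where iss: "distinct is" "length is = ?n"
    "?s = concat (map (\<lambda>i. [axis i 1, axis i \<i>]) is)"
    by (rule standard_frame_concat) (rule that)
  define A where "A = (\<lambda>i j. (L ! i) (axis (is ! j) 1))"
  have ai: "\<alpha> (axis k \<i>) = \<i> * \<alpha> (axis k 1)" if "covector10 \<alpha>" for \<alpha> and k :: 'n
  proof -
    have "axis k \<i> = \<i> *s (axis k 1 :: complex ^ 'n)" by (simp add: Finite_Cartesian_Product.vec_eq_iff axis_def)
    then show ?thesis using covector10_scale[OF that] by simp
  qed
  have len: "length ?s = length ?C" using assms(2) by (simp add: standard_frame_length length_concat_pairs)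
  have lC: "length ?C = 2 * ?n" using assms(2) by (simp add: length_concat_pairs)
  have "altprod ?C ?s = Determinant.det (Matrix.mat (2 * ?n) (2 * ?n) (\<lambda>(i, j). (?C ! i) (?s ! j)))"
    using altprod_det[OF len] lC by simp
  also have "Matrix.mat (2 * ?n) (2 * ?n) (\<lambda>(i, j). (?C ! i) (?s ! j)) = Matrix.mat (2 * ?n) (2 * ?n) (\<lambda>(i, j).
     (if even i then A (i div 2) (j div 2) else cnj (A (i div 2) (j div 2))) *
     (if even j then 1 else if even i then \<i> else - \<i>))"
  proof (rule eq_matI)
    fix i j assume "i < dim_row (Matrix.mat (2 * ?n) (2 * ?n) (\<lambda>(i, j).
     (if even i then A (i div 2) (j div 2) else cnj (A (i div 2) (j div 2))) *
     (if even j then 1 else if even i then \<i> else - \<i>)))" "j < dim_col (Matrix.mat (2 * ?n) (2 * ?n) (\<lambda>(i, j).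
     (if even i then A (i div 2) (j div 2) else cnj (A (i div 2) (j div 2))) *
     (if even j then 1 else if even i then \<i> else - \<i>)))"
    then have ij: "i < 2 * ?n" "j < 2 * ?n" by auto
    then have c: "covector10 (L ! (i div 2))" using assms by simp
    have "(?C ! i) (?s ! j) = (if even i then A (i div 2) (j div 2) else cnj (A (i div 2) (j div 2))) *
     (if even j then 1 else if even i then \<i> else - \<i>)"
      unfolding iss(3) using ij assms(2) iss(2) ai[OF c] by (simp add: nth_concat_pairs' A_def mult.commute)
    then show "Matrix.mat (2 * ?n) (2 * ?n) (\<lambda>(i, j). (?C ! i) (?s ! j)) $$ (i, j) = Matrix.mat (2 * ?n) (2 * ?n) (\<lambda>(i, j).
     (if even i then A (i div 2) (j div 2) else cnj (A (i div 2) (j div 2))) *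
     (if even j then 1 else if even i then \<i> else - \<i>)) $$ (i, j)"
      using ij by simp
  qed simp_all
  also have "Determinant.det \<dots> = (- 2 * \<i>) ^ ?n * of_real ((cmod (Determinant.det (Matrix.mat ?n ?n (\<lambda>(i, j). A i j))))\<^sup>2)"
    by (rule det_interleaved)
  finally have e: "altprod ?C ?s = (- 2 * \<i>) ^ ?n * of_real ((cmod (Determinant.det (Matrix.mat ?n ?n (\<lambda>(i, j). A i j))))\<^sup>2)" .
  have "\<i> ^ ?n * (- 2 * \<i>) ^ ?n = (2 :: complex) ^ ?n"
  proof -
    have "\<i> * (- 2 * \<i>) = 2" by (simp add: complex_eq_iff)
    then show ?thesis by (simp only: power_mult_distrib[symmetric])
  qed
  then have "\<i> ^ ?n * altprod ?C ?s = of_real (2 ^ ?n * (cmod (Determinant.det (Matrix.mat ?n ?n (\<lambda>(i, j). A i j))))\<^sup>2)"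
    unfolding e by (simp add: mult.assoc[symmetric])
  moreover have "cmod (altprod ?C ?s) = 2 ^ ?n * (cmod (Determinant.det (Matrix.mat ?n ?n (\<lambda>(i, j). A i j))))\<^sup>2"
    unfolding e by (simp add: norm_mult norm_power)
  ultimately show ?thesis using assms(2) by (simp add: wedges_elementary)
qed

text \<open>The modulus of the determinant of the coordinates of the standard frame in the
  orthonormal one, which is the Riemannian volume density of \<open>w\<close>. Taking the modulus
  avoids any statement about the orientation of the chosen frame.\<close>

definition frame_det :: "(complex ^ 'n) covector \<Rightarrow> real" where
  "frame_det w = cmod (altprod (map (\<lambda>k v. of_real (metric_of w (orthonormal_frame w ! k) v)) [0..<2 * CARD('n)]) standard_frame)"

text \<open>In the expansion of the power of \<open>w\<close> every word is nonnegative on the standard frame. The word without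
  repetitions is the determinant of the orthonormal frame, because the coframe \<open>\<alpha>, cnj \<alpha>\<close> is unitary on it.\<close>

lemma volume_ge_frame_det:
  fixes w :: "(complex ^ 'n) covector"
  assumes "pos11 w"
  shows "frame_det w \<le> Re (wedge_power 2 CARD('n) w standard_frame)"
proof -
  let ?n = "CARD('n)" and ?s = "standard_frame :: (complex ^ 'n) list"
  let ?e = "(!) (orthonormal_frame w)" and ?g = "metric_of w"
  have r: "real11 w" using assms by (simp add: pos11_def)
  obtain \<alpha> :: "'n \<Rightarrow> complex ^ 'n \<Rightarrow> complex"
    where \<alpha>: "\<And>j. covector10 (\<alpha> j)" "w = (\<lambda>vs. \<Sum>j\<in>UNIV. elementary_11 (\<alpha> j) vs)"
      and m: "\<And>u v. metric_of w u v = 2 * Re (\<Sum>j\<in>UNIV. \<alpha> j u * cnj (\<alpha> j v))"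
    by (rule real11_decomposition[OF r pos11_nonneg[OF assms]]) (rule that)
  let ?C = "\<lambda>is. concat (map (\<lambda>\<alpha>. [\<alpha>, cnj \<circ> \<alpha>]) (map \<alpha> is))"
  let ?W = "{is. set is \<subseteq> (UNIV :: 'n set) \<and> length is = ?n}"
  have word: "wedges 2 (map (\<lambda>j. elementary_11 (\<alpha> j)) is) ?s = of_real (cmod (altprod (?C is) ?s))" if "is \<in> ?W" for "is"
    using wedges_elementary_standard_frame[of "map \<alpha> is"] that \<alpha>(1) by (auto simp: o_def)
  obtain "is" :: "'n list" where iss: "distinct is" "set is = UNIV" "length is = ?n"
    by (metis finite_distinct_list finite_class.finite_UNIV distinct_card)
  have isW: "is \<in> ?W" using iss by simp
  have fW: "finite ?W" by (rule finite_lists_length_eq) simp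
  have "Re (wedge_power 2 ?n w ?s) = (\<Sum>is\<in>?W. cmod (altprod (?C is) ?s))"
  proof -
    have "wedge_power 2 ?n w ?s = (\<Sum>is\<in>?W. wedges 2 (map (\<lambda>j. elementary_11 (\<alpha> j)) is) ?s)"
      by (subst \<alpha>(2), rule wedge_power_sum) simp
    also have "\<dots> = (\<Sum>is\<in>?W. of_real (cmod (altprod (?C is) ?s)))"
      by (intro sum.cong refl word)
    finally show ?thesis by (simp only: Re_sum Re_complex_of_real)
  qed
  also have "\<dots> \<ge> cmod (altprod (?C is) ?s)"
    by (rule member_le_sum[OF isW _ fW]) simp
  finally have 1: "cmod (altprod (?C is) ?s) \<le> Re (wedge_power 2 ?n w ?s)" .
  let ?N = "2 * ?n"
  have lC: "length (?C is) = ?N" using length_concat_pairs[of "\<lambda>\<alpha>. \<alpha>" "\<lambda>\<alpha>. cnj \<circ> \<alpha>" "map \<alpha> is"] iss(3) by simp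
  let ?U = "Matrix.mat ?N ?N (\<lambda>(i, k). (?C is ! i) (?e k))"
  let ?V = "Matrix.mat ?N ?N (\<lambda>(i, k). cnj ((?C is ! i) (?e k)))"
  let ?G = "Matrix.mat ?N ?N (\<lambda>(k, j). complex_of_real (?g (?e k) (?s ! j)))"
  have lin: "linear (?C is ! i)" if "i < ?N" for i
  proof -
    have "?C is ! i \<in> set (?C is)" by (rule nth_mem) (simp only: lC that)
    then obtain x where x: "?C is ! i = \<alpha> x \<or> ?C is ! i = cnj \<circ> \<alpha> x" by auto
    have "linear (\<alpha> x)" by (rule covector10_linear[OF \<alpha>(1)])
    moreover from this have "linear (cnj \<circ> \<alpha> x)" by (rule linear_cnj_comp)
    ultimately show ?thesis using x by (elim disjE) (simp_all only:)
  qed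
  \<comment> \<open>Evaluation on the standard frame factors through the orthonormal frame:
    \<open>?G\<close> holds the coordinates, \<open>?U\<close> the values of the complex coframe on
    the orthonormal vectors.\<close>
  have "Matrix.mat ?N ?N (\<lambda>(i, j). (?C is ! i) (?s ! j)) = ?U * ?G"
  proof (rule eq_matI)
    fix i j assume "i < dim_row (?U * ?G)" "j < dim_col (?U * ?G)"
    then have ij: "i < ?N" "j < ?N" by auto
    have "(?C is ! i) (?s ! j) = (?C is ! i) (\<Sum>k<?N. ?g (?e k) (?s ! j) *\<^sub>R ?e k)"
      using orthonormal_frame_expansion[OF assms, of "?s ! j"] by simp
    also have "\<dots> = (\<Sum>k<?N. of_real (?g (?e k) (?s ! j)) * (?C is ! i) (?e k))"
      by (simp only: linear_sum[OF lin[OF ij(1)]] linear_scale[OF lin[OF ij(1)]] scaleR_conv_of_real[where 'a = complex])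
    finally show "Matrix.mat ?N ?N (\<lambda>(i, j). (?C is ! i) (?s ! j)) $$ (i, j) = (?U * ?G) $$ (i, j)"
      using ij by (simp add: scalar_prod_def lessThan_atLeast0 mult.commute)
  qed auto
  then have "altprod (?C is) ?s = Determinant.det ?U * Determinant.det ?G"
    using altprod_det[of ?s "?C is"] lC by (simp add: standard_frame_length det_mult[of _ ?N])
  moreover have "frame_det w = cmod (Determinant.det ?G)"
  proof -
    have "Matrix.mat ?N ?N (\<lambda>(i, j). (map (\<lambda>k v. complex_of_real (?g (?e k) v)) [0..<?N] ! i) (?s ! j)) = ?G"
      by (intro eq_matI) auto
    then show ?thesis
      unfolding frame_det_def by (subst altprod_det) (simp_all add: standard_frame_length)
  qed
  moreover have "cmod (Determinant.det ?U) = 1"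
  proof -
    \<comment> \<open>Each pair \<open>\<alpha>, cnj \<circ> \<alpha>\<close> contributes a number
      plus its conjugate, twice a real part, and the sum over all pairs is the metric of two frame
      vectors.\<close>
    have "transpose_mat ?U * ?V = 1\<^sub>m ?N"
    proof (rule eq_matI)
      fix k l assume "k < dim_row (1\<^sub>m ?N)" "l < dim_col (1\<^sub>m ?N)"
      then have kl: "k < ?N" "l < ?N" by auto
      have sum2: "(\<Sum>i<2 * m. f i) = (\<Sum>j<m. f (2 * j) + f (Suc (2 * j)))" for m and f :: "nat \<Rightarrow> complex"
        by (induction m) (simp_all add: algebra_simps)
      have "(\<Sum>i<?N. (?C is ! i) (?e k) * cnj ((?C is ! i) (?e l))) =
        (\<Sum>j<?n. (?C is ! (2 * j)) (?e k) * cnj ((?C is ! (2 * j)) (?e l)) +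
             (?C is ! Suc (2 * j)) (?e k) * cnj ((?C is ! Suc (2 * j)) (?e l)))"
        by (rule sum2)
      also have "\<dots> = (\<Sum>j<?n. of_real (2 * Re (\<alpha> (is ! j) (?e k) * cnj (\<alpha> (is ! j) (?e l)))))"
      proof (rule sum.cong[OF refl])
        fix j assume "j \<in> {..<?n}"
        then have j: "j < length (map \<alpha> is)" using iss(3) by simp
        then have "map \<alpha> is ! j = \<alpha> (is ! j)" by simp
        then show "(?C is ! (2 * j)) (?e k) * cnj ((?C is ! (2 * j)) (?e l)) +
             (?C is ! Suc (2 * j)) (?e k) * cnj ((?C is ! Suc (2 * j)) (?e l)) =
             of_real (2 * Re (\<alpha> (is ! j) (?e k) * cnj (\<alpha> (is ! j) (?e l))))"
          unfolding nth_concat_pairs[OF j] by (simp add: complex_eq_iff)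
      qed
      also have "\<dots> = of_real (\<Sum>j<?n. 2 * Re (\<alpha> (is ! j) (?e k) * cnj (\<alpha> (is ! j) (?e l))))"
        by (rule of_real_sum[symmetric])
      also have "(\<Sum>j<?n. 2 * Re (\<alpha> (is ! j) (?e k) * cnj (\<alpha> (is ! j) (?e l)))) = (\<Sum>i\<in>UNIV. 2 * Re (\<alpha> i (?e k) * cnj (\<alpha> i (?e l))))"
        by (rule sum.reindex_bij_betw[of "(!) is"]) (use iss in \<open>auto simp: bij_betw_def inj_on_nth set_conv_nth\<close>)
      also have "\<dots> = ?g (?e k) (?e l)" unfolding m by (simp add: sum_distrib_left)
      also have "\<dots> = (if k = l then 1 else 0)" by (rule orthonormal_frame(2)[OF assms kl])
      finally have S: "(\<Sum>i<?N. (?C is ! i) (?e k) * cnj ((?C is ! i) (?e l))) = of_real (if k = l then 1 else 0)" .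
      have "(transpose_mat ?U * ?V) $$ (k, l) = (\<Sum>i<?N. (?C is ! i) (?e k) * cnj ((?C is ! i) (?e l)))"
        using kl by (simp add: scalar_prod_def lessThan_atLeast0)
      then show "(transpose_mat ?U * ?V) $$ (k, l) = 1\<^sub>m ?N $$ (k, l)"
        unfolding S using kl by simp
    qed auto
    then have "Determinant.det (transpose_mat ?U) * Determinant.det ?V = 1"
      using det_mult[of "transpose_mat ?U" ?N ?V] by simp
    then have "Determinant.det ?U * cnj (Determinant.det ?U) = 1"
      by (simp add: det_transpose[of _ ?N] det_cnj)
    then have "of_real ((cmod (Determinant.det ?U))\<^sup>2) = (1 :: complex)" unfolding complex_norm_square .
    then have "(cmod (Determinant.det ?U))\<^sup>2 = 1" by (simp only: of_real_eq_1_iff)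
    then show ?thesis using norm_ge_zero[of "Determinant.det ?U"] unfolding power2_eq_1_iff by linarith
  qed
  ultimately show ?thesis using 1 by (simp add: norm_mult)
qed

text \<open>Expand both factors in the real orthonormal coframe. Each pair of words contributes a
  coefficient of \<open>\<tau>\<close>, one of \<open>\<gamma>\<close>, and a top-degree word
  bounded by \<open>frame_det w\<close>, hence by the power of \<open>w\<close>. The constant is
  crude; what matters is that it does not depend on the point.\<close>

lemma wedge_volume_bound:
  fixes w :: "(complex ^ 'n) covector" and C :: real
  assumes "pos11 w" "alt_form 2 \<tau>" "alt_form q \<gamma>" "2 + q = 2 * CARD('n)"
    and "\<And>is. length is = q \<Longrightarrow> set is \<subseteq> {..<2 * CARD('n)} \<Longrightarrow> cmod (\<gamma> (map ((!) (orthonormal_frame w)) is)) \<le> C"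
    and "C \<ge> 0"
  shows "cmod (wedge 2 q \<tau> \<gamma> standard_frame) \<le>
    (2 * CARD('n)) ^ (2 * CARD('n)) * C * (cov_norm w 2 \<tau> * Re (wedge_power 2 CARD('n) w standard_frame))"
proof -
  let ?N = "2 * CARD('n)" and ?s = "standard_frame :: (complex ^ 'n) list"
  let ?e = "(!) (orthonormal_frame w)"
  let ?c = "\<lambda>k v. complex_of_real (metric_of w (?e k) v)"
  let ?L = "\<lambda>k. {is. set is \<subseteq> {..<?N} \<and> length is = k}"
  note ex = alt_form_expansion[OF finite_lessThan orthonormal_frame_expansion[OF assms(1)]]
  have t: "\<tau> = (\<lambda>vs. \<Sum>is\<in>?L 2. (\<tau> (map ?e is) / fact 2) * altprod (map ?c is) vs)"
    by (rule ext, rule ex[OF assms(2)])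
  have g: "\<gamma> = (\<lambda>vs. \<Sum>js\<in>?L q. (\<gamma> (map ?e js) / fact q) * altprod (map ?c js) vs)"
    by (rule ext, rule ex[OF assms(3)])
  have "wedge 2 q \<tau> \<gamma> ?s = wedge 2 q (\<lambda>vs. \<Sum>is\<in>?L 2. (\<tau> (map ?e is) / fact 2) * altprod (map ?c is) vs)
    (\<lambda>vs. \<Sum>js\<in>?L q. (\<gamma> (map ?e js) / fact q) * altprod (map ?c js) vs) ?s"
    using t g by simp
  also have "\<dots> = (\<Sum>is\<in>?L 2. \<Sum>js\<in>?L q. (\<tau> (map ?e is) / fact 2) * ((\<gamma> (map ?e js) / fact q) *
      wedge 2 q (altprod (map ?c is)) (altprod (map ?c js)) ?s))"
    by (simp only: wedge_sum_left wedge_sum_right wedge_scale_left wedge_scale_right sum_distrib_left)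
  also have "\<dots> = (\<Sum>is\<in>?L 2. \<Sum>js\<in>?L q. (\<tau> (map ?e is) / fact 2) * ((\<gamma> (map ?e js) / fact q) *
      altprod (map ?c (is @ js)) ?s))"
    by (intro sum.cong refl) (simp add: wedge_altprod)
  finally have "cmod (wedge 2 q \<tau> \<gamma> ?s) \<le> (\<Sum>is\<in>?L 2. \<Sum>js\<in>?L q. cmod ((\<tau> (map ?e is) / fact 2) * ((\<gamma> (map ?e js) / fact q) *
      altprod (map ?c (is @ js)) ?s)))"
    by (simp only:) (rule order_trans[OF norm_sum], rule sum_mono, rule norm_sum)
  also have "\<dots> \<le> (\<Sum>is\<in>?L 2. \<Sum>js\<in>?L q. cov_norm w 2 \<tau> * (C * frame_det w))"
  proof (intro sum_mono)
    fix "is" js assume i: "is \<in> ?L 2" and j: "js \<in> ?L q"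
    have a: "cmod (\<tau> (map ?e is) / fact 2) \<le> cov_norm w 2 \<tau>"
    proof -
      have "cmod (\<tau> (map ?e is)) \<le> cov_norm w 2 \<tau>" using i by (intro cov_norm_bound[OF assms(2)]) auto
      then show ?thesis by (simp add: norm_divide) (use norm_ge_zero[of "\<tau> (map ?e is)"] in linarith)
    qed
    have b: "cmod (\<gamma> (map ?e js) / fact q) \<le> C"
    proof -
      have "cmod (\<gamma> (map ?e js)) \<le> C" using j by (intro assms(5)) auto
      moreover have "cmod (\<gamma> (map ?e js)) / fact q \<le> cmod (\<gamma> (map ?e js)) / 1"
        by (intro divide_left_mono) (auto simp: fact_ge_1)
      ultimately show ?thesis by (simp add: norm_divide)
    qed
    have c: "cmod (altprod (map ?c (is @ js)) ?s) \<le> frame_det w"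
      unfolding frame_det_def using i j assms(4) by (intro altprod_top_bound) auto
    have cn: "0 \<le> cov_norm w 2 \<tau>" using a norm_ge_zero[of "\<tau> (map ?e is) / fact 2"] by linarith
    show "cmod ((\<tau> (map ?e is) / fact 2) * ((\<gamma> (map ?e js) / fact q) * altprod (map ?c (is @ js)) ?s))
      \<le> cov_norm w 2 \<tau> * (C * frame_det w)"
      unfolding norm_mult by (intro mult_mono a b c cn assms(6) mult_nonneg_nonneg norm_ge_zero)
  qed
  also have "\<dots> = ?N ^ ?N * C * (cov_norm w 2 \<tau> * frame_det w)"
  proof -
    \<comment> \<open>There are \<open>?N ^ 2\<close> words for \<open>\<tau>\<close> and
      \<open>?N ^ q\<close> words for \<open>\<gamma>\<close>, and
      \<open>2 + q = ?N\<close>.\<close>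
    have "real (card (?L 2)) * real (card (?L q)) = ?N ^ ?N"
      unfolding card_lists_length_eq[OF finite_lessThan] card_lessThan of_nat_mult[symmetric] power_add[symmetric] assms(4)
      by simp
    then show ?thesis by (simp add: mult.assoc[symmetric])
  qed
  also have "\<dots> \<le> ?N ^ ?N * C * (cov_norm w 2 \<tau> * Re (wedge_power 2 CARD('n) w ?s))"
    using assms(6) volume_ge_frame_det[OF assms(1)]
    by (intro mult_left_mono) (auto simp: cov_norm_def sum_nonneg)
  finally show ?thesis .
qed

subsection \<open>Forms of top bidegree are spanned by products of elementary covectors\<close>

text \<open>A complex subspace given as a predicate, so that the property of being annihilated by a
  current can be inserted for \<open>N\<close>.\<close>

definition covector_subspace :: "('v covector \<Rightarrow> bool) \<Rightarrow> bool" where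
  "covector_subspace N \<longleftrightarrow> N (\<lambda>vs. 0) \<and> (\<forall>\<eta> \<theta>. N \<eta> \<longrightarrow> N \<theta> \<longrightarrow> N (\<lambda>vs. \<eta> vs + \<theta> vs)) \<and>
     (\<forall>c \<eta>. N \<eta> \<longrightarrow> N (\<lambda>vs. c * \<eta> vs))"

lemma covector_subspace_sum:
  assumes "covector_subspace N" "\<And>i. i \<in> I \<Longrightarrow> N (\<eta> i)"
  shows "N (\<lambda>vs. \<Sum>i\<in>I. c i * \<eta> i vs)"
  using assms(2)
proof (induction I rule: infinite_finite_induct)
  case (insert i I)
  then have "N (\<lambda>vs. c i * \<eta> i vs + (\<Sum>i\<in>I. c i * \<eta> i vs))"
    using assms(1) unfolding covector_subspace_def by simp
  then show ?case using insert.hyps by simp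
qed (use assms(1) in \<open>simp_all add: covector_subspace_def\<close>)

lemma covector_subspace_mset:
  assumes "covector_subspace N" "mset \<gamma>s = mset \<delta>s" "N (altprod \<delta>s)"
  shows "N (altprod \<gamma>s)"
proof -
  obtain s :: int where s: "s = 1 \<or> s = -1" "\<And>vs. altprod \<gamma>s vs = of_int s * altprod \<delta>s vs"
    by (rule altprod_mset_eq[OF assms(2)]) (rule that)
  have "altprod \<gamma>s = (\<lambda>vs. of_int s * altprod \<delta>s vs)" by (rule ext, rule s(2))
  then show ?thesis using assms(1,3) unfolding covector_subspace_def by simp
qed

text \<open>Expanding the elementary covector of \<open>a + \<i> ^ k * b\<close> gives terms with
  weights \<open>1\<close>, \<open>(- \<i>) ^ k\<close>, \<open>\<i> ^ k\<close> and
  \<open>1\<close>. Summation over the fourth roots of unity against \<open>\<i> ^ k\<close> retains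
  only the second; the factor \<open>- \<i> / 4\<close> removes the \<open>\<i>\<close> in
  \<open>elementary_11\<close> and the number of roots.\<close>

lemma polarization_11:
  "altprod [a, cnj \<circ> b] vs = (\<Sum>k<4. (- \<i> * \<i> ^ k / 4) * elementary_11 (\<lambda>v. a v + \<i> ^ k * b v) vs)"
proof -
  have e: "elementary_11 (\<lambda>v. a v + \<i> ^ k * b v) vs = \<i> * (altprod [a, cnj \<circ> a] vs + (- \<i>) ^ k * altprod [a, cnj \<circ> b] vs
     + \<i> ^ k * altprod [b, cnj \<circ> a] vs + \<i> ^ k * (- \<i>) ^ k * altprod [b, cnj \<circ> b] vs)" for k
  proof -
    have c: "cnj \<circ> (\<lambda>v. a v + \<i> ^ k * b v) = (\<lambda>v. (cnj \<circ> a) v + (- \<i>) ^ k * (cnj \<circ> b) v)" by auto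
    show ?thesis
      unfolding elementary_11_altprod c
      using altprod_add[of "[]" a "\<lambda>v. \<i> ^ k * b v" "[\<lambda>v. (cnj \<circ> a) v + (- \<i>) ^ k * (cnj \<circ> b) v]" vs]
        altprod_scale[of "[]" "\<i> ^ k" b "[\<lambda>v. (cnj \<circ> a) v + (- \<i>) ^ k * (cnj \<circ> b) v]" vs]
        altprod_add[of "[a]" "cnj \<circ> a" "\<lambda>v. (- \<i>) ^ k * (cnj \<circ> b) v" "[]" vs]
        altprod_add[of "[b]" "cnj \<circ> a" "\<lambda>v. (- \<i>) ^ k * (cnj \<circ> b) v" "[]" vs]
        altprod_scale[of "[a]" "(- \<i>) ^ k" "cnj \<circ> b" "[]" vs]
        altprod_scale[of "[b]" "(- \<i>) ^ k" "cnj \<circ> b" "[]" vs]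
      by (simp add: algebra_simps del: o_apply)
  qed
  have "{..<4::nat} = {0, 1, 2, 3}" by auto
  then show ?thesis unfolding e by (simp add: power2_eq_square power3_eq_cube algebra_simps)
qed

text \<open>Polarization is applied to one mixed pair at a time. Each step moves a pair from
  \<open>ps\<close> to an elementary factor at the end of \<open>L\<close>, so the total number of
  factors stays \<open>m\<close>.\<close>

lemma spanning_pairs:
  fixes N :: "(complex ^ 'n) covector \<Rightarrow> bool"
  assumes N: "covector_subspace N"
    and elem: "\<And>L. length L = m \<Longrightarrow> (\<And>\<alpha>. \<alpha> \<in> set L \<Longrightarrow> covector10 \<alpha>) \<Longrightarrow> N (wedges 2 (map elementary_11 L))"
    and "\<And>\<alpha>. \<alpha> \<in> set L \<Longrightarrow> covector10 \<alpha>" "\<And>a b. (a, b) \<in> set ps \<Longrightarrow> covector10 a \<and> covector10 b"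
    and "length L + length ps = m"
  shows "N (wedges 2 (map elementary_11 L @ map (\<lambda>(a, b). altprod [a, cnj \<circ> b]) ps))"
  using assms(3-)
proof (induction ps arbitrary: L)
  case Nil
  then show ?case using elem by simp
next
  case (Cons p ps)
  obtain a b where p: "p = (a, b)" by (cases p)
  have ab: "covector10 a" "covector10 b" using Cons.prems(2) p by auto
  let ?g = "\<lambda>k::nat. \<lambda>v. a v + \<i> ^ k * b v"
  have "N (wedges 2 (map elementary_11 (L @ [?g k]) @ map (\<lambda>(a, b). altprod [a, cnj \<circ> b]) ps))" for k
  proof (rule Cons.IH)
    have "covector10 (?g k)"
      by (rule covector10I) (simp_all add: covector10_add[OF ab(1)] covector10_add[OF ab(2)]
        covector10_scale[OF ab(1)] covector10_scale[OF ab(2)] algebra_simps)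
    then show "covector10 \<alpha>" if "\<alpha> \<in> set (L @ [?g k])" for \<alpha>
      using that Cons.prems(1) by auto
  qed (use Cons.prems in auto)
  then have "N (\<lambda>vs. \<Sum>k<4. (- \<i> * \<i> ^ k / 4) *
      wedges 2 (map elementary_11 L @ elementary_11 (?g k) # map (\<lambda>(a, b). altprod [a, cnj \<circ> b]) ps) vs)"
    by (intro covector_subspace_sum[OF N]) simp
  moreover have "wedges 2 (map elementary_11 L @ altprod [a, cnj \<circ> b] # map (\<lambda>(a, b). altprod [a, cnj \<circ> b]) ps) =
      (\<lambda>vs. \<Sum>k<4. (- \<i> * \<i> ^ k / 4) *
      wedges 2 (map elementary_11 L @ elementary_11 (?g k) # map (\<lambda>(a, b). altprod [a, cnj \<circ> b]) ps) vs)"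
    by (rule ext, rule wedges_lincomb_slot, rule polarization_11)
  ultimately show ?case by (simp only: p list.map prod.case)
qed

lemma mset_concat_zip:
  "length L = length M \<Longrightarrow> mset (concat (map (\<lambda>(a, b). [a, f b]) (zip L M))) = mset (L @ map f M)"
  by (induction L M rule: list_induct2) auto

text \<open>In \<open>B\<close> the real linear factors of \<open>\<Gamma>\<close> are split one
  after another into a \<open>(1,0)\<close>- and a \<open>(0,1)\<close>-part, collected in
  \<open>L\<close> and \<open>M\<close>. When \<open>\<Gamma>\<close> is exhausted, \<open>A\<close>
  decides by type: words with \<open>m\<close> factors of each kind are reordered into pairs and
  polarized, all others are covered by \<open>off\<close>.\<close>

lemma type_forms_span:
  fixes N :: "(complex ^ 'n) covector \<Rightarrow> bool"
  assumes N: "covector_subspace N"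
    and elem: "\<And>L. length L = m \<Longrightarrow> (\<And>\<alpha>. \<alpha> \<in> set L \<Longrightarrow> covector10 \<alpha>) \<Longrightarrow> N (wedges 2 (map elementary_11 L))"
    and off: "\<And>L M. length L + length M = 2 * m \<Longrightarrow> (length L, length M) \<noteq> (m, m) \<Longrightarrow>
      (\<And>\<alpha>. \<alpha> \<in> set L \<union> set M \<Longrightarrow> covector10 \<alpha>) \<Longrightarrow> N (altprod (L @ map (\<lambda>\<beta>. cnj \<circ> \<beta>) M))"
    and "alt_form (2 * m) \<eta>"
  shows "N \<eta>"
proof -
  have A: "N (altprod (L @ map (\<lambda>\<beta>. cnj \<circ> \<beta>) M))"
    if "length L + length M = 2 * m" "\<And>\<alpha>. \<alpha> \<in> set L \<union> set M \<Longrightarrow> covector10 \<alpha>" for L M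
  proof (cases "(length L, length M) = (m, m)")
    case True
    let ?ps = "zip L M"
    have "N (wedges 2 (map elementary_11 [] @ map (\<lambda>(a, b). altprod [a, cnj \<circ> b]) ?ps))"
      by (rule spanning_pairs[OF N elem]) (use True that(2) in \<open>auto dest: set_zip_leftD set_zip_rightD\<close>)
    moreover have "wedges 2 (map (\<lambda>(a, b). altprod [a, cnj \<circ> b]) ?ps) =
        altprod (concat (map (\<lambda>(a, b). [a, cnj \<circ> b]) ?ps))"
      using wedges_pairs[of "map (\<lambda>(a, b). (a, cnj \<circ> b)) ?ps"] by (simp add: o_def split_def)
    ultimately have "N (altprod (concat (map (\<lambda>(a, b). [a, cnj \<circ> b]) ?ps)))" by simp
    then show ?thesis
      by (rule covector_subspace_mset[OF N mset_concat_zip[symmetric], rotated]) (use True in simp)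
  next
    case False
    then show ?thesis using off that by blast
  qed
  have B: "N (altprod (L @ map (\<lambda>\<beta>. cnj \<circ> \<beta>) M @ \<Gamma>))"
    if "length L + length M + length \<Gamma> = 2 * m" "\<And>\<alpha>. \<alpha> \<in> set L \<union> set M \<Longrightarrow> covector10 \<alpha>"
      "\<And>\<gamma>. \<gamma> \<in> set \<Gamma> \<Longrightarrow> linear \<gamma>" for L M \<Gamma>
    using that
  proof (induction \<Gamma> arbitrary: L M)
    case Nil
    have "N (altprod (L @ map (\<lambda>\<beta>. cnj \<circ> \<beta>) M))" by (rule A) (use Nil.prems in auto)
    then show ?case by (simp only: append_Nil2)
  next
    case (Cons \<gamma> \<Gamma>)
    have lin: "linear \<gamma>" using Cons.prems(3) by simp
    \<comment> \<open>The complex linear part of \<open>\<gamma>\<close>; \<open>b\<close> is the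
      conjugate of the antilinear part, hence complex linear as well.\<close>
    define a where "a = (\<lambda>v. (\<gamma> v - \<i> * \<gamma> (\<i> *s v)) / 2)"
    define b where "b = (\<lambda>v. cnj ((\<gamma> v + \<i> * \<gamma> (\<i> *s v)) / 2))"
    have g: "\<gamma> = (\<lambda>v. a v + (cnj \<circ> b) v)"
      by (rule ext) (simp add: a_def b_def diff_divide_distrib add_divide_distrib)
    have sc: "\<gamma> (c *s v) = of_real (Re c) * \<gamma> v + of_real (Im c) * \<gamma> (\<i> *s v)" for c v
    proof -
      have "c *s v = Re c *\<^sub>R v + Im c *\<^sub>R (\<i> *s v)"
        by (simp add: Finite_Cartesian_Product.vec_eq_iff complex_eq_iff)
      then show ?thesis
        by (simp only: linear_add[OF lin] linear_scale[OF lin] scaleR_conv_of_real[where 'a = complex])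
    qed
    have sci: "\<gamma> (\<i> *s (c *s v)) = of_real (Re c) * \<gamma> (\<i> *s v) - of_real (Im c) * \<gamma> v" for c v
      using sc[of "\<i> * c" v] by (simp add: vector_smult_assoc)
    have vd: "\<i> *s (u + v) = \<i> *s u + \<i> *s v" for u v :: "complex ^ 'n"
      by (rule vector_add_ldistrib)
    have ca: "covector10 a"
    proof (rule covector10I)
      show "a (u + v) = a u + a v" for u v
        unfolding a_def vd linear_add[OF lin] by (simp add: algebra_simps add_divide_distrib diff_divide_distrib)
      show "a (c *s v) = c * a v" for c v
        unfolding a_def sci sc[of c v] by (simp add: complex_eq_iff algebra_simps)
    qed
    have cb: "covector10 b"
    proof (rule covector10I)
      show "b (u + v) = b u + b v" for u v
        unfolding b_def vd linear_add[OF lin] by (simp add: algebra_simps add_divide_distrib)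
      show "b (c *s v) = c * b v" for c v
        unfolding b_def sci sc[of c v] by (simp add: complex_eq_iff algebra_simps)
    qed
    have 1: "N (altprod ((a # L) @ map (\<lambda>\<beta>. cnj \<circ> \<beta>) M @ \<Gamma>))"
      by (rule Cons.IH) (use Cons.prems ca in auto)
    have 2: "N (altprod (L @ map (\<lambda>\<beta>. cnj \<circ> \<beta>) (M @ [b]) @ \<Gamma>))"
      by (rule Cons.IH) (use Cons.prems cb in auto)
    have "mset ((L @ X) @ a # \<Gamma>) = mset ((a # L) @ X @ \<Gamma>)" for X by simp
    then have "N (altprod ((L @ map (\<lambda>\<beta>. cnj \<circ> \<beta>) M) @ a # \<Gamma>))"
      by (rule covector_subspace_mset[OF N _ 1])
    moreover have "N (altprod ((L @ map (\<lambda>\<beta>. cnj \<circ> \<beta>) M) @ (cnj \<circ> b) # \<Gamma>))"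
      using 2 by simp
    ultimately have "N (\<lambda>vs. altprod ((L @ map (\<lambda>\<beta>. cnj \<circ> \<beta>) M) @ a # \<Gamma>) vs +
        altprod ((L @ map (\<lambda>\<beta>. cnj \<circ> \<beta>) M) @ (cnj \<circ> b) # \<Gamma>) vs)"
      using N unfolding covector_subspace_def by blast
    then have "N (altprod ((L @ map (\<lambda>\<beta>. cnj \<circ> \<beta>) M) @ (\<lambda>v. a v + (cnj \<circ> b) v) # \<Gamma>))"
      unfolding altprod_add[symmetric] .
    then show ?case unfolding g[symmetric] by (simp only: append_assoc)
  qed
  let ?I = "{is. set is \<subseteq> (Basis :: (complex ^ 'n) set) \<and> length is = 2 * m}"
  have "\<eta> = (\<lambda>vs. \<Sum>is\<in>?I. (\<eta> (map (\<lambda>x. x) is) / fact (2 * m)) * altprod (map (\<lambda>e v. of_real (v \<bullet> e)) is) vs)"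
    by (rule ext, rule alt_form_expansion[OF finite_Basis _ assms(4)]) (simp add: euclidean_representation)
  moreover have "N (\<lambda>vs. \<Sum>is\<in>?I. (\<eta> (map (\<lambda>x. x) is) / fact (2 * m)) * altprod (map (\<lambda>e v. of_real (v \<bullet> e)) is) vs)"
  proof (rule covector_subspace_sum[OF N])
    fix "is" assume i: "is \<in> ?I"
    have "linear (\<lambda>v. complex_of_real (v \<bullet> e))" for e :: "complex ^ 'n"
      by (rule linearI) (simp_all add: inner_add_left scaleR_conv_of_real[where 'a = complex])
    then show "N (altprod (map (\<lambda>e v. of_real (v \<bullet> e)) is))"
      using B[of "[]" "[]" "map (\<lambda>e v. complex_of_real (v \<bullet> e)) is"] i by auto
  qed
  ultimately show ?thesis by (simp only:)
qed

section \<open>Charts and forms\<close>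

definition smooth_fun :: "('a, 'n::finite) chart set \<Rightarrow> ('a \<Rightarrow> real) \<Rightarrow> bool" where
  "smooth_fun A f \<longleftrightarrow> (\<forall>c\<in>A. smooth_on (chart_image c) (\<lambda>x. f (chart_inv c x)))"

definition overlap :: "('a, 'n::finite) chart \<Rightarrow> ('b, 'm::finite) chart \<Rightarrow> ('a \<Rightarrow> 'b) \<Rightarrow> (complex ^ 'n) set" where
  "overlap c d f = {x \<in> chart_image c. f (chart_inv c x) \<in> fst d}"

abbreviation jacobian :: "('a, 'n::finite) chart \<Rightarrow> ('b, 'm::finite) chart \<Rightarrow> ('a \<Rightarrow> 'b) \<Rightarrow>
    complex ^ 'n \<Rightarrow> complex ^ 'n \<Rightarrow> complex ^ 'm" where
  "jacobian c d f x \<equiv> frechet_derivative (local_rep c d f) (at x)"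

lemma atlas_chart:
  assumes "complex_atlas A" "c \<in> A"
  shows "open (fst c)" "open (chart_image c)" "continuous_on (fst c) (snd c)"
    "continuous_on (chart_image c) (chart_inv c)"
    "\<And>y. y \<in> fst c \<Longrightarrow> chart_inv c (snd c y) = y" "\<And>x. x \<in> chart_image c \<Longrightarrow> snd c (chart_inv c x) = x"
    "\<And>x. x \<in> chart_image c \<Longrightarrow> chart_inv c x \<in> fst c" "\<And>y. y \<in> fst c \<Longrightarrow> snd c y \<in> chart_image c"
  using assms unfolding complex_atlas_def homeomorphism_def chart_image_def by auto

lemma atlas_cover: "complex_atlas A \<Longrightarrow> \<exists>c\<in>A. y \<in> fst c"
  unfolding complex_atlas_def by blast

lemma open_chart_preimage:
  assumes "complex_atlas A" "c \<in> A" "open U"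
  shows "open {x \<in> chart_image c. chart_inv c x \<in> U}"
proof -
  have "{x \<in> chart_image c. chart_inv c x \<in> U} = chart_image c \<inter> chart_inv c -` U" by auto
  then show ?thesis
    using continuous_open_preimage[OF atlas_chart(4)[OF assms(1,2)] atlas_chart(2)[OF assms(1,2)] assms(3)]
    by simp
qed

lemma chart_domain_image:
  assumes "complex_atlas A" "c \<in> A"
  shows "snd c ` {y \<in> fst c. P y} = {x \<in> chart_image c. P (chart_inv c x)}"
  using atlas_chart(5-8)[OF assms] by (auto simp: image_iff) metis+

lemma overlap_id:
  assumes "complex_atlas A" "c \<in> A"
  shows "overlap c d id = snd c ` (fst c \<inter> fst d)"
  using chart_domain_image[OF assms, of "\<lambda>y. y \<in> fst d"] by (simp add: overlap_def Int_def)

lemma overlap_sub: "overlap c d f \<subseteq> chart_image c" by (auto simp: overlap_def)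

lemma local_rep_overlap:
  assumes "complex_atlas A" "d \<in> A" "x \<in> overlap c d f"
  shows "local_rep c d f x \<in> chart_image d" "chart_inv d (local_rep c d f x) = f (chart_inv c x)"
  using assms atlas_chart(5,8)[OF assms(1,2)] by (auto simp: overlap_def local_rep_def)

lemma trans_holo:
  assumes "complex_atlas A" "c \<in> A" "d \<in> A"
  shows "open (overlap c d id)" "holo_on (overlap c d id) (local_rep c d id)"
proof -
  show "open (overlap c d id)"
    using open_chart_preimage[OF assms(1,2) atlas_chart(1)[OF assms(1,3)]] by (simp add: overlap_def)
  show "holo_on (overlap c d id) (local_rep c d id)"
    using assms unfolding overlap_id[OF assms(1,2)] complex_atlas_def by blast
qed

lemma holo_complex_linear:
  assumes "holo_on S f" "x \<in> S"
  shows "complex_linear (frechet_derivative f (at x))"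
  using holo_on_D[OF assms] linear_add[OF has_derivative_linear] unfolding complex_linear_def by blast

lemma jacobian_compose:
  assumes "local_rep c d f differentiable (at x)" "local_rep d e g differentiable (at (local_rep c d f x))"
    and "open S" "x \<in> S" "\<And>y. y \<in> S \<Longrightarrow> local_rep d e g (local_rep c d f y) = local_rep c e h y"
  shows "jacobian c e h x v = jacobian d e g (local_rep c d f x) (jacobian c d f x v)"
proof -
  have "((local_rep d e g \<circ> local_rep c d f) has_derivative
      (jacobian d e g (local_rep c d f x) \<circ> jacobian c d f x)) (at x)"
    using assms(1,2) by (intro diff_chain_at has_frechet_derivative)
  then have "(local_rep c e h has_derivative (jacobian d e g (local_rep c d f x) \<circ> jacobian c d f x)) (at x)"
    by (rule has_derivative_transform_within_open[OF _ assms(3,4)]) (simp add: assms(5))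
  then show ?thesis using frechet_derivativeI by fastforce
qed

lemma trans_compose:
  assumes "complex_atlas A" "c \<in> A" "d \<in> A" "e \<in> A" "x \<in> overlap c d id" "x \<in> overlap c e id"
  shows "local_rep c d id x \<in> overlap d e id"
    "local_rep d e id (local_rep c d id x) = local_rep c e id x"
    "jacobian c e id x v = jacobian d e id (local_rep c d id x) (jacobian c d id x v)"
proof -
  have i: "local_rep c d id y \<in> overlap d e id" "local_rep d e id (local_rep c d id y) = local_rep c e id y"
    if "y \<in> overlap c d id" "y \<in> overlap c e id" for y
    using that local_rep_overlap[OF assms(1,3) that(1)] by (auto simp: overlap_def local_rep_def)
  show "local_rep c d id x \<in> overlap d e id" "local_rep d e id (local_rep c d id x) = local_rep c e id x"
    using i assms(5,6) by auto
  have d1: "local_rep c d id differentiable (at x)"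
    using holo_on_D(1)[OF trans_holo(2)[OF assms(1-3)] assms(5)] unfolding differentiable_def by blast
  have d2: "local_rep d e id differentiable (at (local_rep c d id x))"
    using holo_on_D(1)[OF trans_holo(2)[OF assms(1,3,4)] i(1)[OF assms(5,6)]] unfolding differentiable_def by blast
  have "open (overlap c d id \<inter> overlap c e id)"
    by (rule open_Int[OF trans_holo(1)[OF assms(1-3)] trans_holo(1)[OF assms(1,2,4)]])
  then show "jacobian c e id x v = jacobian d e id (local_rep c d id x) (jacobian c d id x v)"
    by (rule jacobian_compose[OF d1 d2]) (use i assms(5,6) in auto)
qed

lemma diff_formD:
  assumes "diff_form A k \<eta>" "complex_atlas A" "c \<in> A"
  shows "x \<in> chart_image c \<Longrightarrow> alt_form k (\<eta> c x)"
    "d \<in> A \<Longrightarrow> x \<in> overlap c d id \<Longrightarrow> \<eta> c x vs = \<eta> d (local_rep c d id x) (map (jacobian c d id x) vs)"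
proof -
  show "x \<in> chart_image c \<Longrightarrow> alt_form k (\<eta> c x)" using assms(1,3) unfolding diff_form_def by blast
  assume d: "d \<in> A" and "x \<in> overlap c d id"
  then have "x \<in> snd c ` (fst c \<inter> fst d)" unfolding overlap_id[OF assms(2,3)] by blast
  then show "\<eta> c x vs = \<eta> d (local_rep c d id x) (map (jacobian c d id x) vs)"
    using assms(1,3) d unfolding diff_form_def by blast
qed

lemma on_charts_eqI:
  assumes "on_charts A \<eta> = \<eta>" "on_charts A \<theta> = \<theta>"
    and "\<And>c x vs. c \<in> A \<Longrightarrow> x \<in> chart_image c \<Longrightarrow> \<eta> c x vs = \<theta> c x vs"
  shows "\<eta> = \<theta>"
proof -
  have "on_charts A \<eta> = on_charts A \<theta>" using assms(3) by (auto simp: on_charts_def fun_eq_iff)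
  then show ?thesis using assms(1,2) by simp
qed

lemma on_charts_idem: "on_charts A (on_charts A \<eta>) = on_charts A \<eta>"
  by (auto simp: on_charts_def fun_eq_iff)

lemma on_charts_in: "c \<in> A \<Longrightarrow> x \<in> chart_image c \<Longrightarrow> on_charts A \<eta> c x = \<eta> c x"
  by (simp add: on_charts_def)

lemma on_charts_out: "on_charts A \<eta> = \<eta> \<Longrightarrow> \<not> (c \<in> A \<and> x \<in> chart_image c) \<Longrightarrow> \<eta> c x vs = 0"
  by (metis on_charts_def)

lemma diff_form_on_charts: "diff_form A k \<eta> \<Longrightarrow> on_charts A \<eta> = \<eta>"
  by (simp add: diff_form_def)

lemma diff_formI:
  assumes "complex_atlas A" "on_charts A \<eta> = \<eta>"
    and "\<And>c x. c \<in> A \<Longrightarrow> x \<in> chart_image c \<Longrightarrow> alt_form k (\<eta> c x)"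
    and "\<And>c d x vs. c \<in> A \<Longrightarrow> d \<in> A \<Longrightarrow> x \<in> overlap c d id \<Longrightarrow>
      \<eta> c x vs = \<eta> d (local_rep c d id x) (map (jacobian c d id x) vs)"
  shows "diff_form A k \<eta>"
  unfolding diff_form_def
proof (intro conjI ballI allI)
  fix c d x vs assume c: "c \<in> A" and d: "d \<in> A" and "x \<in> snd c ` (fst c \<inter> fst d)"
  then have "x \<in> overlap c d id" unfolding overlap_id[OF assms(1) c] by blast
  then show "\<eta> c x vs = \<eta> d (local_rep c d id x) (map (jacobian c d id x) vs)" by (rule assms(4)[OF c d])
qed (use assms(2,3) in auto)

text \<open>Smoothness of \<open>\<rho>\<close> is known for fixed arguments, but here the arguments
  move with \<open>x\<close>. Expanding them in a basis of the target puts the motion into smooth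
  scalar coefficients.\<close>

lemma pullback_smooth:
  fixes F :: "complex ^ 'n \<Rightarrow> complex ^ 'm"
  assumes "open S" "open T" "F ` S \<subseteq> T" "smooth_on S F" "\<And>y. y \<in> T \<Longrightarrow> alt_form k (\<rho> y)"
    and "\<And>vs. smooth_on T (\<lambda>y. \<rho> y vs)"
  shows "smooth_on S (\<lambda>x. \<rho> (F x) (map (frechet_derivative F (at x)) vs))"
proof (cases "length vs = k")
  case True
  let ?I = "{is. set is \<subseteq> (Basis :: (complex ^ 'm) set) \<and> length is = k}"
  let ?D = "\<lambda>x. frechet_derivative F (at x)"
  have "smooth_on S (\<lambda>x. \<Sum>is\<in>?I. (\<Prod>i<k. complex_of_real (?D x (vs ! i) \<bullet> (is ! i))) * \<rho> (F x) (map (\<lambda>x. x) is))"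
    by (intro smooth_on_sum[OF assms(1)] smooth_on_mult[OF assms(1)] smooth_on_prod[OF assms(1)]
        smooth_on_of_real[OF assms(1)] smooth_on_linear_comp[OF assms(1) bounded_linear_inner_left]
        smooth_on_D(2)[OF assms(4)] smooth_on_compose[OF assms(1,3,2) assms(6) assms(4)])
  then show ?thesis
  proof (rule smooth_on_cong[OF assms(1), rotated])
    fix x assume "x \<in> S"
    then have "multilin k (\<rho> (F x))" using assms(3,5) alt_form_multilin by blast
    from multilin_expansion[OF finite_Basis _ this, where b = "\<lambda>x. x" and c = "\<lambda>e v. v \<bullet> e" and vs = "map (?D x) vs"]
    show "(\<Sum>is\<in>?I. (\<Prod>i<k. complex_of_real (?D x (vs ! i) \<bullet> (is ! i))) * \<rho> (F x) (map (\<lambda>x. x) is)) =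
        \<rho> (F x) (map (?D x) vs)"
      using True by (simp add: euclidean_representation)
  qed
next
  case False
  have "smooth_on S (\<lambda>x. 0 :: complex)" by (rule smooth_on_const[OF assms(1)])
  then show ?thesis
  proof (rule smooth_on_cong[OF assms(1), rotated])
    fix x assume "x \<in> S"
    then have "F x \<in> T" using assms(3) by blast
    from alt_form_length[OF assms(5)[OF this], of "map (frechet_derivative F (at x)) vs"] False
    show "0 = \<rho> (F x) (map (frechet_derivative F (at x)) vs)" by simp
  qed
qed

subsection \<open>Extension of a compactly supported local form by zero\<close>

text \<open>In the other charts the values are forced by pullback along the transition maps. The
  result always satisfies the transformation rule; smoothness needs in addition that
  \<open>\<rho>\<close> vanish off a compact part of the chart.\<close>

definition ext_form :: "('a, 'n::finite) chart set \<Rightarrow> ('a, 'n) chart \<Rightarrow>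
    (complex ^ 'n \<Rightarrow> (complex ^ 'n) covector) \<Rightarrow> ('a, 'n) form" where
  "ext_form A c \<rho> = (\<lambda>d x vs. if d \<in> A \<and> x \<in> overlap d c id
     then \<rho> (local_rep d c id x) (map (jacobian d c id x) vs) else 0)"

lemma compact_chart_inv:
  fixes A :: "('a::{t2_space, second_countable_topology}, 'n::finite) chart set"
  assumes "complex_atlas A" "c \<in> A" "compact K" "K \<subseteq> chart_image c"
  shows "compact (chart_inv c ` K)"
  using compact_continuous_image[OF continuous_on_subset[OF atlas_chart(4)[OF assms(1,2)] assms(4)] assms(3)] .

lemma ext_form_in: "d \<in> A \<Longrightarrow> x \<in> overlap d c id \<Longrightarrow>
    ext_form A c \<rho> d x = (\<lambda>vs. \<rho> (local_rep d c id x) (map (jacobian d c id x) vs))"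
  by (simp add: ext_form_def)

lemma ext_form_out: "\<not> (d \<in> A \<and> x \<in> overlap d c id) \<Longrightarrow> ext_form A c \<rho> d x = (\<lambda>vs. 0)"
  by (auto simp: ext_form_def)

lemma ext_form_diff_form:
  assumes "complex_atlas A" "c \<in> A" "\<And>x. x \<in> chart_image c \<Longrightarrow> alt_form k (\<rho> x)"
  shows "diff_form A k (ext_form A c \<rho>)"
proof (rule diff_formI[OF assms(1)])
  show "on_charts A (ext_form A c \<rho>) = ext_form A c \<rho>"
    by (auto simp: on_charts_def ext_form_def overlap_def fun_eq_iff)
  fix d x assume d: "d \<in> A" and x: "x \<in> chart_image d"
  show "alt_form k (ext_form A c \<rho> d x)"
  proof (cases "x \<in> overlap d c id")
    case True
    have "linear (jacobian d c id x)"
      by (rule complex_linear_linear[OF holo_complex_linear[OF trans_holo(2)[OF assms(1) d assms(2)] True]])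
    then show ?thesis
      unfolding ext_form_in[OF d True]
      by (intro alt_form_map assms(3) local_rep_overlap(1)[OF assms(1,2) True])
  next
    case False
    then show ?thesis by (simp add: ext_form_out alt_form_zero)
  qed
next
  fix d e x vs assume d: "d \<in> A" "e \<in> A" and x: "x \<in> overlap d e id"
  have o: "local_rep d e id x \<in> overlap e c id \<longleftrightarrow> x \<in> overlap d c id"
    using local_rep_overlap[OF assms(1) d(2) x] x by (auto simp: overlap_def)
  show "ext_form A c \<rho> d x vs = ext_form A c \<rho> e (local_rep d e id x) (map (jacobian d e id x) vs)"
  proof (cases "x \<in> overlap d c id")
    case True
    note t = trans_compose[OF assms(1) d assms(2) x True]
    show ?thesis
      using True o d t(2) by (simp add: ext_form_def t(3)[abs_def] o_def)
  qed (use o d in \<open>simp add: ext_form_def\<close>)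
qed

lemma smooth_on_open_cover2:
  assumes "S = U \<union> V" "smooth_on U f" "smooth_on V f"
  shows "smooth_on S f"
  using assms unfolding smooth_on_def by blast

text \<open>Every chart is the union of two open sets: the overlap with \<open>c\<close>, where the
  form is a pullback, and the complement of the support, where it is zero. The latter is open
  because a compact set in a Hausdorff space is closed.\<close>

lemma ext_form_test_form:
  fixes A :: "('a::{t2_space, second_countable_topology}, 'n::finite) chart set"
  assumes "complex_atlas A" "c \<in> A" "\<And>x. x \<in> chart_image c \<Longrightarrow> alt_form k (\<rho> x)"
    and "\<And>vs. smooth_on (chart_image c) (\<lambda>x. \<rho> x vs)"
    and "compact K" "K \<subseteq> chart_image c" "\<And>x. x \<in> chart_image c - K \<Longrightarrow> \<rho> x = (\<lambda>vs. 0)"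
  shows "test_form A k (ext_form A c \<rho>)" "supported_in A (chart_inv c ` K) (ext_form A c \<rho>)"
proof -
  let ?K = "chart_inv c ` K"
  have K: "compact ?K" by (rule compact_chart_inv[OF assms(1,2,5,6)])
  have zero: "ext_form A c \<rho> d x = (\<lambda>vs. 0)" if "d \<in> A" "x \<in> chart_image d" "chart_inv d x \<notin> ?K" for d x
  proof (cases "x \<in> overlap d c id")
    case True
    note l = local_rep_overlap[OF assms(1,2) True]
    have "local_rep d c id x \<notin> K" using that(3) l(2) by (auto simp: image_iff)
    then show ?thesis using assms(7) l(1) unfolding ext_form_in[OF that(1) True] by simp
  qed (simp add: ext_form_out)
  then show s: "supported_in A ?K (ext_form A c \<rho>)" unfolding supported_in_def by blast
  have sm: "smooth_on (chart_image d) (\<lambda>x. ext_form A c \<rho> d x vs)" if d: "d \<in> A" for d vs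
  proof (rule smooth_on_open_cover2)
    let ?V = "{x \<in> chart_image d. chart_inv d x \<in> - ?K}"
    show "chart_image d = overlap d c id \<union> ?V"
      using atlas_chart(7)[OF assms(1,2)] assms(6) by (auto simp: overlap_def)
    have "open (- ?K)" by (rule open_Compl[OF compact_imp_closed[OF K]])
    then have oV: "open ?V" by (rule open_chart_preimage[OF assms(1) d])
    show "smooth_on ?V (\<lambda>x. ext_form A c \<rho> d x vs)"
      by (rule smooth_on_cong[OF oV _ smooth_on_const[OF oV]]) (use zero[OF d] in auto)
    note h = trans_holo[OF assms(1) d assms(2)]
    have "smooth_on (overlap d c id) (\<lambda>x. \<rho> (local_rep d c id x) (map (jacobian d c id x) vs))"
      by (rule pullback_smooth[OF h(1) atlas_chart(2)[OF assms(1,2)] _ holo_on_smooth[OF h(2,1)] assms(3,4)])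
         (rule image_subsetI, rule local_rep_overlap(1)[OF assms(1,2)])
    then show "smooth_on (overlap d c id) (\<lambda>x. ext_form A c \<rho> d x vs)"
      by (rule smooth_on_cong[OF h(1), rotated]) (simp add: ext_form_in[OF d])
  qed
  have "diff_form A k (ext_form A c \<rho>)" by (rule ext_form_diff_form[OF assms(1,2)], rule assms(3))
  with sm K s show "test_form A k (ext_form A c \<rho>)"
    unfolding test_form_def smooth_form_def by blast
qed

lemma form_eq_ext_form:
  assumes "complex_atlas A" "diff_form A k \<eta>" "c \<in> A" "supported_in A K \<eta>" "K \<subseteq> fst c"
  shows "\<eta> = ext_form A c (\<eta> c)"
proof (intro ext)
  fix d x vs
  show "\<eta> d x vs = ext_form A c (\<eta> c) d x vs"
  proof (cases "d \<in> A \<and> x \<in> chart_image d")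
    case True
    then have d: "d \<in> A" by simp
    show ?thesis
    proof (cases "x \<in> overlap d c id")
      case o: True
      show ?thesis unfolding ext_form_in[OF d o] by (rule diff_formD(2)[OF assms(2,1) d assms(3) o])
    next
      case False
      then have "chart_inv d x \<notin> K" using True assms(5) by (auto simp: overlap_def)
      then show ?thesis using assms(4) True False by (simp add: supported_in_def ext_form_out)
    qed
  next
    case False
    then show ?thesis
      using on_charts_out[OF diff_form_on_charts[OF assms(2)] False]
      by (auto simp: ext_form_def overlap_def)
  qed
qed

subsection \<open>Multiplication by a smooth function and the Leibniz rule\<close>

definition fscale :: "('a, 'n::finite) chart set \<Rightarrow> ('a \<Rightarrow> real) \<Rightarrow> ('a, 'n) form \<Rightarrow> ('a, 'n) form" where
  "fscale A f \<eta> = (\<lambda>c x vs. of_real (f (chart_inv c x)) * \<eta> c x vs)"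

lemma fscale_smooth_form:
  assumes "complex_atlas A" "smooth_fun A f" "smooth_form A k \<eta>"
  shows "smooth_form A k (fscale A f \<eta>)"
proof -
  have df: "diff_form A k \<eta>" using assms(3) by (simp add: smooth_form_def)
  have "diff_form A k (fscale A f \<eta>)"
  proof (rule diff_formI[OF assms(1)])
    show "on_charts A (fscale A f \<eta>) = fscale A f \<eta>"
      using on_charts_out[OF diff_form_on_charts[OF df]] by (auto simp: on_charts_def fscale_def fun_eq_iff)
    show "alt_form k (fscale A f \<eta> c x)" if "c \<in> A" "x \<in> chart_image c" for c x
      using diff_formD(1)[OF df assms(1) that] unfolding fscale_def by (rule alt_form_scale)
    show "fscale A f \<eta> c x vs = fscale A f \<eta> d (local_rep c d id x) (map (jacobian c d id x) vs)"
      if "c \<in> A" "d \<in> A" "x \<in> overlap c d id" for c d x vs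
      using diff_formD(2)[OF df assms(1) that] local_rep_overlap(2)[OF assms(1) that(2,3)]
      by (simp add: fscale_def)
  qed
  moreover have "smooth_on (chart_image c) (\<lambda>x. fscale A f \<eta> c x vs)" if "c \<in> A" for c vs
    unfolding fscale_def using assms(2,3) that atlas_chart(2)[OF assms(1) that]
    by (intro smooth_on_mult smooth_on_of_real) (auto simp: smooth_fun_def smooth_form_def)
  ultimately show ?thesis by (simp add: smooth_form_def)
qed

lemma fscale_supported:
  "supported_in A K \<eta> \<Longrightarrow> supported_in A K (fscale A f \<eta>)"
  "(\<And>y. y \<notin> K \<Longrightarrow> f y = 0) \<Longrightarrow> supported_in A K (fscale A f \<eta>)"
  unfolding supported_in_def fscale_def by auto

text \<open>The product \<open>a \<and> \<beta>\<close> of a 1-covector with a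
  \<open>k\<close>-covector, written as a sum over the slot that \<open>a\<close> takes. This is the
  shape in which it appears when \<open>ext_deriv\<close> meets a product, with no
  factorials.\<close>

definition contract_sum :: "nat \<Rightarrow> ('v \<Rightarrow> complex) \<Rightarrow> 'v covector \<Rightarrow> 'v covector" where
  "contract_sum k a \<beta> vs = (if length vs = Suc k
     then \<Sum>i\<le>k. (- 1) ^ i * a (vs ! i) * \<beta> (take i vs @ drop (Suc i) vs) else 0)"

text \<open>Laplace expansion of the determinant along the row of \<open>a\<close>.\<close>

lemma contract_sum_altprod:
  assumes "length bs = k"
  shows "contract_sum k a (altprod bs) = altprod (a # bs)"
proof
  fix vs :: "'a list"
  show "contract_sum k a (altprod bs) vs = altprod (a # bs) vs"
  proof (cases "length vs = Suc k")
    case True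
    let ?M = "Matrix.mat (Suc k) (Suc k) (\<lambda>(i, j). ((a # bs) ! i) (vs ! j))"
    have "altprod (a # bs) vs = Determinant.det ?M"
      using altprod_det[of vs "a # bs"] True assms by simp
    also have "\<dots> = (\<Sum>j<Suc k. ?M $$ (0, j) * cofactor ?M 0 j)"
      by (rule laplace_expansion_row) auto
    also have "\<dots> = (\<Sum>j\<le>k. (- 1) ^ j * a (vs ! j) * altprod bs (take j vs @ drop (Suc j) vs))"
    proof (intro sum.cong)
      fix j assume "j \<in> {..k}"
      then have j: "j \<le> k" by simp
      let ?us = "take j vs @ drop (Suc j) vs"
      have len: "length ?us = length bs" using True assms j by simp
      have "mat_delete ?M 0 j = Matrix.mat k k (\<lambda>(i, l). (bs ! i) (?us ! l))"
        using True assms j unfolding mat_delete_def by (intro eq_matI) (auto simp: nth_append)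
      then have "cofactor ?M 0 j = (- 1) ^ j * altprod bs ?us"
        unfolding cofactor_def altprod_det[OF len] using assms by simp
      then show "?M $$ (0, j) * cofactor ?M 0 j = (- 1) ^ j * a (vs ! j) * altprod bs ?us"
        using j by simp
    qed auto
    finally show ?thesis using True by (simp add: contract_sum_def)
  qed (use assms in \<open>simp add: contract_sum_def altprod_def\<close>)
qed

lemma contract_sum_alt_form:
  fixes a :: "complex ^ 'n \<Rightarrow> complex"
  assumes "alt_form k \<beta>" "linear a"
  shows "alt_form (Suc k) (contract_sum k a \<beta>)"
proof -
  let ?I = "{is. set is \<subseteq> (Basis :: (complex ^ 'n) set) \<and> length is = k}"
  let ?b = "\<lambda>is. map (\<lambda>e v :: complex ^ 'n. complex_of_real (v \<bullet> e)) is"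
  have e: "\<beta> us = (\<Sum>is\<in>?I. (\<beta> (map (\<lambda>x. x) is) / fact k) * altprod (?b is) us)" for us
    by (rule alt_form_expansion[OF finite_Basis _ assms(1)]) (simp add: euclidean_representation)
  have "contract_sum k a \<beta> vs = (\<Sum>is\<in>?I. (\<beta> (map (\<lambda>x. x) is) / fact k) * altprod (a # ?b is) vs)" for vs
  proof (cases "length vs = Suc k")
    case True
    have "contract_sum k a \<beta> vs = (\<Sum>i\<le>k. \<Sum>is\<in>?I. (\<beta> (map (\<lambda>x. x) is) / fact k) *
        ((- 1) ^ i * a (vs ! i) * altprod (?b is) (take i vs @ drop (Suc i) vs)))"
      using True unfolding contract_sum_def
      by (subst e) (simp add: sum_distrib_left mult.assoc mult.left_commute)
    also have "\<dots> = (\<Sum>is\<in>?I. (\<beta> (map (\<lambda>x. x) is) / fact k) * contract_sum k a (altprod (?b is)) vs)"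
      using True by (subst sum.swap) (simp add: contract_sum_def sum_distrib_left)
    also have "\<dots> = (\<Sum>is\<in>?I. (\<beta> (map (\<lambda>x. x) is) / fact k) * altprod (a # ?b is) vs)"
      by (intro sum.cong refl, subst contract_sum_altprod) auto
    finally show ?thesis .
  next
    case False
    then show ?thesis by (simp add: contract_sum_def altprod_def)
  qed
  moreover have "alt_form (Suc k) (\<lambda>vs. \<Sum>is\<in>?I. (\<beta> (map (\<lambda>x. x) is) / fact k) * altprod (a # ?b is) vs)"
  proof (intro alt_form_sum alt_form_scale)
    fix "is" assume i: "is \<in> ?I"
    have "linear (\<lambda>v. complex_of_real (v \<bullet> e))" for e :: "complex ^ 'n"
      by (rule linearI) (simp_all add: inner_add_left scaleR_conv_of_real[where 'a = complex])
    then have "alt_form (length (a # ?b is)) (altprod (a # ?b is))"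
      by (intro altprod_alt_form) (use assms(2) in auto)
    then show "alt_form (Suc k) (altprod (a # ?b is))" using i by simp
  qed
  ultimately show ?thesis using alt_form_cong[of "Suc k" _ "contract_sum k a \<beta>"] by simp
qed

text \<open>The form \<open>d f \<and> \<beta>\<close>, the error term in the Leibniz rule for
  \<open>d (f \<beta>)\<close>.\<close>

definition dwedge :: "('a, 'n::finite) chart set \<Rightarrow> nat \<Rightarrow> ('a \<Rightarrow> real) \<Rightarrow> ('a, 'n) form \<Rightarrow> ('a, 'n) form" where
  "dwedge A k f \<beta> = on_charts A (\<lambda>c x.
     contract_sum k (\<lambda>v. of_real (frechet_derivative (\<lambda>x. f (chart_inv c x)) (at x) v)) (\<beta> c x))"

lemma smooth_fun_D:
  assumes "smooth_fun A f" "c \<in> A" "x \<in> chart_image c"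
  shows "((\<lambda>x. f (chart_inv c x)) has_derivative frechet_derivative (\<lambda>x. f (chart_inv c x)) (at x)) (at x)"
  using assms smooth_on_D(1) has_frechet_derivative unfolding smooth_fun_def by blast

lemma smooth_fun_trans:
  fixes A :: "('a::{t2_space, second_countable_topology}, 'n::finite) chart set"
  assumes "complex_atlas A" "smooth_fun A f" "c \<in> A" "d \<in> A" "x \<in> overlap c d id"
  shows "frechet_derivative (\<lambda>x. f (chart_inv c x)) (at x) v =
    frechet_derivative (\<lambda>x. f (chart_inv d x)) (at (local_rep c d id x)) (jacobian c d id x v)"
proof -
  note h = trans_holo[OF assms(1,3,4)]
  have "((\<lambda>x. f (chart_inv d x)) \<circ> local_rep c d id has_derivative
      (frechet_derivative (\<lambda>x. f (chart_inv d x)) (at (local_rep c d id x)) \<circ> jacobian c d id x)) (at x)"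
    by (rule diff_chain_at[OF holo_on_D(1)[OF h(2) assms(5)]
        smooth_fun_D[OF assms(2,4) local_rep_overlap(1)[OF assms(1,4,5)]]])
  then have "((\<lambda>x. f (chart_inv c x)) has_derivative
      (frechet_derivative (\<lambda>x. f (chart_inv d x)) (at (local_rep c d id x)) \<circ> jacobian c d id x)) (at x)"
    by (rule has_derivative_transform_within_open[OF _ h(1) assms(5)])
       (simp add: local_rep_overlap(2)[OF assms(1,4)])
  then show ?thesis using frechet_derivativeI by fastforce
qed

lemma dwedge_smooth_form:
  fixes A :: "('a::{t2_space, second_countable_topology}, 'n::finite) chart set"
  assumes "complex_atlas A" "smooth_fun A f" "smooth_form A k \<beta>"
  shows "smooth_form A (Suc k) (dwedge A k f \<beta>)"
proof -
  have df: "diff_form A k \<beta>" using assms(3) by (simp add: smooth_form_def)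
  let ?D = "\<lambda>c x v. complex_of_real (frechet_derivative (\<lambda>x. f (chart_inv c x)) (at x) v)"
  have "diff_form A (Suc k) (dwedge A k f \<beta>)"
  proof (rule diff_formI[OF assms(1)])
    show "on_charts A (dwedge A k f \<beta>) = dwedge A k f \<beta>" by (simp add: dwedge_def on_charts_idem)
    show "alt_form (Suc k) (dwedge A k f \<beta> c x)" if "c \<in> A" "x \<in> chart_image c" for c x
    proof -
      have l: "linear (frechet_derivative (\<lambda>x. f (chart_inv c x)) (at x))"
        by (rule has_derivative_linear[OF smooth_fun_D[OF assms(2) that]])
      have "linear (?D c x)"
        by (rule linearI) (simp_all add: linear_add[OF l] linear_scale[OF l] scaleR_conv_of_real[where 'a = complex])
      then show ?thesis
        unfolding dwedge_def on_charts_in[OF that]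
        by (rule contract_sum_alt_form[OF diff_formD(1)[OF df assms(1) that]])
    qed
    show "dwedge A k f \<beta> c x vs = dwedge A k f \<beta> d (local_rep c d id x) (map (jacobian c d id x) vs)"
      if "c \<in> A" "d \<in> A" "x \<in> overlap c d id" for c d x vs
    proof -
      have x: "x \<in> chart_image c" using that(3) overlap_sub by blast
      have "contract_sum k (?D c x) (\<beta> c x) vs =
          contract_sum k (?D d (local_rep c d id x)) (\<beta> d (local_rep c d id x)) (map (jacobian c d id x) vs)"
        unfolding contract_sum_def
        using smooth_fun_trans[OF assms(1,2) that] diff_formD(2)[OF df assms(1) that]
        by (auto simp: take_map drop_map intro!: sum.cong)
      then show ?thesis
        unfolding dwedge_def on_charts_in[OF that(1) x]
          on_charts_in[OF that(2) local_rep_overlap(1)[OF assms(1) that(2,3)]] .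
    qed
  qed
  moreover have "smooth_on (chart_image c) (\<lambda>x. dwedge A k f \<beta> c x vs)" if c: "c \<in> A" for c vs
  proof -
    note op = atlas_chart(2)[OF assms(1) c]
    have "smooth_on (chart_image c) (\<lambda>x. contract_sum k (?D c x) (\<beta> c x) vs)"
    proof (cases "length vs = Suc k")
      case True
      have "smooth_on (chart_image c) (\<lambda>x. f (chart_inv c x))" using assms(2) c by (simp add: smooth_fun_def)
      note fD = smooth_on_D(2)[OF this]
      have "smooth_on (chart_image c) (\<lambda>x. \<beta> c x us)" for us using assms(3) c by (simp add: smooth_form_def)
      then show ?thesis
        using True unfolding contract_sum_def
        by (auto intro!: smooth_on_sum[OF op] smooth_on_mult[OF op] smooth_on_of_real[OF op] smooth_on_const[OF op] fD)
    next
      case False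
      then show ?thesis by (simp add: contract_sum_def smooth_on_const[OF op])
    qed
    then show ?thesis
      by (rule smooth_on_cong[OF op, rotated]) (simp add: dwedge_def on_charts_in[OF c])
  qed
  ultimately show ?thesis by (simp add: smooth_form_def)
qed

lemma mf_d_fscale:
  fixes A :: "('a::{t2_space, second_countable_topology}, 'n::finite) chart set"
  assumes "complex_atlas A" "smooth_fun A f" "smooth_form A k \<beta>"
  shows "mf_d A k (fscale A f \<beta>) = (\<lambda>c x vs. fscale A f (mf_d A k \<beta>) c x vs + dwedge A k f \<beta> c x vs)"
proof (intro ext)
  fix c x vs
  show "mf_d A k (fscale A f \<beta>) c x vs = fscale A f (mf_d A k \<beta>) c x vs + dwedge A k f \<beta> c x vs"
  proof (cases "c \<in> A \<and> x \<in> chart_image c")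
    case True
    then have cx: "c \<in> A" "x \<in> chart_image c" by auto
    let ?f = "\<lambda>x. f (chart_inv c x)"
    have fd: "frechet_derivative (\<lambda>y. of_real (?f y) * \<beta> c y us) (at x) v =
       of_real (?f x) * frechet_derivative (\<lambda>y. \<beta> c y us) (at x) v + of_real (frechet_derivative ?f (at x) v) * \<beta> c x us" for us v
    proof -
      have "(\<lambda>y. \<beta> c y us) differentiable (at x)"
        using assms(3) cx smooth_on_D(1) unfolding smooth_form_def by blast
      from has_derivative_mult[OF has_derivative_of_real[OF smooth_fun_D[OF assms(2) cx]] has_frechet_derivative[OF this]]
      show ?thesis using frechet_derivativeI by fastforce
    qed
    show ?thesis
      unfolding mf_d_def dwedge_def fscale_def on_charts_in[OF cx] ext_deriv_def contract_sum_def fd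
      by (simp add: sum_distrib_left sum.distrib algebra_simps)
  next
    case False
    then show ?thesis by (auto simp: mf_d_def dwedge_def fscale_def on_charts_def)
  qed
qed

section \<open>Pullback along a local biholomorphism\<close>

lemma rep_compose:
  assumes "complex_atlas C" "d \<in> C" "x \<in> overlap c d f" "x \<in> overlap c e h" "\<And>y. h y = g (f y)"
  shows "local_rep c d f x \<in> overlap d e g" "local_rep d e g (local_rep c d f x) = local_rep c e h x"
  using local_rep_overlap[OF assms(1-3)] assms(4) by (auto simp: overlap_def local_rep_def assms(5))

lemma rep_compose_jacobian:
  assumes "complex_atlas C" "d \<in> C" "x \<in> overlap c d f" "x \<in> overlap c e h" "\<And>y. h y = g (f y)"
    and "open (overlap c d f)" "open (overlap c e h)"
    and "holo_on (overlap c d f) (local_rep c d f)" "holo_on (overlap d e g) (local_rep d e g)"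
  shows "jacobian c e h x v = jacobian d e g (local_rep c d f x) (jacobian c d f x v)"
proof -
  note i = rep_compose[where h = h and g = g and f = f and c = c and d = d and e = e, OF assms(1,2) _ _ assms(5)]
  have d1: "local_rep c d f differentiable (at x)"
    using holo_on_D(1)[OF assms(8,3)] unfolding differentiable_def by blast
  have d2: "local_rep d e g differentiable (at (local_rep c d f x))"
    using holo_on_D(1)[OF assms(9) i(1)[OF assms(3,4)]] unfolding differentiable_def by blast
  show ?thesis
    by (rule jacobian_compose[OF d1 d2 open_Int[OF assms(6,7)]]) (use i assms(3,4) in auto)
qed

lemma jacobian_id:
  assumes "complex_atlas A" "c \<in> A" "x \<in> chart_image c"
  shows "jacobian c c id x v = v"
proof -
  have "frechet_derivative (local_rep c c id) (at x) = frechet_derivative (\<lambda>x. x) (at x)"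
    by (rule frechet_derivative_cong_open[OF atlas_chart(2)[OF assms(1,2)] assms(3)])
       (simp add: local_rep_def atlas_chart(6)[OF assms(1,2)])
  then show ?thesis by (simp add: frechet_derivative_ident)
qed

lemma local_biholomorphism_continuous:
  assumes "local_biholomorphism B A f"
  shows "continuous_on UNIV f"
proof -
  let ?S = "{U. open U \<and> continuous_on U f}"
  have "y \<in> \<Union>?S" for y
  proof -
    obtain U where "y \<in> U" "open U" "continuous_on U f"
      using assms unfolding local_biholomorphism_def holo_map_on_def by meson
    then show ?thesis by blast
  qed
  then have "\<Union>?S = UNIV" by blast
  moreover have "continuous_on (\<Union>?S) f" by (rule continuous_on_open_Union) auto
  ultimately show ?thesis by simp
qed

lemma local_biholomorphism_holo:
  assumes "complex_atlas B" "local_biholomorphism B A f" "c \<in> B" "d \<in> A"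
  shows "holo_on (overlap c d f) (local_rep c d f)"
  unfolding holo_on_def
proof
  fix x assume x: "x \<in> overlap c d f"
  obtain U where U: "chart_inv c x \<in> U" "holo_map_on B U A f"
    using assms(2) unfolding local_biholomorphism_def by meson
  have "holo_on (snd c ` {y \<in> fst c \<inter> U. f y \<in> fst d}) (local_rep c d f)"
    using U(2) assms(3,4) unfolding holo_map_on_def by blast
  moreover have "x \<in> snd c ` {y \<in> fst c \<inter> U. f y \<in> fst d}"
    using x U(1) atlas_chart(6,7)[OF assms(1,3), of x] by (force simp: overlap_def)
  ultimately show "\<exists>D. (local_rep c d f has_derivative D) (at x) \<and> Vector_Spaces.linear (*s) (*s) D"
    unfolding holo_on_def by blast
qed

lemma local_biholomorphism_overlap_open:
  assumes "complex_atlas B" "complex_atlas A" "local_biholomorphism B A f" "c \<in> B" "d \<in> A"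
  shows "open (overlap c d f)"
proof -
  have "open (f -` fst d)"
    by (rule open_vimage[OF atlas_chart(1)[OF assms(2,5)] local_biholomorphism_continuous[OF assms(3)]])
  from open_chart_preimage[OF assms(1,4) this] show ?thesis by (simp add: overlap_def)
qed

text \<open>The chain rule for the holomorphic local inverse \<open>g\<close> exhibits a left
  inverse of the jacobian. Injectivity is what keeps the pulled-back metric definite.\<close>

lemma local_biholomorphism_jacobian_injective:
  assumes "complex_atlas B" "complex_atlas A" "local_biholomorphism B A f" "c \<in> B" "d \<in> A"
    and x: "x \<in> overlap c d f" and "jacobian c d f x v = 0"
  shows "v = 0"
proof -
  obtain U V g where U: "chart_inv c x \<in> U" "open U" and hom: "homeomorphism U V f g" and g: "holo_map_on A V B g"
    using assms(3) unfolding local_biholomorphism_def by meson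
  have gf: "g (f y) = y" and fV: "f y \<in> V" if "y \<in> U" for y
    using hom that unfolding homeomorphism_def by auto
  have cx: "x \<in> chart_image c" "chart_inv c x \<in> fst c" "f (chart_inv c x) \<in> fst d"
    using x atlas_chart(7)[OF assms(1,4)] by (auto simp: overlap_def)
  have "holo_on (snd d ` {z \<in> fst d \<inter> V. g z \<in> fst c}) (local_rep d c g)"
    using g assms(4,5) unfolding holo_map_on_def by blast
  moreover have "local_rep c d f x \<in> snd d ` {z \<in> fst d \<inter> V. g z \<in> fst c}"
    unfolding local_rep_def o_def using cx fV[OF U(1)] gf[OF U(1)] by (intro imageI) simp
  ultimately have h: "local_rep d c g differentiable (at (local_rep c d f x))"
    and h0: "linear (jacobian d c g (local_rep c d f x))"
    using holo_on_D(1) has_derivative_linear unfolding differentiable_def by blast+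
  have f: "local_rep c d f differentiable (at x)"
    using holo_on_D(1)[OF local_biholomorphism_holo[OF assms(1,3-5)] x] unfolding differentiable_def by blast
  let ?S = "overlap c d f \<inter> {x \<in> chart_image c. chart_inv c x \<in> U}"
  have S: "open ?S"
    by (rule open_Int[OF local_biholomorphism_overlap_open[OF assms(1-5)] open_chart_preimage[OF assms(1,4) U(2)]])
  have "jacobian c c id x v = jacobian d c g (local_rep c d f x) (jacobian c d f x v)"
  proof (rule jacobian_compose[OF f h S])
    show "x \<in> ?S" using x U cx by simp
    fix y assume y: "y \<in> ?S"
    then have "chart_inv d (local_rep c d f y) = f (chart_inv c y)"
      using local_rep_overlap(2)[OF assms(2,5)] by blast
    then show "local_rep d c g (local_rep c d f y) = local_rep c c id y"
      using y gf by (simp add: local_rep_def)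
  qed
  then show ?thesis using jacobian_id[OF assms(1,4) cx(1)] assms(7) linear_0[OF h0] by simp
qed

text \<open>\<open>mf_pullback\<close> evaluates in a chart picked by choice. The transformation
  rule of \<open>\<eta>\<close>, together with the chain rule from that chart to \<open>d\<close>,
  shows that any chart gives the same value.\<close>

lemma mf_pullback_apply:
  assumes "complex_atlas B" "complex_atlas A" "local_biholomorphism B A f" "diff_form A k \<eta>" "c \<in> B" "d \<in> A"
    and x: "x \<in> overlap c d f"
  shows "mf_pullback B A f \<eta> c x vs = \<eta> d (local_rep c d f x) (map (jacobian c d f x) vs)"
proof -
  define e where "e = (SOME d. d \<in> A \<and> f (chart_inv c x) \<in> fst d)"
  have cx: "x \<in> chart_image c" using x overlap_sub by blast
  have "e \<in> A \<and> f (chart_inv c x) \<in> fst e"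
    unfolding e_def by (rule someI[of _ d]) (use x assms(6) in \<open>simp add: overlap_def\<close>)
  then have e: "e \<in> A" and xe: "x \<in> overlap c e f" using cx by (auto simp: overlap_def)
  note o = local_biholomorphism_overlap_open[OF assms(1-3,5)]
  note h = local_biholomorphism_holo[OF assms(1,3,5)]
  note r = rep_compose[OF assms(2) e xe x, of id, simplified]
  note j = rep_compose_jacobian[OF assms(2) e xe x _ o[OF e] o[OF assms(6)] h[OF e] trans_holo(2)[OF assms(2) e assms(6)], simplified]
  have "mf_pullback B A f \<eta> c x vs = \<eta> e (local_rep c e f x) (map (jacobian c e f x) vs)"
    using assms(5) cx by (simp add: mf_pullback_def on_charts_def e_def[symmetric] Let_def)
  also have "\<dots> = \<eta> d (local_rep e d id (local_rep c e f x)) (map (jacobian e d id (local_rep c e f x)) (map (jacobian c e f x) vs))"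
    by (rule diff_formD(2)[OF assms(4,2) e assms(6) r(1)])
  also have "\<dots> = \<eta> d (local_rep c d f x) (map (jacobian c d f x) vs)"
    by (simp add: r(2) j[abs_def] o_def)
  finally show ?thesis .
qed

lemma mf_pullback_chart:
  assumes "complex_atlas A" "c \<in> B" "x \<in> chart_image c"
  obtains d where "d \<in> A" "x \<in> overlap c d f"
  using atlas_cover[OF assms(1), of "f (chart_inv c x)"] assms(3) by (auto simp: overlap_def)

lemma mf_pullback_smooth_form:
  assumes "complex_atlas B" "complex_atlas A" "local_biholomorphism B A f" "smooth_form A k \<eta>"
  shows "smooth_form B k (mf_pullback B A f \<eta>)"
proof -
  have df: "diff_form A k \<eta>" using assms(4) by (simp add: smooth_form_def)
  note ap = mf_pullback_apply[OF assms(1-3) df]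
  note o = local_biholomorphism_overlap_open[OF assms(1-3)]
  note h = local_biholomorphism_holo[OF assms(1,3)]
  have "diff_form B k (mf_pullback B A f \<eta>)"
  proof (rule diff_formI[OF assms(1)])
    show "on_charts B (mf_pullback B A f \<eta>) = mf_pullback B A f \<eta>"
      by (simp add: mf_pullback_def on_charts_idem)
    fix c x assume c: "c \<in> B" and cx: "x \<in> chart_image c"
    obtain d where d: "d \<in> A" "x \<in> overlap c d f" by (rule mf_pullback_chart[OF assms(2) c cx])
    have "mf_pullback B A f \<eta> c x = (\<lambda>vs. \<eta> d (local_rep c d f x) (map (jacobian c d f x) vs))"
      by (rule ext, rule ap[OF c d])
    then show "alt_form k (mf_pullback B A f \<eta> c x)"
      using alt_form_map[OF diff_formD(1)[OF df assms(2) d(1) local_rep_overlap(1)[OF assms(2) d]]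
          complex_linear_linear[OF holo_complex_linear[OF h[OF c d(1)] d(2)]]] by simp
  next
    fix c e x vs assume c: "c \<in> B" and e: "e \<in> B" and xe: "x \<in> overlap c e id"
    have cx: "x \<in> chart_image c" using xe overlap_sub by blast
    obtain d where d: "d \<in> A" "x \<in> overlap c d f" by (rule mf_pullback_chart[OF assms(2) c cx])
    note r = rep_compose[OF assms(1) e xe d(2), of f, simplified]
    note j = rep_compose_jacobian[OF assms(1) e xe d(2) _ trans_holo(1)[OF assms(1) c e] o[OF c d(1)]
        trans_holo(2)[OF assms(1) c e] h[OF e d(1)], simplified]
    show "mf_pullback B A f \<eta> c x vs = mf_pullback B A f \<eta> e (local_rep c e id x) (map (jacobian c e id x) vs)"
      unfolding ap[OF c d] ap[OF e d(1) r(1)] by (simp add: r(2) j[abs_def] o_def)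
  qed
  moreover have "smooth_on (chart_image c) (\<lambda>x. mf_pullback B A f \<eta> c x vs)" if c: "c \<in> B" for c vs
  proof (rule smooth_on_local)
    fix x assume cx: "x \<in> chart_image c"
    obtain d where d: "d \<in> A" "x \<in> overlap c d f" by (rule mf_pullback_chart[OF assms(2) c cx])
    have "smooth_on (overlap c d f) (\<lambda>x. \<eta> d (local_rep c d f x) (map (jacobian c d f x) vs))"
    proof (rule pullback_smooth[OF o[OF c d(1)] atlas_chart(2)[OF assms(2) d(1)] _ holo_on_smooth[OF h[OF c d(1)] o[OF c d(1)]]])
      show "local_rep c d f ` overlap c d f \<subseteq> chart_image d"
        by (rule image_subsetI, rule local_rep_overlap(1)[OF assms(2) d(1)])
      show "alt_form k (\<eta> d y)" if "y \<in> chart_image d" for y by (rule diff_formD(1)[OF df assms(2) d(1) that])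
      show "smooth_on (chart_image d) (\<lambda>y. \<eta> d y vs)" for vs using assms(4) d(1) by (simp add: smooth_form_def)
    qed
    then show "\<exists>U g. open U \<and> x \<in> U \<and> smooth_on U g \<and> (\<forall>y\<in>U. mf_pullback B A f \<eta> c y vs = g y)"
      using o[OF c d(1)] d(2) ap[OF c d(1)] by blast
  qed
  ultimately show ?thesis by (simp add: smooth_form_def)
qed

text \<open>The chart chosen by \<open>mf_pullback\<close> depends on the point and on
  \<open>f\<close> but not on the form, so both sides use the same one, and there powers commute
  with substitution of vectors.\<close>

lemma mf_pullback_power:
  assumes "complex_atlas B" "complex_atlas A" "local_biholomorphism B A f"
  shows "mf_pullback B A f (mf_power A 2 m \<omega>) = mf_power B 2 m (mf_pullback B A f \<omega>)"
proof (rule on_charts_eqI)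
  fix c x vs assume c: "c \<in> B" and cx: "x \<in> chart_image c"
  define e where "e = (SOME d. d \<in> A \<and> f (chart_inv c x) \<in> fst d)"
  obtain d where d: "d \<in> A" "x \<in> overlap c d f" by (rule mf_pullback_chart[OF assms(2) c cx])
  have "e \<in> A \<and> f (chart_inv c x) \<in> fst e"
    unfolding e_def by (rule someI[of _ d]) (use d in \<open>simp add: overlap_def\<close>)
  then have e: "e \<in> A" and xe: "x \<in> overlap c e f" using cx by (auto simp: overlap_def)
  have p: "mf_pullback B A f \<eta> c x = (\<lambda>vs. \<eta> e (local_rep c e f x) (map (jacobian c e f x) vs))" for \<eta>
    using c cx by (simp add: mf_pullback_def on_charts_def e_def[symmetric] Let_def)
  show "mf_pullback B A f (mf_power A 2 m \<omega>) c x vs = mf_power B 2 m (mf_pullback B A f \<omega>) c x vs"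
    unfolding mf_power_def on_charts_in[OF c cx] p
      on_charts_in[OF e local_rep_overlap(1)[OF assms(2) e xe]] wedge_power_map ..
qed (simp_all add: mf_pullback_def mf_power_def on_charts_idem)

lemma pos11_map:
  assumes "pos11 w" "complex_linear l" "\<And>v. l v = 0 \<Longrightarrow> v = 0"
  shows "pos11 (\<lambda>vs. w (map l vs))" "metric_of (\<lambda>vs. w (map l vs)) u v = metric_of w (l u) (l v)"
proof -
  have li: "l (\<i> *s v) = \<i> *s l v" for v using assms(2) by (simp add: complex_linear_def)
  show m: "metric_of (\<lambda>vs. w (map l vs)) u v = metric_of w (l u) (l v)" for u v
    by (simp add: metric_of_def li)
  have r: "real11 w" using assms(1) by (simp add: pos11_def)
  have "alt_form 2 (\<lambda>vs. w (map l vs))"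
    by (rule alt_form_map[OF _ complex_linear_linear[OF assms(2)]]) (use r in \<open>simp add: real11_def\<close>)
  then have "real11 (\<lambda>vs. w (map l vs))" using r by (simp add: real11_def li)
  then show "pos11 (\<lambda>vs. w (map l vs))"
    using assms(1,3) unfolding pos11_def m by blast
qed

lemma hermitian_metric_pos11:
  assumes "complex_atlas A" "hermitian_metric A \<omega>" "c \<in> A" "x \<in> chart_image c"
  shows "pos11 (\<omega> c x)"
proof -
  have h: "type_form 1 1 (\<omega> c x)" "\<forall>vs. \<omega> c x vs \<in> \<real>" "\<forall>v. v \<noteq> 0 \<longrightarrow> metric_of (\<omega> c x) v v > 0"
    using assms unfolding hermitian_metric_def by auto
  have "diff_form A 2 \<omega>" using assms(2) by (simp add: hermitian_metric_def smooth_form_def)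
  from diff_formD(1)[OF this assms(1,3,4)] show ?thesis
    unfolding pos11_def real11_def using h type_form_11_invariant[OF h(1)] by blast
qed

lemma pullback_metric:
  assumes "complex_atlas B" "complex_atlas A" "local_biholomorphism B A f" "hermitian_metric A \<omega>" "c \<in> B" "d \<in> A"
    and x: "x \<in> overlap c d f"
  shows "pos11 (mf_pullback B A f \<omega> c x)"
    "metric_of (mf_pullback B A f \<omega> c x) u v =
       metric_of (\<omega> d (local_rep c d f x)) (jacobian c d f x u) (jacobian c d f x v)"
proof -
  have df: "diff_form A 2 \<omega>" using assms(4) by (simp add: hermitian_metric_def smooth_form_def)
  have e: "mf_pullback B A f \<omega> c x = (\<lambda>vs. \<omega> d (local_rep c d f x) (map (jacobian c d f x) vs))"
    by (rule ext, rule mf_pullback_apply[OF assms(1-3) df assms(5-7)])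
  note p = pos11_map[OF hermitian_metric_pos11[OF assms(2,4,6) local_rep_overlap(1)[OF assms(2,6) x]]
      holo_complex_linear[OF local_biholomorphism_holo[OF assms(1,3,5,6)] x]
      local_biholomorphism_jacobian_injective[OF assms(1-3,5,6) x]]
  show "pos11 (mf_pullback B A f \<omega> c x)" unfolding e by (rule p(1))
  show "metric_of (mf_pullback B A f \<omega> c x) u v =
       metric_of (\<omega> d (local_rep c d f x)) (jacobian c d f x u) (jacobian c d f x v)"
    unfolding e by (rule p(2))
qed

text \<open>The minimum of the metric over \<open>K\<close> times the Euclidean unit sphere is
  positive, and homogeneity extends the bound to all vectors. Joint continuity is obtained from the
  basis expansion \<open>ex\<close>, since the coefficients of \<open>w\<close> are only known to
  vary smoothly for fixed arguments.\<close>

lemma uniform_positivity: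
  fixes w :: "complex ^ 'n \<Rightarrow> (complex ^ 'n) covector"
  assumes "compact K" "K \<subseteq> S" "\<And>vs. smooth_on S (\<lambda>y. w y vs)" "\<And>y. y \<in> S \<Longrightarrow> pos11 (w y)"
  obtains c where "c > 0" "\<And>y v. y \<in> K \<Longrightarrow> c * (norm v)\<^sup>2 \<le> metric_of (w y) v v"
proof (cases "K = {}")
  case True
  then show thesis using that[of 1] by simp
next
  case False
  have r: "real11 (w y)" if "y \<in> K" for y using assms(2,4) that by (auto simp: pos11_def)
  have ex: "metric_of (w y) v v = (\<Sum>a\<in>Basis. \<Sum>b\<in>Basis. (v \<bullet> a) * ((v \<bullet> b) * metric_of (w y) a b))" if "y \<in> K" for y v
  proof -
    note l = metric_of_linear[OF r[OF that]]
    have "metric_of (w y) v v = (\<Sum>a\<in>Basis. (v \<bullet> a) *\<^sub>R metric_of (w y) a v)"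
      by (rule linear_euclidean_expansion[OF l(2)])
    also have "\<dots> = (\<Sum>a\<in>Basis. (v \<bullet> a) *\<^sub>R (\<Sum>b\<in>Basis. (v \<bullet> b) *\<^sub>R metric_of (w y) a b))"
      by (intro sum.cong refl, subst linear_euclidean_expansion[OF l(1), where v = v]) simp
    finally show ?thesis by (simp add: sum_distrib_left)
  qed
  let ?P = "K \<times> sphere (0 :: complex ^ 'n) 1"
  have cw: "continuous_on K (\<lambda>y. metric_of (w y) a b)" for a b
    unfolding metric_of_def
    by (rule continuous_on_Re, rule continuous_on_subset[OF smooth_on_continuous[OF assms(3)] assms(2)])
  have "continuous_on ?P (\<lambda>(y, v). \<Sum>a\<in>Basis. \<Sum>b\<in>Basis. (v \<bullet> a) * ((v \<bullet> b) * metric_of (w y) a b))"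
    unfolding split_def
    by (intro continuous_intros continuous_on_compose2[OF cw]) auto
  then have cont: "continuous_on ?P (\<lambda>(y, v). metric_of (w y) v v)"
    by (rule continuous_on_eq) (auto simp: ex)
  have "compact ?P" by (rule compact_Times[OF assms(1)]) simp
  moreover have "sphere (0 :: complex ^ 'n) 1 \<noteq> {}" by simp
  then have "?P \<noteq> {}" using False by simp
  ultimately obtain p where p: "p \<in> ?P" "\<And>q. q \<in> ?P \<Longrightarrow> (\<lambda>(y, v). metric_of (w y) v v) p \<le> (\<lambda>(y, v). metric_of (w y) v v) q"
    using continuous_attains_inf[OF _ _ cont] by blast
  obtain y0 v0 where y0: "p = (y0, v0)" by (cases p)
  have "y0 \<in> S" "v0 \<noteq> 0" using p(1) y0 assms(2) by auto
  then have pos: "0 < metric_of (w y0) v0 v0" using assms(4) by (simp add: pos11_def)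
  show thesis
  proof (rule that[OF pos])
    fix y and v :: "complex ^ 'n" assume y: "y \<in> K"
    show "metric_of (w y0) v0 v0 * (norm v)\<^sup>2 \<le> metric_of (w y) v v"
    proof (cases "v = 0")
      case True
      then show ?thesis using linear_0[OF metric_of_linear(1)[OF r[OF y]]] by simp
    next
      case False
      let ?u = "(1 / norm v) *\<^sub>R v"
      have "metric_of (w y0) v0 v0 \<le> metric_of (w y) ?u ?u"
        using p(2)[of "(y, ?u)"] y y0 False by simp
      also have "\<dots> = metric_of (w y) v v / (norm v)\<^sup>2"
        using linear_scale[OF metric_of_linear(1)[OF r[OF y]]] linear_scale[OF metric_of_linear(2)[OF r[OF y]]]
        by (simp add: power2_eq_square)
      finally show ?thesis using False by (simp add: field_simps)
    qed
  qed
qed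

section \<open>Cutoff functions on the covering space\<close>

text \<open>The function is smooth on \<open>U\<close> and zero on the complement of a set that is
  closed in the whole space, and these two open sets cover. \<open>G\<close> is a chart map of the
  manifold itself or a chart map of the base composed with the covering map.\<close>

lemma smooth_fun_bump:
  fixes A :: "('a::{t2_space, second_countable_topology}, 'n::finite) chart set"
    and G :: "'a \<Rightarrow> complex ^ 'm"
  assumes "complex_atlas A" "open U" "smooth_on UNIV h" "\<And>z. z \<notin> K \<Longrightarrow> h z = 0"
    and "closed {y \<in> U. G y \<in> K}"
    and "\<And>c. c \<in> A \<Longrightarrow> smooth_on {x \<in> chart_image c. chart_inv c x \<in> U} (\<lambda>x. G (chart_inv c x))"
  shows "smooth_fun A (\<lambda>y. if y \<in> U then h (G y) else 0)"
  unfolding smooth_fun_def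
proof
  fix c assume c: "c \<in> A"
  let ?V = "{x \<in> chart_image c. chart_inv c x \<in> - {y \<in> U. G y \<in> K}}"
  let ?U = "{x \<in> chart_image c. chart_inv c x \<in> U}"
  have oU: "open ?U" by (rule open_chart_preimage[OF assms(1) c assms(2)])
  have oV: "open ?V" by (rule open_chart_preimage[OF assms(1) c open_Compl[OF assms(5)]])
  show "smooth_on (chart_image c) (\<lambda>x. if chart_inv c x \<in> U then h (G (chart_inv c x)) else 0)"
  proof (rule smooth_on_open_cover2)
    show "chart_image c = ?U \<union> ?V" by auto
    have "smooth_on ?U (\<lambda>x. h (G (chart_inv c x)))"
      by (rule smooth_on_compose[OF oU _ open_UNIV assms(3) assms(6)[OF c]]) simp
    then show "smooth_on ?U (\<lambda>x. if chart_inv c x \<in> U then h (G (chart_inv c x)) else 0)"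
      by (rule smooth_on_cong[OF oU, rotated]) simp
    show "smooth_on ?V (\<lambda>x. if chart_inv c x \<in> U then h (G (chart_inv c x)) else 0)"
      by (rule smooth_on_cong[OF oV _ smooth_on_const[OF oV]]) (use assms(4) in auto)
  qed
qed

text \<open>Bounds the sum of the differentials on unit vectors, not their maximum, because the
  product rule for \<open>1 - b\<close> over many \<open>b\<close> adds them up. The constant is
  quantified outside \<open>F\<close>, so one constant can serve arbitrarily large sets.\<close>

definition grad_le :: "('a, 'n::finite) chart set \<Rightarrow> ('a, 'n) form \<Rightarrow> ('a \<Rightarrow> real) set \<Rightarrow> real \<Rightarrow> bool" where
  "grad_le B w F C \<longleftrightarrow> (\<forall>c\<in>B. \<forall>x\<in>chart_image c. \<forall>u. metric_of (w c x) u u \<le> 1 \<longrightarrow>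
     (\<Sum>b\<in>F. \<bar>frechet_derivative (\<lambda>x. b (chart_inv c x)) (at x) u\<bar>) \<le> C)"

definition compact_bump :: "('a::topological_space, 'n::finite) chart set \<Rightarrow> ('a \<Rightarrow> real) \<Rightarrow> bool" where
  "compact_bump B b \<longleftrightarrow> smooth_fun B b \<and> (\<exists>K. compact K \<and> (\<forall>y. y \<notin> K \<longrightarrow> b y = 0)) \<and> (\<forall>y. 0 \<le> b y \<and> b y \<le> 1)"

text \<open>On the compact set the metric dominates a multiple \<open>c\<close> of the Euclidean
  square norm, so metric unit vectors have Euclidean length at most
  \<open>1 / sqrt c\<close>.\<close>

lemma smooth_function_derivative_bound:
  fixes h :: "complex ^ 'n \<Rightarrow> real" and w :: "complex ^ 'n \<Rightarrow> (complex ^ 'n) covector"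
  assumes "smooth_on UNIV h" "compact K" "K \<subseteq> S" "\<And>vs. smooth_on S (\<lambda>y. w y vs)" "\<And>y. y \<in> S \<Longrightarrow> pos11 (w y)"
  obtains C where "C \<ge> 0" "\<And>y v. y \<in> K \<Longrightarrow> metric_of (w y) v v \<le> 1 \<Longrightarrow> \<bar>frechet_derivative h (at y) v\<bar> \<le> C"
proof -
  obtain c where c: "c > 0" "\<And>y v. y \<in> K \<Longrightarrow> c * (norm v)\<^sup>2 \<le> metric_of (w y) v v"
    by (rule uniform_positivity[where w = w and S = S, OF assms(2-5)]) (assumption | rule that)+
  let ?D = "\<lambda>y. frechet_derivative h (at y)"
  have "continuous_on K (\<lambda>y. \<Sum>b\<in>Basis. \<bar>?D y b\<bar>)"
    by (intro continuous_intros continuous_on_subset[OF smooth_on_continuous[OF smooth_on_D(2)[OF assms(1)]]]) simp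
  then have "bounded ((\<lambda>y. \<Sum>b\<in>Basis. \<bar>?D y b\<bar>) ` K)"
    by (intro compact_imp_bounded compact_continuous_image assms(2))
  then obtain M where M: "M > 0" "\<And>y. y \<in> K \<Longrightarrow> (\<Sum>b\<in>Basis. \<bar>?D y b\<bar>) \<le> M"
    unfolding bounded_pos by fastforce
  show thesis
  proof (rule that[of "M / sqrt c"])
    fix y v assume y: "y \<in> K" and v: "metric_of (w y) v v \<le> 1"
    have "(norm v)\<^sup>2 \<le> 1 / c" using c(1) order_trans[OF c(2)[OF y] v] by (simp add: field_simps)
    then have n: "norm v \<le> 1 / sqrt c" using real_le_rsqrt by (metis real_sqrt_divide real_sqrt_one)
    have l: "linear (?D y)" using smooth_on_D(1)[OF assms(1)] linear_frechet_derivative by blast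
    have "\<bar>?D y v\<bar> = \<bar>\<Sum>b\<in>Basis. (v \<bullet> b) * ?D y b\<bar>" using linear_euclidean_expansion[OF l, of v] by simp
    also have "\<dots> \<le> (\<Sum>b\<in>Basis. \<bar>(v \<bullet> b) * ?D y b\<bar>)" by (rule sum_abs)
    also have "\<dots> \<le> (\<Sum>b\<in>Basis. norm v * \<bar>?D y b\<bar>)"
      unfolding abs_mult by (intro sum_mono mult_right_mono Basis_le_norm) auto
    also have "\<dots> = norm v * (\<Sum>b\<in>Basis. \<bar>?D y b\<bar>)" by (simp add: sum_distrib_left)
    also have "\<dots> \<le> (1 / sqrt c) * M" using n M(2)[OF y] c(1) by (intro mult_mono) (auto intro: sum_nonneg)
    finally show "\<bar>?D y v\<bar> \<le> M / sqrt c" by simp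
  qed (use M(1) c(1) in simp)
qed

text \<open>One bump on the base is lifted to every sheet over an evenly covered set. With the
  lifted metric the differential upstairs is measured exactly as downstairs, which gives one
  constant for all sheets, and disjointness of the sheets leaves at most one nonzero term in the
  sum. There are countably many sheets because disjoint nonempty open sets in a second countable
  space are countable.\<close>

lemma local_bumps:
  fixes B :: "('y::{t2_space, second_countable_topology}, 'n::finite) chart set"
    and A :: "('x::{t2_space, second_countable_topology}, 'n) chart set"
  assumes B: "complex_atlas B" and A: "complex_atlas A" and lb: "local_biholomorphism B A \<pi>"
    and cov: "covering_space UNIV \<pi> UNIV" and herm: "hermitian_metric A \<omega>"
  shows "\<exists>N \<F> C. open N \<and> p \<in> N \<and> countable \<F> \<and> (\<forall>b\<in>\<F>. compact_bump B b) \<and>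
    (\<forall>y. \<pi> y \<in> N \<longrightarrow> (\<exists>b\<in>\<F>. \<exists>U. open U \<and> y \<in> U \<and> (\<forall>y'\<in>U. b y' = 1))) \<and>
    C \<ge> 0 \<and> (\<forall>F. finite F \<and> F \<subseteq> \<F> \<longrightarrow> grad_le B (mf_pullback B A \<pi> \<omega>) F C)"
proof -
  have cont: "continuous_on UNIV \<pi>" by (rule local_biholomorphism_continuous[OF lb])
  obtain T \<V> where T: "p \<in> T" "open T" "\<Union>\<V> = \<pi> -` T" "\<And>u. u \<in> \<V> \<Longrightarrow> open u" "pairwise disjnt \<V>"
    "\<And>u. u \<in> \<V> \<Longrightarrow> \<exists>q. homeomorphism u T \<pi> q"
    using cov unfolding covering_space_def by auto metis
  obtain d where d: "d \<in> A" "p \<in> fst d" using atlas_cover[OF A] by blast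
  note ch = atlas_chart[OF A d(1)]
  let ?W = "{z \<in> chart_image d. chart_inv d z \<in> T}"
  have "open ?W" by (rule open_chart_preimage[OF A d(1) T(2)])
  moreover have "snd d p \<in> ?W" using T(1) d(2) ch(5,8) by simp
  ultimately obtain h :: "complex ^ 'n \<Rightarrow> real" and K N where h: "smooth_on UNIV h" "\<And>x. 0 \<le> h x" "\<And>x. h x \<le> 1"
    and K: "compact K" "K \<subseteq> ?W" "\<And>x. x \<notin> K \<Longrightarrow> h x = 0"
    and N: "open N" "snd d p \<in> N" "N \<subseteq> ?W" "\<And>x. x \<in> N \<Longrightarrow> h x = 1"
    by (rule smooth_bump) (rule that)
  let ?N = "T \<inter> (fst d \<inter> snd d -` N)"
  have oN: "open ?N" by (intro open_Int T(2) continuous_open_preimage ch N(1))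
  \<comment> \<open>The evenly covered set need not lie in the chart \<open>d\<close>, so a sheet is
    cut down to the part over the chart domain.\<close>
  define U where "U = (\<lambda>u. u \<inter> \<pi> -` fst d)"
  define b where "b = (\<lambda>u y. if y \<in> U u then h (snd d (\<pi> y)) else 0)"
  have oU: "open (U u)" if "u \<in> \<V>" for u
    unfolding U_def by (intro open_Int T(4)[OF that] open_vimage ch(1) cont)
  have cpt: "compact {y \<in> U u. snd d (\<pi> y) \<in> K}" if u: "u \<in> \<V>" for u
  proof -
    obtain q where q: "homeomorphism u T \<pi> q" using T(6)[OF u] by blast
    have "{y \<in> U u. snd d (\<pi> y) \<in> K} = q ` chart_inv d ` K"
    proof (intro equalityI subsetI)
      fix y assume "y \<in> {y \<in> U u. snd d (\<pi> y) \<in> K}"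
      then have y: "y \<in> u" "\<pi> y \<in> fst d" "snd d (\<pi> y) \<in> K" by (auto simp: U_def)
      then have "y = q (chart_inv d (snd d (\<pi> y)))" using ch(5) q by (simp add: homeomorphism_def)
      then show "y \<in> q ` chart_inv d ` K" using y(3) by blast
    next
      fix y assume "y \<in> q ` chart_inv d ` K"
      then obtain k where k: "k \<in> K" "y = q (chart_inv d k)" by blast
      then have "chart_inv d k \<in> T" "chart_inv d k \<in> fst d" "snd d (chart_inv d k) = k" using K(2) ch(6,7) by auto
      moreover from this have "y \<in> u" "\<pi> y = chart_inv d k" using k(2) q by (auto simp: homeomorphism_def)
      ultimately show "y \<in> {y \<in> U u. snd d (\<pi> y) \<in> K}" using k(1) by (simp add: U_def)
    qed
    moreover have "compact (chart_inv d ` K)" by (rule compact_chart_inv[OF A d(1) K(1)]) (use K(2) in blast)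
    moreover have "continuous_on (chart_inv d ` K) q"
      by (rule continuous_on_subset[of T]) (use q K(2) in \<open>auto simp: homeomorphism_def\<close>)
    ultimately show ?thesis by (simp add: compact_continuous_image)
  qed
  have smooth: "smooth_fun B (b u)" if u: "u \<in> \<V>" for u
    unfolding b_def
  proof (rule smooth_fun_bump[OF B oU[OF u] h(1) K(3) compact_imp_closed[OF cpt[OF u]]])
    fix c assume c: "c \<in> B"
    have o: "open (overlap c d \<pi>)" by (rule local_biholomorphism_overlap_open[OF B A lb c d(1)])
    have "smooth_on (overlap c d \<pi>) (local_rep c d \<pi>)"
      by (rule holo_on_smooth[OF local_biholomorphism_holo[OF B lb c d(1)] o])
    then have "smooth_on {x \<in> chart_image c. chart_inv c x \<in> U u} (local_rep c d \<pi>)"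
      by (rule smooth_on_subset) (auto simp: overlap_def U_def)
    then show "smooth_on {x \<in> chart_image c. chart_inv c x \<in> U u} (\<lambda>x. snd d (\<pi> (chart_inv c x)))"
      by (simp only: local_rep_def o_def)
  qed
  have bump: "compact_bump B (b u)" if u: "u \<in> \<V>" for u
    unfolding compact_bump_def
  proof (intro conjI smooth[OF u] exI[of _ "{y \<in> U u. snd d (\<pi> y) \<in> K}"] cpt[OF u] allI impI)
    show "b u y = 0" if "y \<notin> {y \<in> U u. snd d (\<pi> y) \<in> K}" for y using that K(3) by (auto simp: b_def)
    show "0 \<le> b u y" "b u y \<le> 1" for y using h(2,3) by (auto simp: b_def)
  qed
  have cover: "\<exists>f\<in>b ` \<V>. \<exists>U. open U \<and> y \<in> U \<and> (\<forall>y'\<in>U. f y' = 1)" if y: "\<pi> y \<in> ?N" for y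
  proof -
    have "y \<in> \<Union>\<V>" unfolding T(3) using y by simp
    then obtain u where u: "u \<in> \<V>" "y \<in> u" by (rule UnionE)
    have "open (u \<inter> \<pi> -` ?N)" by (intro open_Int T(4)[OF u(1)] open_vimage oN cont)
    moreover have "y \<in> u \<inter> \<pi> -` ?N" using u(2) y by simp
    moreover have "\<forall>y'\<in>u \<inter> \<pi> -` ?N. b u y' = 1" using N(4) by (auto simp: b_def U_def)
    ultimately show ?thesis
      by (intro bexI[of _ "b u"] exI[of _ "u \<inter> \<pi> -` ?N"] conjI imageI u(1))
  qed
  have sm: "smooth_on (chart_image d) (\<lambda>y. \<omega> d y vs)" for vs
    using herm d(1) by (simp add: hermitian_metric_def smooth_form_def)
  have Kd: "K \<subseteq> chart_image d" using K(2) by blast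
  obtain C where C: "C \<ge> 0" "\<And>z v. z \<in> K \<Longrightarrow> metric_of (\<omega> d z) v v \<le> 1 \<Longrightarrow> \<bar>frechet_derivative h (at z) v\<bar> \<le> C"
    by (rule smooth_function_derivative_bound[where w = "\<omega> d", OF h(1) K(1) Kd sm hermitian_metric_pos11[OF A herm d(1)]])
       (assumption | rule that)+
  have grad: "grad_le B (mf_pullback B A \<pi> \<omega>) F C" if F: "finite F" "F \<subseteq> b ` \<V>" for F
    unfolding grad_le_def
  proof (intro ballI allI impI)
    fix c x v assume c: "c \<in> B" and x: "x \<in> chart_image c" and v: "metric_of (mf_pullback B A \<pi> \<omega> c x) v v \<le> 1"
    let ?D = "\<lambda>f. frechet_derivative (\<lambda>x. f (chart_inv c x)) (at x) v"
    let ?y = "chart_inv c x"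
    \<comment> \<open>Off its compact, hence closed, support the lifted bump vanishes on an open
      set, so a nonzero differential places the point in the support and in particular in the
      sheet.\<close>
    have nz: "?y \<in> U u \<and> snd d (\<pi> ?y) \<in> K" if u: "u \<in> \<V>" and "?D (b u) \<noteq> 0" for u
    proof (rule ccontr)
      assume n: "\<not> (?y \<in> U u \<and> snd d (\<pi> ?y) \<in> K)"
      let ?V = "{x \<in> chart_image c. chart_inv c x \<in> - {y \<in> U u. snd d (\<pi> y) \<in> K}}"
      have "open ?V" by (rule open_chart_preimage[OF B c open_Compl[OF compact_imp_closed[OF cpt[OF u]]]])
      then have "frechet_derivative (\<lambda>x. b u (chart_inv c x)) (at x) = frechet_derivative (\<lambda>x. 0) (at x)"
        by (rule frechet_derivative_cong_open) (use x n K(3) in \<open>auto simp: b_def\<close>)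
      then show False using that(2) by (simp add: frechet_derivative_const)
    qed
    have bd: "\<bar>?D (b u)\<bar> \<le> C" if u: "u \<in> \<V>" for u
    proof (cases "?D (b u) = 0")
      case False
      then have n: "?y \<in> U u" "snd d (\<pi> ?y) \<in> K" using nz[OF u] by auto
      have xo: "x \<in> overlap c d \<pi>" using n(1) x by (simp add: overlap_def U_def)
      have z: "local_rep c d \<pi> x \<in> K" using n(2) by (simp add: local_rep_def)
      let ?V = "{x \<in> chart_image c. chart_inv c x \<in> U u}"
      have oV: "open ?V" by (rule open_chart_preimage[OF B c oU[OF u]])
      have "(h \<circ> local_rep c d \<pi> has_derivative frechet_derivative h (at (local_rep c d \<pi> x)) \<circ> jacobian c d \<pi> x) (at x)"
        by (rule diff_chain_at[OF holo_on_D(1)[OF local_biholomorphism_holo[OF B lb c d(1)] xo]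
              has_frechet_derivative[OF smooth_on_D(1)[OF h(1) UNIV_I]]])
      then have "((\<lambda>x. b u (chart_inv c x)) has_derivative
          frechet_derivative h (at (local_rep c d \<pi> x)) \<circ> jacobian c d \<pi> x) (at x)"
        by (rule has_derivative_transform_within_open[OF _ oV]) (use n(1) x in \<open>auto simp: b_def local_rep_def\<close>)
      then have "?D (b u) = frechet_derivative h (at (local_rep c d \<pi> x)) (jacobian c d \<pi> x v)"
        using frechet_derivativeI by fastforce
      moreover have "metric_of (\<omega> d (local_rep c d \<pi> x)) (jacobian c d \<pi> x v) (jacobian c d \<pi> x v) \<le> 1"
        using v unfolding pullback_metric(2)[OF B A lb herm c d(1) xo] .
      ultimately show ?thesis using C(2)[OF z] by simp
    qed (use C(1) in simp)
    show "(\<Sum>f\<in>F. \<bar>?D f\<bar>) \<le> C"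
    proof (cases "\<exists>f\<in>F. ?D f \<noteq> 0")
      case True
      then obtain f where f: "f \<in> F" "?D f \<noteq> 0" by (elim bexE)
      moreover from f(1) F(2) have "f \<in> b ` \<V>" by (rule rev_subsetD)
      ultimately obtain u where u: "u \<in> \<V>" "b u \<in> F" "?D (b u) \<noteq> 0" by auto
      \<comment> \<open>A second function with nonzero differential would place the point in a
        second sheet, contradicting disjointness.\<close>
      have "?D f = 0" if f: "f \<in> F - {b u}" for f
      proof (rule ccontr)
        assume "?D f \<noteq> 0"
        moreover have "f \<in> b ` \<V>" using f F(2) by auto
        then obtain u' where u': "u' \<in> \<V>" "f = b u'" by (elim imageE)
        ultimately have "?y \<in> u \<inter> u'" using nz[OF u(1,3)] nz[OF u'(1)] by (auto simp: U_def)
        then have "\<not> disjnt u u'" by (auto simp: disjnt_def)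
        then have "u = u'" using pairwiseD[OF T(5) u(1) u'(1)] by auto
        then show False using u'(2) f by simp
      qed
      then have "(\<Sum>f\<in>F. \<bar>?D f\<bar>) = \<bar>?D (b u)\<bar>"
        by (subst sum.remove[OF F(1) u(2)]) simp
      then show ?thesis using bd[OF u(1)] by simp
    qed (use C(1) in simp)
  qed
  have "countable \<V>"
    by (rule countable_disjoint_open_subsets[OF T(4) T(5)[folded disjoint_def]]) 
  then have "countable (b ` \<V>)" by (rule countable_image)
  moreover have "p \<in> ?N" using T(1) d(2) N(2) by simp
  moreover have "\<forall>f\<in>b ` \<V>. compact_bump B f" using bump by blast
  ultimately show ?thesis
    by (intro exI[of _ ?N] exI[of _ "b ` \<V>"] exI[of _ C] conjI allI impI oN cover C(1) grad) simp_all
qed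

text \<open>In the product rule each differential is multiplied by factors with values in
  \<open>[0, 1]\<close>, which can only decrease it.\<close>

lemma bump_product:
  fixes B :: "('y::{t2_space, second_countable_topology}, 'n::finite) chart set"
  assumes B: "complex_atlas B" and "finite F" "\<And>b. b \<in> F \<Longrightarrow> compact_bump B b"
  shows "smooth_fun B (\<lambda>y. \<Prod>b\<in>F. 1 - b y) \<and> (\<forall>y. 0 \<le> (\<Prod>b\<in>F. 1 - b y) \<and> (\<Prod>b\<in>F. 1 - b y) \<le> 1) \<and>
    (\<forall>c\<in>B. \<forall>x\<in>chart_image c. \<forall>u. \<bar>frechet_derivative (\<lambda>x. \<Prod>b\<in>F. 1 - b (chart_inv c x)) (at x) u\<bar> \<le>
      (\<Sum>b\<in>F. \<bar>frechet_derivative (\<lambda>x. b (chart_inv c x)) (at x) u\<bar>))"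
  using assms(2,3)
proof (induction F rule: finite_induct)
  case empty
  then show ?case using atlas_chart(2)[OF B] by (auto simp: smooth_fun_def smooth_on_const frechet_derivative_const)
next
  case (insert b F)
  let ?Q = "\<lambda>y. \<Prod>b\<in>F. 1 - b y"
  have Q: "smooth_fun B ?Q" "\<And>y. 0 \<le> ?Q y" "\<And>y. ?Q y \<le> 1"
    and Qd: "\<And>c x u. c \<in> B \<Longrightarrow> x \<in> chart_image c \<Longrightarrow> \<bar>frechet_derivative (\<lambda>x. ?Q (chart_inv c x)) (at x) u\<bar> \<le>
      (\<Sum>b\<in>F. \<bar>frechet_derivative (\<lambda>x. b (chart_inv c x)) (at x) u\<bar>)"
    using insert.IH insert.prems by auto
  have b: "smooth_fun B b" "\<And>y. 0 \<le> b y" "\<And>y. b y \<le> 1"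
    using insert.prems[of b] by (auto simp: compact_bump_def)
  have e: "(\<Prod>b\<in>insert b F. 1 - b y) = (1 - b y) * ?Q y" for y
    using insert.hyps by simp
  have sm: "smooth_fun B (\<lambda>y. (1 - b y) * ?Q y)"
    unfolding smooth_fun_def
  proof
    fix c assume c: "c \<in> B"
    note op = atlas_chart(2)[OF B c]
    have "smooth_on (chart_image c) (\<lambda>x. b (chart_inv c x))" "smooth_on (chart_image c) (\<lambda>x. ?Q (chart_inv c x))"
      using b(1) Q(1) c by (auto simp: smooth_fun_def)
    then show "smooth_on (chart_image c) (\<lambda>x. (1 - b (chart_inv c x)) * ?Q (chart_inv c x))"
      by (intro smooth_on_mult[OF op] smooth_on_diff[OF op] smooth_on_const[OF op])
  qed
  have bd: "0 \<le> (1 - b y) * ?Q y" "(1 - b y) * ?Q y \<le> 1" for y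
    using b(2,3)[of y] Q(2,3)[of y] by (auto intro: mult_le_one)
  have d: "\<bar>frechet_derivative (\<lambda>x. (1 - b (chart_inv c x)) * ?Q (chart_inv c x)) (at x) u\<bar> \<le>
      (\<Sum>b\<in>insert b F. \<bar>frechet_derivative (\<lambda>x. b (chart_inv c x)) (at x) u\<bar>)" if cx: "c \<in> B" "x \<in> chart_image c" for c x u
  proof -
    let ?D = "\<lambda>f. frechet_derivative (\<lambda>x. f (chart_inv c x)) (at x)"
    let ?y = "chart_inv c x"
    have "((\<lambda>x. (1 - b (chart_inv c x)) * ?Q (chart_inv c x)) has_derivative
        (\<lambda>u. (1 - b ?y) * ?D ?Q u + (0 - ?D b u) * ?Q ?y)) (at x)"
      by (intro has_derivative_mult has_derivative_diff has_derivative_const smooth_fun_D[OF b(1) cx] smooth_fun_D[OF Q(1) cx])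
    then have "frechet_derivative (\<lambda>x. (1 - b (chart_inv c x)) * ?Q (chart_inv c x)) (at x) u =
        (1 - b ?y) * ?D ?Q u + (0 - ?D b u) * ?Q ?y"
      by (simp only: frechet_derivativeI)
    also have "\<bar>\<dots>\<bar> \<le> \<bar>(1 - b ?y) * ?D ?Q u\<bar> + \<bar>(0 - ?D b u) * ?Q ?y\<bar>" by (rule abs_triangle_ineq)
    also have "\<dots> \<le> \<bar>?D ?Q u\<bar> + \<bar>?D b u\<bar>"
    proof (rule add_mono)
      show "\<bar>(1 - b ?y) * ?D ?Q u\<bar> \<le> \<bar>?D ?Q u\<bar>"
        unfolding abs_mult using b(2,3)[of ?y] by (intro mult_left_le_one_le) auto
      show "\<bar>(0 - ?D b u) * ?Q ?y\<bar> \<le> \<bar>?D b u\<bar>"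
        unfolding abs_mult using Q(2,3)[of ?y] by (intro order_trans[OF mult_right_le_one_le]) auto
    qed
    also have "\<dots> \<le> (\<Sum>b\<in>insert b F. \<bar>?D b u\<bar>)" using Qd[OF cx, of u] insert.hyps by simp
    finally show ?thesis .
  qed
  show ?case unfolding e using sm bd d by blast
qed

text \<open>The cutoffs are \<open>1 - \<Prod> (1 - b)\<close> over finite parts of a countable
  family of bumps. In contrast to a sum of bumps this stays in \<open>[0, 1]\<close> and equals 1 as
  soon as one factor \<open>b\<close> does. Compactness of the base leaves finitely many evenly
  covered sets, whose constants add up to a bound independent of the number of bumps.\<close>

lemma cutoffs:
  fixes B :: "('y::{t2_space, second_countable_topology}, 'n::finite) chart set"
    and A :: "('x::{t2_space, second_countable_topology}, 'n) chart set"
  assumes B: "complex_atlas B" and A: "complex_atlas A" and lb: "local_biholomorphism B A \<pi>"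
    and cov: "covering_space UNIV \<pi> UNIV" and herm: "hermitian_metric A \<omega>" and cpt: "compact (UNIV :: 'x set)"
  obtains \<psi> :: "nat \<Rightarrow> 'y \<Rightarrow> real" and C where "C \<ge> 0" "\<And>m. compact_bump B (\<psi> m)"
    "\<And>y. \<exists>U M. open U \<and> y \<in> U \<and> (\<forall>m\<ge>M. \<forall>y'\<in>U. \<psi> m y' = 1)"
    "\<And>m. grad_le B (mf_pullback B A \<pi> \<omega>) {\<psi> m} C"
proof -
  let ?w = "mf_pullback B A \<pi> \<omega>"
  define \<Phi> where "\<Phi> = (\<lambda>p N \<F> C. open N \<and> p \<in> N \<and> countable \<F> \<and> (\<forall>b\<in>\<F>. compact_bump B b) \<and>
    (\<forall>y. \<pi> y \<in> N \<longrightarrow> (\<exists>b\<in>\<F>. \<exists>U. open U \<and> y \<in> U \<and> (\<forall>y'\<in>U. b y' = 1))) \<and>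
    C \<ge> 0 \<and> (\<forall>F. finite F \<and> F \<subseteq> \<F> \<longrightarrow> grad_le B ?w F C))"
  have "\<forall>p. \<exists>N \<F> C. \<Phi> p N \<F> C" unfolding \<Phi>_def by (intro allI local_bumps[OF B A lb cov herm])
  then obtain NN FF CC where "\<And>p. \<Phi> p (NN p) (FF p) (CC p)" by metis
  then have N: "\<And>p. open (NN p)" "\<And>p. p \<in> NN p" and cF: "\<And>p. countable (FF p)"
    and bF: "\<And>p b. b \<in> FF p \<Longrightarrow> compact_bump B b"
    and oF: "\<And>p y. \<pi> y \<in> NN p \<Longrightarrow> \<exists>b\<in>FF p. \<exists>U. open U \<and> y \<in> U \<and> (\<forall>y'\<in>U. b y' = 1)"
    and C0: "\<And>p. CC p \<ge> 0" and gF: "\<And>p F. finite F \<Longrightarrow> F \<subseteq> FF p \<Longrightarrow> grad_le B ?w F (CC p)"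
    unfolding \<Phi>_def by auto
  have "UNIV \<subseteq> (\<Union>p\<in>UNIV. NN p)" using N(2) by auto
  from compactE_image[OF cpt N(1) this] obtain P where P: "finite P" "UNIV \<subseteq> (\<Union>p\<in>P. NN p)" by metis
  define \<F> where "\<F> = (\<Union>p\<in>P. FF p)"
  have cnt: "countable \<F>" unfolding \<F>_def using P(1) cF by (simp add: countable_finite)
  have one: "\<exists>b\<in>\<F>. \<exists>U. open U \<and> y \<in> U \<and> (\<forall>y'\<in>U. b y' = 1)" for y
  proof -
    have "\<pi> y \<in> (\<Union>p\<in>P. NN p)" using P(2) by blast
    then obtain p where "p \<in> P" "\<pi> y \<in> NN p" by blast
    with oF[OF this(2)] show ?thesis unfolding \<F>_def by blast
  qed
  then have ne: "\<F> \<noteq> {}" by blast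
  have bump: "compact_bump B b" if "b \<in> \<F>" for b using that bF unfolding \<F>_def by blast
  have grad: "grad_le B ?w F (\<Sum>p\<in>P. CC p)" if F: "finite F" "F \<subseteq> \<F>" for F
    unfolding grad_le_def
  proof (intro ballI allI impI)
    fix c x u assume cx: "c \<in> B" "x \<in> chart_image c" and u: "metric_of (?w c x) u u \<le> 1"
    let ?g = "\<lambda>b. \<bar>frechet_derivative (\<lambda>x. b (chart_inv c x)) (at x) u\<bar>"
    \<comment> \<open>The families of different base points may overlap. The induction removes one
      family at a time, and each bump is charged to the family with which it is removed.\<close>
    have "(\<Sum>b\<in>F. ?g b) \<le> (\<Sum>p\<in>P. CC p)" if "finite F" "F \<subseteq> (\<Union>p\<in>P. FF p)" for F
      using P(1) that
    proof (induction P arbitrary: F rule: finite_induct)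
      case empty
      then show ?case by simp
    next
      case (insert p P)
      have "(\<Sum>b\<in>F. ?g b) = (\<Sum>b\<in>F \<inter> FF p. ?g b) + (\<Sum>b\<in>F - FF p. ?g b)"
        by (rule sum.Int_Diff[OF insert.prems(1)])
      also have "(\<Sum>b\<in>F \<inter> FF p. ?g b) \<le> CC p"
        using gF[of "F \<inter> FF p" p] insert.prems(1) cx u by (auto simp: grad_le_def)
      also have "(\<Sum>b\<in>F - FF p. ?g b) \<le> (\<Sum>p\<in>P. CC p)"
        using insert.prems by (intro insert.IH) auto
      finally show ?case using insert.hyps by simp
    qed
    from this[OF F[unfolded \<F>_def]] show "(\<Sum>b\<in>F. ?g b) \<le> (\<Sum>p\<in>P. CC p)" .
  qed
  \<comment> \<open>The first \<open>m\<close> members of an enumeration, taken as a set so that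
    repetitions in the enumeration do not matter.\<close>
  define F where "F = (\<lambda>m. from_nat_into \<F> ` {..<m})"
  have Ff: "finite (F m)" and Fs: "F m \<subseteq> \<F>" for m
    using from_nat_into[OF ne] by (auto simp: F_def)
  have bp: "smooth_fun B (\<lambda>y. \<Prod>b\<in>F m. 1 - b y) \<and> (\<forall>y. 0 \<le> (\<Prod>b\<in>F m. 1 - b y) \<and> (\<Prod>b\<in>F m. 1 - b y) \<le> 1) \<and>
    (\<forall>c\<in>B. \<forall>x\<in>chart_image c. \<forall>u. \<bar>frechet_derivative (\<lambda>x. \<Prod>b\<in>F m. 1 - b (chart_inv c x)) (at x) u\<bar> \<le>
      (\<Sum>b\<in>F m. \<bar>frechet_derivative (\<lambda>x. b (chart_inv c x)) (at x) u\<bar>))" for m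
    by (rule bump_product[OF B Ff]) (rule bump, rule subsetD[OF Fs])
  let ?\<psi> = "\<lambda>m y. 1 - (\<Prod>b\<in>F m. 1 - b y)"
  show thesis
  proof (rule that[of "\<Sum>p\<in>P. CC p" ?\<psi>])
    show "0 \<le> (\<Sum>p\<in>P. CC p)" using C0 by (simp add: sum_nonneg)
    show "compact_bump B (?\<psi> m)" for m
      unfolding compact_bump_def
    proof (intro conjI allI)
      show "smooth_fun B (?\<psi> m)"
        using bp[of m] atlas_chart(2)[OF B] by (auto simp: smooth_fun_def intro!: smooth_on_diff smooth_on_const)
      show "0 \<le> ?\<psi> m y" "?\<psi> m y \<le> 1" for y using bp[of m] by auto
      have "\<exists>K. compact K \<and> (\<forall>y. y \<notin> K \<longrightarrow> b y = 0)" if "b \<in> F m" for b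
        using bump[OF subsetD[OF Fs that]] by (auto simp: compact_bump_def)
      then obtain K where K: "\<And>b. b \<in> F m \<Longrightarrow> compact (K b)" "\<And>b y. b \<in> F m \<Longrightarrow> y \<notin> K b \<Longrightarrow> b y = 0" by metis
      have "compact (\<Union>b\<in>F m. K b)" using Ff K(1) by (intro compact_UN) auto
      moreover have "?\<psi> m y = 0" if "y \<notin> (\<Union>b\<in>F m. K b)" for y
      proof -
        have "(\<Prod>b\<in>F m. 1 - b y) = (\<Prod>b\<in>F m. 1)"
          by (intro prod.cong refl) (use K(2) that in auto)
        then show ?thesis by simp
      qed
      ultimately show "\<exists>K. compact K \<and> (\<forall>y. y \<notin> K \<longrightarrow> ?\<psi> m y = 0)" by blast
    qed
    show "\<exists>U M. open U \<and> y \<in> U \<and> (\<forall>m\<ge>M. \<forall>y'\<in>U. ?\<psi> m y' = 1)" for y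
    proof -
      obtain b U where b: "b \<in> \<F>" "open U" "y \<in> U" "\<forall>y'\<in>U. b y' = 1" using one[of y] by blast
      obtain j where j: "b = from_nat_into \<F> j" using b(1) from_nat_into_surj[OF cnt] by metis
      have "?\<psi> m y' = 1" if "m \<ge> Suc j" "y' \<in> U" for m y'
      proof -
        have "b \<in> F m" unfolding F_def j using that(1) by (intro imageI) simp
        moreover have "1 - b y' = 0" using b(4) that(2) by simp
        ultimately have "(\<Prod>b\<in>F m. 1 - b y') = 0" using Ff by (metis (mono_tags, lifting) prod_zero_iff)
        then show ?thesis by simp
      qed
      then show ?thesis using b(2,3) by blast
    qed
    show "grad_le B ?w {?\<psi> m} (\<Sum>p\<in>P. CC p)" for m
      unfolding grad_le_def
    proof (intro ballI allI impI)
      fix c x u assume cx: "c \<in> B" "x \<in> chart_image c" and u: "metric_of (?w c x) u u \<le> 1"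
      let ?Q = "\<lambda>x. \<Prod>b\<in>F m. 1 - b (chart_inv c x)"
      have sQ: "smooth_fun B (\<lambda>y. \<Prod>b\<in>F m. 1 - b y)" using bp[of m] by blast
      have "((\<lambda>x. 1 - ?Q x) has_derivative (\<lambda>v. 0 - frechet_derivative ?Q (at x) v)) (at x)"
        by (intro has_derivative_diff has_derivative_const smooth_fun_D[OF sQ cx])
      then have "frechet_derivative (\<lambda>x. 1 - ?Q x) (at x) u = - frechet_derivative ?Q (at x) u"
        by (simp add: frechet_derivativeI)
      moreover have "\<bar>frechet_derivative ?Q (at x) u\<bar> \<le> (\<Sum>b\<in>F m. \<bar>frechet_derivative (\<lambda>x. b (chart_inv c x)) (at x) u\<bar>)"
        using bp[of m] cx by blast
      moreover have "\<dots> \<le> (\<Sum>p\<in>P. CC p)" using grad[OF Ff Fs, of m] cx u by (auto simp: grad_le_def)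
      ultimately show "(\<Sum>b\<in>{?\<psi> m}. \<bar>frechet_derivative (\<lambda>x. b (chart_inv c x)) (at x) u\<bar>) \<le> (\<Sum>p\<in>P. CC p)"
        by simp
    qed
  qed
qed

section \<open>Integration\<close>

text \<open>Second countability enters through Lindelof's theorem and makes the choice in
  \<open>chart_seq\<close> meaningful. A sequence of charts may repeat itself; the cell of a
  repeated chart is empty.\<close>

lemma chart_seq:
  fixes A :: "('a::{t2_space, second_countable_topology}, 'n::finite) chart set"
  assumes "complex_atlas A"
  shows "chart_seq A i \<in> A" "(\<Union>i. fst (chart_seq A i)) = UNIV"
proof -
  have "\<exists>cs :: nat \<Rightarrow> ('a, 'n) chart. range cs \<subseteq> A \<and> (\<Union>i. fst (cs i)) = UNIV"
  proof -
    obtain \<F>' where f: "\<F>' \<subseteq> fst ` A" "countable \<F>'" "\<Union>\<F>' = \<Union>(fst ` A)"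
      by (rule Lindelof[of "fst ` A"]) (use atlas_chart(1)[OF assms] in auto)
    obtain A' where A': "A' \<subseteq> A" "countable A'" "\<F>' = fst ` A'"
      using countable_image_eq_inj f(1,2) countable_subset_image[of \<F>' fst A] by auto
    have "\<Union>(fst ` A) = UNIV" using assms unfolding complex_atlas_def by blast
    then have u: "(\<Union>c\<in>A'. fst c) = UNIV" using f(3) A'(3) by simp
    then have ne: "A' \<noteq> {}" by auto
    have "range (from_nat_into A') = A'" by (rule range_from_nat_into[OF ne A'(2)])
    then have "range (from_nat_into A') \<subseteq> A \<and> (\<Union>i. fst (from_nat_into A' i)) = UNIV"
      using A'(1) u by (metis image_image)
    then show ?thesis by blast
  qed
  then have "range (chart_seq A) \<subseteq> A \<and> (\<Union>i. fst (chart_seq A i)) = UNIV"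
    unfolding chart_seq_def by (rule someI_ex)
  then show "chart_seq A i \<in> A" "(\<Union>i. fst (chart_seq A i)) = UNIV" by auto
qed

lemma cell_measurable:
  fixes A :: "('a::{t2_space, second_countable_topology}, 'n::finite) chart set"
  assumes "complex_atlas A"
  shows "cell A i \<subseteq> chart_image (chart_seq A i)" "cell A i \<in> sets lebesgue"
proof -
  let ?c = "chart_seq A i"
  note c = chart_seq(1)[OF assms, of i]
  let ?O = "\<Union>j<i. fst (chart_seq A j)"
  show "cell A i \<subseteq> chart_image ?c" by (auto simp: cell_def chart_image_def)
  have "cell A i = {x \<in> chart_image ?c. chart_inv ?c x \<notin> ?O}"
    unfolding cell_def set_diff_eq by (rule chart_domain_image[OF assms c])
  also have "\<dots> = chart_image ?c - {x \<in> chart_image ?c. chart_inv ?c x \<in> ?O}" by auto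
  also have "\<dots> \<in> sets borel"
    using atlas_chart(2)[OF assms c] open_chart_preimage[OF assms c, of ?O] atlas_chart(1)[OF assms chart_seq(1)[OF assms]]
    by (intro sets.Diff borel_open) auto
  finally show "cell A i \<in> sets lebesgue" by (simp add: sets_completionI_sets)
qed

lemma ennreal_norm_suminf_le:
  fixes a :: "nat \<Rightarrow> complex"
  assumes "\<And>i. ennreal (norm (a i)) \<le> J i" "(\<Sum>i. J i) < \<infinity>"
  shows "ennreal (norm (suminf a)) \<le> (\<Sum>i. J i)"
proof -
  have le: "(\<Sum>i. ennreal (norm (a i))) \<le> (\<Sum>i. J i)" by (intro suminf_le assms(1) summableI)
  then have "(\<Sum>i. ennreal (norm (a i))) < \<infinity>" using assms(2) by (rule le_less_trans)
  then have s: "summable (\<lambda>i. norm (a i))"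
    by (intro summable_suminf_not_top) (auto simp: infinity_ennreal_def less_top)
  have "ennreal (norm (suminf a)) \<le> ennreal (\<Sum>i. norm (a i))" by (intro ennreal_leI summable_norm s)
  also have "\<dots> = (\<Sum>i. ennreal (norm (a i)))" by (rule suminf_ennreal2[symmetric]) (use s in auto)
  finally show ?thesis using le by (rule order_trans)
qed

lemma norm_set_integral_le_nn_integral:
  fixes g :: "'a::euclidean_space \<Rightarrow> complex"
  shows "ennreal (norm (set_lebesgue_integral lebesgue S g)) \<le> (\<integral>\<^sup>+x. ennreal (norm (g x)) * indicator S x \<partial>lebesgue)"
proof (cases "set_integrable lebesgue S g")
  case True
  have "ennreal (norm (set_lebesgue_integral lebesgue S g)) \<le> (\<integral>\<^sup>+x. ennreal (norm (indicat_real S x *\<^sub>R g x)) \<partial>lebesgue)"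
    using integral_norm_bound_ennreal[of lebesgue "\<lambda>x. indicat_real S x *\<^sub>R g x"] True
    by (simp add: set_lebesgue_integral_def set_integrable_def)
  also have "\<dots> = (\<integral>\<^sup>+x. ennreal (norm (g x)) * indicator S x \<partial>lebesgue)"
    by (intro nn_integral_cong) (simp split: split_indicator)
  finally show ?thesis .
next
  case False
  \<comment> \<open>A function that is not integrable has integral 0 by convention, so the bound is
    trivial.\<close>
  then have "set_lebesgue_integral lebesgue S g = 0"
    by (simp add: set_lebesgue_integral_def set_integrable_def not_integrable_integral_eq)
  then show ?thesis by simp
qed

text \<open>The integrand of the \<open>L\<^sup>1\<close> norm need not be measurable, so its integral is only a lower integral.
  The dominating function is therefore the supremum of the measurable integrands themselves.\<close>

lemma mf_integral_dominated_tendsto_0: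
  fixes A :: "('a::{t2_space, second_countable_topology}, 'n::finite) chart set"
    and \<mu> :: "nat \<Rightarrow> ('a, 'n) form" and t :: "nat \<Rightarrow> complex ^ 'n \<Rightarrow> real"
  assumes A: "complex_atlas A" and C: "C > 0"
    and meas: "\<And>m i. (\<lambda>x. \<mu> m (chart_seq A i) x standard_frame) \<in> borel_measurable lebesgue"
    and bound: "\<And>m i x. x \<in> cell A i \<Longrightarrow> cmod (\<mu> m (chart_seq A i) x standard_frame) \<le> C * t i x"
    and lim: "\<And>i x. x \<in> cell A i \<Longrightarrow> \<exists>M. \<forall>m\<ge>M. \<mu> m (chart_seq A i) x standard_frame = 0"
    and fin: "(\<Sum>i. \<integral>\<^sup>+x. ennreal (t i x) * indicator (cell A i) x \<partial>lebesgue) < \<infinity>"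
  shows "(\<lambda>m. mf_integral A (\<mu> m)) \<longlonglongrightarrow> 0"
proof -
  let ?L = "\<lambda>i. \<integral>\<^sup>+x. ennreal (t i x) * indicator (cell A i) x \<partial>lebesgue"
  define g where "g = (\<lambda>m i x. \<mu> m (chart_seq A i) x standard_frame)"
  \<comment> \<open>The measurable integrands, divided by \<open>C\<close> so that they lie below
    \<open>t\<close> itself.\<close>
  define u where "u = (\<lambda>m i x. ennreal (norm (g m i x / of_real C)) * indicator (cell A i) x)"
  have um: "u m i \<in> borel_measurable lebesgue" for m i
    unfolding u_def g_def using meas[of m i] cell_measurable(2)[OF A, of i] by measurable
  have ub: "u m i x \<le> ennreal (t i x) * indicator (cell A i) x" for m i x
    unfolding u_def using bound[of x i m] C
    by (auto simp: g_def norm_divide field_simps split: split_indicator intro!: ennreal_leI)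
  have Li: "?L i < \<infinity>" for i
    by (rule ennreal_suminf_lessD[OF fin])
  have "(\<lambda>m. \<integral>\<^sup>+x. u m i x \<partial>lebesgue) \<longlonglongrightarrow> (\<integral>\<^sup>+(x :: complex ^ 'n). 0 \<partial>lebesgue)" for i
  proof (rule nn_integral_dominated_convergence[where w = "\<lambda>x. SUP m. u m i x"])
    show "(\<lambda>x. SUP m. u m i x) \<in> borel_measurable lebesgue" using um by (intro borel_measurable_SUP) auto
    have "(\<integral>\<^sup>+x. (SUP m. u m i x) \<partial>lebesgue) \<le> ?L i"
      by (intro nn_integral_mono SUP_least ub)
    then show "(\<integral>\<^sup>+x. (SUP m. u m i x) \<partial>lebesgue) < \<infinity>" using Li by (rule le_less_trans)
    show "AE x in lebesgue. (\<lambda>m. u m i x) \<longlonglongrightarrow> 0"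
    proof (rule AE_I2)
      fix x
      show "(\<lambda>m. u m i x) \<longlonglongrightarrow> 0"
      proof (cases "x \<in> cell A i")
        case True
        then obtain M where "\<forall>m\<ge>M. g m i x = 0" using lim unfolding g_def by blast
        then have "eventually (\<lambda>m. u m i x = 0) sequentially"
          unfolding eventually_sequentially by (intro exI[of _ M]) (simp add: u_def)
        then show ?thesis by (rule tendsto_eventually)
      qed (simp add: u_def)
    qed
  qed (use um in \<open>auto intro!: AE_I2 SUP_upper\<close>)
  then have ui: "(\<lambda>m. \<integral>\<^sup>+x. u m i x \<partial>lebesgue) \<longlonglongrightarrow> 0" for i by simp
  \<comment> \<open>The sum over cells is an integral against counting measure, and dominated
    convergence is applied a second time with the integrals of \<open>t\<close> as majorant.\<close>
  have "(\<lambda>m. \<integral>\<^sup>+i. (\<integral>\<^sup>+x. u m i x \<partial>lebesgue) \<partial>count_space UNIV) \<longlonglongrightarrow> (\<integral>\<^sup>+i. 0 \<partial>count_space (UNIV :: nat set))"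
    by (rule nn_integral_dominated_convergence[where w = ?L])
       (use fin ui in \<open>auto simp: nn_integral_count_space_nat intro!: AE_I2 nn_integral_mono ub\<close>)
  then have S: "(\<lambda>m. \<Sum>i. \<integral>\<^sup>+x. u m i x \<partial>lebesgue) \<longlonglongrightarrow> 0" by (simp add: nn_integral_count_space_nat)
  have le: "ennreal (norm (mf_integral A (\<mu> m) / of_real C)) \<le> (\<Sum>i. \<integral>\<^sup>+x. u m i x \<partial>lebesgue)" for m
  proof -
    let ?a = "\<lambda>i. set_lebesgue_integral lebesgue (cell A i) (\<lambda>x. g m i x / of_real C)"
    have Jf: "(\<Sum>i. \<integral>\<^sup>+x. u m i x \<partial>lebesgue) < \<infinity>"
      by (rule le_less_trans[OF suminf_le fin]) (auto intro!: nn_integral_mono ub summableI)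
    have J: "ennreal (norm (?a i)) \<le> (\<integral>\<^sup>+x. u m i x \<partial>lebesgue)" for i
      unfolding u_def by (rule norm_set_integral_le_nn_integral)
    have a: "?a i = set_lebesgue_integral lebesgue (cell A i) (g m i) / of_real C" for i
      by (simp add: set_lebesgue_integral_def)
    have "(\<Sum>i. ennreal (norm (?a i))) \<le> (\<Sum>i. \<integral>\<^sup>+x. u m i x \<partial>lebesgue)" by (intro suminf_le J summableI)
    then have "(\<Sum>i. ennreal (norm (?a i))) < \<infinity>" using Jf by (rule le_less_trans)
    then have "summable (\<lambda>i. norm (?a i))"
      by (intro summable_suminf_not_top) (auto simp: infinity_ennreal_def less_top)
    then have sa: "summable ?a" by (rule summable_norm_cancel)
    have "mf_integral A (\<mu> m) = (\<Sum>i. of_real C * ?a i)"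
      unfolding mf_integral_def a using C by (simp add: g_def)
    also have "\<dots> = of_real C * suminf ?a" by (rule suminf_mult[OF sa])
    finally have "mf_integral A (\<mu> m) / of_real C = suminf ?a" using C by simp
    then show ?thesis using ennreal_norm_suminf_le[of ?a, OF J Jf] by simp
  qed
  have "(\<lambda>m. ennreal (norm (mf_integral A (\<mu> m) / of_real C))) \<longlonglongrightarrow> 0"
    by (rule tendsto_sandwich[OF _ _ tendsto_const S]) (use le in auto)
  then have "(\<lambda>m. norm (mf_integral A (\<mu> m) / of_real C)) \<longlonglongrightarrow> 0"
    by (simp add: tendsto_ennreal_iff[where x = 0, simplified, symmetric])
  then have "(\<lambda>m. mf_integral A (\<mu> m) / of_real C) \<longlonglongrightarrow> 0" by (rule tendsto_norm_zero_cancel)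
  from tendsto_mult[OF tendsto_const[of "of_real C"] this] show ?thesis using C by simp
qed

section \<open>Smoothness and measurability of wedge products\<close>

lemma wedge_smooth:
  assumes "open S" "\<And>us. smooth_on S (\<lambda>x. \<alpha> x us)" "\<And>us. smooth_on S (\<lambda>x. \<beta> x us)"
  shows "smooth_on S (\<lambda>x. wedge p q (\<alpha> x) (\<beta> x) vs)"
proof (cases "length vs = p + q")
  case True
  have "smooth_on S (\<lambda>x. (1 / (fact p * fact q)) * (\<Sum>\<sigma> | \<sigma> permutes {..<p + q}.
           of_int (sign \<sigma>) * \<alpha> x (take p (permute_list \<sigma> vs)) * \<beta> x (drop p (permute_list \<sigma> vs))))"
    by (intro smooth_on_mult[OF assms(1)] smooth_on_const[OF assms(1)] smooth_on_sum[OF assms(1)] assms(2,3))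
  then show ?thesis using True by (simp add: wedge_def)
next
  case False
  then show ?thesis by (simp add: wedge_def smooth_on_const[OF assms(1)])
qed

lemma wedge_power_smooth:
  assumes "open S" "\<And>us. smooth_on S (\<lambda>x. \<alpha> x us)"
  shows "smooth_on S (\<lambda>x. wedge_power k m (\<alpha> x) vs)"
proof (induction m arbitrary: vs)
  case 0
  then show ?case by (simp add: wedge_power_def smooth_on_const[OF assms(1)])
next
  case (Suc m)
  have "smooth_on S (\<lambda>x. wedges k (replicate m (\<alpha> x)) us)" for us
    using Suc[of us] by (simp add: wedge_power_def)
  from wedge_smooth[OF assms(1) assms(2) this] show ?case by (simp add: wedge_power_def)
qed

text \<open>That the power is alternating is taken from the diagonalisation of the positive covector
  \<open>w c x\<close>; its transformation rule is naturality of wedge powers.\<close>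

lemma mf_power_smooth_form:
  fixes B :: "('y::{t2_space, second_countable_topology}, 'n::finite) chart set"
  assumes B: "complex_atlas B" and w: "smooth_form B 2 w"
    and p: "\<And>c x. c \<in> B \<Longrightarrow> x \<in> chart_image c \<Longrightarrow> pos11 (w c x)"
  shows "smooth_form B (2 * m) (mf_power B 2 m w)"
proof -
  have df: "diff_form B 2 w" using w by (simp add: smooth_form_def)
  have "diff_form B (2 * m) (mf_power B 2 m w)"
  proof (rule diff_formI[OF B])
    show "on_charts B (mf_power B 2 m w) = mf_power B 2 m w" by (simp add: mf_power_def on_charts_idem)
    show "alt_form (2 * m) (mf_power B 2 m w c x)" if "c \<in> B" "x \<in> chart_image c" for c x
      unfolding mf_power_def on_charts_in[OF that]
      by (rule wedge_power_positive(2)) (use p[OF that] pos11_nonneg in \<open>auto simp: pos11_def\<close>)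
    show "mf_power B 2 m w c x vs = mf_power B 2 m w d (local_rep c d id x) (map (jacobian c d id x) vs)"
      if "c \<in> B" "d \<in> B" "x \<in> overlap c d id" for c d x vs
    proof -
      have cx: "x \<in> chart_image c" using that(3) overlap_sub by blast
      have e: "w c x = (\<lambda>us. w d (local_rep c d id x) (map (jacobian c d id x) us))"
        by (rule ext, rule diff_formD(2)[OF df B that])
      show ?thesis
        unfolding mf_power_def on_charts_in[OF that(1) cx] on_charts_in[OF that(2) local_rep_overlap(1)[OF B that(2,3)]]
          wedge_power_map e ..
    qed
  qed
  moreover have "smooth_on (chart_image c) (\<lambda>x. mf_power B 2 m w c x vs)" if c: "c \<in> B" for c vs
  proof -
    have "smooth_on (chart_image c) (\<lambda>x. wedge_power 2 m (w c x) vs)"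
      by (rule wedge_power_smooth[OF atlas_chart(2)[OF B c]]) (use w c in \<open>simp add: smooth_form_def\<close>)
    then show ?thesis
      by (rule smooth_on_cong[OF atlas_chart(2)[OF B c], rotated]) (simp add: mf_power_def on_charts_in[OF c])
  qed
  ultimately show ?thesis by (simp add: smooth_form_def)
qed

lemma smooth_form_measurable:
  fixes B :: "('y::{t2_space, second_countable_topology}, 'n::finite) chart set"
  assumes "complex_atlas B" "smooth_form B k \<eta>" "c \<in> B"
  shows "(\<lambda>x. \<eta> c x vs) \<in> borel_measurable lebesgue"
proof -
  have s: "smooth_on (chart_image c) (\<lambda>x. \<eta> c x vs)" using assms(2,3) by (simp add: smooth_form_def)
  have "(\<lambda>x. if x \<in> chart_image c then \<eta> c x vs else 0) \<in> borel_measurable borel"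
    by (rule borel_measurable_continuous_on_if[OF borel_open[OF atlas_chart(2)[OF assms(1,3)]] smooth_on_continuous[OF s]])
       (rule continuous_on_const)
  moreover have "diff_form B k \<eta>" using assms(2) by (simp add: smooth_form_def)
  then have "\<eta> c x vs = 0" if "x \<notin> chart_image c" for x
    using on_charts_out[OF diff_form_on_charts] that by blast
  then have "(\<lambda>x. if x \<in> chart_image c then \<eta> c x vs else 0) = (\<lambda>x. \<eta> c x vs)" by auto
  ultimately show ?thesis by (simp add: measurable_completion)
qed

lemma wedge_measurable:
  assumes "\<And>us. (\<lambda>x. \<alpha> x us) \<in> borel_measurable M" "\<And>us. (\<lambda>x. \<beta> x us) \<in> borel_measurable M"
  shows "(\<lambda>x. wedge p q (\<alpha> x) (\<beta> x) vs) \<in> borel_measurable M"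
  unfolding wedge_def
  by (cases "length vs = p + q")
     (auto intro!: borel_measurable_divide borel_measurable_sum borel_measurable_times assms)

section \<open>The trace of a closed positive integrable current vanishes\<close>

text \<open>The situation on the covering space alone: the lifted metric \<open>w\<close>, a bounded
  primitive \<open>\<beta>\<close> of its power, the cutoffs \<open>\<psi>\<close>, and the
  coefficients \<open>\<tau>\<close> of \<open>T\<close>. Of the covering map and the base, only the
  cutoffs and the primitive have left a trace.\<close>

locale closed_positive_current =
  fixes B :: "('y::{t2_space, second_countable_topology}, 'n::finite) chart set"
    and w :: "('y, 'n) form" and T :: "('y, 'n) current" and \<tau> :: "('y, 'n) form"
    and \<beta> :: "('y, 'n) form" and \<psi> :: "nat \<Rightarrow> 'y \<Rightarrow> real" and C :: real
  assumes B: "complex_atlas B"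
    and n2: "2 \<le> CARD('n)"
    and w: "smooth_form B 2 w"
    and pos: "\<And>c x. c \<in> B \<Longrightarrow> x \<in> chart_image c \<Longrightarrow> pos11 (w c x)"
    and bump: "\<And>m. compact_bump B (\<psi> m)"
    and exhaust: "\<And>y. \<exists>U M. open U \<and> y \<in> U \<and> (\<forall>m\<ge>M. \<forall>y'\<in>U. \<psi> m y' = 1)"
    and C: "0 \<le> C"
    and grad: "\<And>m. grad_le B w {\<psi> m} C"
    and beta: "smooth_form B (2 * CARD('n) - 3) \<beta>"
    and beta_bound: "bounded_form B w (2 * CARD('n) - 3) \<beta>"
    and d_beta: "mf_power B 2 (CARD('n) - 1) w = mf_d B (2 * CARD('n) - 3) \<beta>"
    and bidegree: "bidegree_current B 1 1 T"
    and closed: "closed_current B 2 T"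
    and positive: "positive_current B 1 T"
    and coeffs: "measurable_coeffs B 2 T \<tau>"
    and L1: "L1_norm B w 2 \<tau> < \<infinity>"
begin

text \<open>Subtraction of natural numbers truncates. With \<open>n2\<close> the number
  \<open>2 n - 3\<close> is the true degree of the primitive, one less than that of the power of the
  metric.\<close>

lemma degrees: "2 * CARD('n) - 2 = 2 * (CARD('n) - 1)" "Suc (2 * CARD('n) - 3) = 2 * (CARD('n) - 1)"
  "2 + 2 * (CARD('n) - 1) = 2 * CARD('n)" "2 * CARD('n) - (1 + 1) = 2 * (CARD('n) - 1)"
  "2 * CARD('n) - (2 + 1) = 2 * CARD('n) - 3" "2 * CARD('n) - 2 * 1 = 2 * (CARD('n) - 1)"
  using n2 by auto

lemma psi: "smooth_fun B (\<psi> m)" "0 \<le> \<psi> m y" "\<psi> m y \<le> 1" "\<exists>K. compact K \<and> (\<forall>y. y \<notin> K \<longrightarrow> \<psi> m y = 0)"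
  using bump[of m] by (auto simp: compact_bump_def)

section \<open>Linearity of the current and of the space of test forms\<close>

lemma T_add:
  assumes "test_form B (2 * (CARD('n) - 1)) \<phi>" "test_form B (2 * (CARD('n) - 1)) \<phi>'"
  shows "T (\<lambda>c x vs. \<phi> c x vs + \<phi>' c x vs) = T \<phi> + T \<phi>'"
  using bidegree assms unfolding bidegree_current_def is_current_def degrees by blast

lemma T_scale:
  assumes "test_form B (2 * (CARD('n) - 1)) \<phi>"
  shows "T (\<lambda>c x vs. a * \<phi> c x vs) = a * T \<phi>"
  using bidegree assms unfolding bidegree_current_def is_current_def degrees by blast

lemma test_form_zero: "test_form B k (\<lambda>c x vs. 0)"
  unfolding test_form_def smooth_form_def
proof (intro conjI exI[of _ "{}"])
  show "diff_form B k (\<lambda>c x vs. 0)" by (rule diff_formI[OF B]) (auto simp: on_charts_def fun_eq_iff alt_form_zero)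
  show "\<forall>c\<in>B. \<forall>vs. smooth_on (chart_image c) (\<lambda>x. 0 :: complex)"
    using atlas_chart(2)[OF B] by (simp add: smooth_on_const)
qed (auto simp: supported_in_def)

lemma T_zero: "T (\<lambda>c x vs. 0) = 0"
  using T_scale[OF test_form_zero, of 0] by simp

lemma smooth_form_add:
  assumes "smooth_form B k \<eta>" "smooth_form B k \<theta>"
  shows "smooth_form B k (\<lambda>c x vs. \<eta> c x vs + \<theta> c x vs)"
proof -
  have d: "diff_form B k \<eta>" "diff_form B k \<theta>" using assms by (auto simp: smooth_form_def)
  have "diff_form B k (\<lambda>c x vs. \<eta> c x vs + \<theta> c x vs)"
  proof (rule diff_formI[OF B])
    show "on_charts B (\<lambda>c x vs. \<eta> c x vs + \<theta> c x vs) = (\<lambda>c x vs. \<eta> c x vs + \<theta> c x vs)"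
      using on_charts_out[OF diff_form_on_charts[OF d(1)]] on_charts_out[OF diff_form_on_charts[OF d(2)]]
      by (auto simp: on_charts_def fun_eq_iff)
    show "alt_form k (\<lambda>vs. \<eta> c x vs + \<theta> c x vs)" if "c \<in> B" "x \<in> chart_image c" for c x
      by (intro alt_form_add diff_formD(1)[OF d(1) B that] diff_formD(1)[OF d(2) B that])
    show "\<eta> c x vs + \<theta> c x vs = \<eta> e (local_rep c e id x) (map (jacobian c e id x) vs) +
        \<theta> e (local_rep c e id x) (map (jacobian c e id x) vs)"
      if "c \<in> B" "e \<in> B" "x \<in> overlap c e id" for c e x vs
      using diff_formD(2)[OF d(1) B that] diff_formD(2)[OF d(2) B that] by simp
  qed
  then show ?thesis
    using assms atlas_chart(2)[OF B] by (auto simp: smooth_form_def intro!: smooth_on_add)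
qed

lemma test_form_add:
  assumes "test_form B k \<eta>" "test_form B k \<theta>"
  shows "test_form B k (\<lambda>c x vs. \<eta> c x vs + \<theta> c x vs)"
proof -
  obtain K K' where "compact K" "supported_in B K \<eta>" "compact K'" "supported_in B K' \<theta>"
    using assms unfolding test_form_def by blast
  then have "compact (K \<union> K')" "supported_in B (K \<union> K') (\<lambda>c x vs. \<eta> c x vs + \<theta> c x vs)"
    by (auto simp: supported_in_def)
  then show ?thesis using smooth_form_add assms unfolding test_form_def by blast
qed

lemma test_form_scale:
  assumes "test_form B k \<eta>"
  shows "test_form B k (\<lambda>c x vs. a * \<eta> c x vs)"
proof -
  have s: "smooth_form B k \<eta>" using assms by (simp add: test_form_def)
  then have d: "diff_form B k \<eta>" by (simp add: smooth_form_def)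
  have "diff_form B k (\<lambda>c x vs. a * \<eta> c x vs)"
  proof (rule diff_formI[OF B])
    show "on_charts B (\<lambda>c x vs. a * \<eta> c x vs) = (\<lambda>c x vs. a * \<eta> c x vs)"
      using on_charts_out[OF diff_form_on_charts[OF d]] by (auto simp: on_charts_def fun_eq_iff)
    show "alt_form k (\<lambda>vs. a * \<eta> c x vs)" if "c \<in> B" "x \<in> chart_image c" for c x
      by (intro alt_form_scale diff_formD(1)[OF d B that])
    show "a * \<eta> c x vs = a * \<eta> e (local_rep c e id x) (map (jacobian c e id x) vs)"
      if "c \<in> B" "e \<in> B" "x \<in> overlap c e id" for c e x vs
      using diff_formD(2)[OF d B that] by simp
  qed
  then have "smooth_form B k (\<lambda>c x vs. a * \<eta> c x vs)"
    using s atlas_chart(2)[OF B] by (auto simp: smooth_form_def intro!: smooth_on_mult smooth_on_const)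
  moreover obtain K where "compact K" "supported_in B K \<eta>" using assms unfolding test_form_def by blast
  then have "\<exists>K. compact K \<and> supported_in B K (\<lambda>c x vs. a * \<eta> c x vs)"
    by (intro exI[of _ K]) (simp add: supported_in_def)
  ultimately show ?thesis by (simp add: test_form_def)
qed

lemma T_sum:
  assumes "finite I" "\<And>i. i \<in> I \<Longrightarrow> test_form B (2 * (CARD('n) - 1)) (\<phi> i)"
  shows "test_form B (2 * (CARD('n) - 1)) (\<lambda>c x vs. \<Sum>i\<in>I. \<phi> i c x vs) \<and>
    T (\<lambda>c x vs. \<Sum>i\<in>I. \<phi> i c x vs) = (\<Sum>i\<in>I. T (\<phi> i))"
  using assms
proof (induction I rule: finite_induct)
  case empty
  then show ?case using test_form_zero T_zero by simp
next
  case (insert i I)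
  then show ?case using test_form_add T_add by simp
qed

section \<open>The trace of the current and the error term\<close>

abbreviation "trace_form m \<equiv> fscale B (\<psi> m) (mf_power B 2 (CARD('n) - 1) w)"

abbreviation "error_form m \<equiv> dwedge B (2 * CARD('n) - 3) (\<psi> m) \<beta>"

lemma trace_form_test: "test_form B (2 * (CARD('n) - 1)) (trace_form m)"
proof -
  obtain K where "compact K" "\<And>y. y \<notin> K \<Longrightarrow> \<psi> m y = 0" using psi(4) by blast
  then show ?thesis
    unfolding test_form_def
    using fscale_smooth_form[OF B psi(1) mf_power_smooth_form[OF B w pos]] fscale_supported(2)[of K "\<psi> m"] by blast
qed

text \<open>Needed with both constant values of a cutoff: 0 shows that the error form has compact
  support, 1 that it eventually vanishes at each point.\<close>

lemma dwedge_locally_constant: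
  assumes "c \<in> B" "x \<in> chart_image c" "open U" "chart_inv c x \<in> U" "\<And>y. y \<in> U \<Longrightarrow> f y = a"
  shows "dwedge B k f \<eta> c x = (\<lambda>vs. 0)"
proof -
  have "frechet_derivative (\<lambda>x. f (chart_inv c x)) (at x) = frechet_derivative (\<lambda>x. a) (at x)"
    by (rule frechet_derivative_cong_open[OF open_chart_preimage[OF B assms(1,3)]]) (use assms(2,4,5) in auto)
  then show ?thesis
    unfolding dwedge_def on_charts_in[OF assms(1,2)] by (auto simp: contract_sum_def frechet_derivative_const fun_eq_iff)
qed

lemma error_form_test: "test_form B (2 * (CARD('n) - 1)) (error_form m)"
proof -
  have "smooth_form B (2 * (CARD('n) - 1)) (error_form m)"
    using dwedge_smooth_form[OF B psi(1) beta] unfolding degrees .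
  moreover obtain K where K: "compact K" "\<And>y. y \<notin> K \<Longrightarrow> \<psi> m y = 0" using psi(4) by blast
  have "supported_in B K (error_form m)"
    unfolding supported_in_def
  proof (intro ballI impI)
    fix c x assume cx: "c \<in> B" "x \<in> chart_image c" "chart_inv c x \<notin> K"
    show "error_form m c x = (\<lambda>_. 0)"
      by (rule dwedge_locally_constant[OF cx(1,2) open_Compl[OF compact_imp_closed[OF K(1)]], where a = 0])
         (use cx K(2) in auto)
  qed
  ultimately show ?thesis using K(1) unfolding test_form_def by blast
qed

lemma T_trace_eq_error: "T (trace_form m) = - T (error_form m)"
proof -
  let ?k = "2 * CARD('n) - 3"
  obtain K where K: "compact K" "\<And>y. y \<notin> K \<Longrightarrow> \<psi> m y = 0" using psi(4) by blast
  \<comment> \<open>The primitive itself is not compactly supported; the cutoff makes it a form on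
    which closedness of \<open>T\<close> can be tested.\<close>
  have "test_form B ?k (fscale B (\<psi> m) \<beta>)"
    unfolding test_form_def
    using fscale_smooth_form[OF B psi(1) beta] K fscale_supported(2)[of K "\<psi> m"] by blast
  then have "T (mf_d B ?k (fscale B (\<psi> m) \<beta>)) = 0"
    using closed unfolding closed_current_def zero_current_def degrees by blast
  also have "mf_d B ?k (fscale B (\<psi> m) \<beta>) = (\<lambda>c x vs. trace_form m c x vs + error_form m c x vs)"
    unfolding mf_d_fscale[OF B psi(1) beta] d_beta ..
  finally have "T (trace_form m) + T (error_form m) = 0"
    by (simp only: T_add[OF trace_form_test error_form_test])
  then show ?thesis by (simp add: eq_neg_iff_add_eq_0)
qed

lemma T_error_tendsto_0: "(\<lambda>m. T (error_form m)) \<longlonglongrightarrow> 0"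
proof -
  let ?n = "CARD('n)" and ?q = "2 * (CARD('n) - 1)" and ?k = "2 * CARD('n) - 3"
  obtain Cb where Cb: "\<And>c x. c \<in> B \<Longrightarrow> x \<in> chart_image c \<Longrightarrow> cov_norm (w c x) ?k (\<beta> c x) \<le> Cb"
    using beta_bound unfolding bounded_form_def by blast
  \<comment> \<open>On a frame \<open>d \<psi> \<and> \<beta>\<close> has \<open>Suc ?k\<close>
    terms, each the product of a differential on a unit vector, at most \<open>C\<close>, and a
    frame coefficient of \<open>\<beta>\<close>, at most \<open>\<bar>Cb\<bar>\<close>.\<close>
  define Cg where "Cg = real (Suc ?k) * (C * \<bar>Cb\<bar>)"
  \<comment> \<open>The constant of \<open>wedge_volume_bound\<close>, times the factorial by which
    \<open>volume_form\<close> is normalised. Adding 1 makes it positive even if \<open>Cg\<close>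
    is zero.\<close>
  define D where "D = (2 * ?n) ^ (2 * ?n) * Cg * fact ?n + 1"
  have Cg0: "Cg \<ge> 0" using C by (simp add: Cg_def)
  then have D: "D > 0" unfolding D_def by (simp add: add_nonneg_pos)
  have dfb: "diff_form B ?k \<beta>" using beta by (simp add: smooth_form_def)
  have dft: "diff_form B 2 \<tau>" using coeffs by (simp add: measurable_coeffs_def)
  have err: "cmod (error_form m c x (map ((!) (orthonormal_frame (w c x))) is)) \<le> Cg"
    if cx: "c \<in> B" "x \<in> chart_image c" and iss: "length is = ?q" "set is \<subseteq> {..<2 * ?n}" for m c x "is"
  proof -
    let ?e = "(!) (orthonormal_frame (w c x))"
    let ?a = "\<lambda>v. complex_of_real (frechet_derivative (\<lambda>x. \<psi> m (chart_inv c x)) (at x) v)"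
    let ?vs = "map ?e is"
    have len: "length ?vs = Suc ?k" using iss(1) degrees by simp
    have a: "cmod (?a (?e j)) \<le> C" if "j < 2 * ?n" for j
      using grad[of m] cx orthonormal_frame(2)[OF pos[OF cx] that that] by (simp add: grad_le_def)
    have "cmod (error_form m c x ?vs) \<le>
        (\<Sum>i\<le>?k. cmod ((- 1) ^ i * ?a (?vs ! i) * \<beta> c x (take i ?vs @ drop (Suc i) ?vs)))"
      unfolding dwedge_def on_charts_in[OF cx] contract_sum_def using len by (simp add: norm_sum)
    also have "\<dots> \<le> (\<Sum>i\<le>?k. C * \<bar>Cb\<bar>)"
    proof (rule sum_mono)
      fix i assume i: "i \<in> {..?k}"
      have il: "i < length is" using i len by simp
      have 1: "cmod (?a (?vs ! i)) \<le> C" using a[of "is ! i"] il subsetD[OF iss(2) nth_mem[OF il]] by simp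
      have "take i ?vs @ drop (Suc i) ?vs = map ?e (take i is @ drop (Suc i) is)" by (simp add: take_map drop_map)
      moreover have "cmod (\<beta> c x (map ?e (take i is @ drop (Suc i) is))) \<le> cov_norm (w c x) ?k (\<beta> c x)"
        by (rule cov_norm_bound[OF diff_formD(1)[OF dfb B cx]])
           (use il len iss(2) set_take_subset[of i "is"] set_drop_subset[of "Suc i" "is"] in auto)
      ultimately have 2: "cmod (\<beta> c x (take i ?vs @ drop (Suc i) ?vs)) \<le> \<bar>Cb\<bar>"
        using Cb[OF cx] by simp
      show "cmod ((- 1) ^ i * ?a (?vs ! i) * \<beta> c x (take i ?vs @ drop (Suc i) ?vs)) \<le> C * \<bar>Cb\<bar>"
        unfolding norm_mult norm_power using 1 2 C by (simp add: mult_mono)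
    qed
    also have "\<dots> = Cg" by (simp add: Cg_def)
    finally show ?thesis .
  qed
  define t where "t = (\<lambda>i x. cov_norm (w (chart_seq B i) x) 2 (\<tau> (chart_seq B i) x) *
     Re (volume_form B w (chart_seq B i) x standard_frame))"
  let ?\<mu> = "\<lambda>m. mf_wedge B 2 ?q \<tau> (error_form m)"
  have "(\<lambda>m. mf_integral B (?\<mu> m)) \<longlonglongrightarrow> 0"
  proof (rule mf_integral_dominated_tendsto_0[OF B D, where t = t])
    fix m i
    let ?c = "chart_seq B i"
    have c: "?c \<in> B" by (rule chart_seq(1)[OF B])
    have "(\<lambda>x. wedge 2 ?q (\<tau> ?c x) (error_form m ?c x) standard_frame) \<in> borel_measurable lebesgue"
      by (rule wedge_measurable)
         (use coeffs c smooth_form_measurable[OF B _ c] error_form_test[of m] in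
           \<open>auto simp: measurable_coeffs_def test_form_def\<close>)
    moreover have "?\<mu> m ?c x standard_frame = wedge 2 ?q (\<tau> ?c x) (error_form m ?c x) standard_frame" for x
    proof (cases "x \<in> chart_image ?c")
      case True
      then show ?thesis by (simp add: mf_wedge_def on_charts_in[OF c])
    next
      case False
      have "\<tau> ?c x vs = 0" for vs using on_charts_out[OF diff_form_on_charts[OF dft]] False by blast
      then show ?thesis using False by (simp add: mf_wedge_def on_charts_def wedge_def)
    qed
    ultimately show "(\<lambda>x. ?\<mu> m ?c x standard_frame) \<in> borel_measurable lebesgue" by simp
  next
    fix m i x assume "x \<in> cell B i"
    let ?c = "chart_seq B i"
    have c: "?c \<in> B" by (rule chart_seq(1)[OF B])
    have x: "x \<in> chart_image ?c" using cell_measurable(1)[OF B] \<open>x \<in> cell B i\<close> by blast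
    have sf: "diff_form B ?q (error_form m)" using error_form_test[of m] by (simp add: test_form_def smooth_form_def)
    have v: "Re (volume_form B w ?c x standard_frame) = Re (wedge_power 2 ?n (w ?c x) standard_frame) / fact ?n"
    proof -
      have "volume_form B w ?c x standard_frame = wedge_power 2 ?n (w ?c x) standard_frame / of_real (fact ?n)"
        by (simp add: volume_form_def mf_power_def on_charts_in[OF c x])
      then show ?thesis by (simp only: Re_divide_of_real)
    qed
    have "cmod (?\<mu> m ?c x standard_frame) = cmod (wedge 2 ?q (\<tau> ?c x) (error_form m ?c x) standard_frame)"
      by (simp add: mf_wedge_def on_charts_in[OF c x])
    also have "\<dots> \<le> (2 * ?n) ^ (2 * ?n) * Cg * (cov_norm (w ?c x) 2 (\<tau> ?c x) * Re (wedge_power 2 ?n (w ?c x) standard_frame))"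
      by (rule wedge_volume_bound[OF pos[OF c x] diff_formD(1)[OF dft B c x] diff_formD(1)[OF sf B c x] degrees(3)
            err[OF c x] Cg0])
    also have "\<dots> = (2 * ?n) ^ (2 * ?n) * Cg * fact ?n * t i x"
      by (simp add: t_def v)
    also have "\<dots> \<le> D * t i x"
    proof (rule mult_right_mono)
      have "0 \<le> Re (wedge_power 2 ?n (w ?c x) standard_frame)"
        using volume_ge_frame_det[OF pos[OF c x]] by (rule order_trans[rotated]) (simp add: frame_det_def)
      then show "0 \<le> t i x" by (simp add: t_def v cov_norm_def sum_nonneg)
    qed (simp add: D_def)
    finally show "cmod (?\<mu> m ?c x standard_frame) \<le> D * t i x" .
  next
    fix i x assume "x \<in> cell B i"
    let ?c = "chart_seq B i"
    have c: "?c \<in> B" by (rule chart_seq(1)[OF B])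
    have x: "x \<in> chart_image ?c" using cell_measurable(1)[OF B] \<open>x \<in> cell B i\<close> by blast
    \<comment> \<open>The cutoffs are eventually 1 on a neighbourhood and not just at the point, so
      their differentials are eventually zero there.\<close>
    obtain U M where U: "open U" "chart_inv ?c x \<in> U" "\<forall>m\<ge>M. \<forall>y'\<in>U. \<psi> m y' = 1" using exhaust by blast
    have "?\<mu> m ?c x standard_frame = 0" if "m \<ge> M" for m
    proof -
      have "error_form m ?c x = (\<lambda>vs. 0)"
        by (rule dwedge_locally_constant[OF c x U(1,2), where a = 1]) (use U(3) that in blast)
      then show ?thesis by (simp add: mf_wedge_def on_charts_in[OF c x] wedge_def)
    qed
    then show "\<exists>M. \<forall>m\<ge>M. ?\<mu> m ?c x standard_frame = 0" by blast
  next
    show "(\<Sum>i. \<integral>\<^sup>+x. ennreal (t i x) * indicator (cell B i) x \<partial>lebesgue) < \<infinity>"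
      using L1 by (simp add: L1_norm_def t_def)
  qed
  moreover have "T (error_form m) = mf_integral B (?\<mu> m)" for m
    using coeffs error_form_test[of m] unfolding measurable_coeffs_def degrees by blast
  ultimately show ?thesis by simp
qed

lemma T_trace_tendsto_0: "(\<lambda>m. T (trace_form m)) \<longlonglongrightarrow> 0"
  unfolding T_trace_eq_error using tendsto_minus[OF T_error_tendsto_0] by simp

text \<open>A finite subcover makes the local thresholds uniform; their sum serves as a common upper
  bound.\<close>

lemma psi_eventually_1:
  assumes "compact K"
  shows "\<exists>M. \<forall>m\<ge>M. \<forall>y\<in>K. \<psi> m y = 1"
proof -
  obtain U M where U: "\<And>y. open (U y)" "\<And>y. y \<in> U y" "\<And>y m y'. m \<ge> M y \<Longrightarrow> y' \<in> U y \<Longrightarrow> \<psi> m y' = 1"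
    using exhaust by metis
  have "K \<subseteq> (\<Union>y\<in>K. U y)" using U(2) by blast
  from compactE_image[OF assms U(1) this] obtain K' where K': "K' \<subseteq> K" "finite K'" "K \<subseteq> (\<Union>y\<in>K'. U y)" by metis
  have "\<psi> m y = 1" if m: "m \<ge> (\<Sum>y\<in>K'. M y)" and y: "y \<in> K" for m y
  proof -
    obtain y0 where y0: "y0 \<in> K'" "y \<in> U y0" using K'(3) y by blast
    have "M y0 \<le> (\<Sum>y\<in>K'. M y)" by (rule member_le_sum[OF y0(1) _ K'(2)]) simp
    then show ?thesis using U(3)[OF _ y0(2)] m by simp
  qed
  then show ?thesis by blast
qed

section \<open>Domination of local forms by the trace form\<close>

lemma chart_pos_power:
  assumes "c \<in> B" "x \<in> chart_image c"
  shows "strongly_positive m (wedge_power 2 m (w c x))"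
  using wedge_power_positive(1) pos[OF assms] pos11_nonneg by (auto simp: pos11_def)

lemma elementary_dominated:
  assumes c: "c \<in> B" and K: "compact K" "K \<subseteq> chart_image c" and L: "length L = m" "\<And>\<alpha>. \<alpha> \<in> set L \<Longrightarrow> covector10 \<alpha>"
  obtains a where "a > 0" "\<And>x. x \<in> K \<Longrightarrow>
    strongly_positive m (\<lambda>vs. wedge_power 2 m (w c x) vs - of_real (a ^ m) * wedges 2 (map elementary_11 L) vs)"
proof -
  have sm: "smooth_on (chart_image c) (\<lambda>x. w c x vs)" for vs using w c by (simp add: smooth_form_def)
  obtain c0 where c0: "c0 > 0" "\<And>x v. x \<in> K \<Longrightarrow> c0 * (norm v)\<^sup>2 \<le> metric_of (w c x) v v"
    by (rule uniform_positivity[where w = "w c", OF K sm pos[OF c]]) (assumption | rule that)+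
  have "\<exists>M. \<forall>v. cmod (\<alpha> v) \<le> norm v * M" if "\<alpha> \<in> set L" for \<alpha>
    using bounded_linear.bounded[OF linear_conv_bounded_linear[THEN iffD1, OF covector10_linear[OF L(2)[OF that]]]] by blast
  then obtain M where M: "\<And>\<alpha> v. \<alpha> \<in> set L \<Longrightarrow> cmod (\<alpha> v) \<le> norm v * M \<alpha>" by metis
  define S where "S = (\<Sum>s<m. 2 * (M (L ! s))\<^sup>2)"
  have S0: "S \<ge> 0" unfolding S_def by (intro sum_nonneg) simp
  \<comment> \<open>\<open>S\<close> bounds the quadratic form of \<open>L\<close> against the
    Euclidean square norm and \<open>c0\<close> bounds the metric from below. The added 1 keeps the
    quotient meaningful when \<open>S\<close> is zero.\<close>
  define a where "a = c0 / (S + 1)"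
  have a: "a > 0" using c0(1) S0 by (simp add: a_def)
  show thesis
  proof (rule that[OF a])
    fix x assume x: "x \<in> K"
    then have xc: "x \<in> chart_image c" using K(2) by blast
    show "strongly_positive m (\<lambda>vs. wedge_power 2 m (w c x) vs - of_real (a ^ m) * wedges 2 (map elementary_11 L) vs)"
    proof (rule wedge_power_dominates[OF _ L])
      show "real11 (w c x)" using pos[OF c xc] by (simp add: pos11_def)
      show "0 \<le> a" using a by simp
      fix v :: "complex ^ 'n"
      have "(\<Sum>s<m. 2 * (cmod ((L ! s) v))\<^sup>2) \<le> (\<Sum>s<m. 2 * ((norm v)\<^sup>2 * (M (L ! s))\<^sup>2))"
      proof (intro sum_mono mult_left_mono)
        fix s assume "s \<in> {..<m}"
        then have "L ! s \<in> set L" using L(1) by simp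
        then show "(cmod ((L ! s) v))\<^sup>2 \<le> (norm v)\<^sup>2 * (M (L ! s))\<^sup>2"
          using power_mono[OF M norm_ge_zero, of "L ! s" v 2] by (simp add: power_mult_distrib)
      qed simp
      also have "\<dots> = (norm v)\<^sup>2 * S" by (simp add: S_def sum_distrib_left algebra_simps)
      also have "\<dots> \<le> (norm v)\<^sup>2 * (S + 1)" by (intro mult_left_mono) auto
      finally have "a * (\<Sum>s<m. 2 * (cmod ((L ! s) v))\<^sup>2) \<le> a * ((norm v)\<^sup>2 * (S + 1))"
        using a by (intro mult_left_mono) auto
      also have "\<dots> = c0 * (norm v)\<^sup>2" using S0 by (simp add: a_def)
      also have "\<dots> \<le> metric_of (w c x) v v" by (rule c0(2)[OF x])
      finally show "a * (\<Sum>s<m. 2 * (cmod ((L ! s) v))\<^sup>2) \<le> metric_of (w c x) v v" .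
    qed
  qed
qed

lemma ext_form_test:
  assumes "c \<in> B" "alt_form k \<eta>" "compact K" "K \<subseteq> chart_image c" "smooth_on (chart_image c) f"
    and "\<And>x. x \<in> chart_image c - K \<Longrightarrow> f x = 0"
  shows "test_form B k (ext_form B c (\<lambda>x vs. f x * \<eta> vs))"
proof (rule ext_form_test_form(1)[OF B assms(1) _ _ assms(3,4)])
  show "alt_form k (\<lambda>vs. f x * \<eta> vs)" for x by (rule alt_form_scale[OF assms(2)])
  show "smooth_on (chart_image c) (\<lambda>x. f x * \<eta> vs)" for vs
    by (intro smooth_on_mult assms(5) smooth_on_const atlas_chart(2)[OF B assms(1)])
  show "(\<lambda>vs. f x * \<eta> vs) = (\<lambda>vs. 0)" if "x \<in> chart_image c - K" for x
    using assms(6)[OF that] by simp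
qed

text \<open>For large \<open>m\<close> a multiple of the trace form dominates both \<open>f \<sigma>\<close> and \<open>- f \<sigma>\<close>, and the current of the
  trace form tends to zero.\<close>

lemma T_real_elementary:
  assumes c: "c \<in> B" and K: "compact K" "K \<subseteq> chart_image c"
    and f: "smooth_on (chart_image c) f" "\<And>x. x \<in> chart_image c - K \<Longrightarrow> f x = (0 :: real)"
    and L: "length L = CARD('n) - 1" "\<And>\<alpha>. \<alpha> \<in> set L \<Longrightarrow> covector10 \<alpha>"
  shows "T (ext_form B c (\<lambda>x vs. of_real (f x) * wedges 2 (map elementary_11 L) vs)) = 0"
proof -
  let ?m = "CARD('n) - 1"
  let ?\<sigma> = "wedges 2 (map elementary_11 L)"
  let ?E = "ext_form B c (\<lambda>x vs. of_real (f x) * ?\<sigma> vs)"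
  have alt: "alt_form (2 * ?m) ?\<sigma>" using wedges_elementary_alt_form[of L, OF L(2)] L(1) by simp
  have op: "open (chart_image c)" by (rule atlas_chart(2)[OF B c])
  have E: "test_form B (2 * ?m) ?E"
    by (rule ext_form_test[OF c alt K]) (use f in \<open>auto intro: smooth_on_of_real[OF op]\<close>)
  obtain a where a: "a > 0" "\<And>x. x \<in> K \<Longrightarrow>
      strongly_positive ?m (\<lambda>vs. wedge_power 2 ?m (w c x) vs - of_real (a ^ ?m) * ?\<sigma> vs)"
    by (rule elementary_dominated[OF c K L]) (assumption | rule that)+
  have "bounded (f ` K)"
    by (intro compact_imp_bounded compact_continuous_image continuous_on_subset[OF smooth_on_continuous[OF f(1)]] K)
  then obtain F where F: "F > 0" "\<And>x. x \<in> K \<Longrightarrow> \<bar>f x\<bar> \<le> F" unfolding bounded_pos by fastforce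
  \<comment> \<open>With \<open>D a ^ m = F\<close> the form \<open>D w ^ m + s f \<sigma>\<close>
    is \<open>D (w ^ m - a ^ m \<sigma>) + (F + s f) \<sigma>\<close>, a sum of two strongly
    positive covectors because \<open>F\<close> bounds the modulus of \<open>f\<close> on
    \<open>K\<close>.\<close>
  define D where "D = F / a ^ ?m"
  have D: "D \<ge> 0" "D * a ^ ?m = F" using F(1) a(1) by (auto simp: D_def)
  obtain M where M: "\<And>m y. m \<ge> M \<Longrightarrow> y \<in> chart_inv c ` K \<Longrightarrow> \<psi> m y = 1"
    using psi_eventually_1[OF compact_chart_inv[OF B c K]] by blast
  have dfw: "diff_form B 2 w" using w by (simp add: smooth_form_def)
  have sp: "strongly_positive ?m (\<lambda>vs. of_real D * trace_form m d x vs + of_real s * ?E d x vs)"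
    if m: "m \<ge> M" and s: "\<bar>s\<bar> = 1" and d: "d \<in> B" and x: "x \<in> chart_image d" for m d x and s :: real
  \<comment> \<open>Over \<open>K\<close> the cutoff equals 1 and the power of the metric dominates.
    Elsewhere the local form vanishes, and the trace form alone is strongly positive.\<close>
  proof (cases "x \<in> overlap d c id \<and> local_rep d c id x \<in> K")
    case True
    then have o: "x \<in> overlap d c id" and xK: "local_rep d c id x \<in> K" by auto
    let ?x = "local_rep d c id x" and ?J = "jacobian d c id x"
    have "chart_inv d x \<in> chart_inv c ` K" using local_rep_overlap(2)[OF B c o] xK by (metis id_apply imageI)
    then have p1: "\<psi> m (chart_inv d x) = 1" by (rule M[OF m])
    have e: "w d x = (\<lambda>us. w c ?x (map ?J us))" by (rule ext, rule diff_formD(2)[OF dfw B d c o])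
    have "0 \<le> F + s * f ?x" using F(2)[OF xK] s by (cases "s = 1") (auto simp: abs_if split: if_splits)
    then have "strongly_positive ?m (\<lambda>vs. of_real D * (wedge_power 2 ?m (w c ?x) vs - of_real (a ^ ?m) * ?\<sigma> vs) +
        of_real (F + s * f ?x) * ?\<sigma> vs)"
      by (intro strongly_positive_add strongly_positive_scale a(2)[OF xK] D(1) strongly_positive_elementary L)
    from strongly_positive_map[OF this holo_complex_linear[OF trans_holo(2)[OF B d c] o]]
    have 1: "strongly_positive ?m (\<lambda>vs. of_real D * (wedge_power 2 ?m (w c ?x) (map ?J vs) - of_real (a ^ ?m) * ?\<sigma> (map ?J vs)) +
        of_real (F + s * f ?x) * ?\<sigma> (map ?J vs))" .
    have t: "trace_form m d x vs = wedge_power 2 ?m (w c ?x) (map ?J vs)" for vs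
      unfolding fscale_def mf_power_def on_charts_in[OF d x] p1 wedge_power_map by (simp add: e)
    have 2: "of_real D * trace_form m d x vs + of_real s * ?E d x vs =
        of_real D * (wedge_power 2 ?m (w c ?x) (map ?J vs) - of_real (a ^ ?m) * ?\<sigma> (map ?J vs)) +
        of_real (F + s * f ?x) * ?\<sigma> (map ?J vs)" for vs
      unfolding t ext_form_in[OF d o] D(2)[symmetric] by (simp add: algebra_simps)
    show ?thesis unfolding 2 by (rule 1)
  next
    case False
    have E0: "?E d x = (\<lambda>vs. 0)"
    proof (cases "x \<in> overlap d c id")
      case True
      have "f (local_rep d c id x) = 0"
        using f(2) local_rep_overlap(1)[OF B c True] False True by blast
      then show ?thesis by (simp add: ext_form_in[OF d True])
    qed (simp add: ext_form_out)
    have "strongly_positive ?m (\<lambda>vs. of_real (D * \<psi> m (chart_inv d x)) * wedge_power 2 ?m (w d x) vs)"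
      by (intro strongly_positive_scale chart_pos_power[OF d x]) (use D(1) psi(2) in simp)
    then show ?thesis
      by (simp add: E0 fscale_def mf_power_def on_charts_in[OF d x] mult.assoc)
  qed
  have lim: "of_real s * T ?E \<in> \<real>\<^sub>\<ge>\<^sub>0" if s: "\<bar>s\<bar> = 1" for s :: real
  proof -
    have "(\<lambda>m. of_real D * T (trace_form m) + of_real s * T ?E) \<longlonglongrightarrow> of_real D * 0 + of_real s * T ?E"
      by (intro tendsto_intros T_trace_tendsto_0)
    moreover have "of_real D * T (trace_form m) + of_real s * T ?E \<in> \<real>\<^sub>\<ge>\<^sub>0" if m: "m \<ge> M" for m
    proof -
      let ?\<Theta> = "\<lambda>d x vs. of_real D * trace_form m d x vs + of_real s * ?E d x vs"
      have t: "test_form B (2 * ?m) ?\<Theta>"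
        by (rule test_form_add[OF test_form_scale[OF trace_form_test] test_form_scale[OF E]])
      have "T ?\<Theta> = of_real D * T (trace_form m) + of_real s * T ?E"
        by (simp only: T_add[OF test_form_scale[OF trace_form_test] test_form_scale[OF E]] T_scale[OF trace_form_test] T_scale[OF E])
      moreover have "T ?\<Theta> \<in> \<real>\<^sub>\<ge>\<^sub>0"
        using positive t sp[OF m s] unfolding positive_current_def degrees by blast
      ultimately show ?thesis by simp
    qed
    then have "eventually (\<lambda>m. of_real D * T (trace_form m) + of_real s * T ?E \<in> \<real>\<^sub>\<ge>\<^sub>0) sequentially"
      unfolding eventually_sequentially by blast
    ultimately show ?thesis
      using Lim_in_closed_set[OF closed_nonneg_Reals_complex _ sequentially_bot] by fastforce
  qed
  \<comment> \<open>Both signs of \<open>s\<close> place \<open>T ?E\<close> and its negative in the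
    closed half-line of nonnegative reals, which leaves only 0.\<close>
  have "T ?E \<in> \<real>\<^sub>\<ge>\<^sub>0" "- T ?E \<in> \<real>\<^sub>\<ge>\<^sub>0" using lim[of 1] lim[of "-1"] by auto
  then show ?thesis by (simp add: complex_nonneg_Reals_iff complex_eq_iff)
qed

section \<open>Vanishing on forms supported in one chart\<close>

lemma T_elementary:
  assumes c: "c \<in> B" and K: "compact K" "K \<subseteq> chart_image c"
    and f: "smooth_on (chart_image c) f" "\<And>x. x \<in> chart_image c - K \<Longrightarrow> f x = (0 :: complex)"
    and L: "length L = CARD('n) - 1" "\<And>\<alpha>. \<alpha> \<in> set L \<Longrightarrow> covector10 \<alpha>"
  shows "T (ext_form B c (\<lambda>x vs. f x * wedges 2 (map elementary_11 L) vs)) = 0"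
proof -
  let ?\<sigma> = "wedges 2 (map elementary_11 L)"
  let ?E = "\<lambda>g :: complex ^ 'n \<Rightarrow> real. ext_form B c (\<lambda>x vs. of_real (g x) * ?\<sigma> vs)"
  have alt: "alt_form (2 * (CARD('n) - 1)) ?\<sigma>" using wedges_elementary_alt_form[of L, OF L(2)] L(1) by simp
  have op: "open (chart_image c)" by (rule atlas_chart(2)[OF B c])
  have re: "smooth_on (chart_image c) (\<lambda>x. Re (f x))" and im: "smooth_on (chart_image c) (\<lambda>x. Im (f x))"
    by (rule smooth_on_linear_comp[OF op bounded_linear_Re f(1)], rule smooth_on_linear_comp[OF op bounded_linear_Im f(1)])
  have t: "test_form B (2 * (CARD('n) - 1)) (?E (\<lambda>x. Re (f x)))" "test_form B (2 * (CARD('n) - 1)) (?E (\<lambda>x. Im (f x)))"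
    by (rule ext_form_test[OF c alt K]; use f(2) re im in \<open>auto intro: smooth_on_of_real[OF op]\<close>)+
  have z: "T (?E (\<lambda>x. Re (f x))) = 0" "T (?E (\<lambda>x. Im (f x))) = 0"
    by (rule T_real_elementary[OF c K _ _ L]; use f(2) re im in auto)+
  have "f x * v = of_real (Re (f x)) * v + \<i> * (of_real (Im (f x)) * v)" for x v
    by (simp add: complex_eq_iff)
  then have "ext_form B c (\<lambda>x vs. f x * ?\<sigma> vs) = (\<lambda>d x vs. ?E (\<lambda>x. Re (f x)) d x vs + \<i> * ?E (\<lambda>x. Im (f x)) d x vs)"
    by (auto simp: ext_form_def fun_eq_iff)
  then show ?thesis
    by (simp only: T_add[OF t(1) test_form_scale[OF t(2)]] T_scale[OF t(2)] z mult_zero_right add_0_left)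
qed

text \<open>\<open>N\<close> is the subspace of covectors \<open>\<eta>\<close> such that
  \<open>T\<close> annihilates \<open>f \<eta>\<close> for every admissible coefficient
  \<open>f\<close>. It contains the products of elementary covectors by positivity and the words of
  the other types by bidegree, and together these span.\<close>

lemma T_constant_form:
  assumes c: "c \<in> B" and \<eta>: "alt_form (2 * (CARD('n) - 1)) \<eta>" and K: "compact K" "K \<subseteq> chart_image c"
    and f: "smooth_on (chart_image c) f" "\<And>x. x \<in> chart_image c - K \<Longrightarrow> f x = (0 :: complex)"
  shows "T (ext_form B c (\<lambda>x vs. f x * \<eta> vs)) = 0"
proof -
  let ?m = "CARD('n) - 1"
  define N where "N = (\<lambda>\<eta>. alt_form (2 * ?m) \<eta> \<and> (\<forall>f K. compact K \<longrightarrow> K \<subseteq> chart_image c \<longrightarrow>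
      smooth_on (chart_image c) f \<longrightarrow> (\<forall>x\<in>chart_image c - K. f x = (0 :: complex)) \<longrightarrow>
      T (ext_form B c (\<lambda>x vs. f x * \<eta> vs)) = 0))"
  have NI: "N \<eta>" if "alt_form (2 * ?m) \<eta>" "\<And>f K. compact K \<Longrightarrow> K \<subseteq> chart_image c \<Longrightarrow> smooth_on (chart_image c) f \<Longrightarrow>
      (\<And>x. x \<in> chart_image c - K \<Longrightarrow> f x = (0 :: complex)) \<Longrightarrow> T (ext_form B c (\<lambda>x vs. f x * \<eta> vs)) = 0" for \<eta>
    unfolding N_def by (intro conjI allI impI that) auto
  have NA: "alt_form (2 * ?m) \<eta>" if "N \<eta>" for \<eta> using that by (simp add: N_def)
  have NT: "T (ext_form B c (\<lambda>x vs. f x * \<eta> vs)) = 0" if "N \<eta>" "compact K" "K \<subseteq> chart_image c" "smooth_on (chart_image c) f"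
      "\<And>x. x \<in> chart_image c - K \<Longrightarrow> f x = (0 :: complex)" for \<eta> f K
    using that(1)[unfolded N_def, THEN conjunct2, rule_format, OF that(2-4)] that(5) by blast
  have "covector_subspace N"
    unfolding covector_subspace_def
  proof (intro conjI allI impI)
    have "ext_form B c (\<lambda>x vs. f x * 0) = (\<lambda>d x vs. 0)" for f :: "complex ^ 'n \<Rightarrow> complex" by (auto simp: ext_form_def fun_eq_iff)
    then show "N (\<lambda>vs. 0)" by (intro NI alt_form_zero) (simp add: T_zero)
  next
    fix \<eta> \<theta> assume n: "N \<eta>" "N \<theta>"
    show "N (\<lambda>vs. \<eta> vs + \<theta> vs)"
    proof (rule NI[OF alt_form_add[OF NA[OF n(1)] NA[OF n(2)]]])
      fix f :: "complex ^ 'n \<Rightarrow> complex" and K assume a: "compact K" "K \<subseteq> chart_image c" "smooth_on (chart_image c) f" "\<And>x. x \<in> chart_image c - K \<Longrightarrow> f x = 0"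
      have "ext_form B c (\<lambda>x vs. f x * (\<eta> vs + \<theta> vs)) =
          (\<lambda>d x vs. ext_form B c (\<lambda>x vs. f x * \<eta> vs) d x vs + ext_form B c (\<lambda>x vs. f x * \<theta> vs) d x vs)"
        by (auto simp: ext_form_def fun_eq_iff algebra_simps)
      then show "T (ext_form B c (\<lambda>x vs. f x * (\<eta> vs + \<theta> vs))) = 0"
        using T_add[OF ext_form_test[OF c NA[OF n(1)] a] ext_form_test[OF c NA[OF n(2)] a]] NT[OF n(1) a] NT[OF n(2) a]
        by simp
    qed
  next
    fix k \<eta> assume n: "N \<eta>"
    show "N (\<lambda>vs. k * \<eta> vs)"
    proof (rule NI[OF alt_form_scale[OF NA[OF n]]])
      fix f :: "complex ^ 'n \<Rightarrow> complex" and K assume a: "compact K" "K \<subseteq> chart_image c" "smooth_on (chart_image c) f" "\<And>x. x \<in> chart_image c - K \<Longrightarrow> f x = 0"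
      have "ext_form B c (\<lambda>x vs. f x * (k * \<eta> vs)) = (\<lambda>d x vs. k * ext_form B c (\<lambda>x vs. f x * \<eta> vs) d x vs)"
        by (auto simp: ext_form_def fun_eq_iff)
      then show "T (ext_form B c (\<lambda>x vs. f x * (k * \<eta> vs))) = 0"
        using T_scale[OF ext_form_test[OF c NA[OF n] a], of k] NT[OF n a] by simp
    qed
  qed
  moreover have "N (wedges 2 (map elementary_11 L))" if L: "length L = ?m" "\<And>\<alpha>. \<alpha> \<in> set L \<Longrightarrow> covector10 \<alpha>" for L
  proof (rule NI)
    show "alt_form (2 * ?m) (wedges 2 (map elementary_11 L))" using wedges_elementary_alt_form[of L, OF L(2)] L(1) by simp
  qed (rule T_elementary[OF c _ _ _ _ L])
  moreover have "N (altprod (L @ map (\<lambda>\<beta>. cnj \<circ> \<beta>) M))"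
    if len: "length L + length M = 2 * ?m" "(length L, length M) \<noteq> (?m, ?m)" and c10: "\<And>\<alpha>. \<alpha> \<in> set L \<union> set M \<Longrightarrow> covector10 \<alpha>" for L M
  proof (rule NI)
    let ?\<eta> = "altprod (L @ map (\<lambda>\<beta>. cnj \<circ> \<beta>) M)"
    have "linear \<gamma>" if "\<gamma> \<in> set (L @ map (\<lambda>\<beta>. cnj \<circ> \<beta>) M)" for \<gamma>
      using that c10 covector10_linear linear_cnj_comp by auto
    from altprod_alt_form[of "L @ map (\<lambda>\<beta>. cnj \<circ> \<beta>) M", OF this]
    show alt: "alt_form (2 * ?m) ?\<eta>" using len(1) by simp
    fix f :: "complex ^ 'n \<Rightarrow> complex" and K assume a: "compact K" "K \<subseteq> chart_image c" "smooth_on (chart_image c) f" "\<And>x. x \<in> chart_image c - K \<Longrightarrow> f x = 0"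
    let ?E = "ext_form B c (\<lambda>x vs. f x * ?\<eta> vs)"
    have cc: "(\<circ>) cnj = (\<lambda>\<beta> x. cnj (\<beta> x) :: complex)" by (simp add: fun_eq_iff)
    \<comment> \<open>The scalar is general because it is a value of \<open>f\<close> on the overlap
      with \<open>c\<close> and 0 off it.\<close>
    have ty: "type_form (length L) (length M) (\<lambda>vs. k * ?\<eta> vs)" for k
      unfolding type_form_def
      by (rule exI[of _ 1], rule exI[of _ "\<lambda>_. k"], rule exI[of _ "\<lambda>_. L"], rule exI[of _ "\<lambda>_. M"])
         (use c10 wedges_covector1[of "L @ map (\<lambda>\<beta>. cnj \<circ> \<beta>) M"] in \<open>simp add: o_def cc\<close>)
    have "type_form (length L) (length M) (?E d x)" if d: "d \<in> B" "x \<in> chart_image d" for d x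
    proof (cases "x \<in> overlap d c id")
      case True
      show ?thesis
        unfolding ext_form_in[OF d(1) True]
        by (rule type_form_map[OF ty holo_complex_linear[OF trans_holo(2)[OF B d(1) c] True]])
    next
      case False
      then show ?thesis using ty[of 0] by (simp add: ext_form_out)
    qed
    moreover have "test_form B (length L + length M) ?E" using ext_form_test[OF c alt a] len(1) by simp
    ultimately show "T ?E = 0"
      using bidegree len unfolding bidegree_current_def degrees by blast
  qed
  ultimately have "N \<eta>" by (rule type_forms_span[OF _ _ _ \<eta>])
  then show ?thesis by (rule NT[OF _ K f])
qed

text \<open>The coefficients of \<open>\<rho>\<close> in a fixed real coframe are smooth and vanish
  off \<open>K\<close>, so \<open>\<rho>\<close> is a finite sum of functions times constant
  covectors.\<close>

lemma T_local_form:
  assumes c: "c \<in> B" and K: "compact K" "K \<subseteq> chart_image c"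
    and \<rho>: "\<And>x. x \<in> chart_image c \<Longrightarrow> alt_form (2 * (CARD('n) - 1)) (\<rho> x)" "\<And>vs. smooth_on (chart_image c) (\<lambda>x. \<rho> x vs)"
    "\<And>x. x \<in> chart_image c - K \<Longrightarrow> \<rho> x = (\<lambda>vs. 0)"
  shows "T (ext_form B c \<rho>) = 0"
proof -
  let ?k = "2 * (CARD('n) - 1)"
  let ?I = "{is. set is \<subseteq> (Basis :: (complex ^ 'n) set) \<and> length is = ?k}"
  let ?f = "\<lambda>is x. \<rho> x (map (\<lambda>x. x) is) / fact ?k"
  let ?\<eta> = "\<lambda>is. altprod (map (\<lambda>e v. complex_of_real (v \<bullet> e)) is)"
  have op: "open (chart_image c)" by (rule atlas_chart(2)[OF B c])
  have fin: "finite ?I" by (rule finite_lists_length_eq) simp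
  have alt: "alt_form ?k (?\<eta> is)" if "is \<in> ?I" for "is"
  proof -
    have "linear (\<lambda>v. complex_of_real (v \<bullet> e))" for e :: "complex ^ 'n"
      by (rule linearI) (simp_all add: inner_add_left scaleR_conv_of_real[where 'a = complex])
    then have "alt_form (length (map (\<lambda>e v. complex_of_real (v \<bullet> e)) is)) (?\<eta> is)" by (intro altprod_alt_form) auto
    then show ?thesis using that by simp
  qed
  have fs: "smooth_on (chart_image c) (?f is)" for "is"
    unfolding divide_inverse by (intro smooth_on_mult op smooth_on_const \<rho>(2))
  have f0: "?f is x = 0" if "x \<in> chart_image c - K" for "is" x using \<rho>(3)[OF that] by simp
  have "ext_form B c \<rho> = (\<lambda>d x vs. \<Sum>is\<in>?I. ext_form B c (\<lambda>x vs. ?f is x * ?\<eta> is vs) d x vs)"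
  proof (intro ext)
    fix d x vs
    show "ext_form B c \<rho> d x vs = (\<Sum>is\<in>?I. ext_form B c (\<lambda>x vs. ?f is x * ?\<eta> is vs) d x vs)"
    proof (cases "d \<in> B \<and> x \<in> overlap d c id")
      case True
      then have d: "d \<in> B" "x \<in> overlap d c id" by auto
      show ?thesis
        unfolding ext_form_in[OF d]
        by (rule alt_form_expansion[OF finite_Basis _ \<rho>(1)[OF local_rep_overlap(1)[OF B c d(2)]]])
           (simp add: euclidean_representation)
    qed (simp add: ext_form_out)
  qed
  moreover have "T (\<lambda>d x vs. \<Sum>is\<in>?I. ext_form B c (\<lambda>x vs. ?f is x * ?\<eta> is vs) d x vs) =
      (\<Sum>is\<in>?I. T (ext_form B c (\<lambda>x vs. ?f is x * ?\<eta> is vs)))"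
    by (rule T_sum[THEN conjunct2, OF fin], rule ext_form_test[OF c alt K fs f0])
  moreover have "T (ext_form B c (\<lambda>x vs. ?f is x * ?\<eta> is vs)) = 0" if "is \<in> ?I" for "is"
    by (rule T_constant_form[OF c alt[OF that] K fs f0])
  ultimately show ?thesis by simp
qed

section \<open>From local to global vanishing\<close>

lemma chart_bump:
  obtains q :: "'y \<Rightarrow> real" and U where "smooth_fun B q" "open U" "y \<in> U" "\<And>y'. y' \<in> U \<Longrightarrow> q y' = 1"
    "\<And>\<theta>. test_form B (2 * (CARD('n) - 1)) \<theta> \<Longrightarrow> T (fscale B q \<theta>) = 0"
proof -
  obtain c where c: "c \<in> B" "y \<in> fst c" using atlas_cover[OF B] by blast
  note ch = atlas_chart[OF B c(1)]
  obtain h :: "complex ^ 'n \<Rightarrow> real" and K N where h: "smooth_on UNIV h"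
    and K: "compact K" "K \<subseteq> chart_image c" "\<And>x. x \<notin> K \<Longrightarrow> h x = 0"
    and N: "open N" "snd c y \<in> N" "N \<subseteq> chart_image c" "\<And>x. x \<in> N \<Longrightarrow> h x = 1"
    by (rule smooth_bump[OF ch(2) ch(8)[OF c(2)]]) (rule that)
  define q where "q = (\<lambda>y. if y \<in> fst c then h (snd c y) else 0)"
  have cK: "compact (chart_inv c ` K)" by (rule compact_chart_inv[OF B c(1) K(1,2)])
  have Ke: "{y \<in> fst c. snd c y \<in> K} = chart_inv c ` K"
  proof (intro equalityI subsetI)
    fix y assume "y \<in> {y \<in> fst c. snd c y \<in> K}"
    then have "snd c y \<in> K" "y = chart_inv c (snd c y)" using ch(5) by auto
    then show "y \<in> chart_inv c ` K" by blast
  next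
    fix y assume "y \<in> chart_inv c ` K"
    then obtain k where "k \<in> K" "y = chart_inv c k" by blast
    then show "y \<in> {y \<in> fst c. snd c y \<in> K}" using ch(6,7) K(2) by auto
  qed
  have sq: "smooth_fun B q"
    unfolding q_def
  proof (rule smooth_fun_bump[OF B ch(1) h K(3)])
    show "Topological_Spaces.closed {y \<in> fst c. snd c y \<in> K}" unfolding Ke by (rule compact_imp_closed[OF cK])
    fix d assume d: "d \<in> B"
    have "smooth_on (overlap d c id) (local_rep d c id)"
      by (rule holo_on_smooth[OF trans_holo(2,1)[OF B d c(1)]])
    then show "smooth_on {x \<in> chart_image d. chart_inv d x \<in> fst c} (\<lambda>x. snd c (chart_inv d x))"
      by (simp add: overlap_def local_rep_def[abs_def] o_def)
  qed
  have q0: "q y = 0" if "y \<notin> chart_inv c ` K" for y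
    using that K(3) unfolding Ke[symmetric] by (auto simp: q_def)
  show thesis
  proof (rule that[OF sq])
    show "open (fst c \<inter> snd c -` N)" by (rule continuous_open_preimage[OF ch(3,1) N(1)])
    show "y \<in> fst c \<inter> snd c -` N" using c(2) N(2) by simp
    show "q y' = 1" if "y' \<in> fst c \<inter> snd c -` N" for y' using that N(4) by (simp add: q_def)
    fix \<theta> assume \<theta>: "test_form B (2 * (CARD('n) - 1)) \<theta>"
    let ?q = "fscale B q \<theta>"
    have s: "smooth_form B (2 * (CARD('n) - 1)) ?q"
      using fscale_smooth_form[OF B sq] \<theta> by (simp add: test_form_def)
    then have df: "diff_form B (2 * (CARD('n) - 1)) ?q" by (simp add: smooth_form_def)
    have sup: "supported_in B (chart_inv c ` K) ?q" by (rule fscale_supported(2)) (rule q0)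
    have "chart_inv c ` K \<subseteq> fst c" using ch(7) K(2) by blast
    from form_eq_ext_form[OF B df c(1) sup this] have e: "?q = ext_form B c (?q c)" .
    have "T (ext_form B c (?q c)) = 0"
    proof (rule T_local_form[OF c(1) K(1,2)])
      show "alt_form (2 * (CARD('n) - 1)) (?q c x)" if "x \<in> chart_image c" for x
        by (rule diff_formD(1)[OF df B c(1) that])
      show "smooth_on (chart_image c) (\<lambda>x. ?q c x vs)" for vs using s c(1) by (simp add: smooth_form_def)
      show "?q c x = (\<lambda>vs. 0)" if x: "x \<in> chart_image c - K" for x
      proof -
        have "q (chart_inv c x) = 0" using x ch(6,7) K(3) by (simp add: q_def)
        then show ?thesis by (simp add: fscale_def)
      qed
    qed
    then show "T ?q = 0" using e by simp
  qed
qed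

text \<open>A product of factors \<open>1 - q\<close> takes the place of a partition of unity.
  Multiplying a test form by \<open>1 - q\<close> does not change the value of \<open>T\<close>,
  since \<open>T\<close> annihilates \<open>q\<close> times the form. After finitely many factors
  the form is zero, because at each point of its support one of the \<open>q\<close> equals
  1.\<close>

lemma T_eq_0:
  assumes \<phi>: "test_form B (2 * (CARD('n) - 1)) \<phi>"
  shows "T \<phi> = 0"
proof -
  let ?k = "2 * (CARD('n) - 1)"
  obtain K where K: "compact K" "supported_in B K \<phi>" using \<phi> unfolding test_form_def by blast
  define Q where "Q = (\<lambda>y q U. smooth_fun B q \<and> open U \<and> y \<in> U \<and> (\<forall>y'\<in>U. q y' = (1 :: real)) \<and>
    (\<forall>\<theta>. test_form B ?k \<theta> \<longrightarrow> T (fscale B q \<theta>) = 0))"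
  have "\<forall>y. \<exists>q U. Q y q U"
  proof
    fix y
    obtain q U where "smooth_fun B q" "open U" "y \<in> U" "\<And>y'. y' \<in> U \<Longrightarrow> q y' = 1"
      "\<And>\<theta>. test_form B ?k \<theta> \<Longrightarrow> T (fscale B q \<theta>) = 0"
      by (rule chart_bump[of y]) (rule that)
    then show "\<exists>q U. Q y q U" unfolding Q_def by (intro exI[of _ q] exI[of _ U]) blast
  qed
  then obtain q U where "\<And>y. Q y (q y) (U y)" by metis
  then have q: "\<And>y. smooth_fun B (q y)" and U: "\<And>y. open (U y)" "\<And>y. y \<in> U y"
    and q1: "\<And>y y'. y' \<in> U y \<Longrightarrow> q y y' = 1" and qT: "\<And>y \<theta>. test_form B ?k \<theta> \<Longrightarrow> T (fscale B (q y) \<theta>) = 0"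
    unfolding Q_def by auto
  have "K \<subseteq> (\<Union>y\<in>K. U y)" using U(2) by blast
  from compactE_image[OF K(1) U(1) this] obtain K' where K': "K' \<subseteq> K" "finite K'" "K \<subseteq> (\<Union>y\<in>K'. U y)" by metis
  have fact: "test_form B ?k (fscale B (\<lambda>y'. \<Prod>y\<in>F. 1 - q y y') \<phi>) \<and> T (fscale B (\<lambda>y'. \<Prod>y\<in>F. 1 - q y y') \<phi>) = T \<phi>"
    if "finite F" for F
    using that
  proof (induction F rule: finite_induct)
    case empty
    then show ?case using \<phi> by (simp add: fscale_def)
  next
    case (insert z F)
    let ?\<theta> = "fscale B (\<lambda>y'. \<Prod>y\<in>F. 1 - q y y') \<phi>"
    have t: "test_form B ?k ?\<theta>" "T ?\<theta> = T \<phi>" using insert.IH by auto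
    obtain L where L: "compact L" "supported_in B L ?\<theta>" using t(1) unfolding test_form_def by (elim conjE exE)
    have s: "smooth_form B ?k ?\<theta>" using t(1) unfolding test_form_def by (elim conjE)
    have t2: "test_form B ?k (fscale B (q z) ?\<theta>)"
      unfolding test_form_def
      by (intro conjI exI[of _ L] L(1) fscale_smooth_form[OF B q s] fscale_supported(1)[OF L(2)])
    have e: "fscale B (\<lambda>y'. \<Prod>y\<in>insert z F. 1 - q y y') \<phi> = (\<lambda>c x vs. ?\<theta> c x vs + (- 1) * fscale B (q z) ?\<theta> c x vs)"
      using insert.hyps by (auto simp: fscale_def fun_eq_iff algebra_simps)
    show ?case
      unfolding e
      by (intro conjI test_form_add[OF t(1) test_form_scale[OF t2]])
        (simp only: T_add[OF t(1) test_form_scale[OF t2]] T_scale[OF t2] qT[OF t(1)] t(2) mult_zero_right add_0_right)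
  qed
  have "fscale B (\<lambda>y'. \<Prod>y\<in>K'. 1 - q y y') \<phi> = (\<lambda>c x vs. 0)"
  proof (intro ext)
    fix c x vs
    show "fscale B (\<lambda>y'. \<Prod>y\<in>K'. 1 - q y y') \<phi> c x vs = 0"
    proof (cases "c \<in> B \<and> x \<in> chart_image c \<and> chart_inv c x \<notin> K")
      case True
      then show ?thesis using K(2) by (simp add: supported_in_def fscale_def)
    next
      case False
      have "\<phi> c x vs = 0" if "\<not> (c \<in> B \<and> x \<in> chart_image c)"
      proof (rule on_charts_out[OF diff_form_on_charts that])
        show "diff_form B ?k \<phi>" using \<phi> unfolding test_form_def smooth_form_def by (elim conjE)
      qed
      moreover have "(\<Prod>y\<in>K'. 1 - q y (chart_inv c x)) = 0" if "chart_inv c x \<in> K"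
      proof -
        have "chart_inv c x \<in> (\<Union>y\<in>K'. U y)" using K'(3) that by (rule subsetD)
        then obtain y where y: "y \<in> K'" "chart_inv c x \<in> U y" by blast
        have "1 - q y (chart_inv c x) = 0" using q1[OF y(2)] by simp
        then show ?thesis by (rule prod_zero[OF K'(2) bexI[OF _ y(1)]])
      qed
      ultimately show ?thesis using False
        by (cases "chart_inv c x \<in> K") (auto simp: fscale_def simp del: of_real_prod)
    qed
  qed
  then show ?thesis using fact[OF K'(2)] T_zero by simp
qed

end

theorem proposition1p4:
  fixes A :: "('x::{t2_space, second_countable_topology}, 'n::finite) chart set"
    and B :: "('y::{t2_space, second_countable_topology}, 'n) chart set"
    and \<pi> :: "'y \<Rightarrow> 'x"
    and \<omega> :: "('x, 'n) form"
  assumes "complex_atlas A"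
    and "compact (UNIV :: 'x set)"
    and "connected (UNIV :: 'x set)"
    and "CARD('n) \<ge> 2"
    and "universal_cover B A \<pi>"
    and "balanced_hyperbolic B A \<pi> \<omega>"
  shows "\<not> (\<exists>T. bidegree_current B 1 1 T \<and>
               \<not> zero_current B 2 T \<and>
               closed_current B 2 T \<and>
               positive_current B 1 T \<and>
               L1_current B (mf_pullback B A \<pi> \<omega>) 2 T)"
proof (rule notI, elim exE conjE)
  fix T
  assume T: "bidegree_current B 1 1 T" "\<not> zero_current B 2 T" "closed_current B 2 T" "positive_current B 1 T"
    and "L1_current B (mf_pullback B A \<pi> \<omega>) 2 T"
  then obtain \<tau> where \<tau>: "measurable_coeffs B 2 T \<tau>" "L1_norm B (mf_pullback B A \<pi> \<omega>) 2 \<tau> < \<infinity>"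
    unfolding L1_current_def by blast
  have B: "complex_atlas B" and cov: "covering_space UNIV \<pi> UNIV" and lb: "local_biholomorphism B A \<pi>"
    using assms(5) by (auto simp: universal_cover_def)
  obtain \<beta> where herm: "hermitian_metric A \<omega>" and \<beta>: "smooth_form B (2 * CARD('n) - 3) \<beta>"
    "bounded_form B (mf_pullback B A \<pi> \<omega>) (2 * CARD('n) - 3) \<beta>"
    "mf_pullback B A \<pi> (mf_power A 2 (CARD('n) - 1) \<omega>) = mf_d B (2 * CARD('n) - 3) \<beta>"
    using assms(6) unfolding balanced_hyperbolic_def balanced_def by blast
  obtain \<psi> :: "nat \<Rightarrow> 'y \<Rightarrow> real" and C where \<psi>: "C \<ge> 0" "\<And>m. compact_bump B (\<psi> m)"
    "\<And>y. \<exists>U M. open U \<and> y \<in> U \<and> (\<forall>m\<ge>M. \<forall>y'\<in>U. \<psi> m y' = 1)"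
    "\<And>m. grad_le B (mf_pullback B A \<pi> \<omega>) {\<psi> m} C"
    by (rule cutoffs[OF B assms(1) lb cov herm assms(2)]) (rule that)
  interpret closed_positive_current B "mf_pullback B A \<pi> \<omega>" T \<tau> \<beta> \<psi> C
  proof
    show "smooth_form B 2 (mf_pullback B A \<pi> \<omega>)"
      using mf_pullback_smooth_form[OF B assms(1) lb] herm by (simp add: hermitian_metric_def)
    show "pos11 (mf_pullback B A \<pi> \<omega> c x)" if cx: "c \<in> B" "x \<in> chart_image c" for c x
    proof -
      obtain d where "d \<in> A" "x \<in> overlap c d \<pi>" by (rule mf_pullback_chart[OF assms(1) cx])
      then show ?thesis by (rule pullback_metric(1)[OF B assms(1) lb herm cx(1)])
    qed
    \<comment> \<open>Hyperbolicity provides a primitive of the pulled-back power; it is also a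
      primitive of the power of the pulled-back metric.\<close>
    show "mf_power B 2 (CARD('n) - 1) (mf_pullback B A \<pi> \<omega>) = mf_d B (2 * CARD('n) - 3) \<beta>"
      using \<beta>(3) mf_pullback_power[OF B assms(1) lb] by simp
  qed (use B assms(4) \<psi> \<beta>(1,2) T(1,3,4) \<tau> in auto)
  show False using T(2) T_eq_0 unfolding zero_current_def degrees by blast
qed

end
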